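(* Let $p_+,p_-$ be coprime positive integers and let $\mathfrak g=\mathfrak g_{p_+,p_-}$ be the Hopf algebra of the context, with irreducible modules $\mathsf X^{\pm}_{r,r'}$, $1\le r\le p_+$, $1\le r'\le p_-$. Multiplication in the Grothendieck ring of (finite-dimensional modules of) $\mathfrak g$ is given, for $\alpha,\beta\in\{+,-\}$, $1\le r,s\le p_+$, $1\le r',s'\le p_-$, by $$\mathsf X^{\alpha}_{r,r'}\mathsf X^{\beta}_{s,s'}=\sum_{\substack{u=|r-s|+1\\ \mathrm{step}=2}}^{r+s-1}\ \sum_{\substack{u'=|r'-s'|+1\\ \mathrm{step}=2}}^{r'+s'-1}\widetilde{\mathsf X}^{\alpha\beta}_{u,u'},$$ where $$\widetilde{\mathsf X}^{\alpha}_{r,r'}=\begin{cases}\mathsf X^{\alpha}_{r,r'},&1\le r\le p_+,\ 1\le r'\le p_-,\\[2pt] \mathsf X^{\alpha}_{2p_+-r,r'}+2\mathsf X^{-\alpha}_{r-p_+,r'},&p_++1\le r\le2p_+-1,\ 1\le r'\le p_-,\\[2pt] \mathsf X^{\alpha}_{r,2p_--r'}+2\mathsf X^{-\alpha}_{r,r'-p_-},&1\le r\le p_+,\ p_-+1\le r'\le2p_--1,\\[2pt] \mathsf X^{\alpha}_{2p_+-r,2p_--r'}+2\mathsf X^{-\alpha}_{2p_+-r,r'-p_-}+2\mathsf X^{-\alpha}_{r-p_+,2p_--r'}+4\mathsf X^{\alpha}_{r-p_+,r'-p_-},&p_++1\le r\le2p_+-1,\ p_-+1\le r'\le2p_--1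.\end{cases}$$
   Context: $\mathfrak q_\pm=e^{i\pi/p_\pm}$, $Q_+=\mathfrak q_+^{p_-}$, $Q_-=\mathfrak q_-^{p_+}$, $[n]_\pm=\frac{Q_\pm^n-Q_\pm^{-n}}{Q_\pm-Q_\pm^{-1}}$. $\mathfrak g=\mathfrak g_{p_+,p_-}$ is the Hopf algebra over $\mathbb C$ generated by $e_+,f_+,e_-,f_-,K$ with relations $e_\pm^{p_\pm}=f_\pm^{p_\pm}=0$, $K^{2p_+p_-}=1$, $Ke_\pm K^{-1}=\mathfrak q_\pm^2e_\pm$, $Kf_\pm K^{-1}=\mathfrak q_\pm^{-2}f_\pm$, each of $e_+,f_+$ commutes with each of $e_-,f_-$, $[e_+,f_+]=\frac{K^{p_-}-K^{-p_-}}{Q_+-Q_+^{-1}}$, $[e_-,f_-]=\frac{K^{p_+}-K^{-p_+}}{Q_--Q_-^{-1}}$ (if $p_\pm=1$ then $e_\pm=f_\pm=0$ and the corresponding commutator relation is void), and $\Delta(K)=K\otimes K$, $\Delta(e_+)=e_+\otimes1+K^{p_-}\otimes e_+$, $\Delta(f_-)=f_-\otimes1+K^{-p_+}\otimes f_-$, $\Delta(f_+)=f_+\otimes K^{-p_-}+1\otimes f_+$, $\Delta(e_-)=e_-\otimes K^{p_+}+1\otimes e_-$, $S(K)=K^{-1}$, $S(e_+)=-K^{-p_-}e_+$, $S(f_-)=-K^{p_+}f_-$, $S(f_+)=-f_+K^{p_-}$, $S(e_-)=-e_-K^{-p_+}$, $\epsilon(e_\pm)=\epsilon(f_\pm)=0$,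 $\epsilon(K)=1$. There are $2p_+p_-$ irreducible modules $\mathsf X^\alpha_{r,r'}$ ($\alpha=\pm$, $1\le r\le p_+$, $1\le r'\le p_-$), of dimension $rr'$, with basis $|n,n'\rangle$, $0\le n\le r-1$, $0\le n'\le r'-1$, and action $K|n,n'\rangle=\alpha\,\mathfrak q_+^{r-1-2n}\mathfrak q_-^{r'-1-2n'}|n,n'\rangle$, $e_+|n,n'\rangle=\alpha^{p_-}(-1)^{r'-1}[n]_+[r-n]_+|n-1,n'\rangle$, $e_-|n,n'\rangle=\alpha^{p_+}(-1)^{r-1}[n']_-[r'-n']_-|n,n'-1\rangle$, $f_+|n,n'\rangle=|n+1,n'\rangle$, $f_-|n,n'\rangle=|n,n'+1\rangle$ (vectors with indices out of range are zero). In the Grothendieck ring, the class of an irreducible module is denoted by the same symbol, addition is induced by short exact sequences and multiplication by the tensor product. In $\widetilde{\mathsf X}^{\alpha\beta}$, $\alpha\beta$ is the product of signs. *)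

theory Defs
  imports
    "HOL-Library.Poly_Mapping"
    "HOL-Library.Product_Plus"
    "HOL-Algebra.Algebraic_Closure_Type"
    "HOL-Algebra.QuotRing"
    "HOL-Algebra.Generated_Groups"
    "Jordan_Normal_Form.Matrix_Kernel"
begin

text \<open>
  Throughout, \<open>p\<close> and \<open>p'\<close> stand for $p_+$ and $p_-$, and signs are the integers
  \<open>1\<close> and \<open>-1\<close>.
\<close>

section \<open>The Hopf algebra\<close>

definition qroot :: "nat \<Rightarrow> complex" where
  "qroot n = exp (\<i> * of_real pi / of_nat n)"

text \<open>$Q_+$ is \<open>Qpar p p'\<close> and $Q_-$ is \<open>Qpar p' p\<close>.\<close>

definition Qpar :: "nat \<Rightarrow> nat \<Rightarrow> complex" where
  "Qpar a b = qroot a ^ b"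

definition qnum :: "complex \<Rightarrow> nat \<Rightarrow> complex" where
  "qnum Q n = (Q powi int n - Q powi (- int n)) / (Q - inverse Q)"

datatype gen = EP | FP | EM | FM | KK

text \<open>
  Lists form a monoid under concatenation.  Hence \<open>gen list \<Rightarrow>\<^sub>0 complex\<close>, with the convolution
  product of \<open>HOL-Library.Poly_Mapping\<close>, is the free unital associative complex algebra
  on the generators, and \<open>gen list \<times> gen list \<Rightarrow>\<^sub>0 complex\<close> is its tensor square, the pure tensor
  of two words \<open>u\<close> and \<open>v\<close> being the basis element indexed by \<open>(u, v)\<close>.
\<close>

instantiation list :: (type) monoid_add
begin
definition zero_list :: "'a list" where "zero_list = []"
definition plus_list :: "'a list \<Rightarrow> 'a list \<Rightarrow> 'a list" where "plus_list = (@)"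
instance by standard (simp_all add: zero_list_def plus_list_def)
end

type_synonym free_alg = "gen list \<Rightarrow>\<^sub>0 complex"
type_synonym free_alg2 = "gen list \<times> gen list \<Rightarrow>\<^sub>0 complex"

definition scal :: "complex \<Rightarrow> ('a::monoid_add \<Rightarrow>\<^sub>0 complex)" where
  "scal c = Poly_Mapping.single 0 c"

definition wd :: "'a \<Rightarrow> ('a \<Rightarrow>\<^sub>0 complex)" where
  "wd w = Poly_Mapping.single w 1"

definition gn :: "gen \<Rightarrow> free_alg" where
  "gn x = wd [x]"

text \<open>Since $K^{2p_+p_-} = 1$, the power $K^k$ for integer $k$ is represented by the word
  $K^{k \bmod 2p_+p_-}$.\<close>

definition Kword :: "nat \<Rightarrow> nat \<Rightarrow> int \<Rightarrow> gen list" where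
  "Kword p p' k = replicate (nat (k mod (2 * int p * int p'))) KK"

definition Kpow :: "nat \<Rightarrow> nat \<Rightarrow> int \<Rightarrow> free_alg" where
  "Kpow p p' k = wd (Kword p p' k)"

definition relators :: "nat \<Rightarrow> nat \<Rightarrow> free_alg set" where
  "relators p p' =
     {gn EP ^ p, gn FP ^ p, gn EM ^ p', gn FM ^ p', gn KK ^ (2 * p * p') - 1,
      gn KK * gn EP * Kpow p p' (-1) - scal (qroot p ^ 2) * gn EP,
      gn KK * gn EM * Kpow p p' (-1) - scal (qroot p' ^ 2) * gn EM,
      gn KK * gn FP * Kpow p p' (-1) - scal (qroot p powi (-2)) * gn FP,
      gn KK * gn FM * Kpow p p' (-1) - scal (qroot p' powi (-2)) * gn FM}
   \<union> {gn x * gn y - gn y * gn x |x y. x \<in> {EP, FP} \<and> y \<in> {EM, FM}}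
   \<union> (if p = 1 then {} else
       {gn EP * gn FP - gn FP * gn EP
         - scal (1 / (Qpar p p' - inverse (Qpar p p'))) * (Kpow p p' (int p') - Kpow p p' (- int p'))})
   \<union> (if p' = 1 then {} else
       {gn EM * gn FM - gn FM * gn EM
         - scal (1 / (Qpar p' p - inverse (Qpar p' p))) * (Kpow p p' (int p) - Kpow p p' (- int p))})"

text \<open>The algebra $\mathfrak g$ is the quotient of \<open>free_alg\<close> by the following two-sided ideal.\<close>

definition rel_ideal :: "nat \<Rightarrow> nat \<Rightarrow> free_alg set" where
  "rel_ideal p p' = Idl\<^bsub>ring_of_type_algebra\<^esub> (relators p p')"

text \<open>
  The structure maps of $\mathfrak g$ are induced by the following (anti)homomorphisms, defined on
  \<open>free_alg\<close> by their values on the generators.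
\<close>

definition comult_gen :: "nat \<Rightarrow> nat \<Rightarrow> gen \<Rightarrow> free_alg2" where
  "comult_gen p p' x = (case x of
       KK \<Rightarrow> wd ([KK], [KK])
     | EP \<Rightarrow> wd ([EP], []) + wd (Kword p p' (int p'), [EP])
     | FM \<Rightarrow> wd ([FM], []) + wd (Kword p p' (- int p), [FM])
     | FP \<Rightarrow> wd ([FP], Kword p p' (- int p')) + wd ([], [FP])
     | EM \<Rightarrow> wd ([EM], Kword p p' (int p)) + wd ([], [EM]))"

definition comult :: "nat \<Rightarrow> nat \<Rightarrow> free_alg \<Rightarrow> free_alg2" where
  "comult p p' x = (\<Sum>w\<in>Poly_Mapping.keys x.
     scal (Poly_Mapping.lookup x w) * prod_list (map (comult_gen p p') w))"

definition counit :: "free_alg \<Rightarrow> complex" where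
  "counit x = (\<Sum>w\<in>Poly_Mapping.keys x.
     Poly_Mapping.lookup x w * prod_list (map (\<lambda>y. if y = KK then 1 else 0) w))"

definition antipode_gen :: "nat \<Rightarrow> nat \<Rightarrow> gen \<Rightarrow> free_alg" where
  "antipode_gen p p' x = (case x of
       KK \<Rightarrow> Kpow p p' (-1)
     | EP \<Rightarrow> - (Kpow p p' (- int p') * gn EP)
     | FM \<Rightarrow> - (Kpow p p' (int p) * gn FM)
     | FP \<Rightarrow> - (gn FP * Kpow p p' (int p'))
     | EM \<Rightarrow> - (gn EM * Kpow p p' (- int p)))"

definition antipode :: "nat \<Rightarrow> nat \<Rightarrow> free_alg \<Rightarrow> free_alg" where
  "antipode p p' x = (\<Sum>w\<in>Poly_Mapping.keys x.
     scal (Poly_Mapping.lookup x w) * prod_list (map (antipode_gen p p') (rev w)))"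


section \<open>Finite-dimensional modules\<close>

text \<open>
  A pair \<open>(n, \<rho>)\<close> stands for the space of column vectors of dimension \<open>n\<close> on which an algebra
  element \<open>x\<close> acts by the matrix \<open>\<rho> x\<close>.  Every finite-dimensional module is isomorphic to one of
  this form.  A module over the quotient of \<open>free_alg\<close> by \<open>rel_ideal\<close> is a module over \<open>free_alg\<close>
  annihilated by that ideal.
\<close>

type_synonym fd_module = "nat \<times> (free_alg \<Rightarrow> complex mat)"

definition modules :: "nat \<Rightarrow> nat \<Rightarrow> fd_module set" where
  "modules p p' = {(n, \<rho>).
     \<rho> \<in> Ring.ring_hom ring_of_type_algebra (ring_mat TYPE(complex) n ()) \<and>
     (\<forall>c. \<rho> (scal c) = c \<cdot>\<^sub>m 1\<^sub>m n) \<and>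
     (\<forall>x\<in>rel_ideal p p'. \<rho> x = 0\<^sub>m n n)}"

definition short_exact :: "fd_module \<Rightarrow> fd_module \<Rightarrow> fd_module \<Rightarrow> bool" where
  "short_exact U V W \<longleftrightarrow>
     (\<exists>A \<in> carrier_mat (fst V) (fst U). \<exists>B \<in> carrier_mat (fst W) (fst V).
        (\<forall>x. A * snd U x = snd V x * A) \<and>
        (\<forall>x. B * snd V x = snd W x * B) \<and>
        mat_kernel A = {0\<^sub>v (fst U)} \<and>
        (\<lambda>v. A *\<^sub>v v) ` carrier_vec (fst U) = mat_kernel B \<and>
        (\<lambda>v. B *\<^sub>v v) ` carrier_vec (fst V) = carrier_vec (fst W))"

text \<open>The matrix of the tensor product of two linear maps, in the basis
  $v_i \otimes w_k$ placed at position $i \dim W + k$.\<close>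

definition kron :: "complex mat \<Rightarrow> complex mat \<Rightarrow> complex mat" where
  "kron A B = mat (dim_row A * dim_row B) (dim_col A * dim_col B)
     (\<lambda>(i, j). A $$ (i div dim_row B, j div dim_col B) * B $$ (i mod dim_row B, j mod dim_col B))"

text \<open>An element \<open>x\<close> acts on the tensor product by its coproduct.\<close>

definition tensor_module :: "nat \<Rightarrow> nat \<Rightarrow> fd_module \<Rightarrow> fd_module \<Rightarrow> fd_module" where
  "tensor_module p p' V W = (fst V * fst W, \<lambda>x. mat (fst V * fst W) (fst V * fst W)
     (\<lambda>ij. \<Sum>(u, v)\<in>Poly_Mapping.keys (comult p p' x).
        Poly_Mapping.lookup (comult p p' x) (u, v) * kron (snd V (wd u)) (snd W (wd v)) $$ ij))"

definition trivial_module :: fd_module where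
  "trivial_module = (1, \<lambda>x. counit x \<cdot>\<^sub>m 1\<^sub>m 1)"

text \<open>
  The matrix coefficients of the irreducible modules: \<open>irr_coeff p p' \<alpha> r r' x (m, m') (n, n')\<close> is
  the coefficient of $|m,m'\rangle$ in $x\,|n,n'\rangle$.
\<close>

definition irr_coeff ::
  "nat \<Rightarrow> nat \<Rightarrow> int \<Rightarrow> nat \<Rightarrow> nat \<Rightarrow> gen \<Rightarrow> nat \<times> nat \<Rightarrow> nat \<times> nat \<Rightarrow> complex" where
  "irr_coeff p p' \<alpha> r r' x = (\<lambda>(m, m') (n, n'). case x of
       KK \<Rightarrow> if m = n \<and> m' = n'
             then of_int \<alpha> * qroot p powi (int r - 1 - 2 * int n) * qroot p' powi (int r' - 1 - 2 * int n')
             else 0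
     | EP \<Rightarrow> if m + 1 = n \<and> m' = n'
             then of_int (\<alpha> ^ p') * (-1) ^ (r' - 1) * qnum (Qpar p p') n * qnum (Qpar p p') (r - n)
             else 0
     | EM \<Rightarrow> if m = n \<and> m' + 1 = n'
             then of_int (\<alpha> ^ p) * (-1) ^ (r - 1) * qnum (Qpar p' p) n' * qnum (Qpar p' p) (r' - n')
             else 0
     | FP \<Rightarrow> if m = n + 1 \<and> m' = n' then 1 else 0
     | FM \<Rightarrow> if m = n \<and> m' = n' + 1 then 1 else 0)"

text \<open>The basis vector $|n,n'\rangle$ is placed at position $n r' + n'$.\<close>

definition irr_mat :: "nat \<Rightarrow> nat \<Rightarrow> int \<Rightarrow> nat \<Rightarrow> nat \<Rightarrow> gen \<Rightarrow> complex mat" where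
  "irr_mat p p' \<alpha> r r' x = mat (r * r') (r * r')
     (\<lambda>(i, j). irr_coeff p p' \<alpha> r r' x (i div r', i mod r') (j div r', j mod r'))"

definition irr_module :: "nat \<Rightarrow> nat \<Rightarrow> int \<Rightarrow> nat \<Rightarrow> nat \<Rightarrow> fd_module" where
  "irr_module p p' \<alpha> r r' = (r * r', \<lambda>x. mat (r * r') (r * r')
     (\<lambda>ij. \<Sum>w\<in>Poly_Mapping.keys x. Poly_Mapping.lookup x w *
        foldr (\<lambda>y M. irr_mat p p' \<alpha> r r' y * M) w (1\<^sub>m (r * r')) $$ ij))"


section \<open>The Grothendieck ring\<close>

text \<open>The free abelian group on the modules, with the biadditive extension of the tensor product.\<close>

definition module_ring :: "nat \<Rightarrow> nat \<Rightarrow> (fd_module \<Rightarrow>\<^sub>0 int) ring" where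
  "module_ring p p' =
     \<lparr>carrier = {x. Poly_Mapping.keys x \<subseteq> modules p p'},
      monoid.mult = (\<lambda>x y. frag_extend (\<lambda>V. frag_extend (\<lambda>W. frag_of (tensor_module p p' V W)) y) x),
      one = frag_of trivial_module, zero = 0, add = (+)\<rparr>"

text \<open>The subgroup generated by the short exact sequences is already a two-sided ideal, because
  tensoring over the field of complex numbers is exact.\<close>

definition exact_relations :: "nat \<Rightarrow> nat \<Rightarrow> (fd_module \<Rightarrow>\<^sub>0 int) set" where
  "exact_relations p p' = generate (add_monoid (module_ring p p'))
     {frag_of V - (frag_of U + frag_of W) |U V W.
        U \<in> modules p p' \<and> V \<in> modules p p' \<and> W \<in> modules p p' \<and> short_exact U V W}"

definition Groth :: "nat \<Rightarrow> nat \<Rightarrow> (fd_module \<Rightarrow>\<^sub>0 int) set ring" where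
  "Groth p p' = module_ring p p' Quot exact_relations p p'"

definition Groth_class :: "nat \<Rightarrow> nat \<Rightarrow> fd_module \<Rightarrow> (fd_module \<Rightarrow>\<^sub>0 int) set" where
  "Groth_class p p' V = exact_relations p p' +>\<^bsub>module_ring p p'\<^esub> frag_of V"

definition irrX :: "nat \<Rightarrow> nat \<Rightarrow> int \<Rightarrow> nat \<Rightarrow> nat \<Rightarrow> (fd_module \<Rightarrow>\<^sub>0 int) set" where
  "irrX p p' \<alpha> r r' = Groth_class p p' (irr_module p p' \<alpha> r r')"

definition Xtilde :: "nat \<Rightarrow> nat \<Rightarrow> int \<Rightarrow> nat \<Rightarrow> nat \<Rightarrow> (fd_module \<Rightarrow>\<^sub>0 int) set" where
  "Xtilde p p' \<alpha> r r' =
    (if 1 \<le> r \<and> r \<le> p \<and> 1 \<le> r' \<and> r' \<le> p' then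
       irrX p p' \<alpha> r r'
     else if p + 1 \<le> r \<and> r \<le> 2 * p - 1 \<and> 1 \<le> r' \<and> r' \<le> p' then
       irrX p p' \<alpha> (2 * p - r) r'
       \<oplus>\<^bsub>Groth p p'\<^esub> [(2::nat)] \<cdot>\<^bsub>Groth p p'\<^esub> irrX p p' (- \<alpha>) (r - p) r'
     else if 1 \<le> r \<and> r \<le> p \<and> p' + 1 \<le> r' \<and> r' \<le> 2 * p' - 1 then
       irrX p p' \<alpha> r (2 * p' - r')
       \<oplus>\<^bsub>Groth p p'\<^esub> [(2::nat)] \<cdot>\<^bsub>Groth p p'\<^esub> irrX p p' (- \<alpha>) r (r' - p')
     else if p + 1 \<le> r \<and> r \<le> 2 * p - 1 \<and> p' + 1 \<le> r' \<and> r' \<le> 2 * p' - 1 then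
       irrX p p' \<alpha> (2 * p - r) (2 * p' - r')
       \<oplus>\<^bsub>Groth p p'\<^esub> [(2::nat)] \<cdot>\<^bsub>Groth p p'\<^esub> irrX p p' (- \<alpha>) (2 * p - r) (r' - p')
       \<oplus>\<^bsub>Groth p p'\<^esub> [(2::nat)] \<cdot>\<^bsub>Groth p p'\<^esub> irrX p p' (- \<alpha>) (r - p) (2 * p' - r')
       \<oplus>\<^bsub>Groth p p'\<^esub> [(4::nat)] \<cdot>\<^bsub>Groth p p'\<^esub> irrX p p' \<alpha> (r - p) (r' - p')
     else undefined)"

text \<open>The summation range \<open>a, a + 2, \<dots>, b\<close>.\<close>

definition step2 :: "nat \<Rightarrow> nat \<Rightarrow> nat set" where
  "step2 a b = {u. a \<le> u \<and> u \<le> b \<and> even (u - a)}"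

end

theory Submission
  imports Defs
begin

text \<open>
  A module is the same thing as five matrices satisfying the defining relations.  The Gaussian binomial
  theorem shows that tensor products satisfy \<open>e\<^sup>p = f\<^sup>p = 0\<close> again, and the tensor product is strictly
  associative and exact, so it descends to the Grothendieck group.  It therefore suffices to multiply
  by $\mathsf X^{\beta}_{1,1}$, which only twists the sign, and by $\mathsf X^{+}_{2,1}$ and
  $\mathsf X^{+}_{1,2}$.  The product $\mathsf X^\alpha_{r,r'}\mathsf X^+_{2,1}$ has an explicit filtration
  with factors $\mathsf X^\alpha_{r\pm1,r'}$ if $r<p_+$; if $r=p_+$, its two factors are baby Verma modules, each
  with the composition factors $\mathsf X^\alpha_{p_+-1,r'}$ and $\mathsf X^{-\alpha}_{1,r'}$.  Consequently
  $\widetilde{\mathsf X}^\alpha_{u,u'}\mathsf X^+_{2,1}=\widetilde{\mathsf X}^\alpha_{u+1,u'}+\widetilde{\mathsf X}^\alpha_{u-1,u'}$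
  for $1\le u\le 2p_+-2$, and likewise in the second index, which is the Clebsch--Gordan recursion:
  induction on $s$ and then on $s'$ gives the formula.
\<close>

text \<open>The relations are checked by hand only in dimensions one and two. Every larger
  irreducible module is produced as a submodule of a tensor product already known to be a module and
  inherits the relations from it. Exactness is handled through linear splittings: an exact sequence
  becomes four matrix identities that survive Kronecker products with identity matrices, so
  exactness of the tensor product and the passage of a sequence from one index to two are formal.
  The obstacle is signs. A power of K that is scalar on the two-dimensional factor equals -1 there,
  because q_+^(p_+) = q_-^(p_-) = -1. Tensoring with X_{2,1} puts this sign on e_-, where the
  formulas for the irreducible modules already expect it; tensoring with X_{1,2} puts it on f_+,
  where a diagonal sign matrix has to remove it. The case r = p_+ is special because f_+^r sends v_0
  \<otimes> w_0 to [r]_+ v_(r-1) \<otimes> w_1. This vector vanishes exactly for r = p_+, and one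
  dimension then moves from the submodule to the quotient.\<close>

lemma sum_div_mod:
  fixes f :: "nat \<Rightarrow> nat \<Rightarrow> 'a::comm_monoid_add"
  shows "(\<Sum>l<a * b. f (l div b) (l mod b)) = (\<Sum>x<a. \<Sum>y<b. f x y)"
proof (cases "b = 0")
  case False
  have "(\<Sum>l<a * b. f (l div b) (l mod b)) = (\<Sum>(x, y)\<in>{..<a} \<times> {..<b}. f x y)"
  proof (rule sum.reindex_bij_witness[where i="\<lambda>(x, y). x * b + y" and j="\<lambda>l. (l div b, l mod b)"])
    fix z assume "z \<in> {..<a} \<times> {..<b}"
    then obtain x y where z: "z = (x, y)" "x < a" "y < b" by auto
    have "x * b + y < Suc x * b" using z by simp
    also have "\<dots> \<le> a * b" using z by (intro mult_right_mono) auto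
    finally show "(case z of (x, y) \<Rightarrow> x * b + y) \<in> {..<a * b}" using z by simp
  qed (use False in \<open>auto simp: less_mult_imp_div_less\<close>)
  then show ?thesis by (simp add: sum.cartesian_product)
qed auto

lemma mult_mat_index:
  "A \<in> carrier_mat a b \<Longrightarrow> B \<in> carrier_mat b c \<Longrightarrow> i < a \<Longrightarrow> j < c \<Longrightarrow>
    (A * B) $$ (i, j) = (\<Sum>k<b. A $$ (i, k) * (B $$ (k, j) :: complex))"
  by (auto simp: scalar_prod_def atLeast0LessThan)

section \<open>Kronecker products\<close>

lemma kron_dim [simp]:
  "dim_row (kron A B) = dim_row A * dim_row B" "dim_col (kron A B) = dim_col A * dim_col B"
  by (simp_all add: kron_def)

lemma kron_carrier [simp]:
  "A \<in> carrier_mat a b \<Longrightarrow> B \<in> carrier_mat c d \<Longrightarrow> kron A B \<in> carrier_mat (a * c) (b * d)"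
  by (auto simp: kron_def)

lemma kron_index:
  "A \<in> carrier_mat a b \<Longrightarrow> B \<in> carrier_mat c d \<Longrightarrow> i < a * c \<Longrightarrow> j < b * d \<Longrightarrow>
    kron A B $$ (i, j) = A $$ (i div c, j div d) * B $$ (i mod c, j mod d)"
  by (auto simp: kron_def)

lemma mod_less_of_mult: "(i::nat) < a * c \<Longrightarrow> i mod c < c"
  by (cases "c = 0") auto

text \<open>The inner index runs over the pairs \<open>(l div d, l mod d)\<close>, so the sum splits
  into a product of two sums. Most later computations in tensor products go through this
  mixed-product rule.\<close>

lemma kron_mult:
  assumes "A \<in> carrier_mat a b" "B \<in> carrier_mat c d" "C \<in> carrier_mat b e" "D \<in> carrier_mat d f"
  shows "kron A B * kron C D = kron (A * C) (B * D)"
proof (rule eq_matI)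
  fix i j assume "i < dim_row (kron (A * C) (B * D))" "j < dim_col (kron (A * C) (B * D))"
  then have ij: "i < a * c" "j < e * f" using assms by auto
  then have *: "i div c < a" "i mod c < c" "j div f < e" "j mod f < f"
    by (auto simp: less_mult_imp_div_less mod_less_of_mult)
  have "(kron A B * kron C D) $$ (i, j) = (\<Sum>l<b * d. kron A B $$ (i, l) * kron C D $$ (l, j))"
    using assms ij by (intro mult_mat_index) auto
  also have "\<dots> = (\<Sum>l<b * d. (A $$ (i div c, l div d) * B $$ (i mod c, l mod d))
      * (C $$ (l div d, j div f) * D $$ (l mod d, j mod f)))"
    using assms ij by (intro sum.cong) (auto simp: kron_index[of _ _ _ _ _ _])
  also have "\<dots> = (\<Sum>x<b. \<Sum>y<d. (A $$ (i div c, x) * B $$ (i mod c, y))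
      * (C $$ (x, j div f) * D $$ (y, j mod f)))"
    by (rule sum_div_mod)
  also have "\<dots> = (\<Sum>x<b. A $$ (i div c, x) * C $$ (x, j div f)) *
      (\<Sum>y<d. B $$ (i mod c, y) * D $$ (y, j mod f))"
    by (simp add: sum_product mult_ac)
  also have "\<dots> = kron (A * C) (B * D) $$ (i, j)"
    using assms ij * by (subst kron_index[of _ a e _ c f]) (auto simp: mult_mat_index[of _ _ _ _ _] simp del: index_mult_mat)
  finally show "(kron A B * kron C D) $$ (i, j) = kron (A * C) (B * D) $$ (i, j)" .
qed (use assms in auto)

text \<open>Positions in iterated tensor products are mixed-radix numbers, so both bracketings place
  a basis vector at the same index. The result is an equality of matrices, which makes the tensor
  product of modules associative on the nose rather than up to isomorphism.\<close>

lemma kron_assoc: "kron (kron A B) C = kron A (kron B C)"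
proof (rule eq_matI)
  fix i j assume "i < dim_row (kron A (kron B C))" "j < dim_col (kron A (kron B C))"
  then have ij: "i < dim_row A * dim_row B * dim_row C" "j < dim_col A * dim_col B * dim_col C"
    by (simp_all add: mult_ac)
  have d: "i div dim_row C < dim_row A * dim_row B" "j div dim_col C < dim_col A * dim_col B"
    using ij by (auto simp: less_mult_imp_div_less)
  have m: "i mod (dim_row B * dim_row C) < dim_row B * dim_row C"
     "j mod (dim_col B * dim_col C) < dim_col B * dim_col C"
    using ij by (metis mod_less_divisor mult.assoc mult_0_right not_gr0 not_less0)+
  have dm: "x mod (b * c) div c = x div c mod b" "x mod (b * c) mod c = x mod c" for x b c :: nat
    by (cases "c = 0"; simp add: mult.commute[of b c] mod_mult2_eq)+
  have e: "i div (dim_row B * dim_row C) = i div dim_row C div dim_row B"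
    "j div (dim_col B * dim_col C) = j div dim_col C div dim_col B"
    by (metis div_mult2_eq mult.commute)+
  show "kron (kron A B) C $$ (i, j) = kron A (kron B C) $$ (i, j)"
    using ij d m unfolding kron_def by (simp add: dm e mult.assoc)
qed (simp_all add: mult_ac)

lemma kron_add_left:
  "A \<in> carrier_mat a b \<Longrightarrow> B \<in> carrier_mat a b \<Longrightarrow> C \<in> carrier_mat c d \<Longrightarrow>
    kron (A + B) C = kron A C + kron B C"
  by (rule eq_matI) (auto simp: kron_def less_mult_imp_div_less algebra_simps)

lemma kron_add_right:
  "A \<in> carrier_mat a b \<Longrightarrow> B \<in> carrier_mat c d \<Longrightarrow> C \<in> carrier_mat c d \<Longrightarrow>
    kron A (B + C) = kron A B + kron A C"
  by (rule eq_matI) (auto simp: kron_def mod_less_of_mult[of _ a c] mod_less_of_mult[of _ b d] algebra_simps)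

lemma kron_smult_left: "kron (x \<cdot>\<^sub>m A) B = x \<cdot>\<^sub>m kron A B"
  by (rule eq_matI) (auto simp: kron_def less_mult_imp_div_less algebra_simps)

lemma kron_smult_right: "kron A (x \<cdot>\<^sub>m B) = x \<cdot>\<^sub>m kron A B"
  by (rule eq_matI) (auto simp: kron_def mod_less_of_mult[of _ "dim_row A" "dim_row B"] mod_less_of_mult[of _ "dim_col A" "dim_col B"] algebra_simps)

lemma kron_zero_left: "kron (0\<^sub>m a b) B = 0\<^sub>m (a * dim_row B) (b * dim_col B)"
  by (rule eq_matI) (auto simp: kron_def less_mult_imp_div_less)

lemma kron_zero_right: "kron A (0\<^sub>m a b) = 0\<^sub>m (dim_row A * a) (dim_col A * b)"
  by (rule eq_matI) (auto simp: kron_def mod_less_of_mult[of _ "dim_row A" a] mod_less_of_mult[of _ "dim_col A" b])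

lemma kron_one: "kron (1\<^sub>m a) (1\<^sub>m b) = 1\<^sub>m (a * b)"
  by (rule eq_matI) (auto simp: kron_def less_mult_imp_div_less mod_less_of_mult, metis div_mult_mod_eq)

lemma kron_pow:
  assumes "A \<in> carrier_mat a a" "B \<in> carrier_mat b b"
  shows "kron A B ^\<^sub>m n = kron (A ^\<^sub>m n) (B ^\<^sub>m n)"
proof (induction n)
  case 0
  then show ?case using assms by (simp add: kron_one)
next
  case (Suc n)
  have "kron (A ^\<^sub>m n) (B ^\<^sub>m n) * kron A B = kron (A ^\<^sub>m n * A) (B ^\<^sub>m n * B)"
    using assms by (intro kron_mult[of _ a a _ b b _ a _ b] pow_carrier_mat) auto
  then show ?case using Suc by simp
qed

section \<open>Linear extension\<close>

text \<open>Both \<open>irr_module\<close>, with words as basis, and \<open>tensor_module\<close>,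
  with pairs of words, have this shape. The size \<open>n\<close> is an argument because it cannot
  be read off from the element 0, whose support is empty.\<close>

definition lin :: "nat \<Rightarrow> ('m \<Rightarrow> complex mat) \<Rightarrow> ('m \<Rightarrow>\<^sub>0 complex) \<Rightarrow> complex mat" where
  "lin n \<phi> z = mat n n (\<lambda>ij. \<Sum>w\<in>Poly_Mapping.keys z. Poly_Mapping.lookup z w * \<phi> w $$ ij)"

lemma lin_carrier [simp]: "lin n \<phi> z \<in> carrier_mat n n"
  by (simp add: lin_def)

lemma lin_dim [simp]: "dim_row (lin n \<phi> z) = n" "dim_col (lin n \<phi> z) = n"
  by (simp_all add: lin_def)

lemma lin_index:
  assumes "finite S" "Poly_Mapping.keys z \<subseteq> S" "i < n" "j < n"
  shows "lin n \<phi> z $$ (i, j) = (\<Sum>w\<in>S. Poly_Mapping.lookup z w * \<phi> w $$ (i, j))"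
proof -
  have "lin n \<phi> z $$ (i, j) = (\<Sum>w\<in>Poly_Mapping.keys z. Poly_Mapping.lookup z w * \<phi> w $$ (i, j))"
    using assms by (simp add: lin_def)
  also have "\<dots> = (\<Sum>w\<in>S. Poly_Mapping.lookup z w * \<phi> w $$ (i, j))"
    using assms by (intro sum.mono_neutral_left) (auto simp: in_keys_iff)
  finally show ?thesis .
qed

lemma lin_add: "lin n \<phi> (x + y) = lin n \<phi> x + lin n \<phi> y"
proof (rule eq_matI)
  fix i j assume "i < dim_row (lin n \<phi> x + lin n \<phi> y)" "j < dim_col (lin n \<phi> x + lin n \<phi> y)"
  then have ij: "i < n" "j < n" by auto
  let ?S = "Poly_Mapping.keys x \<union> Poly_Mapping.keys y"
  have k: "Poly_Mapping.keys (x + y) \<subseteq> ?S" by (rule Poly_Mapping.keys_add)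
  show "lin n \<phi> (x + y) $$ (i, j) = (lin n \<phi> x + lin n \<phi> y) $$ (i, j)"
    using ij by (simp add: lin_index[of ?S] k lookup_add algebra_simps sum.distrib)
qed auto

lemma lin_zero: "lin n \<phi> 0 = 0\<^sub>m n n"
  by (rule eq_matI) (auto simp: lin_def)

lemma lin_single: "\<phi> w \<in> carrier_mat n n \<Longrightarrow> lin n \<phi> (Poly_Mapping.single w c) = c \<cdot>\<^sub>m \<phi> w"
  by (rule eq_matI) (auto simp: lin_index[of "{w}"])

lemma poly_mapping_additive_induct [case_names zero single add]:
  assumes "P 0" "\<And>w c. P (Poly_Mapping.single w c)" "\<And>x y. P x \<Longrightarrow> P y \<Longrightarrow> P (x + y)"
  shows "P (z :: 'm \<Rightarrow>\<^sub>0 'b::comm_monoid_add)"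
proof -
  have "z = (\<Sum>w\<in>Poly_Mapping.keys z. Poly_Mapping.single w (Poly_Mapping.lookup z w))"
    by (rule poly_mapping_eqI)
       (auto simp: lookup_sum lookup_single when_def sum.delta' in_keys_iff cong: if_cong)
  moreover have "P (\<Sum>w\<in>S. Poly_Mapping.single w (f w))" if "finite S" for S f
    using that by induction (auto intro: assms)
  ultimately show ?thesis by (metis finite_keys)
qed

lemma smult_smult_mat: "a \<cdot>\<^sub>m (b \<cdot>\<^sub>m A) = (a * b :: complex) \<cdot>\<^sub>m A"
  by (rule eq_matI) auto

text \<open>The monoid is left abstract: words give representations of \<open>free_alg\<close>,
  pairs of words give representations of its tensor square.\<close>

locale mat_rep =
  fixes n :: nat and \<phi> :: "'m::monoid_add \<Rightarrow> complex mat"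
  assumes carrier [simp]: "\<And>w. \<phi> w \<in> carrier_mat n n"
    and zero: "\<phi> 0 = 1\<^sub>m n"
    and plus: "\<And>u v. \<phi> (u + v) = \<phi> u * \<phi> v"
begin

text \<open>Both sides are biadditive, so it suffices to compare them on monomials, where
  convolution adds the exponents and \<open>\<phi>\<close> turns sums into products.\<close>

lemma lin_mult: "lin n \<phi> (x * y) = lin n \<phi> x * lin n \<phi> y"
proof (induction x rule: poly_mapping_additive_induct)
  case zero
  show ?case by (simp add: lin_zero)
next
  case (add x y')
  then show ?case
    by (simp add: distrib_right lin_add add_mult_distrib_mat[of _ n n _ _ n])
next
  case (single u c)
  show ?case
  proof (induction y rule: poly_mapping_additive_induct)
    case zero
    then show ?case by (simp add: lin_zero)
  next
    case (add x y)
    then show ?case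
      by (simp add: distrib_left lin_add mult_add_distrib_mat[of _ n n _ n])
  next
    case (single v d)
    have "(c \<cdot>\<^sub>m \<phi> u) * (d \<cdot>\<^sub>m \<phi> v) = (c * d) \<cdot>\<^sub>m (\<phi> u * \<phi> v)"
      by (simp add: mult_smult_assoc_mat[of _ n n _ n] mult_smult_distrib[of _ n n _ n] smult_smult_mat mult.commute[of d c])
    then show ?case by (simp add: mult_single lin_single plus[symmetric])
  qed
qed

lemma lin_scal: "lin n \<phi> (scal c) = c \<cdot>\<^sub>m 1\<^sub>m n"
  by (simp add: scal_def lin_single zero[symmetric])

lemma lin_wd: "lin n \<phi> (wd w) = \<phi> w"
  unfolding wd_def by (subst lin_single) auto

lemma lin_one: "lin n \<phi> 1 = 1\<^sub>m n"
proof -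
  have "lin n \<phi> (scal 1) = 1\<^sub>m n" by (auto simp: lin_scal intro!: eq_matI)
  then show ?thesis by (simp add: scal_def)
qed

lemma lin_uminus: "lin n \<phi> (- x) = - lin n \<phi> x"
  by (rule eq_matI) (auto simp: lin_def sum_negf)

lemma lin_minus: "lin n \<phi> (x - y) = lin n \<phi> x - lin n \<phi> y"
  using lin_add[of n \<phi> x "- y"] by (simp add: lin_uminus add_uminus_minus_mat[of _ n n])

lemma lin_pow: "lin n \<phi> (x ^ k) = lin n \<phi> x ^\<^sub>m k"
  by (induction k) (simp_all add: lin_one lin_mult power_Suc2 del: power_Suc)

lemma lin_scal_mult: "lin n \<phi> (scal c * x) = c \<cdot>\<^sub>m lin n \<phi> x"
  by (simp add: lin_mult lin_scal mult_smult_assoc_mat[of _ n n _ n] left_mult_one_mat[of _ n n])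

end

lemma lin_intertwine:
  assumes A: "A \<in> carrier_mat m n" and c: "\<And>w. \<phi> w \<in> carrier_mat n n" "\<And>w. \<psi> w \<in> carrier_mat m m"
    and e: "\<And>w. A * \<phi> w = \<psi> w * A"
  shows "A * lin n \<phi> z = lin m \<psi> z * A"
proof (induction z rule: poly_mapping_additive_induct)
  case zero
  then show ?case using A by (simp add: lin_zero)
next
  case (single w d)
  then show ?case using A c[of w] e[of w]
    by (simp add: lin_single mult_smult_distrib[of _ m n _ n] mult_smult_assoc_mat[of _ m m _ n])
next
  case (add x y)
  then show ?case using A
    by (simp add: lin_add mult_add_distrib_mat[of _ m n _ n] add_mult_distrib_mat[of _ m m _ _ n])
qed

definition word_mat :: "nat \<Rightarrow> (gen \<Rightarrow> complex mat) \<Rightarrow> gen list \<Rightarrow> complex mat" where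
  "word_mat n M w = foldr (\<lambda>y N. M y * N) w (1\<^sub>m n)"

lemma word_mat_simps [simp]:
  "word_mat n M [] = 1\<^sub>m n" "word_mat n M (y # w) = M y * word_mat n M w"
  by (simp_all add: word_mat_def)

lemma word_mat_carrier:
  assumes "\<And>g. M g \<in> carrier_mat n n" shows "word_mat n M w \<in> carrier_mat n n"
  by (induction w) (use assms in \<open>auto intro: mult_carrier_mat\<close>)

lemma word_mat_rep:
  assumes "\<And>g. M g \<in> carrier_mat n n" shows "mat_rep n (word_mat n M)"
proof
  show "word_mat n M w \<in> carrier_mat n n" for w using assms by (rule word_mat_carrier)
  show "word_mat n M 0 = 1\<^sub>m n" by (simp add: zero_list_def)
  show "word_mat n M (u + v) = word_mat n M u * word_mat n M v" for u v
    unfolding plus_list_def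
  proof (induction u)
    case Nil
    then show ?case using word_mat_carrier[of M n v] assms by simp
  next
    case (Cons a u)
    then show ?case
      using assms word_mat_carrier[of M n u] word_mat_carrier[of M n v]
      by (simp add: assoc_mult_mat[of _ n n _ n _ n])
  qed
qed

lemma word_mat_intertwine:
  assumes "A \<in> carrier_mat m n" "\<And>g. M g \<in> carrier_mat n n" "\<And>g. N g \<in> carrier_mat m m"
    and e: "\<And>g. A * M g = N g * A"
  shows "A * word_mat n M w = word_mat m N w * A"
proof (induction w)
  case Nil
  then show ?case using assms by simp
next
  case (Cons g w)
  note c = word_mat_carrier[of M n w, OF assms(2)] word_mat_carrier[of N m w, OF assms(3)]
  have "A * (M g * word_mat n M w) = (A * M g) * word_mat n M w"
    by (rule assoc_mult_mat[symmetric, of _ m n _ n _ n]) (use assms c in auto)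
  also have "\<dots> = N g * (A * word_mat n M w)"
    unfolding e by (rule assoc_mult_mat[of _ m m _ n _ n]) (use assms c in auto)
  also have "\<dots> = N g * word_mat m N w * A"
    unfolding Cons by (rule assoc_mult_mat[symmetric, of _ m m _ m _ n]) (use assms c in auto)
  finally show ?case by simp
qed

section \<open>Roots of unity\<close>

text \<open>The power is \<open>cis (pi * m / a)\<close>, and the value 1 of \<open>cis\<close> is
  detected by the cosine alone, since sin^2 + cos^2 = 1. Thus \<open>qroot a\<close> is a primitive
  root of unity of order 2a.\<close>

lemma qroot_pow_eq_one_iff:
  assumes "a \<ge> 1" shows "qroot a ^ m = 1 \<longleftrightarrow> 2 * a dvd m"
proof -
  have e: "qroot a ^ m = cis (pi * m / a)"
    unfolding qroot_def exp_of_nat_mult[symmetric] cis_conv_exp by (simp add: mult_ac)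
  have "cis x = 1 \<longleftrightarrow> cos x = 1" for x
    using sin_cos_squared_add[of x] by (auto simp: complex_eq_iff power2_eq_square)
  then have "qroot a ^ m = 1 \<longleftrightarrow> (\<exists>k::int. pi * m / a = of_int (2 * k) * pi)"
    unfolding e by (simp add: cos_one_2pi_int mult_ac)
  also have "\<dots> \<longleftrightarrow> (\<exists>k::int. int m = 2 * k * int a)"
  proof (intro iff_exI)
    fix k :: int
    have "pi * m / a = of_int (2 * k) * pi \<longleftrightarrow> pi * real m = pi * (of_int (2 * k) * real a)"
      using assms by (simp add: field_simps)
    also have "\<dots> \<longleftrightarrow> real_of_int (int m) = real_of_int (2 * k * int a)"
      by simp
    also have "\<dots> \<longleftrightarrow> int m = 2 * k * int a" by (rule of_int_eq_iff)
    finally show "pi * m / a = of_int (2 * k) * pi \<longleftrightarrow> int m = 2 * k * int a" .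
  qed
  also have "\<dots> \<longleftrightarrow> int (2 * a) dvd int m"
    unfolding dvd_def by (intro iff_exI) (simp add: mult_ac)
  also have "\<dots> \<longleftrightarrow> 2 * a dvd m" by (rule int_dvd_int_iff)
  finally show ?thesis .
qed

lemma qroot_nonzero [simp]: "qroot a \<noteq> 0"
  by (simp add: qroot_def)

lemma qroot_pow_self: "a \<ge> 1 \<Longrightarrow> qroot a ^ a = -1"
proof -
  assume a: "a \<ge> 1"
  have "(qroot a ^ a)\<^sup>2 = 1" using qroot_pow_eq_one_iff[OF a, of "a * 2"] by (simp add: power_mult mult.commute)
  moreover have "qroot a ^ a \<noteq> 1" using qroot_pow_eq_one_iff[OF a, of a] a by (auto dest: dvd_imp_le)
  ultimately show ?thesis by (simp add: power2_eq_1_iff)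
qed

lemma qroot_pow_double: "a \<ge> 1 \<Longrightarrow> qroot a ^ (2 * a * k) = 1"
  by (simp add: qroot_pow_eq_one_iff)

lemma Qpar_nonzero [simp]: "Qpar a b \<noteq> 0"
  by (simp add: Qpar_def)

text \<open>Q^2 = exp(2 pi i b / a) has order exactly a because b is coprime to a. The vanishing
  behaviour of q-binomial coefficients and of quantum integers comes from this.\<close>

lemma Qpar_primitive:
  assumes "a \<ge> 1" "coprime a b" "0 < j" "j < a"
  shows "(Qpar a b)\<^sup>2 ^ j \<noteq> 1"
proof
  assume "(Qpar a b)\<^sup>2 ^ j = 1"
  then have "qroot a ^ (b * 2 * j) = 1" by (simp add: Qpar_def power_mult)
  then have "2 * a dvd 2 * (b * j)" using qroot_pow_eq_one_iff[OF assms(1)] by (simp add: mult_ac)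
  then have "a dvd b * j" by simp
  then have "a dvd j" using assms(2) coprime_dvd_mult_right_iff by blast
  then show False using assms by (auto dest: dvd_imp_le)
qed

lemma Qpar_pow: "a \<ge> 1 \<Longrightarrow> (Qpar a b)\<^sup>2 ^ a = 1"
proof -
  assume a: "a \<ge> 1"
  have "(Qpar a b)\<^sup>2 ^ a = qroot a ^ (2 * a * b)"
    unfolding Qpar_def by (simp add: power_mult[symmetric] mult_ac)
  then show ?thesis using a by (simp add: qroot_pow_double)
qed

section \<open>Matrix algebra with side conditions on dimensions only\<close>

lemma mat_assoc:
  "dim_col A = dim_row B \<Longrightarrow> dim_col B = dim_row C \<Longrightarrow> (A * B) * C = A * (B * (C :: complex mat))"
  by (rule assoc_mult_mat[of _ "dim_row A" "dim_row B" _ "dim_row C" _ "dim_col C"]) auto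

lemma mat_smult_left: "dim_col A = dim_row B \<Longrightarrow> (c \<cdot>\<^sub>m A) * B = c \<cdot>\<^sub>m (A * (B :: complex mat))"
  by (rule mult_smult_assoc_mat[of _ "dim_row A" "dim_row B" _ "dim_col B"]) auto

lemma mat_smult_right: "dim_col A = dim_row B \<Longrightarrow> A * (c \<cdot>\<^sub>m B) = c \<cdot>\<^sub>m (A * (B :: complex mat))"
  by (rule mult_smult_distrib[of _ "dim_row A" "dim_row B" _ "dim_col B"]) auto

declare assoc_mult_mat [simp del]

section \<open>The Gaussian binomial theorem\<close>

text \<open>Gaussian binomial coefficients by Pascal's rule. The recursion makes sense for every
  \<open>t\<close>, in particular at roots of unity, where the quotient formula may read
  0/0.\<close>

fun qbinom :: "complex \<Rightarrow> nat \<Rightarrow> nat \<Rightarrow> complex" where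
  "qbinom t n 0 = 1"
| "qbinom t 0 (Suc k) = 0"
| "qbinom t (Suc n) (Suc k) = qbinom t n k + t ^ Suc k * qbinom t n (Suc k)"

text \<open>Pascal's rule adds two products that differ in one factor, and (1 - t^(k+1)) + t^(k+1)
  (1 - t^(n-k)) = 1 - t^(n+1) for k <= n. The denominator of the quotient formula is kept on the
  left because it may vanish.\<close>

lemma qbinom_prod: "qbinom t n k * (\<Prod>i<k. 1 - t ^ Suc i) = (\<Prod>i<k. 1 - t ^ (n - i))"
proof (induction t n k rule: qbinom.induct)
  case (2 t k)
  then show ?case by (simp add: prod.lessThan_Suc_shift del: prod.lessThan_Suc)
next
  case (3 t n k)
  let ?D = "\<lambda>k. \<Prod>i<k. 1 - t ^ Suc i" and ?N = "\<lambda>n k. \<Prod>i<k. 1 - t ^ (n - i)"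
  have "qbinom t (Suc n) (Suc k) * ?D (Suc k) = (qbinom t n k * ?D k) * (1 - t ^ Suc k)
      + t ^ Suc k * (qbinom t n (Suc k) * ?D (Suc k))"
    by (simp add: algebra_simps)
  also have "\<dots> = ?N n k * (1 - t ^ Suc k) + t ^ Suc k * ?N n (Suc k)"
    using 3 by (simp only:)
  also have "\<dots> = ?N n k * (1 - t ^ (Suc k + (n - k)))"
    by (simp add: algebra_simps power_add)
  also have "\<dots> = ?N n k * (1 - t ^ Suc n)"
  proof (cases "k \<le> n")
    case False
    \<comment> \<open>Here n < k, so the product contains the factor with i = n, which is 1 - t^0 =
      0.\<close>
    then have "?N n k = 0" by (intro prod_zero bexI[of _ n]) auto
    then show ?thesis by (simp only: mult_zero_left)
  qed simp
  also have "\<dots> = ?N (Suc n) (Suc k)"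
    by (simp only: prod.lessThan_Suc_shift) (simp add: mult.commute)
  finally show ?case .
qed auto

text \<open>At a primitive n-th root of unity the numerator contains 1 - t^n = 0, while the factors
  1 - t^(i+1) of the denominator, with i < k < n, are all nonzero.\<close>

lemma qbinom_eq_0:
  assumes "t ^ n = 1" "\<And>j. 0 < j \<Longrightarrow> j < n \<Longrightarrow> t ^ j \<noteq> 1" "0 < k" "k < n"
  shows "qbinom t n k = 0"
proof -
  have "(\<Prod>i<k. 1 - t ^ (n - i)) = 0"
    using assms by (intro prod_zero) (auto intro!: bexI[of _ 0])
  moreover have "(\<Prod>i<k. 1 - t ^ Suc i) \<noteq> 0"
    using assms(2)[of "Suc _"] assms(4) by (auto simp del: power_Suc)
  ultimately show ?thesis using qbinom_prod[of t n k] by (metis mult_eq_0_iff)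
qed

lemma qbinom_gt: "n < k \<Longrightarrow> qbinom t n k = 0"
  by (induction t n k rule: qbinom.induct) auto

lemma pow_mat_Suc_left: "A \<in> carrier_mat n n \<Longrightarrow> A ^\<^sub>m Suc k = A * (A :: complex mat) ^\<^sub>m k"
  by (induction k) (simp_all add: mat_assoc)

lemma mat_qcommute_pow:
  assumes "U \<in> carrier_mat n n" "W \<in> carrier_mat n n" "W * U = (t :: complex) \<cdot>\<^sub>m (U * W)"
  shows "W * U ^\<^sub>m k = (t ^ k) \<cdot>\<^sub>m (U ^\<^sub>m k * W)"
proof (induction k)
  case 0
  then show ?case using assms by (simp add: smult_mat_def) (auto intro!: eq_matI)
next
  case (Suc k)
  note c = assms(1,2) pow_carrier_mat[OF assms(1), of k]
  have "W * U ^\<^sub>m Suc k = (W * U ^\<^sub>m k) * U"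
    using c by (simp add: mat_assoc)
  also have "\<dots> = (t ^ k) \<cdot>\<^sub>m (U ^\<^sub>m k * (W * U))"
    using c Suc by (simp add: mat_smult_left mat_assoc)
  also have "\<dots> = (t ^ Suc k) \<cdot>\<^sub>m (U ^\<^sub>m Suc k * W)"
    using c assms by (simp add: mat_smult_right mat_assoc smult_smult_mat mult.commute)
  finally show ?case .
qed

text \<open>The factor U + W is multiplied on from the left; moving W past U^k costs t^k, which is
  the coefficient in Pascal's rule. Entries are compared so that the right-hand side is a sum of
  numbers.\<close>

lemma mat_qbinomial:
  assumes c: "U \<in> carrier_mat N N" "W \<in> carrier_mat N N" and q: "W * U = (t :: complex) \<cdot>\<^sub>m (U * W)"
    and ij: "i < N" "j < N"
  shows "((U + W) ^\<^sub>m n) $$ (i, j) = (\<Sum>k\<le>n. qbinom t n k * (U ^\<^sub>m k * W ^\<^sub>m (n - k)) $$ (i, j))"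
  using ij
proof (induction n arbitrary: i j)
  case 0
  then show ?case using c by simp
next
  case (Suc n)
  note p = pow_carrier_mat[OF c(1)] pow_carrier_mat[OF c(2)]
  have m: "U ^\<^sub>m k * W ^\<^sub>m (n - k) \<in> carrier_mat N N" for k using p by (metis mult_carrier_mat)
  have s: "U + W \<in> carrier_mat N N" using c by simp
  let ?f = "\<lambda>k. (U ^\<^sub>m k * W ^\<^sub>m (Suc n - k)) $$ (i, j)"
  have step: "((U + W) * (U ^\<^sub>m k * W ^\<^sub>m (n - k))) $$ (i, j) = ?f (Suc k) + t ^ k * ?f k" if "k \<le> n" for k
  proof -
    have "U * (U ^\<^sub>m k * W ^\<^sub>m (n - k)) = U ^\<^sub>m Suc k * W ^\<^sub>m (n - k)"
      using c by (simp add: pow_mat_Suc_left[of U N] mat_assoc del: pow_mat.simps)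
    moreover have "W * (U ^\<^sub>m k * W ^\<^sub>m (n - k)) = (t ^ k) \<cdot>\<^sub>m (U ^\<^sub>m k * W ^\<^sub>m (Suc n - k))"
    proof -
      have "W * (U ^\<^sub>m k * W ^\<^sub>m (n - k)) = (W * U ^\<^sub>m k) * W ^\<^sub>m (n - k)"
        using c by (simp add: mat_assoc)
      also have "\<dots> = (t ^ k) \<cdot>\<^sub>m (U ^\<^sub>m k * (W * W ^\<^sub>m (n - k)))"
        using c by (simp add: mat_qcommute_pow[OF c q] mat_smult_left mat_assoc)
      also have "W * W ^\<^sub>m (n - k) = W ^\<^sub>m (Suc n - k)"
        using c that by (simp only: pow_mat_Suc_left[symmetric] Suc_diff_le)
      finally show ?thesis .
    qed
    ultimately have "(U + W) * (U ^\<^sub>m k * W ^\<^sub>m (n - k)) =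
        U ^\<^sub>m Suc k * W ^\<^sub>m (n - k) + (t ^ k) \<cdot>\<^sub>m (U ^\<^sub>m k * W ^\<^sub>m (Suc n - k))"
      using m c by (simp add: add_mult_distrib_mat[of _ N N _ _ N])
    then show ?thesis using Suc.prems c p by (simp del: index_mult_mat(1) pow_mat.simps)
  qed
  have "((U + W) ^\<^sub>m Suc n) $$ (i, j) = ((U + W) * (U + W) ^\<^sub>m n) $$ (i, j)"
    using s by (simp only: pow_mat_Suc_left)
  also have "\<dots> = (\<Sum>l<N. (U + W) $$ (i, l) * (\<Sum>k\<le>n. qbinom t n k * (U ^\<^sub>m k * W ^\<^sub>m (n - k)) $$ (l, j)))"
    using Suc s by (subst mult_mat_index[of _ N N _ N]) (auto intro!: sum.cong)
  also have "\<dots> = (\<Sum>k\<le>n. qbinom t n k * (\<Sum>l<N. (U + W) $$ (i, l) * (U ^\<^sub>m k * W ^\<^sub>m (n - k)) $$ (l, j)))"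
    by (simp only: sum_distrib_left, subst sum.swap) (simp only: mult_ac)
  also have "\<dots> = (\<Sum>k\<le>n. qbinom t n k * ((U + W) * (U ^\<^sub>m k * W ^\<^sub>m (n - k))) $$ (i, j))"
    using Suc.prems s m by (simp add: mult_mat_index[of _ N N _ N] del: index_mult_mat(1))
  also have "\<dots> = (\<Sum>k\<le>n. qbinom t n k * (?f (Suc k) + t ^ k * ?f k))"
    by (intro sum.cong) (auto simp: step)
  also have "\<dots> = (\<Sum>k\<le>n. qbinom t n k * ?f (Suc k)) + (\<Sum>k\<le>n. t ^ k * qbinom t n k * ?f k)"
    by (simp only: distrib_left sum.distrib mult_ac)
  also have "(\<Sum>k\<le>n. t ^ k * qbinom t n k * ?f k) = (\<Sum>k\<le>Suc n. t ^ k * qbinom t n k * ?f k)"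
    by (simp add: qbinom_gt)
  also have "\<dots> = ?f 0 + (\<Sum>k\<le>n. t ^ Suc k * qbinom t n (Suc k) * ?f (Suc k))"
    by (simp only: sum.atMost_Suc_shift) (simp del: index_mult_mat(1))
  also have "(\<Sum>k\<le>n. qbinom t n k * ?f (Suc k)) + (?f 0 + (\<Sum>k\<le>n. t ^ Suc k * qbinom t n (Suc k) * ?f (Suc k)))
     = (\<Sum>k\<le>Suc n. qbinom t (Suc n) k * ?f k)"
    by (simp only: sum.atMost_Suc_shift qbinom.simps distrib_right sum.distrib) (simp only: add_ac mult_1_left)
  finally show ?case .
qed

text \<open>All middle q-binomial coefficients vanish at a primitive n-th root of unity, so only U^n
  and W^n survive, as for a Frobenius map.\<close>

lemma mat_qbinomial_nilpotent:
  assumes c: "U \<in> carrier_mat N N" "W \<in> carrier_mat N N" and q: "W * U = (t :: complex) \<cdot>\<^sub>m (U * W)"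
    and n: "U ^\<^sub>m n = 0\<^sub>m N N" "W ^\<^sub>m n = 0\<^sub>m N N"
    and t: "t ^ n = 1" "\<And>j. 0 < j \<Longrightarrow> j < n \<Longrightarrow> t ^ j \<noteq> 1"
  shows "(U + W) ^\<^sub>m n = 0\<^sub>m N N"
proof (rule eq_matI)
  fix i j assume "i < dim_row (0\<^sub>m N N :: complex mat)" "j < dim_col (0\<^sub>m N N :: complex mat)"
  then have ij: "i < N" "j < N" by auto
  note p = pow_carrier_mat[OF c(1)] pow_carrier_mat[OF c(2)]
  have "((U + W) ^\<^sub>m n) $$ (i, j) = (\<Sum>k\<le>n. qbinom t n k * (U ^\<^sub>m k * W ^\<^sub>m (n - k)) $$ (i, j))"
    by (rule mat_qbinomial[OF c q ij])
  also have "\<dots> = 0"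
  proof (rule sum.neutral, rule ballI)
    fix k assume "k \<in> {..n}"
    then consider "k = 0" | "k = n" | "0 < k" "k < n" by fastforce
    then show "qbinom t n k * (U ^\<^sub>m k * W ^\<^sub>m (n - k)) $$ (i, j) = 0"
    proof cases
      case 1
      then show ?thesis using n ij p[of 0] c
        by (simp add: right_mult_zero_mat[of _ N N] del: index_mult_mat(1))
    next
      case 2
      then show ?thesis using n ij p[of 0] c
        by (simp add: left_mult_zero_mat[of _ N N] del: index_mult_mat(1))
    qed (simp add: qbinom_eq_0[OF t])
  qed
  finally show "((U + W) ^\<^sub>m n) $$ (i, j) = (0\<^sub>m N N :: complex mat) $$ (i, j)" using ij by simp
qed (use c in auto)

section \<open>Modules as tuples of matrices\<close>

lemma ring_type_algebra: "ring (ring_of_type_algebra :: ('m::monoid_add \<Rightarrow>\<^sub>0 complex) ring)"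
proof -
  have "\<exists>y. x + y = 0" for x :: "'m \<Rightarrow>\<^sub>0 complex"
    using add.right_inverse by blast
  then show ?thesis
    unfolding ring_of_type_algebra_def using add.right_inverse
    by unfold_locales (auto simp: algebra_simps Units_def)
qed

text \<open>A representation of a free algebra is an arbitrary choice of matrices for its
  generators; \<open>gens\<close> recovers them.\<close>

definition mk_module :: "nat \<Rightarrow> (gen \<Rightarrow> complex mat) \<Rightarrow> fd_module" where
  "mk_module n M = (n, lin n (word_mat n M))"

definition gens :: "fd_module \<Rightarrow> gen \<Rightarrow> complex mat" where
  "gens V g = snd V (gn g)"

lemma fst_mk_module [simp]: "fst (mk_module n M) = n"
  by (simp add: mk_module_def)

lemma snd_mk_module: "snd (mk_module n M) = lin n (word_mat n M)"
  by (simp add: mk_module_def)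

lemma lin_gn:
  assumes "\<And>g. M g \<in> carrier_mat n n" shows "lin n (word_mat n M) (gn g) = M g"
proof -
  interpret mat_rep n "word_mat n M" using assms by (rule word_mat_rep)
  show ?thesis by (simp add: gn_def lin_wd right_mult_one_mat[OF assms])
qed

lemma gens_mk_module:
  "(\<And>g. M g \<in> carrier_mat n n) \<Longrightarrow> gens (mk_module n M) = M"
  by (rule ext) (simp add: gens_def snd_mk_module lin_gn)

lemma wd_append: "wd (u @ v) = wd u * wd v"
  by (simp add: wd_def mult_single plus_list_def)

lemma wd_Nil: "wd [] = 1"
  by (simp add: wd_def zero_list_def[symmetric])

text \<open>A ring homomorphism out of the free algebra is determined by the generators and the
  scalars. The conclusion is an equality of pairs, not an isomorphism, so a module may be replaced
  by its five matrices everywhere.\<close>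

lemma modules_eq_mk_module:
  assumes "V \<in> modules p p'"
  shows "V = mk_module (fst V) (gens V)" and "\<And>g. gens V g \<in> carrier_mat (fst V) (fst V)"
    and "\<And>w. snd V (wd w) = word_mat (fst V) (gens V) w"
proof -
  obtain n \<rho> where V: "V = (n, \<rho>)" by (cases V)
  have h: "\<rho> \<in> Ring.ring_hom ring_of_type_algebra (ring_mat TYPE(complex) n ())"
    and s: "\<And>c. \<rho> (scal c) = c \<cdot>\<^sub>m 1\<^sub>m n"
    using assms by (auto simp: modules_def V)
  have c: "\<rho> x \<in> carrier_mat n n" for x
    using ring_hom_closed[OF h] by (simp add: ring_of_type_algebra_def ring_mat_def)
  have m: "\<rho> (x * y) = \<rho> x * \<rho> y" for x y
    using ring_hom_mult[OF h] by (simp add: ring_of_type_algebra_def ring_mat_def)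
  have a: "\<rho> (x + y) = \<rho> x + \<rho> y" for x y
    using ring_hom_add[OF h] by (simp add: ring_of_type_algebra_def ring_mat_def)
  have o: "\<rho> 1 = 1\<^sub>m n"
    using ring_hom_one[OF h] by (simp add: ring_of_type_algebra_def ring_mat_def)
  have z: "\<rho> 0 = 0\<^sub>m n n"
    using s[of 0] by (simp add: scal_def) (auto intro!: eq_matI)
  show g: "gens V g \<in> carrier_mat (fst V) (fst V)" for g
    by (simp add: V gens_def c)
  show w: "snd V (wd w) = word_mat (fst V) (gens V) w" for w
  proof (induction w)
    case Nil
    then show ?case by (simp add: V wd_Nil o)
  next
    case (Cons x w)
    have "wd (x # w) = gn x * wd w" using wd_append[of "[x]" w] by (simp add: gn_def)
    then show ?case using Cons by (simp add: V m gens_def)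
  qed
  have gc: "gens V g \<in> carrier_mat n n" for g using g[of g] by (simp add: V)
  note wc = word_mat_carrier[of "gens V" n, OF gc]
  have "\<rho> x = lin n (word_mat n (gens V)) x" for x
  proof (induction x rule: poly_mapping_additive_induct)
    case zero
    then show ?case by (simp add: z lin_zero)
  next
    case (single u d)
    have "Poly_Mapping.single u d = scal d * wd u"
      by (simp add: scal_def wd_def mult_single)
    moreover have "\<rho> (wd u) = word_mat n (gens V) u" using w[of u] by (simp add: V)
    ultimately have "\<rho> (Poly_Mapping.single u d) = d \<cdot>\<^sub>m word_mat n (gens V) u"
      using wc[of u] by (simp add: m s mat_smult_left)
    then show ?case by (simp add: lin_single wc)
  next
    case (add x y)
    then show ?case by (simp add: a lin_add)
  qed
  then show "V = mk_module (fst V) (gens V)" by (auto simp: mk_module_def V)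
qed

text \<open>The relators evaluated on matrices and brought into a convenient form: inverse powers of
  K become the exponents \<open>2 * p * p' - k\<close>, and K e K^(-1) = q^2 e is written as K e =
  q^2 e K.\<close>

definition mod_rels :: "nat \<Rightarrow> nat \<Rightarrow> nat \<Rightarrow> (gen \<Rightarrow> complex mat) \<Rightarrow> bool" where
  "mod_rels p p' n M \<longleftrightarrow>
     (\<forall>g. M g \<in> carrier_mat n n) \<and>
     M EP ^\<^sub>m p = 0\<^sub>m n n \<and> M FP ^\<^sub>m p = 0\<^sub>m n n \<and> M EM ^\<^sub>m p' = 0\<^sub>m n n \<and> M FM ^\<^sub>m p' = 0\<^sub>m n n \<and>
     M KK ^\<^sub>m (2 * p * p') = 1\<^sub>m n \<and>
     M KK * M EP = (qroot p)\<^sup>2 \<cdot>\<^sub>m (M EP * M KK) \<and>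
     M KK * M EM = (qroot p')\<^sup>2 \<cdot>\<^sub>m (M EM * M KK) \<and>
     M KK * M FP = inverse ((qroot p)\<^sup>2) \<cdot>\<^sub>m (M FP * M KK) \<and>
     M KK * M FM = inverse ((qroot p')\<^sup>2) \<cdot>\<^sub>m (M FM * M KK) \<and>
     (\<forall>x\<in>{EP, FP}. \<forall>y\<in>{EM, FM}. M x * M y = M y * M x) \<and>
     (p \<noteq> 1 \<longrightarrow> M EP * M FP - M FP * M EP = (1 / (Qpar p p' - inverse (Qpar p p'))) \<cdot>\<^sub>m
        (M KK ^\<^sub>m p' - M KK ^\<^sub>m (2 * p * p' - p'))) \<and>
     (p' \<noteq> 1 \<longrightarrow> M EM * M FM - M FM * M EM = (1 / (Qpar p' p - inverse (Qpar p' p))) \<cdot>\<^sub>m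
        (M KK ^\<^sub>m p - M KK ^\<^sub>m (2 * p * p' - p)))"

lemma word_mat_replicate:
  assumes "\<And>g. M g \<in> carrier_mat n n"
  shows "word_mat n M (replicate k g) = M g ^\<^sub>m k"
proof (induction k)
  case 0
  then show ?case using assms[of g] by simp
next
  case (Suc k)
  have "M g ^\<^sub>m Suc k = M g * M g ^\<^sub>m k" using assms by (rule pow_mat_Suc_left)
  then show ?case using Suc by simp
qed

lemma mat_minus_eq_zero_iff:
  "A \<in> carrier_mat n m \<Longrightarrow> B \<in> carrier_mat n m \<Longrightarrow> A - B = 0\<^sub>m n m \<longleftrightarrow> A = (B :: complex mat)"
proof
  assume c: "A \<in> carrier_mat n m" "B \<in> carrier_mat n m" and e: "A - B = 0\<^sub>m n m"
  show "A = B"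
  proof (rule eq_matI)
    fix i j assume "i < dim_row B" "j < dim_col B"
    then have "(A - B) $$ (i, j) = 0" using c e by simp
    then show "A $$ (i, j) = B $$ (i, j)" using c \<open>i < dim_row B\<close> \<open>j < dim_col B\<close> by simp
  qed (use c in auto)
qed auto

lemma nat_mod_exponents:
  assumes "p \<ge> 1" "p' \<ge> 1"
  shows "nat (- 1 mod (2 * int p * int p')) = 2 * p * p' - 1"
    "nat (int p' mod (2 * int p * int p')) = p'"
    "nat (- int p' mod (2 * int p * int p')) = 2 * p * p' - p'"
    "nat (int p mod (2 * int p * int p')) = p"
    "nat (- int p mod (2 * int p * int p')) = 2 * p * p' - p"
proof -
  have neg: "nat (- int k mod (2 * int p * int p')) = 2 * p * p' - k" if "0 < k" "k \<le> 2 * p * p'" for k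
  proof -
    have "- int k mod (2 * int p * int p') = (2 * int p * int p' - int k) mod (2 * int p * int p')"
      by simp
    also have "\<dots> = 2 * int p * int p' - int k"
    proof (rule mod_pos_pos_trivial)
      have "int k \<le> int (2 * p * p')" using that(2) by (simp only: of_nat_le_iff)
      then show "0 \<le> 2 * int p * int p' - int k" by simp
    qed (use that in simp)
    finally have "- int k mod (2 * int p * int p') = int (2 * p * p' - k)"
      using that(2) by (simp only: of_nat_diff) simp
    then show ?thesis by simp
  qed
  have le: "p' \<le> 2 * p * p'" "p \<le> 2 * p * p'" "1 \<le> 2 * p * p'" using assms by auto
  show "nat (- 1 mod (2 * int p * int p')) = 2 * p * p' - 1"
    using neg[of 1] le by simp
  show "nat (- int p' mod (2 * int p * int p')) = 2 * p * p' - p'"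
    "nat (- int p mod (2 * int p * int p')) = 2 * p * p' - p"
    using neg[of p] neg[of p'] assms le by simp_all
  have pos: "nat (int k mod (2 * int p * int p')) = k" if "k < 2 * p * p'" for k
  proof -
    have "int k < int (2 * p * p')" using that by (simp only: of_nat_less_iff)
    then have "int k mod int (2 * p * p') = int k" by (intro mod_pos_pos_trivial) (rule of_nat_0_le_iff)
    then show ?thesis by simp
  qed
  have "p' < 2 * p * p'" "p < 2 * p * p'" using assms by auto
  then show "nat (int p' mod (2 * int p * int p')) = p'" "nat (int p mod (2 * int p * int p')) = p"
    by (simp_all add: pos)
qed

text \<open>K^m is the inverse of K, so conjugation by K is traded for q-commutation by multiplying
  with K or K^m on the right.\<close>

lemma conj_relation_iff:
  assumes c: "(K :: complex mat) \<in> carrier_mat n n" "U \<in> carrier_mat n n" and k: "K ^\<^sub>m Suc m = 1\<^sub>m n"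
  shows "K * U * K ^\<^sub>m m - c \<cdot>\<^sub>m U = 0\<^sub>m n n \<longleftrightarrow> K * U = c \<cdot>\<^sub>m (U * K)"
proof -
  note p = pow_carrier_mat[OF c(1), of m]
  have l: "K * K ^\<^sub>m m = 1\<^sub>m n" using k pow_mat_Suc_left[OF c(1), of m] by metis
  have r: "K ^\<^sub>m m * K = 1\<^sub>m n" using k by simp
  have "K * U * K ^\<^sub>m m - c \<cdot>\<^sub>m U = 0\<^sub>m n n \<longleftrightarrow> K * U * K ^\<^sub>m m = c \<cdot>\<^sub>m U"
    using c p by (intro mat_minus_eq_zero_iff) auto
  also have "\<dots> \<longleftrightarrow> K * U = c \<cdot>\<^sub>m (U * K)"
  proof
    assume a: "K * U * K ^\<^sub>m m = c \<cdot>\<^sub>m U"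
    have "K * U = K * U * (K ^\<^sub>m m * K)" unfolding r using c by simp
    also have "\<dots> = (K * U * K ^\<^sub>m m) * K"
      by (rule assoc_mult_mat[symmetric, of _ n n _ n _ n]) (use c p in auto)
    also have "\<dots> = c \<cdot>\<^sub>m (U * K)" unfolding a using c by (simp add: mult_smult_assoc_mat[of _ n n _ n])
    finally show "K * U = c \<cdot>\<^sub>m (U * K)" .
  next
    assume a: "K * U = c \<cdot>\<^sub>m (U * K)"
    have "K * U * K ^\<^sub>m m = c \<cdot>\<^sub>m (U * (K * K ^\<^sub>m m))"
      unfolding a using c p by (simp add: mult_smult_assoc_mat[of _ n n _ n] assoc_mult_mat[of _ n n _ n _ n])
    then show "K * U * K ^\<^sub>m m = c \<cdot>\<^sub>m U" unfolding l using c by simp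
  qed
  finally show ?thesis .
qed

lemma ball_relators_iff:
  "(\<forall>x\<in>relators p p'. Z x) \<longleftrightarrow>
     Z (gn EP ^ p) \<and> Z (gn FP ^ p) \<and> Z (gn EM ^ p') \<and> Z (gn FM ^ p') \<and>
     Z (gn KK ^ (2 * p * p') - 1) \<and>
     Z (gn KK * gn EP * Kpow p p' (-1) - scal (qroot p ^ 2) * gn EP) \<and>
     Z (gn KK * gn EM * Kpow p p' (-1) - scal (qroot p' ^ 2) * gn EM) \<and>
     Z (gn KK * gn FP * Kpow p p' (-1) - scal (qroot p powi (-2)) * gn FP) \<and>
     Z (gn KK * gn FM * Kpow p p' (-1) - scal (qroot p' powi (-2)) * gn FM) \<and>
     (\<forall>x\<in>{EP, FP}. \<forall>y\<in>{EM, FM}. Z (gn x * gn y - gn y * gn x)) \<and>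
     (p \<noteq> 1 \<longrightarrow> Z (gn EP * gn FP - gn FP * gn EP
         - scal (1 / (Qpar p p' - inverse (Qpar p p'))) * (Kpow p p' (int p') - Kpow p p' (- int p')))) \<and>
     (p' \<noteq> 1 \<longrightarrow> Z (gn EM * gn FM - gn FM * gn EM
         - scal (1 / (Qpar p' p - inverse (Qpar p' p))) * (Kpow p p' (int p) - Kpow p p' (- int p))))"
proof -
  have c: "(\<forall>x\<in>{gn x * gn y - gn y * gn x |x y. x \<in> {EP, FP} \<and> y \<in> {EM, FM}}. Z x) \<longleftrightarrow>
     (\<forall>x\<in>{EP, FP}. \<forall>y\<in>{EM, FM}. Z (gn x * gn y - gn y * gn x))" by blast
  show ?thesis
    unfolding relators_def ball_Un c by (cases "p = 1"; cases "p' = 1"; simp only: ball_simps if_True if_False simp_thms conj_assoc)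
qed

text \<open>The elements acting by zero form the kernel of a ring homomorphism, hence a two-sided
  ideal. It contains the ideal generated by the relators as soon as it contains the
  relators.\<close>

lemma mk_module_in_modules_iff:
  assumes p: "p \<ge> 1" "p' \<ge> 1" and c: "\<And>g. M g \<in> carrier_mat n n"
  shows "mk_module n M \<in> modules p p' \<longleftrightarrow> mod_rels p p' n M"
proof -
  interpret mat_rep n "word_mat n M" using c by (rule word_mat_rep)
  let ?\<rho> = "lin n (word_mat n M)"
  let ?R = "ring_of_type_algebra :: free_alg ring" and ?S = "ring_mat TYPE(complex) n ()"
  have h: "?\<rho> \<in> Ring.ring_hom ?R ?S"
    by (rule ring_hom_memI) (auto simp: ring_of_type_algebra_def ring_mat_def lin_mult lin_add lin_one)
  have kernel_ideal: "ideal (a_kernel ?R ?S ?\<rho>) ?R"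
    by (rule ring_hom_ring.kernel_is_ideal[OF ring_hom_ringI2[OF ring_type_algebra ring_mat h]])
  have kernel: "x \<in> a_kernel ?R ?S ?\<rho> \<longleftrightarrow> ?\<rho> x = 0\<^sub>m n n" for x
    by (simp add: a_kernel_def' ring_of_type_algebra_def ring_mat_def)
  have ideal: "(\<forall>x\<in>rel_ideal p p'. ?\<rho> x = 0\<^sub>m n n) \<longleftrightarrow> (\<forall>x\<in>relators p p'. ?\<rho> x = 0\<^sub>m n n)"
  proof
    assume a: "\<forall>x\<in>relators p p'. ?\<rho> x = 0\<^sub>m n n"
    have "rel_ideal p p' \<subseteq> a_kernel ?R ?S ?\<rho>"
      unfolding rel_ideal_def using a
      by (intro ring.genideal_minimal[OF ring_type_algebra] kernel_ideal) (auto simp: kernel)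
    then show "\<forall>x\<in>rel_ideal p p'. ?\<rho> x = 0\<^sub>m n n" using kernel by blast
  next
    assume a: "\<forall>x\<in>rel_ideal p p'. ?\<rho> x = 0\<^sub>m n n"
    have "relators p p' \<subseteq> rel_ideal p p'"
      unfolding rel_ideal_def by (rule ring.genideal_self[OF ring_type_algebra]) (simp add: ring_of_type_algebra_def)
    with a show "\<forall>x\<in>relators p p'. ?\<rho> x = 0\<^sub>m n n" by blast
  qed
  have g: "?\<rho> (gn x) = M x" for x by (rule lin_gn[OF c])
  have Kp: "?\<rho> (Kpow p p' k) = M KK ^\<^sub>m nat (k mod (2 * int p * int p'))" for k
    by (simp add: Kpow_def Kword_def lin_wd word_mat_replicate[OF c])
  have cc: "M x * M y \<in> carrier_mat n n" for x y using c by (metis mult_carrier_mat)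
  have pc: "M x ^\<^sub>m k \<in> carrier_mat n n" for x k using c by simp
  have one: "Suc (2 * p * p' - 1) = 2 * p * p'" using p by simp
  have K1: "?\<rho> (gn KK ^ (2 * p * p') - 1) = 0\<^sub>m n n \<longleftrightarrow> M KK ^\<^sub>m (2 * p * p') = 1\<^sub>m n"
    by (simp add: lin_minus lin_pow lin_one g mat_minus_eq_zero_iff[OF pc])
  have conj: "?\<rho> (gn KK * gn x * Kpow p p' (- 1) - scal d * gn x) = 0\<^sub>m n n \<longleftrightarrow>
      M KK * M x = d \<cdot>\<^sub>m (M x * M KK)" if "M KK ^\<^sub>m (2 * p * p') = 1\<^sub>m n" for x d
  proof -
    have "?\<rho> (gn KK * gn x * Kpow p p' (- 1) - scal d * gn x) =
        M KK * M x * M KK ^\<^sub>m (2 * p * p' - 1) - d \<cdot>\<^sub>m M x"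
      by (simp only: lin_minus lin_scal_mult) (simp only: lin_mult g Kp nat_mod_exponents[OF p])
    then show ?thesis
      using conj_relation_iff[OF c[of KK] c[of x], of "2 * p * p' - 1" d] that unfolding one by simp
  qed
  have comm: "?\<rho> (gn x * gn y - gn y * gn x) = 0\<^sub>m n n \<longleftrightarrow> M x * M y = M y * M x" for x y
    by (simp only: lin_minus lin_mult g mat_minus_eq_zero_iff[OF cc cc])
  have bracket: "?\<rho> (gn x * gn y - gn y * gn x - scal d * (Kpow p p' k - Kpow p p' l)) = 0\<^sub>m n n
     \<longleftrightarrow> M x * M y - M y * M x = d \<cdot>\<^sub>m
       (M KK ^\<^sub>m nat (k mod (2 * int p * int p')) - M KK ^\<^sub>m nat (l mod (2 * int p * int p')))" for x y d k l
  proof -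
    have "?\<rho> (gn x * gn y - gn y * gn x - scal d * (Kpow p p' k - Kpow p p' l)) =
      M x * M y - M y * M x - d \<cdot>\<^sub>m
       (M KK ^\<^sub>m nat (k mod (2 * int p * int p')) - M KK ^\<^sub>m nat (l mod (2 * int p * int p')))"
      by (simp only: lin_minus lin_scal_mult) (simp only: lin_mult g Kp)
    then show ?thesis
      by (simp only:) (rule mat_minus_eq_zero_iff; intro smult_carrier_mat minus_carrier_mat cc pc)
  qed
  have rels: "(\<forall>x\<in>relators p p'. ?\<rho> x = 0\<^sub>m n n) \<longleftrightarrow> mod_rels p p' n M"
  \<comment> \<open>If K^(2pp') = 1 fails, the word standing for K^(-1) need not invert K and the
    conjugation relators cannot be rewritten; but then both sides of the equivalence fail.\<close>
  proof (cases "M KK ^\<^sub>m (2 * p * p') = 1\<^sub>m n")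
    case True
    have powi: "qroot a powi - 2 = inverse ((qroot a)\<^sup>2)" for a
      by (simp add: power_int_minus)
    have c': "\<forall>g. M g \<in> carrier_mat n n" using c by blast
    show ?thesis
      unfolding ball_relators_iff mod_rels_def K1 conj[OF True] comm bracket lin_pow g
        nat_mod_exponents[OF p] powi by (simp only: True c' simp_thms)
  next
    case False
    then show ?thesis unfolding ball_relators_iff mod_rels_def K1 by (simp only: simp_thms)
  qed
  have "mk_module n M \<in> modules p p' \<longleftrightarrow> (\<forall>x\<in>rel_ideal p p'. ?\<rho> x = 0\<^sub>m n n)"
    using h by (auto simp: modules_def mk_module_def lin_scal)
  then show ?thesis using ideal rels by simp
qed

lemma modules_iff:
  assumes "p \<ge> 1" "p' \<ge> 1"
  shows "V \<in> modules p p' \<longleftrightarrow> V = mk_module (fst V) (gens V) \<and> mod_rels p p' (fst V) (gens V)"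
proof
  assume V: "V \<in> modules p p'"
  note e = modules_eq_mk_module[OF V]
  show "V = mk_module (fst V) (gens V) \<and> mod_rels p p' (fst V) (gens V)"
    using e mk_module_in_modules_iff[OF assms, of "gens V" "fst V"] V by simp
next
  assume a: "V = mk_module (fst V) (gens V) \<and> mod_rels p p' (fst V) (gens V)"
  then have "\<And>g. gens V g \<in> carrier_mat (fst V) (fst V)" by (simp add: mod_rels_def)
  then show "V \<in> modules p p'" using mk_module_in_modules_iff[OF assms, of "gens V" "fst V"] a by simp
qed

lemma mk_module_in_modules:
  "p \<ge> 1 \<Longrightarrow> p' \<ge> 1 \<Longrightarrow> mod_rels p p' n M \<Longrightarrow> mk_module n M \<in> modules p p'"
  by (subst mk_module_in_modules_iff) (auto simp: mod_rels_def)

lemma mod_relsD: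
  "p \<ge> 1 \<Longrightarrow> p' \<ge> 1 \<Longrightarrow> V \<in> modules p p' \<Longrightarrow> mod_rels p p' (fst V) (gens V)"
  by (simp add: modules_iff)

section \<open>Tensor products of modules\<close>

text \<open>The coproducts of the five generators evaluated in two modules;
  \<open>2 * p * p' - k\<close> is again the exponent that stands for -k.\<close>

definition tgen :: "nat \<Rightarrow> nat \<Rightarrow> nat \<Rightarrow> (gen \<Rightarrow> complex mat) \<Rightarrow> nat \<Rightarrow> (gen \<Rightarrow> complex mat) \<Rightarrow> gen \<Rightarrow> complex mat" where
  "tgen p p' n M m N g = (case g of
     KK \<Rightarrow> kron (M KK) (N KK)
   | EP \<Rightarrow> kron (M EP) (1\<^sub>m m) + kron (M KK ^\<^sub>m p') (N EP)
   | FM \<Rightarrow> kron (M FM) (1\<^sub>m m) + kron (M KK ^\<^sub>m (2 * p * p' - p)) (N FM)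
   | FP \<Rightarrow> kron (M FP) (N KK ^\<^sub>m (2 * p * p' - p')) + kron (1\<^sub>m n) (N FP)
   | EM \<Rightarrow> kron (M EM) (N KK ^\<^sub>m p) + kron (1\<^sub>m n) (N EM))"

lemma tgen_carrier:
  "(\<And>g. M g \<in> carrier_mat n n) \<Longrightarrow> (\<And>g. N g \<in> carrier_mat m m) \<Longrightarrow>
    tgen p p' n M m N g \<in> carrier_mat (n * m) (n * m)"
  by (cases g) (simp_all add: tgen_def)

lemma mat_rep_kron:
  fixes \<phi> :: "'a::monoid_add \<Rightarrow> complex mat" and \<psi> :: "'b::monoid_add \<Rightarrow> complex mat"
  assumes "mat_rep n \<phi>" "mat_rep m \<psi>"
  shows "mat_rep (n * m) (\<lambda>(u, v). kron (\<phi> u) (\<psi> v))"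
proof -
  interpret A: mat_rep n \<phi> by fact
  interpret B: mat_rep m \<psi> by fact
  show ?thesis
  proof
    fix w :: "'a \<times> 'b" show "(case w of (u, v) \<Rightarrow> kron (\<phi> u) (\<psi> v)) \<in> carrier_mat (n * m) (n * m)"
      by (auto split: prod.split)
  next
    show "(case 0 of (u, v) \<Rightarrow> kron (\<phi> u) (\<psi> v)) = 1\<^sub>m (n * m)"
      by (simp add: zero_prod_def A.zero B.zero kron_one)
  next
    fix u v :: "'a \<times> 'b"
    obtain a b c d where "u = (a, b)" "v = (c, d)" by (metis surj_pair)
    then show "(case u + v of (u, v) \<Rightarrow> kron (\<phi> u) (\<psi> v)) =
        (case u of (u, v) \<Rightarrow> kron (\<phi> u) (\<psi> v)) * (case v of (u, v) \<Rightarrow> kron (\<phi> u) (\<psi> v))"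
      by (simp add: A.plus B.plus kron_mult[OF A.carrier B.carrier A.carrier B.carrier])
  qed
qed

lemma lin_sum_index:
  "finite S \<Longrightarrow> i < n \<Longrightarrow> j < n \<Longrightarrow>
    lin n \<phi> (\<Sum>w\<in>S. f w) $$ (i, j) = (\<Sum>w\<in>S. lin n \<phi> (f w) $$ (i, j))"
  by (induction S rule: finite_induct) (auto simp: lin_zero lin_add)

text \<open>The coproduct is multiplicative on words, and Kronecker products of word matrices
  represent the tensor square. Hence the tensor action is multiplicative too and is fixed by its
  values on generators.\<close>

lemma tensor_module_eq:
  assumes p: "p \<ge> 1" "p' \<ge> 1" and V: "V \<in> modules p p'" and W: "W \<in> modules p p'"
  shows "tensor_module p p' V W =
    mk_module (fst V * fst W) (tgen p p' (fst V) (gens V) (fst W) (gens W))"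
proof -
  note v = modules_eq_mk_module[OF V] and w = modules_eq_mk_module[OF W]
  let ?n = "fst V" and ?m = "fst W" and ?M = "gens V" and ?N = "gens W"
  let ?\<phi> = "\<lambda>(u, v). kron (snd V (wd u)) (snd W (wd v))"
  let ?T = "tgen p p' ?n ?M ?m ?N"
  note vr = word_mat_rep[of "gens V" ?n, OF v(2)] and wr = word_mat_rep[of "gens W" ?m, OF w(2)]
  interpret mat_rep "?n * ?m" ?\<phi>
    unfolding v(3) w(3) by (rule mat_rep_kron[OF vr wr])
  have wd: "lin (?n * ?m) ?\<phi> (wd (a, b)) = kron (word_mat ?n ?M a) (word_mat ?m ?N b)" for a b
  proof -
    have "lin (?n * ?m) ?\<phi> (wd (a, b)) = kron (snd V (wd a)) (snd W (wd b))"
      by (simp only: lin_wd prod.case)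
    then show ?thesis by (rule trans) (simp only: v(3) w(3))
  qed
  have K: "Kword p p' (int p') = replicate p' KK" "Kword p p' (- int p') = replicate (2 * p * p' - p') KK"
    "Kword p p' (int p) = replicate p KK" "Kword p p' (- int p) = replicate (2 * p * p' - p) KK"
    unfolding Kword_def nat_mod_exponents[OF p] by (rule refl)+
  have g: "lin (?n * ?m) ?\<phi> (comult_gen p p' g) = ?T g" for g
    by (cases g; simp only: comult_gen_def gen.case lin_add wd K word_mat_replicate[of "gens V" ?n, OF v(2)]
        word_mat_replicate[of "gens W" ?m, OF w(2)] word_mat_simps tgen_def right_mult_one_mat[OF v(2)] right_mult_one_mat[OF w(2)])
  have prod: "lin (?n * ?m) ?\<phi> (prod_list (map (comult_gen p p') w)) = word_mat (?n * ?m) ?T w" for w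
    by (induction w) (simp_all add: lin_one lin_mult g)
  have "snd (tensor_module p p' V W) x = lin (?n * ?m) (word_mat (?n * ?m) ?T) x" for x
  proof (rule eq_matI)
    fix i j assume "i < dim_row (lin (?n * ?m) (word_mat (?n * ?m) ?T) x)"
      "j < dim_col (lin (?n * ?m) (word_mat (?n * ?m) ?T) x)"
    then have ij: "i < ?n * ?m" "j < ?n * ?m" by auto
    note wc = word_mat_carrier[of ?T "?n * ?m", OF tgen_carrier[OF v(2) w(2)]]
    have wd: "dim_row (word_mat (?n * ?m) ?T w) = ?n * ?m" "dim_col (word_mat (?n * ?m) ?T w) = ?n * ?m" for w
      using wc[of w] by simp_all
    have "snd (tensor_module p p' V W) x $$ (i, j) = lin (?n * ?m) ?\<phi> (comult p p' x) $$ (i, j)"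
      using ij by (simp add: tensor_module_def lin_def case_prod_unfold)
    also have "\<dots> = (\<Sum>w\<in>Poly_Mapping.keys x. Poly_Mapping.lookup x w * word_mat (?n * ?m) ?T w $$ (i, j))"
      unfolding comult_def using ij
      by (subst lin_sum_index) (auto simp: lin_scal_mult prod wd intro!: sum.cong)
    also have "\<dots> = lin (?n * ?m) (word_mat (?n * ?m) ?T) x $$ (i, j)"
      using ij by (simp add: lin_def)
    finally show "snd (tensor_module p p' V W) x $$ (i, j) = lin (?n * ?m) (word_mat (?n * ?m) ?T) x $$ (i, j)" .
  qed (simp_all add: tensor_module_def)
  then show ?thesis by (auto simp: mk_module_def tensor_module_def)
qed

section \<open>Sums of two Kronecker products, the shape of a coproduct\<close>

lemma kron_two_terms_mult:
  assumes "A \<in> carrier_mat n n" "B \<in> carrier_mat n n" "C \<in> carrier_mat n n" "D \<in> carrier_mat n n"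
    "a \<in> carrier_mat m m" "b \<in> carrier_mat m m" "c \<in> carrier_mat m m" "d \<in> carrier_mat m m"
  shows "(kron A a + kron B b) * (kron C c + kron D d) =
    (kron (A * C) (a * c) + kron (A * D) (a * d)) + (kron (B * C) (b * c) + kron (B * D) (b * d))"
proof -
  have k: "kron Z z \<in> carrier_mat (n * m) (n * m)" if "Z \<in> carrier_mat n n" "z \<in> carrier_mat m m" for Z z
    using that by simp
  note m = kron_mult[of _ n n _ m m _ n _ m]
  note kk = k[OF assms(1,5)] k[OF assms(2,6)] k[OF assms(3,7)] k[OF assms(4,8)]
  show ?thesis
    by (simp only: add_mult_distrib_mat[OF kk(1,2) add_carrier_mat[OF kk(4)]]
        mult_add_distrib_mat[OF kk(1,3,4)] mult_add_distrib_mat[OF kk(2,3,4)] m assms)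
qed

lemma mat_commutator_four:
  fixes P1 :: "complex mat"
  assumes "P1 \<in> carrier_mat n n" "P2 \<in> carrier_mat n n" "P3 \<in> carrier_mat n n" "P4 \<in> carrier_mat n n"
     "Q1 \<in> carrier_mat n n" "Q4 \<in> carrier_mat n n"
  shows "((P1 + P2) + (P3 + P4)) - ((Q1 + P3) + (P2 + Q4)) = (P1 - Q1) + (P4 - Q4)"
  by (rule eq_matI) (use assms in auto)

text \<open>Pattern for the bracket of the coproducts of e and f: the mixed terms commute by
  hypothesis and cancel, and only the brackets inside a single tensor factor remain.\<close>

lemma kron_commutator:
  assumes c: "A \<in> carrier_mat n n" "B \<in> carrier_mat n n" "C \<in> carrier_mat n n" "D \<in> carrier_mat n n"
    "a \<in> carrier_mat m m" "b \<in> carrier_mat m m" "c \<in> carrier_mat m m" "d \<in> carrier_mat m m"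
    and e: "kron (A * D) (a * d) = kron (D * A) (d * a)" "kron (B * C) (b * c) = kron (C * B) (c * b)"
  shows "(kron A a + kron B b) * (kron C c + kron D d) - (kron C c + kron D d) * (kron A a + kron B b) =
    (kron (A * C) (a * c) - kron (C * A) (c * a)) + (kron (B * D) (b * d) - kron (D * B) (d * b))"
proof -
  have k: "kron (Z * Z') (z * z') \<in> carrier_mat (n * m) (n * m)"
    if "Z \<in> carrier_mat n n" "Z' \<in> carrier_mat n n" "z \<in> carrier_mat m m" "z' \<in> carrier_mat m m" for Z Z' z z'
    using that by (intro kron_carrier mult_carrier_mat[of _ n n _ n] mult_carrier_mat[of _ m m _ m])
  show ?thesis
    unfolding kron_two_terms_mult[OF c] kron_two_terms_mult[OF c(3,4,1,2,7,8,5,6)]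
      e[symmetric]
    by (rule mat_commutator_four) (use c in \<open>auto intro!: k\<close>)
qed

lemma kron_two_terms_commute:
  assumes c: "A \<in> carrier_mat n n" "B \<in> carrier_mat n n" "C \<in> carrier_mat n n" "D \<in> carrier_mat n n"
    "a \<in> carrier_mat m m" "b \<in> carrier_mat m m" "c \<in> carrier_mat m m" "d \<in> carrier_mat m m"
    and e: "A * C = C * A" "A * D = D * A" "B * C = C * B" "B * D = D * B"
     "a * c = c * a" "a * d = d * a" "b * c = c * b" "b * d = d * b"
  shows "(kron A a + kron B b) * (kron C c + kron D d) = (kron C c + kron D d) * (kron A a + kron B b)"
  unfolding kron_two_terms_mult[OF c] kron_two_terms_mult[OF c(3,4,1,2,7,8,5,6)] e
  by (rule eq_matI) (use c in \<open>auto simp: mult_carrier_mat\<close>)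

lemma kron_conj:
  assumes c: "A \<in> carrier_mat n n" "B \<in> carrier_mat n n" "K \<in> carrier_mat n n"
    "a \<in> carrier_mat m m" "b \<in> carrier_mat m m" "k \<in> carrier_mat m m"
    and e: "K * A = c \<cdot>\<^sub>m (A * K)" "K * B = B * K" "k * a = a * k" "k * b = c \<cdot>\<^sub>m (b * k)"
  shows "kron K k * (kron A a + kron B b) = c \<cdot>\<^sub>m ((kron A a + kron B b) * kron K k)"
proof -
  note m = kron_mult[of _ n n _ m m _ n _ m]
  have k: "kron Z z \<in> carrier_mat (n * m) (n * m)" if "Z \<in> carrier_mat n n" "z \<in> carrier_mat m m" for Z z
    using that by simp
  note kk = k[OF c(1,4)] k[OF c(2,5)] k[OF c(3,6)]
  have "kron K k * (kron A a + kron B b) = c \<cdot>\<^sub>m kron (A * K) (a * k) + c \<cdot>\<^sub>m kron (B * K) (b * k)"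
    by (simp only: mult_add_distrib_mat[OF kk(3,1,2)] m c e kron_smult_left kron_smult_right)
  also have "\<dots> = c \<cdot>\<^sub>m (kron (A * K) (a * k) + kron (B * K) (b * k))"
    using c by (intro add_smult_distrib_left_mat[symmetric, of _ "n * m" "n * m"]) auto
  also have "kron (A * K) (a * k) + kron (B * K) (b * k) = (kron A a + kron B b) * kron K k"
    by (simp only: add_mult_distrib_mat[OF kk] m c)
  finally show ?thesis .
qed

text \<open>The two summands q-commute, and each of them is nilpotent because one of its tensor
  factors is; the q-binomial theorem then applies to their sum.\<close>

lemma kron_nilpotent:
  assumes c: "A \<in> carrier_mat n n" "B \<in> carrier_mat n n" "a \<in> carrier_mat m m" "b \<in> carrier_mat m m"
    and q: "kron (B * A) (b * a) = t \<cdot>\<^sub>m kron (A * B) (a * b)"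
    and n: "A ^\<^sub>m l = 0\<^sub>m n n \<or> a ^\<^sub>m l = 0\<^sub>m m m" "B ^\<^sub>m l = 0\<^sub>m n n \<or> b ^\<^sub>m l = 0\<^sub>m m m"
    and t: "t ^ l = 1" "\<And>j. 0 < j \<Longrightarrow> j < l \<Longrightarrow> t ^ j \<noteq> 1"
  shows "(kron A a + kron B b) ^\<^sub>m l = 0\<^sub>m (n * m) (n * m)"
proof (rule mat_qbinomial_nilpotent[OF _ _ _ _ _ t])
  show "kron B b * kron A a = t \<cdot>\<^sub>m (kron A a * kron B b)"
    using c q by (simp add: kron_mult[of _ n n _ m m _ n _ m])
  have z: "kron Z z ^\<^sub>m l = 0\<^sub>m (n * m) (n * m)"
    if "Z \<in> carrier_mat n n" "z \<in> carrier_mat m m" "Z ^\<^sub>m l = 0\<^sub>m n n \<or> z ^\<^sub>m l = 0\<^sub>m m m" for Z z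
    using that by (auto simp: kron_pow kron_zero_left kron_zero_right)
  show "kron A a ^\<^sub>m l = 0\<^sub>m (n * m) (n * m)" "kron B b ^\<^sub>m l = 0\<^sub>m (n * m) (n * m)"
    using z c n by blast+
qed (use c in auto)

lemma mat_pow_commute:
  "A \<in> carrier_mat n n \<Longrightarrow> B \<in> carrier_mat n n \<Longrightarrow> A * B = B * A \<Longrightarrow> A ^\<^sub>m k * B = B * (A::complex mat) ^\<^sub>m k"
  by (induction k) (simp_all add: mat_assoc, simp flip: mat_assoc)

lemma pow_mat_add_commute:
  "A \<in> carrier_mat n n \<Longrightarrow> A ^\<^sub>m j * A ^\<^sub>m k = A ^\<^sub>m k * (A::complex mat) ^\<^sub>m j"
  by (rule mat_pow_commute[of _ n]) (auto intro: mat_pow_commute[of _ n, symmetric])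

lemma mat_conj_pow:
  "K \<in> carrier_mat n n \<Longrightarrow> A \<in> carrier_mat n n \<Longrightarrow> K * A = c \<cdot>\<^sub>m (A * K) \<Longrightarrow>
    K ^\<^sub>m k * A = (c ^ k) \<cdot>\<^sub>m (A * (K::complex mat) ^\<^sub>m k)"
proof (induction k)
  case 0
  then show ?case by (auto intro!: eq_matI)
next
  case (Suc k)
  have "K ^\<^sub>m Suc k * A = c \<cdot>\<^sub>m ((K ^\<^sub>m k * A) * K)"
    using Suc.prems by (simp add: mat_assoc mat_smult_right)
  also have "\<dots> = (c ^ Suc k) \<cdot>\<^sub>m (A * K ^\<^sub>m Suc k)"
    using Suc by (simp add: mat_assoc mat_smult_left smult_smult_mat)
  finally show ?case .
qed

lemma kron_diff_left:
  "A \<in> carrier_mat a b \<Longrightarrow> B \<in> carrier_mat a b \<Longrightarrow> C \<in> carrier_mat c d \<Longrightarrow>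
    kron (A - B) C = kron A C - kron B C"
  by (rule eq_matI) (auto simp: kron_def less_mult_imp_div_less algebra_simps)

lemma kron_diff_right:
  "A \<in> carrier_mat a b \<Longrightarrow> B \<in> carrier_mat c d \<Longrightarrow> C \<in> carrier_mat c d \<Longrightarrow>
    kron A (B - C) = kron A B - kron A C"
  by (rule eq_matI) (auto simp: kron_def mod_less_of_mult[of _ a c] mod_less_of_mult[of _ b d] algebra_simps)

text \<open>Telescoping: L \<otimes> l - L' \<otimes> l' = (L - L') \<otimes> l' + L \<otimes> (l -
  l'), or the same with L' \<otimes> l as the middle term. The two variants match the placements of
  the powers of K in the coproducts of the plus and of the minus generators.\<close>

lemma kron_bracket:
  assumes "L \<in> carrier_mat n n" "L' \<in> carrier_mat n n" "l \<in> carrier_mat m m" "l' \<in> carrier_mat m m"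
    and "P \<in> carrier_mat n n" "Q \<in> carrier_mat n n" "x \<in> carrier_mat m m" "y \<in> carrier_mat m m"
    and e: "P - Q = c \<cdot>\<^sub>m (L - L')" "x - y = c \<cdot>\<^sub>m (l - l')"
  shows "(kron P l' - kron Q l') + (kron L x - kron L y) = c \<cdot>\<^sub>m (kron L l - kron L' l')"
    and "(kron P l - kron Q l) + (kron L' x - kron L' y) = c \<cdot>\<^sub>m (kron L l - kron L' l')"
proof -
  have 1: "kron P z - kron Q z = c \<cdot>\<^sub>m (kron L z - kron L' z)" if "z \<in> carrier_mat m m" for z
    using that assms(1-6) by (simp add: kron_diff_left[symmetric] e kron_smult_left)
  have 2: "kron Z x - kron Z y = c \<cdot>\<^sub>m (kron Z l - kron Z l')" if "Z \<in> carrier_mat n n" for Z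
    using that assms(3,4,7,8) by (simp add: kron_diff_right[symmetric] e kron_smult_right)
  show "(kron P l' - kron Q l') + (kron L x - kron L y) = c \<cdot>\<^sub>m (kron L l - kron L' l')"
    unfolding 1[OF assms(4)] 2[OF assms(1)]
    by (rule eq_matI) (use assms(1-4) in \<open>auto simp: algebra_simps\<close>)
  show "(kron P l - kron Q l) + (kron L' x - kron L' y) = c \<cdot>\<^sub>m (kron L l - kron L' l')"
    unfolding 1[OF assms(3)] 2[OF assms(2)]
    by (rule eq_matI) (use assms(1-4) in \<open>auto simp: algebra_simps\<close>)
qed

text \<open>K^(p_-) q-commutes with e_+ by the factor q_+^(2 p_-) = Q_+^2 but commutes with e_-,
  because q_-^(2 p_-) = 1; symmetrically for K^(p_+). This decouples the two halves of the algebra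
  and supplies the parameters \<open>t\<close> and \<open>s\<close> of the q-binomial
  theorem.\<close>

lemma mod_rels_powers:
  assumes p: "p \<ge> 1" "p' \<ge> 1" and M: "mod_rels p p' n M"
  defines "t \<equiv> (Qpar p p')\<^sup>2" and "s \<equiv> (Qpar p' p)\<^sup>2"
    and "L \<equiv> M KK ^\<^sub>m p'" and "L' \<equiv> M KK ^\<^sub>m (2 * p * p' - p')"
    and "R \<equiv> M KK ^\<^sub>m p" and "R' \<equiv> M KK ^\<^sub>m (2 * p * p' - p)"
  shows "L * M EP = t \<cdot>\<^sub>m (M EP * L)" "L * M FP = inverse t \<cdot>\<^sub>m (M FP * L)"
    "L' * M EP = inverse t \<cdot>\<^sub>m (M EP * L')" "L' * M FP = t \<cdot>\<^sub>m (M FP * L')"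
    "R * M EM = s \<cdot>\<^sub>m (M EM * R)" "R * M FM = inverse s \<cdot>\<^sub>m (M FM * R)"
    "R' * M EM = inverse s \<cdot>\<^sub>m (M EM * R')" "R' * M FM = s \<cdot>\<^sub>m (M FM * R')"
    "L * M EM = M EM * L" "L * M FM = M FM * L" "L' * M EM = M EM * L'" "L' * M FM = M FM * L'"
    "R * M EP = M EP * R" "R * M FP = M FP * R" "R' * M EP = M EP * R'" "R' * M FP = M FP * R'"
proof -
  have c: "M g \<in> carrier_mat n n" for g using M by (simp add: mod_rels_def)
  have K: "M KK * M EP = (qroot p)\<^sup>2 \<cdot>\<^sub>m (M EP * M KK)" "M KK * M EM = (qroot p')\<^sup>2 \<cdot>\<^sub>m (M EM * M KK)"
     "M KK * M FP = inverse ((qroot p)\<^sup>2) \<cdot>\<^sub>m (M FP * M KK)"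
     "M KK * M FM = inverse ((qroot p')\<^sup>2) \<cdot>\<^sub>m (M FM * M KK)"
    using M by (simp_all add: mod_rels_def)
  note kp = mat_conj_pow[OF c c K(1)] mat_conj_pow[OF c c K(2)] mat_conj_pow[OF c c K(3)] mat_conj_pow[OF c c K(4)]
  have le: "p' \<le> 2 * p * p'" "p \<le> 2 * p * p'" using p by auto
  have full: "(qroot p)\<^sup>2 ^ (2 * p * p') = 1" "(qroot p')\<^sup>2 ^ (2 * p * p') = 1"
    using qroot_pow_double[OF p(1), of "2 * p'"] qroot_pow_double[OF p(2), of "2 * p"]
    by (simp_all add: power_mult[symmetric] mult_ac)
  have one: "(qroot p)\<^sup>2 ^ p = 1" "(qroot p')\<^sup>2 ^ p' = 1"
    using qroot_pow_double[OF p(1), of 1] qroot_pow_double[OF p(2), of 1]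
    by (simp_all add: power_mult[symmetric] mult_ac)
  have t: "(qroot p)\<^sup>2 ^ p' = t" "(qroot p')\<^sup>2 ^ p = s"
    by (simp_all add: t_def s_def Qpar_def power_mult[symmetric] mult_ac)
  have d: "x ^ (2 * p * p' - a) = inverse (x ^ a)" if "x ^ (2 * p * p') = 1" "x \<noteq> 0" "a \<le> 2 * p * p'" for x :: complex and a
    using that by (simp add: power_diff inverse_eq_divide)
  note dd = d[OF full(1) _ le(1)] d[OF full(1) _ le(2)] d[OF full(2) _ le(1)] d[OF full(2) _ le(2)]
  have u: "1 \<cdot>\<^sub>m A = A" for A :: "complex mat" by (auto intro!: eq_matI)
  show "L * M EP = t \<cdot>\<^sub>m (M EP * L)" "L * M FP = inverse t \<cdot>\<^sub>m (M FP * L)"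
    "L' * M EP = inverse t \<cdot>\<^sub>m (M EP * L')" "L' * M FP = t \<cdot>\<^sub>m (M FP * L')"
    "R * M EM = s \<cdot>\<^sub>m (M EM * R)" "R * M FM = inverse s \<cdot>\<^sub>m (M FM * R)"
    "R' * M EM = inverse s \<cdot>\<^sub>m (M EM * R')" "R' * M FM = s \<cdot>\<^sub>m (M FM * R')"
    "L * M EM = M EM * L" "L * M FM = M FM * L" "L' * M EM = M EM * L'" "L' * M FM = M FM * L'"
    "R * M EP = M EP * R" "R * M FP = M FP * R" "R' * M EP = M EP * R'" "R' * M FP = M FP * R'"
    unfolding L_def L'_def R_def R'_def kp
    by (simp_all add: power_inverse t one dd u)
qed

lemma tgen_mod_rels:
  assumes p: "p \<ge> 1" "p' \<ge> 1" "coprime p p'" and M: "mod_rels p p' n M" and N: "mod_rels p p' m N"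
  shows "mod_rels p p' (n * m) (tgen p p' n M m N)"
proof -
  have c: "M g \<in> carrier_mat n n" "N g \<in> carrier_mat m m" for g using M N by (simp_all add: mod_rels_def)
  have pc: "M g ^\<^sub>m j \<in> carrier_mat n n" "N g ^\<^sub>m j \<in> carrier_mat m m" for g j using c by simp_all
  note o = one_carrier_mat[of n] one_carrier_mat[of m]
  have id: "M g * 1\<^sub>m n = M g" "1\<^sub>m n * M g = M g" "N g * 1\<^sub>m m = N g" "1\<^sub>m m * N g = N g"
    "M g ^\<^sub>m j * 1\<^sub>m n = M g ^\<^sub>m j" "1\<^sub>m n * M g ^\<^sub>m j = M g ^\<^sub>m j"
    "N g ^\<^sub>m j * 1\<^sub>m m = N g ^\<^sub>m j" "1\<^sub>m m * N g ^\<^sub>m j = N g ^\<^sub>m j" for g j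
    using c[of g] pc[of g j] by simp_all
  note Mp = mod_rels_powers[OF p(1,2) M] and Np = mod_rels_powers[OF p(1,2) N]
  let ?T = "tgen p p' n M m N"
  let ?t = "(Qpar p p')\<^sup>2" and ?s = "(Qpar p' p)\<^sup>2"
  have t: "?t ^ p = 1" "\<And>j. 0 < j \<Longrightarrow> j < p \<Longrightarrow> ?t ^ j \<noteq> 1" "?t \<noteq> 0"
    using Qpar_pow[OF p(1)] Qpar_primitive[OF p(1,3)] by auto
  have s: "?s ^ p' = 1" "\<And>j. 0 < j \<Longrightarrow> j < p' \<Longrightarrow> ?s ^ j \<noteq> 1" "?s \<noteq> 0"
    using Qpar_pow[OF p(2)] Qpar_primitive[OF p(2) coprime_commute[THEN iffD1, OF p(3)]] by auto
  \<comment> \<open>In the coproducts of f_+ and e_- the power of K sits in the right factor, so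
    their summands q-commute with the inverse parameter, which is again a primitive root of
    unity.\<close>
  have t': "inverse ?t ^ p = 1" "\<And>j. 0 < j \<Longrightarrow> j < p \<Longrightarrow> inverse ?t ^ j \<noteq> 1"
    using t by (auto simp: power_inverse)
  have s': "inverse ?s ^ p' = 1" "\<And>j. 0 < j \<Longrightarrow> j < p' \<Longrightarrow> inverse ?s ^ j \<noteq> 1"
    using s by (auto simp: power_inverse)
  have flip: "A = x \<cdot>\<^sub>m B \<Longrightarrow> x \<noteq> 0 \<Longrightarrow> B = inverse x \<cdot>\<^sub>m (A :: complex mat)" for A B x
    by (auto simp: smult_smult_mat intro!: eq_matI)
  have comm_pow: "M KK * M KK ^\<^sub>m j = M KK ^\<^sub>m j * M KK" "N KK * N KK ^\<^sub>m j = N KK ^\<^sub>m j * N KK" for j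
    using pow_mat_Suc_left[OF c(1)[of KK], of j] pow_mat_Suc_left[OF c(2)[of KK], of j] by simp_all
  have T: "?T KK = kron (M KK) (N KK)"
    "?T EP = kron (M EP) (1\<^sub>m m) + kron (M KK ^\<^sub>m p') (N EP)"
    "?T FM = kron (M FM) (1\<^sub>m m) + kron (M KK ^\<^sub>m (2 * p * p' - p)) (N FM)"
    "?T FP = kron (M FP) (N KK ^\<^sub>m (2 * p * p' - p')) + kron (1\<^sub>m n) (N FP)"
    "?T EM = kron (M EM) (N KK ^\<^sub>m p) + kron (1\<^sub>m n) (N EM)"
    by (simp_all add: tgen_def)
  have Kpow: "?T KK ^\<^sub>m j = kron (M KK ^\<^sub>m j) (N KK ^\<^sub>m j)" for j
    unfolding T by (rule kron_pow[OF c])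
  have MK: "M KK * M EP = (qroot p)\<^sup>2 \<cdot>\<^sub>m (M EP * M KK)" "M KK * M EM = (qroot p')\<^sup>2 \<cdot>\<^sub>m (M EM * M KK)"
     "M KK * M FP = inverse ((qroot p)\<^sup>2) \<cdot>\<^sub>m (M FP * M KK)"
     "M KK * M FM = inverse ((qroot p')\<^sup>2) \<cdot>\<^sub>m (M FM * M KK)"
    and NK: "N KK * N EP = (qroot p)\<^sup>2 \<cdot>\<^sub>m (N EP * N KK)" "N KK * N EM = (qroot p')\<^sup>2 \<cdot>\<^sub>m (N EM * N KK)"
     "N KK * N FP = inverse ((qroot p)\<^sup>2) \<cdot>\<^sub>m (N FP * N KK)"
     "N KK * N FM = inverse ((qroot p')\<^sup>2) \<cdot>\<^sub>m (N FM * N KK)"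
    using M N by (simp_all add: mod_rels_def)
  have Mc: "M EP * M EM = M EM * M EP" "M EP * M FM = M FM * M EP" "M FP * M EM = M EM * M FP" "M FP * M FM = M FM * M FP"
    and Nc: "N EP * N EM = N EM * N EP" "N EP * N FM = N FM * N EP" "N FP * N EM = N EM * N FP" "N FP * N FM = N FM * N FP"
    using M N by (simp_all add: mod_rels_def)
  have Mn: "M EP ^\<^sub>m p = 0\<^sub>m n n" "M FP ^\<^sub>m p = 0\<^sub>m n n" "M EM ^\<^sub>m p' = 0\<^sub>m n n" "M FM ^\<^sub>m p' = 0\<^sub>m n n"
    and Nn: "N EP ^\<^sub>m p = 0\<^sub>m m m" "N FP ^\<^sub>m p = 0\<^sub>m m m" "N EM ^\<^sub>m p' = 0\<^sub>m m m" "N FM ^\<^sub>m p' = 0\<^sub>m m m"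
    using M N by (simp_all add: mod_rels_def)
  have "\<forall>g. ?T g \<in> carrier_mat (n * m) (n * m)"
    using tgen_carrier[of M n N m] c by blast
  moreover have "?T EP ^\<^sub>m p = 0\<^sub>m (n * m) (n * m)" unfolding T
    by (rule kron_nilpotent[OF c(1) pc(1) o(2) c(2) _ disjI1[OF Mn(1)] disjI2[OF Nn(1)] t(1,2)])
       (simp_all add: id Mp kron_smult_left)
  moreover have "?T FP ^\<^sub>m p = 0\<^sub>m (n * m) (n * m)" unfolding T
    by (rule kron_nilpotent[OF c(1) o(1) pc(2) c(2) _ disjI1[OF Mn(2)] disjI2[OF Nn(2)] t'(1,2)])
       (simp_all add: id flip[OF Np(4) t(3)] kron_smult_right)
  moreover have "?T EM ^\<^sub>m p' = 0\<^sub>m (n * m) (n * m)" unfolding T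
    by (rule kron_nilpotent[OF c(1) o(1) pc(2) c(2) _ disjI1[OF Mn(3)] disjI2[OF Nn(3)] s'(1,2)])
       (simp_all add: id flip[OF Np(5) s(3)] kron_smult_right)
  moreover have "?T FM ^\<^sub>m p' = 0\<^sub>m (n * m) (n * m)" unfolding T
    by (rule kron_nilpotent[OF c(1) pc(1) o(2) c(2) _ disjI1[OF Mn(4)] disjI2[OF Nn(4)] s(1,2)])
       (simp_all add: id Mp kron_smult_left)
  moreover have "?T KK ^\<^sub>m (2 * p * p') = 1\<^sub>m (n * m)"
    using M N unfolding Kpow by (simp add: mod_rels_def kron_one)
  moreover have "?T KK * ?T EP = (qroot p)\<^sup>2 \<cdot>\<^sub>m (?T EP * ?T KK)" unfolding T
    by (rule kron_conj[OF c(1) pc(1) c(1) o(2) c(2) c(2) MK(1) _ _ NK(1)]) (simp_all only: comm_pow id)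
  moreover have "?T KK * ?T EM = (qroot p')\<^sup>2 \<cdot>\<^sub>m (?T EM * ?T KK)" unfolding T
    by (rule kron_conj[OF c(1) o(1) c(1) pc(2) c(2) c(2) MK(2) _ _ NK(2)]) (simp_all only: comm_pow id)
  moreover have "?T KK * ?T FP = inverse ((qroot p)\<^sup>2) \<cdot>\<^sub>m (?T FP * ?T KK)" unfolding T
    by (rule kron_conj[OF c(1) o(1) c(1) pc(2) c(2) c(2) MK(3) _ _ NK(3)]) (simp_all only: comm_pow id)
  moreover have "?T KK * ?T FM = inverse ((qroot p')\<^sup>2) \<cdot>\<^sub>m (?T FM * ?T KK)" unfolding T
    by (rule kron_conj[OF c(1) pc(1) c(1) o(2) c(2) c(2) MK(4) _ _ NK(4)]) (simp_all only: comm_pow id)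
  moreover have "?T EP * ?T EM = ?T EM * ?T EP" unfolding T
    by (rule kron_two_terms_commute[OF c(1) pc(1) c(1) o(1) o(2) c(2) pc(2) c(2)]) (simp_all only: Mp Np Mc Nc id)
  moreover have "?T EP * ?T FM = ?T FM * ?T EP" unfolding T
    by (rule kron_two_terms_commute[OF c(1) pc(1) c(1) pc(1) o(2) c(2) o(2) c(2)])
       (simp_all only: Mp Np Mc Nc id pow_mat_add_commute[OF c(1)])
  moreover have "?T FP * ?T EM = ?T EM * ?T FP" unfolding T
    by (rule kron_two_terms_commute[OF c(1) o(1) c(1) o(1) pc(2) c(2) pc(2) c(2)])
       (simp_all only: Mp Np Mc Nc id pow_mat_add_commute[OF c(2)])
  moreover have "?T FP * ?T FM = ?T FM * ?T FP" unfolding T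
    by (rule kron_two_terms_commute[OF c(1) o(1) c(1) pc(1) pc(2) c(2) o(2) c(2)]) (simp_all only: Mp Np Mc Nc id)
  moreover have "?T EP * ?T FP - ?T FP * ?T EP = (1 / (Qpar p p' - inverse (Qpar p p'))) \<cdot>\<^sub>m
        (?T KK ^\<^sub>m p' - ?T KK ^\<^sub>m (2 * p * p' - p'))" (is "_ = ?c \<cdot>\<^sub>m _") if "p \<noteq> 1"
  proof -
    have b: "M EP * M FP - M FP * M EP = ?c \<cdot>\<^sub>m (M KK ^\<^sub>m p' - M KK ^\<^sub>m (2 * p * p' - p'))"
      "N EP * N FP - N FP * N EP = ?c \<cdot>\<^sub>m (N KK ^\<^sub>m p' - N KK ^\<^sub>m (2 * p * p' - p'))"
      using M N that by (simp_all add: mod_rels_def)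
    \<comment> \<open>In the mixed term K^(p_-) f_+ \<otimes> e_+ K^(-p_-), reversing the left
      factor costs t^(-1) and reversing the right one costs t, so the term equals its reverse and
      cancels.\<close>
    have "?T EP * ?T FP - ?T FP * ?T EP =
      (kron (M EP * M FP) (N KK ^\<^sub>m (2 * p * p' - p')) - kron (M FP * M EP) (N KK ^\<^sub>m (2 * p * p' - p'))) +
      (kron (M KK ^\<^sub>m p') (N EP * N FP) - kron (M KK ^\<^sub>m p') (N FP * N EP))"
      unfolding T
      by (subst kron_commutator[OF c(1) pc(1) c(1) o(1) o(2) c(2) pc(2) c(2)])
         (simp_all only: id Mp Np kron_smult_left kron_smult_right)
    also have "\<dots> = ?c \<cdot>\<^sub>m (?T KK ^\<^sub>m p' - ?T KK ^\<^sub>m (2 * p * p' - p'))"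
      unfolding Kpow
      by (rule kron_bracket(1)[OF pc(1) pc(1) pc(2) pc(2) _ _ _ _ b]) (rule mult_carrier_mat[OF c(1) c(1)] mult_carrier_mat[OF c(2) c(2)])+
    finally show ?thesis .
  qed
  moreover have "?T EM * ?T FM - ?T FM * ?T EM = (1 / (Qpar p' p - inverse (Qpar p' p))) \<cdot>\<^sub>m
        (?T KK ^\<^sub>m p - ?T KK ^\<^sub>m (2 * p * p' - p))" (is "_ = ?c \<cdot>\<^sub>m _") if "p' \<noteq> 1"
  proof -
    have b: "M EM * M FM - M FM * M EM = ?c \<cdot>\<^sub>m (M KK ^\<^sub>m p - M KK ^\<^sub>m (2 * p * p' - p))"
      "N EM * N FM - N FM * N EM = ?c \<cdot>\<^sub>m (N KK ^\<^sub>m p - N KK ^\<^sub>m (2 * p * p' - p))"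
      using M N that by (simp_all add: mod_rels_def)
    have "?T EM * ?T FM - ?T FM * ?T EM =
      (kron (M EM * M FM) (N KK ^\<^sub>m p) - kron (M FM * M EM) (N KK ^\<^sub>m p)) +
      (kron (M KK ^\<^sub>m (2 * p * p' - p)) (N EM * N FM) - kron (M KK ^\<^sub>m (2 * p * p' - p)) (N FM * N EM))"
      unfolding T
      by (subst kron_commutator[OF c(1) o(1) c(1) pc(1) pc(2) c(2) o(2) c(2)])
         (simp_all only: id Mp Np kron_smult_left kron_smult_right)
    also have "\<dots> = ?c \<cdot>\<^sub>m (?T KK ^\<^sub>m p - ?T KK ^\<^sub>m (2 * p * p' - p))"
      unfolding Kpow
      by (rule kron_bracket(2)[OF pc(1) pc(1) pc(2) pc(2) _ _ _ _ b]) (rule mult_carrier_mat[OF c(1) c(1)] mult_carrier_mat[OF c(2) c(2)])+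
    finally show ?thesis .
  qed
  ultimately show ?thesis unfolding mod_rels_def by simp
qed

lemma tensor_in_modules:
  assumes "p \<ge> 1" "p' \<ge> 1" "coprime p p'" "V \<in> modules p p'" "W \<in> modules p p'"
  shows "tensor_module p p' V W \<in> modules p p'"
  unfolding tensor_module_eq[OF assms(1,2,4,5)]
  by (intro mk_module_in_modules tgen_mod_rels mod_relsD assms)

section \<open>Short exact sequences\<close>

text \<open>A short exact sequence of vector spaces with a linear retraction \<open>A'\<close> and a
  linear section \<open>B'\<close>, which need not be module maps. Unlike statements on kernels and
  images, these identities pass directly through Kronecker products.\<close>

definition split_maps :: "nat \<Rightarrow> nat \<Rightarrow> nat \<Rightarrow> complex mat \<Rightarrow> complex mat \<Rightarrow> complex mat \<Rightarrow> complex mat \<Rightarrow> bool" where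
  "split_maps u v w A A' B B' \<longleftrightarrow>
     A \<in> carrier_mat v u \<and> A' \<in> carrier_mat u v \<and> B \<in> carrier_mat w v \<and> B' \<in> carrier_mat v w \<and>
     A' * A = 1\<^sub>m u \<and> B * B' = 1\<^sub>m w \<and> B * A = 0\<^sub>m w u \<and> A * A' + B' * B = 1\<^sub>m v"

declare col_mult [simp del]

lemma mat_of_columns:
  assumes "\<And>j. j < m \<Longrightarrow> f j \<in> carrier_vec n" and A: "A \<in> carrier_mat k n"
  shows "\<exists>C\<in>carrier_mat n m. \<forall>j<m. col C j = f j \<and> col (A * C) j = A *\<^sub>v (f j :: complex vec)"
proof (intro bexI allI impI conjI)
  let ?C = "mat n m (\<lambda>(i, j). f j $ i)"
  show C: "?C \<in> carrier_mat n m" by simp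
  fix j assume j: "j < m"
  show c: "col ?C j = f j" using j assms(1)[OF j] by (auto intro!: eq_vecI)
  show "col (A * ?C) j = A *\<^sub>v f j" by (simp only: col_mult2[OF A C j] c)
qed

lemma mat_mult_unit_vec: "A \<in> carrier_mat m n \<Longrightarrow> j < n \<Longrightarrow> A *\<^sub>v unit_vec n j = col (A :: complex mat) j"
  by (auto intro!: eq_vecI)

lemma mat_eq_by_cols:
  "A \<in> carrier_mat n m \<Longrightarrow> B \<in> carrier_mat n m \<Longrightarrow> (\<And>j. j < m \<Longrightarrow> col A j = col B j) \<Longrightarrow> A = B"
proof (rule eq_matI)
  fix i j assume c: "A \<in> carrier_mat n m" "B \<in> carrier_mat n m" "\<And>j. j < m \<Longrightarrow> col A j = col B j"
    and ij: "i < dim_row B" "j < dim_col B"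
  then have "col A j $ i = col B j $ i" by auto
  then show "A $$ (i, j) = B $$ (i, j)" using c(1,2) ij by simp
qed auto

text \<open>The section \<open>B'\<close> collects chosen preimages of the basis vectors. The
  columns of 1 - B'B lie in the kernel of B, hence in the image of A, and chosen preimages of them
  under A form the retraction \<open>A'\<close>.\<close>

lemma short_exact_imp_split:
  assumes "short_exact U V W"
  obtains A A' B B' where "split_maps (fst U) (fst V) (fst W) A A' B B'"
    "\<And>x. A * snd U x = snd V x * A" "\<And>x. B * snd V x = snd W x * B"
proof -
  let ?u = "fst U" and ?v = "fst V" and ?w = "fst W"
  obtain A B where A: "A \<in> carrier_mat ?v ?u" and B: "B \<in> carrier_mat ?w ?v"
    and i: "\<And>x. A * snd U x = snd V x * A" "\<And>x. B * snd V x = snd W x * B"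
    and k: "mat_kernel A = {0\<^sub>v ?u}" "(\<lambda>v. A *\<^sub>v v) ` carrier_vec ?u = mat_kernel B"
    and s: "(\<lambda>v. B *\<^sub>v v) ` carrier_vec ?v = carrier_vec ?w"
    using assms unfolding short_exact_def by blast
  have "\<exists>x. x \<in> carrier_vec ?v \<and> B *\<^sub>v x = unit_vec ?w j" for j
  proof -
    have "unit_vec ?w j \<in> (\<lambda>v. B *\<^sub>v v) ` carrier_vec ?v" unfolding s by simp
    then show ?thesis by force
  qed
  then obtain f where f: "\<And>j. f j \<in> carrier_vec ?v" "\<And>j. B *\<^sub>v f j = unit_vec ?w j" by metis
  obtain B' where B': "B' \<in> carrier_mat ?v ?w" "\<forall>j<?w. col (B * B') j = B *\<^sub>v f j"
    using mat_of_columns[of ?w f ?v B ?w] f B by blast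
  have BB': "B * B' = 1\<^sub>m ?w"
    using B B' f by (intro mat_eq_by_cols[of _ ?w ?w]) auto
  have BA: "B * A = 0\<^sub>m ?w ?u"
  proof (rule mat_eq_by_cols[of _ ?w ?u])
    fix j assume j: "j < ?u"
    have "A *\<^sub>v unit_vec ?u j \<in> mat_kernel B" using k(2) by auto
    moreover have "col A j = A *\<^sub>v unit_vec ?u j" using A j by (simp add: mat_mult_unit_vec)
    ultimately have "B *\<^sub>v col A j = 0\<^sub>v ?w" using B by (simp add: mat_kernel_def)
    then show "col (B * A) j = col (0\<^sub>m ?w ?u) j" using col_mult2[OF B A j] j by simp
  qed (use A B in auto)
  \<comment> \<open>The projection onto the kernel of B along the image of B'.\<close>
  let ?D = "1\<^sub>m ?v - B' * B"
  have D: "?D \<in> carrier_mat ?v ?v" "B' * B \<in> carrier_mat ?v ?v" using B B' by (auto intro: minus_carrier_mat)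
  have BD: "B * ?D = 0\<^sub>m ?w ?v"
  proof -
    have "B * ?D = B - B * B' * B"
      using B B' D by (simp add: mult_minus_distrib_mat[of _ ?w ?v _ ?v] mat_assoc)
    then show ?thesis unfolding BB' using B by (auto intro!: eq_matI)
  qed
  have "\<exists>x. x \<in> carrier_vec ?u \<and> A *\<^sub>v x = col ?D j" if j: "j < ?v" for j
  proof -
    have c: "col ?D j \<in> carrier_vec ?v" using D j by (intro col_carrier_vec)
    have "B *\<^sub>v col ?D j = 0\<^sub>v ?w" using col_mult2[OF B D(1) j] BD j by simp
    then have "col ?D j \<in> mat_kernel B" using c B by (simp add: mat_kernel_def)
    then show ?thesis unfolding k(2)[symmetric] image_iff by metis
  qed
  then obtain h where h: "\<And>j. j < ?v \<Longrightarrow> h j \<in> carrier_vec ?u" "\<And>j. j < ?v \<Longrightarrow> A *\<^sub>v h j = col ?D j"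
    by metis
  obtain A' where A': "A' \<in> carrier_mat ?u ?v" "\<forall>j<?v. col (A * A') j = A *\<^sub>v h j"
    using mat_of_columns[of ?v h ?u A ?v] h A by blast
  have AA': "A * A' = ?D"
    using A A' h D by (intro mat_eq_by_cols[of _ ?v ?v]) auto
  have A'A: "A' * A = 1\<^sub>m ?u"
  proof (rule mat_eq_by_cols[of _ ?u ?u])
    fix j assume j: "j < ?u"
    have c: "A' * A \<in> carrier_mat ?u ?u" using A A' by simp
    let ?x = "col (A' * A) j - unit_vec ?u j"
    \<comment> \<open>Once A A' A = A is known, A' A = 1 follows column by column because A has
      trivial kernel.\<close>
    have "A * (A' * A) = A * A' * A" using A A' by (simp add: mat_assoc)
    also have "\<dots> = A - B' * (B * A)" unfolding AA'
      using A B B' D by (simp add: minus_mult_distrib_mat[of _ ?v ?v _ _ ?u] mat_assoc)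
    also have "\<dots> = A" unfolding BA using A B' by (auto intro!: eq_matI)
    finally have e: "A * (A' * A) = A" .
    have cc: "col (A' * A) j \<in> carrier_vec ?u" using c j by (intro col_carrier_vec)
    have "A *\<^sub>v ?x = A *\<^sub>v col (A' * A) j - A *\<^sub>v unit_vec ?u j"
      using A cc by (intro mult_minus_distrib_mat_vec) auto
    also have "A *\<^sub>v col (A' * A) j = col A j" using col_mult2[OF A c j] e by simp
    also have "A *\<^sub>v unit_vec ?u j = col A j" using A j by (simp add: mat_mult_unit_vec)
    finally have "A *\<^sub>v ?x = 0\<^sub>v ?v" using A j by simp
    then have "?x \<in> mat_kernel A" using A cc by (simp add: mat_kernel_def)
    then have "?x = 0\<^sub>v ?u" using k(1) by simp
    then have "?x $ i = 0" if "i < ?u" for i using that by simp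
    then show "col (A' * A) j = col (1\<^sub>m ?u) j" using cc A' j by (intro eq_vecI) auto
  qed (use A A' in auto)
  have "A * A' + B' * B = 1\<^sub>m ?v" unfolding AA' using B B' by (auto intro!: eq_matI)
  then have "split_maps ?u ?v ?w A A' B B'" using A A' B B' A'A BB' BA by (simp add: split_maps_def)
  then show ?thesis using that i by blast
qed

lemma split_imp_short_exact:
  assumes s: "split_maps (fst U) (fst V) (fst W) A A' B B'"
    and i: "\<And>x. A * snd U x = snd V x * A" "\<And>x. B * snd V x = snd W x * B"
  shows "short_exact U V W"
proof -
  let ?u = "fst U" and ?v = "fst V" and ?w = "fst W"
  have c: "A \<in> carrier_mat ?v ?u" "A' \<in> carrier_mat ?u ?v" "B \<in> carrier_mat ?w ?v" "B' \<in> carrier_mat ?v ?w"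
    and e: "A' * A = 1\<^sub>m ?u" "B * B' = 1\<^sub>m ?w" "B * A = 0\<^sub>m ?w ?u" "A * A' + B' * B = 1\<^sub>m ?v"
    using s by (simp_all add: split_maps_def)
  have ker: "mat_kernel A = {0\<^sub>v ?u}"
  proof
    show "mat_kernel A \<subseteq> {0\<^sub>v ?u}"
    proof
      fix x assume "x \<in> mat_kernel A"
      then have x: "x \<in> carrier_vec ?u" "A *\<^sub>v x = 0\<^sub>v ?v" using c by (auto simp: mat_kernel_def)
      have "x = (A' * A) *\<^sub>v x" using x e by simp
      also have "\<dots> = A' *\<^sub>v 0\<^sub>v ?v" using c x by (simp add: assoc_mult_mat_vec[of _ ?u ?v _ ?u])
      finally show "x \<in> {0\<^sub>v ?u}" using c by (simp add: mult_mat_vec_def)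
          (auto intro!: eq_vecI)
    qed
    show "{0\<^sub>v ?u} \<subseteq> mat_kernel A" using c by (auto simp: mat_kernel_def intro!: eq_vecI)
  qed
  have im: "(\<lambda>v. A *\<^sub>v v) ` carrier_vec ?u = mat_kernel B"
  proof (intro equalityI subsetI)
    fix y assume "y \<in> (\<lambda>v. A *\<^sub>v v) ` carrier_vec ?u"
    then obtain x where x: "x \<in> carrier_vec ?u" "y = A *\<^sub>v x" by blast
    have "B *\<^sub>v y = (B * A) *\<^sub>v x" using c x by (simp add: assoc_mult_mat_vec[of _ ?w ?v _ ?u])
    also have "\<dots> = 0\<^sub>v ?w" unfolding e using x by (auto intro!: eq_vecI)
    finally show "y \<in> mat_kernel B" using c x by (simp add: mat_kernel_def)
  next
    fix y assume "y \<in> mat_kernel B"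
    then have y: "y \<in> carrier_vec ?v" "B *\<^sub>v y = 0\<^sub>v ?w" using c by (auto simp: mat_kernel_def)
    have "y = (A * A' + B' * B) *\<^sub>v y" using y e by simp
    also have "\<dots> = A *\<^sub>v (A' *\<^sub>v y) + B' *\<^sub>v 0\<^sub>v ?w"
      using c y by (simp add: add_mult_distrib_mat_vec[of _ ?v ?v] assoc_mult_mat_vec[of _ ?v ?u _ ?v]
          assoc_mult_mat_vec[of _ ?v ?w _ ?v])
    also have "\<dots> = A *\<^sub>v (A' *\<^sub>v y)" using c y by (auto intro!: eq_vecI)
    finally show "y \<in> (\<lambda>v. A *\<^sub>v v) ` carrier_vec ?u" using c y by (intro image_eqI[of _ _ "A' *\<^sub>v y"]) auto
  qed
  have sur: "(\<lambda>v. B *\<^sub>v v) ` carrier_vec ?v = carrier_vec ?w"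
  proof (intro equalityI subsetI)
    fix y assume "y \<in> (\<lambda>v. B *\<^sub>v v) ` carrier_vec ?v"
    then show "y \<in> carrier_vec ?w" using c by auto
  next
    fix y :: "complex vec" assume y: "y \<in> carrier_vec ?w"
    have "B *\<^sub>v (B' *\<^sub>v y) = y" using c y e by (simp add: assoc_mult_mat_vec[of _ ?w ?v _ ?w, symmetric])
    then show "y \<in> (\<lambda>v. B *\<^sub>v v) ` carrier_vec ?v" using c y by (intro image_eqI[of _ _ "B' *\<^sub>v y"]) auto
  qed
  show ?thesis unfolding short_exact_def
    by (rule bexI[OF _ c(1)], rule bexI[OF _ c(3)]) (use i ker im sur in auto)
qed

section \<open>Exact sequences of modules given by generator matrices\<close>

lemma mk_module_intertwine:
  assumes "A \<in> carrier_mat m n" "\<And>g. M g \<in> carrier_mat n n" "\<And>g. N g \<in> carrier_mat m m"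
    and e: "\<And>g. A * M g = N g * A"
  shows "A * snd (mk_module n M) x = snd (mk_module m N) x * A"
  unfolding snd_mk_module
  by (intro lin_intertwine word_mat_intertwine word_mat_carrier assms)

text \<open>Intertwining is checked on generators only. An element acting by \<rho> on the middle
  space acts on the outer ones by A' \<rho> A and B \<rho> B', so the outer spaces inherit the
  relations; this is how new modules are obtained without verifying relations.\<close>

lemma split_maps_mk_module:
  assumes p: "p \<ge> 1" "p' \<ge> 1" and s: "split_maps u v w A A' B B'"
    and V: "mk_module v M \<in> modules p p'" and cV: "\<And>g. M g \<in> carrier_mat v v"
    and cU: "\<And>g. L g \<in> carrier_mat u u" and cW: "\<And>g. N g \<in> carrier_mat w w"
    and iA: "\<And>g. A * L g = M g * A" and iB: "\<And>g. B * M g = N g * B"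
  shows "mk_module u L \<in> modules p p'" "mk_module w N \<in> modules p p'"
    "short_exact (mk_module u L) (mk_module v M) (mk_module w N)"
proof -
  have c: "A \<in> carrier_mat v u" "A' \<in> carrier_mat u v" "B \<in> carrier_mat w v" "B' \<in> carrier_mat v w"
    and e: "A' * A = 1\<^sub>m u" "B * B' = 1\<^sub>m w"
    using s by (simp_all add: split_maps_def)
  note iA' = mk_module_intertwine[of A v u L M, OF c(1) cU cV iA]
    and iB' = mk_module_intertwine[of B w v M N, OF c(3) cV cW iB]
  show "short_exact (mk_module u L) (mk_module v M) (mk_module w N)"
    by (rule split_imp_short_exact[of _ _ _ A A' B B']) (use s iA' iB' in auto)
  interpret U: mat_rep u "word_mat u L" by (rule word_mat_rep[OF cU])
  interpret W: mat_rep w "word_mat w N" by (rule word_mat_rep[OF cW])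
  have sub: "lin u (word_mat u L) x = A' * lin v (word_mat v M) x * A"
    and quo: "lin w (word_mat w N) x = B * lin v (word_mat v M) x * B'" for x
  proof -
    have "lin u (word_mat u L) x = (A' * A) * lin u (word_mat u L) x" unfolding e by simp
    also have "\<dots> = A' * (A * lin u (word_mat u L) x)" using c by (simp add: mat_assoc)
    also have "A * lin u (word_mat u L) x = lin v (word_mat v M) x * A"
      using iA'[of x] by (simp add: snd_mk_module)
    finally show "lin u (word_mat u L) x = A' * lin v (word_mat v M) x * A" using c by (simp add: mat_assoc)
    have "lin w (word_mat w N) x = lin w (word_mat w N) x * (B * B')" unfolding e by simp
    also have "\<dots> = (lin w (word_mat w N) x * B) * B'" using c by (simp add: mat_assoc)
    also have "lin w (word_mat w N) x * B = B * lin v (word_mat v M) x"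
      using iB'[of x] by (simp add: snd_mk_module)
    finally show "lin w (word_mat w N) x = B * lin v (word_mat v M) x * B'" .
  qed
  have z: "lin v (word_mat v M) x = 0\<^sub>m v v" if "x \<in> rel_ideal p p'" for x
    using V that by (auto simp: modules_def mk_module_def)
  have hom: "lin k (word_mat k N) \<in> Ring.ring_hom ring_of_type_algebra (ring_mat TYPE(complex) k ())"
    "\<forall>c. lin k (word_mat k N) (scal c) = c \<cdot>\<^sub>m 1\<^sub>m k" if "mat_rep k (word_mat k N)" for k N
  proof -
    interpret mat_rep k "word_mat k N" by fact
    show "lin k (word_mat k N) \<in> Ring.ring_hom ring_of_type_algebra (ring_mat TYPE(complex) k ())"
      by (rule ring_hom_memI) (auto simp: ring_of_type_algebra_def ring_mat_def lin_mult lin_add lin_one)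
    show "\<forall>c. lin k (word_mat k N) (scal c) = c \<cdot>\<^sub>m 1\<^sub>m k" by (simp add: lin_scal)
  qed
  have "lin u (word_mat u L) x = 0\<^sub>m u u" "lin w (word_mat w N) x = 0\<^sub>m w w" if "x \<in> rel_ideal p p'" for x
    using c by (simp_all add: sub quo z[OF that])
  then show "mk_module u L \<in> modules p p'" "mk_module w N \<in> modules p p'"
    using hom[OF U.mat_rep_axioms] hom[OF W.mat_rep_axioms] by (simp_all add: modules_def mk_module_def)
qed

lemma kron_split_maps:
  assumes "split_maps u v w A A' B B'"
  shows "split_maps (u * z) (v * z) (w * z) (kron A (1\<^sub>m z)) (kron A' (1\<^sub>m z)) (kron B (1\<^sub>m z)) (kron B' (1\<^sub>m z))"
    and "split_maps (z * u) (z * v) (z * w) (kron (1\<^sub>m z) A) (kron (1\<^sub>m z) A') (kron (1\<^sub>m z) B) (kron (1\<^sub>m z) B')"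
proof -
  have c: "A \<in> carrier_mat v u" "A' \<in> carrier_mat u v" "B \<in> carrier_mat w v" "B' \<in> carrier_mat v w"
    and e: "A' * A = 1\<^sub>m u" "B * B' = 1\<^sub>m w" "B * A = 0\<^sub>m w u" "A * A' + B' * B = 1\<^sub>m v"
    using assms by (simp_all add: split_maps_def)
  note o = one_carrier_mat[of z]
  have cc: "A * A' \<in> carrier_mat v v" "B' * B \<in> carrier_mat v v" using c by auto
  have oo: "1\<^sub>m z * 1\<^sub>m z = (1\<^sub>m z :: complex mat)" by simp
  show "split_maps (u * z) (v * z) (w * z) (kron A (1\<^sub>m z)) (kron A' (1\<^sub>m z)) (kron B (1\<^sub>m z)) (kron B' (1\<^sub>m z))"
    unfolding split_maps_def kron_mult[OF c(2) o c(1) o] kron_mult[OF c(3) o c(4) o] kron_mult[OF c(3) o c(1) o]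
      kron_mult[OF c(1) o c(2) o] kron_mult[OF c(4) o c(3) o] oo kron_add_left[OF cc o, symmetric] e
    using c by (simp add: kron_one kron_zero_left)
  show "split_maps (z * u) (z * v) (z * w) (kron (1\<^sub>m z) A) (kron (1\<^sub>m z) A') (kron (1\<^sub>m z) B) (kron (1\<^sub>m z) B')"
    unfolding split_maps_def kron_mult[OF o c(2) o c(1)] kron_mult[OF o c(3) o c(4)] kron_mult[OF o c(3) o c(1)]
      kron_mult[OF o c(1) o c(2)] kron_mult[OF o c(4) o c(3)] oo kron_add_right[OF o cc, symmetric] e
    using c by (simp add: kron_one kron_zero_right)
qed

lemma mat_intertwine_pow:
  "A \<in> carrier_mat m n \<Longrightarrow> L \<in> carrier_mat n n \<Longrightarrow> N \<in> carrier_mat m m \<Longrightarrow> A * L = N * A \<Longrightarrow>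
    A * L ^\<^sub>m k = N ^\<^sub>m k * (A :: complex mat)"
proof (induction k)
  case (Suc k)
  have "A * L ^\<^sub>m Suc k = (A * L ^\<^sub>m k) * L" using Suc.prems by (simp add: mat_assoc)
  also have "\<dots> = N ^\<^sub>m k * (A * L)" using Suc by (simp add: mat_assoc)
  also have "\<dots> = N ^\<^sub>m Suc k * A" using Suc.prems by (simp add: mat_assoc)
  finally show ?case .
qed simp

lemma kron_one_mult:
  assumes "A \<in> carrier_mat m n"
  shows "L \<in> carrier_mat n n \<Longrightarrow> z \<in> carrier_mat k k \<Longrightarrow> kron A (1\<^sub>m k) * kron L z = kron (A * L) z"
    and "N \<in> carrier_mat m m \<Longrightarrow> z \<in> carrier_mat k k \<Longrightarrow> kron N z * kron A (1\<^sub>m k) = kron (N * A) z"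
    and "L \<in> carrier_mat n n \<Longrightarrow> z \<in> carrier_mat k k \<Longrightarrow> kron (1\<^sub>m k) A * kron z L = kron z (A * L)"
    and "N \<in> carrier_mat m m \<Longrightarrow> z \<in> carrier_mat k k \<Longrightarrow> kron z N * kron (1\<^sub>m k) A = kron z (N * A)"
  using assms
  by (simp_all add: kron_mult[of A m n _ k k _ n _ k] kron_mult[of N m m z k k A n _ k]
      kron_mult[of _ k k A m n _ k _ n] kron_mult[of z k k N m m _ k A n])

text \<open>A map that commutes with all generators commutes with powers of K as well, hence its
  Kronecker product with an identity commutes with every term of every coproduct.\<close>

lemma tgen_intertwine:
  assumes A: "A \<in> carrier_mat m n" and c: "\<And>g. L g \<in> carrier_mat n n" "\<And>g. N g \<in> carrier_mat m m"
      "\<And>g. Z g \<in> carrier_mat k k"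
    and e: "\<And>g. A * L g = N g * A"
  shows "kron A (1\<^sub>m k) * tgen p p' n L k Z g = tgen p p' m N k Z g * kron A (1\<^sub>m k)"
    and "kron (1\<^sub>m k) A * tgen p p' k Z n L g = tgen p p' k Z m N g * kron (1\<^sub>m k) A"
proof -
  have pc: "L g ^\<^sub>m j \<in> carrier_mat n n" "N g ^\<^sub>m j \<in> carrier_mat m m" "Z g ^\<^sub>m j \<in> carrier_mat k k" for g j
    using c by simp_all
  note ep = mat_intertwine_pow[OF A c(1) c(2) e]
  note o = one_carrier_mat
  note k1 = kron_one_mult(1)[OF A] and k2 = kron_one_mult(2)[OF A] and k3 = kron_one_mult(3)[OF A] and k4 = kron_one_mult(4)[OF A]
  have oA: "A * 1\<^sub>m n = A" "1\<^sub>m m * A = A" using A by auto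
  have A1: "kron A (1\<^sub>m k) \<in> carrier_mat (m * k) (n * k)" "kron (1\<^sub>m k) A \<in> carrier_mat (k * m) (k * n)" using A by simp_all
  have kc: "kron P z \<in> carrier_mat (q * k) (q * k)" "kron z P \<in> carrier_mat (k * q) (k * q)"
    if "P \<in> carrier_mat q q" "z \<in> carrier_mat k k" for P z q
    using that by simp_all
  have d1: "kron A (1\<^sub>m k) * (kron P z + kron P' z') = kron (A * P) z + kron (A * P') z'"
    if "P \<in> carrier_mat n n" "P' \<in> carrier_mat n n" "z \<in> carrier_mat k k" "z' \<in> carrier_mat k k" for P P' z z'
    using that by (simp only: mult_add_distrib_mat[OF A1(1) kc(1) kc(1)] k1)
  have d2: "(kron P z + kron P' z') * kron A (1\<^sub>m k) = kron (P * A) z + kron (P' * A) z'"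
    if "P \<in> carrier_mat m m" "P' \<in> carrier_mat m m" "z \<in> carrier_mat k k" "z' \<in> carrier_mat k k" for P P' z z'
    using that by (simp only: add_mult_distrib_mat[OF kc(1) kc(1) A1(1)] k2)
  have d3: "kron (1\<^sub>m k) A * (kron z P + kron z' P') = kron z (A * P) + kron z' (A * P')"
    if "P \<in> carrier_mat n n" "P' \<in> carrier_mat n n" "z \<in> carrier_mat k k" "z' \<in> carrier_mat k k" for P P' z z'
    using that by (simp only: mult_add_distrib_mat[OF A1(2) kc(2) kc(2)] k3)
  have d4: "(kron z P + kron z' P') * kron (1\<^sub>m k) A = kron z (P * A) + kron z' (P' * A)"
    if "P \<in> carrier_mat m m" "P' \<in> carrier_mat m m" "z \<in> carrier_mat k k" "z' \<in> carrier_mat k k" for P P' z z'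
    using that by (simp only: add_mult_distrib_mat[OF kc(2) kc(2) A1(2)] k4)
  show "kron A (1\<^sub>m k) * tgen p p' n L k Z g = tgen p p' m N k Z g * kron A (1\<^sub>m k)"
    by (cases g; simp only: tgen_def gen.case d1 d2 k1 k2 c pc o e ep oA)
  show "kron (1\<^sub>m k) A * tgen p p' k Z n L g = tgen p p' k Z m N g * kron (1\<^sub>m k) A"
    by (cases g; simp only: tgen_def gen.case d3 d4 k3 k4 c pc o e ep oA)
qed

text \<open>A linear splitting stays a splitting after tensoring with an identity matrix, and the
  tensored maps still intertwine.\<close>

lemma short_exact_tensor:
  assumes p: "p \<ge> 1" "p' \<ge> 1"
    and m: "U \<in> modules p p'" "V \<in> modules p p'" "W \<in> modules p p'" "Z \<in> modules p p'"
    and ex: "short_exact U V W"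
  shows "short_exact (tensor_module p p' U Z) (tensor_module p p' V Z) (tensor_module p p' W Z)"
    and "short_exact (tensor_module p p' Z U) (tensor_module p p' Z V) (tensor_module p p' Z W)"
proof -
  obtain A A' B B' where s: "split_maps (fst U) (fst V) (fst W) A A' B B'"
    and i: "\<And>x. A * snd U x = snd V x * A" "\<And>x. B * snd V x = snd W x * B"
    using short_exact_imp_split[OF ex] by blast
  have c: "A \<in> carrier_mat (fst V) (fst U)" "B \<in> carrier_mat (fst W) (fst V)" using s by (simp_all add: split_maps_def)
  have g: "A * gens U g = gens V g * A" "B * gens V g = gens W g * B" for g
    using i by (simp_all add: gens_def)
  note gU = modules_eq_mk_module(2)[OF m(1)] and gV = modules_eq_mk_module(2)[OF m(2)]
    and gW = modules_eq_mk_module(2)[OF m(3)] and gZ = modules_eq_mk_module(2)[OF m(4)]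
  note tA = tgen_intertwine[OF c(1) gU gV gZ g(1)] and tB = tgen_intertwine[OF c(2) gV gW gZ g(2)]
  note tc = tgen_carrier
  have k: "kron A (1\<^sub>m (fst Z)) \<in> carrier_mat (fst V * fst Z) (fst U * fst Z)"
    "kron B (1\<^sub>m (fst Z)) \<in> carrier_mat (fst W * fst Z) (fst V * fst Z)"
    "kron (1\<^sub>m (fst Z)) A \<in> carrier_mat (fst Z * fst V) (fst Z * fst U)"
    "kron (1\<^sub>m (fst Z)) B \<in> carrier_mat (fst Z * fst W) (fst Z * fst V)"
    using c by simp_all
  show "short_exact (tensor_module p p' U Z) (tensor_module p p' V Z) (tensor_module p p' W Z)"
    unfolding tensor_module_eq[OF p m(1,4)] tensor_module_eq[OF p m(2,4)] tensor_module_eq[OF p m(3,4)]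
    by (rule split_imp_short_exact, unfold fst_mk_module, rule kron_split_maps(1)[OF s])
       (rule mk_module_intertwine[OF k(1) tc[OF gU gZ] tc[OF gV gZ] tA(1)]
          mk_module_intertwine[OF k(2) tc[OF gV gZ] tc[OF gW gZ] tB(1)])+
  show "short_exact (tensor_module p p' Z U) (tensor_module p p' Z V) (tensor_module p p' Z W)"
    unfolding tensor_module_eq[OF p m(4,1)] tensor_module_eq[OF p m(4,2)] tensor_module_eq[OF p m(4,3)]
    by (rule split_imp_short_exact, unfold fst_mk_module, rule kron_split_maps(2)[OF s])
       (rule mk_module_intertwine[OF k(3) tc[OF gZ gU] tc[OF gZ gV] tA(2)]
          mk_module_intertwine[OF k(4) tc[OF gZ gV] tc[OF gZ gW] tB(2)])+
qed

text \<open>Coassociativity on the five generators, combined with the strict associativity of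
  Kronecker products. K is grouplike, so K^j on a tensor product is again a Kronecker product of
  powers.\<close>

lemma tensor_module_assoc:
  assumes p: "p \<ge> 1" "p' \<ge> 1" "coprime p p'"
    and m: "U \<in> modules p p'" "V \<in> modules p p'" "W \<in> modules p p'"
  shows "tensor_module p p' (tensor_module p p' U V) W = tensor_module p p' U (tensor_module p p' V W)"
proof -
  let ?u = "fst U" and ?v = "fst V" and ?w = "fst W" and ?L = "gens U" and ?M = "gens V" and ?N = "gens W"
  note c = modules_eq_mk_module(2)[OF m(1)] modules_eq_mk_module(2)[OF m(2)] modules_eq_mk_module(2)[OF m(3)]
  have pc: "?L g ^\<^sub>m j \<in> carrier_mat ?u ?u" "?M g ^\<^sub>m j \<in> carrier_mat ?v ?v" "?N g ^\<^sub>m j \<in> carrier_mat ?w ?w" for g j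
    using c by simp_all
  note o = one_carrier_mat
  have k: "kron A B \<in> carrier_mat (a * b) (a * b)" if "A \<in> carrier_mat a a" "B \<in> carrier_mat b b" for A B a b
    using that by simp
  note tUV = tensor_module_eq[OF p(1,2) m(1,2)] and tVW = tensor_module_eq[OF p(1,2) m(2,3)]
  note gUV = gens_mk_module[OF tgen_carrier[OF c(1,2)]] and gVW = gens_mk_module[OF tgen_carrier[OF c(2,3)]]
  have kk: "tgen p p' a A b B KK ^\<^sub>m j = kron (A KK ^\<^sub>m j) (B KK ^\<^sub>m j)"
    if "A KK \<in> carrier_mat a a" "B KK \<in> carrier_mat b b" for A B a b j
    using kron_pow[OF that] by (simp add: tgen_def)
  have eq: "tgen p p' (?u * ?v) (tgen p p' ?u ?L ?v ?M) ?w ?N g = tgen p p' ?u ?L (?v * ?w) (tgen p p' ?v ?M ?w ?N) g" for g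
  proof (cases g)
    case EP
    show ?thesis unfolding EP tgen_def[of p p' "?u * ?v"] tgen_def[of p p' ?u _ "?v * ?w"] gen.case kk[OF c(1,2)] kk[OF c(2,3)]
      unfolding tgen_def gen.case
      by (simp only: kron_add_left[OF k[OF c(1) o] k[OF pc(1) c(2)] o] kron_add_right[OF pc(1) k[OF c(2) o] k[OF pc(2) c(3)]] kron_assoc kron_one)
         (simp only: assoc_add_mat[OF k[OF c(1) o] k[OF pc(1) k[OF c(2) o]] k[OF pc(1) k[OF pc(2) c(3)]]])
  next
    case FM
    show ?thesis unfolding FM tgen_def[of p p' "?u * ?v"] tgen_def[of p p' ?u _ "?v * ?w"] gen.case kk[OF c(1,2)] kk[OF c(2,3)]
      unfolding tgen_def gen.case
      by (simp only: kron_add_left[OF k[OF c(1) o] k[OF pc(1) c(2)] o] kron_add_right[OF pc(1) k[OF c(2) o] k[OF pc(2) c(3)]] kron_assoc kron_one)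
         (simp only: assoc_add_mat[OF k[OF c(1) o] k[OF pc(1) k[OF c(2) o]] k[OF pc(1) k[OF pc(2) c(3)]]])
  next
    case FP
    show ?thesis unfolding FP tgen_def[of p p' "?u * ?v"] tgen_def[of p p' ?u _ "?v * ?w"] gen.case kk[OF c(1,2)] kk[OF c(2,3)]
      unfolding tgen_def gen.case
      by (simp only: kron_add_left[OF k[OF c(1) pc(2)] k[OF o c(2)] pc(3)] kron_add_right[OF o k[OF c(2) pc(3)] k[OF o c(3)]] kron_assoc kron_one[symmetric])
         (simp only: assoc_add_mat[OF k[OF c(1) k[OF pc(2) pc(3)]] k[OF o k[OF c(2) pc(3)]] k[OF o k[OF o c(3)]]])
  next
    case EM
    show ?thesis unfolding EM tgen_def[of p p' "?u * ?v"] tgen_def[of p p' ?u _ "?v * ?w"] gen.case kk[OF c(1,2)] kk[OF c(2,3)]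
      unfolding tgen_def gen.case
      by (simp only: kron_add_left[OF k[OF c(1) pc(2)] k[OF o c(2)] pc(3)] kron_add_right[OF o k[OF c(2) pc(3)] k[OF o c(3)]] kron_assoc kron_one[symmetric])
         (simp only: assoc_add_mat[OF k[OF c(1) k[OF pc(2) pc(3)]] k[OF o k[OF c(2) pc(3)]] k[OF o k[OF o c(3)]]])
  next
    case KK
    show ?thesis unfolding KK tgen_def gen.case by (rule kron_assoc)
  qed
  have mm: "mk_module (?u * ?v) (tgen p p' ?u ?L ?v ?M) \<in> modules p p'"
    "mk_module (?v * ?w) (tgen p p' ?v ?M ?w ?N) \<in> modules p p'"
    using tensor_in_modules[OF p m(1,2)] tensor_in_modules[OF p m(2,3)] unfolding tUV tVW by auto
  show ?thesis
    unfolding tUV tVW tensor_module_eq[OF p(1,2) mm(1) m(3)] tensor_module_eq[OF p(1,2) m(1) mm(2)]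
      fst_mk_module gUV gVW
    unfolding ext[of "tgen p p' _ _ _ _", OF eq] by (simp only: mult.assoc)
qed

section \<open>The Grothendieck ring\<close>

definition tens :: "nat \<Rightarrow> nat \<Rightarrow> (fd_module \<Rightarrow>\<^sub>0 int) \<Rightarrow> (fd_module \<Rightarrow>\<^sub>0 int) \<Rightarrow> (fd_module \<Rightarrow>\<^sub>0 int)" where
  "tens p p' x y = frag_extend (\<lambda>V. frag_extend (\<lambda>W. frag_of (tensor_module p p' V W)) y) x"

lemma module_ring_simps:
  "carrier (module_ring p p') = {x. Poly_Mapping.keys x \<subseteq> modules p p'}"
  "\<zero>\<^bsub>module_ring p p'\<^esub> = 0"
  "x \<oplus>\<^bsub>module_ring p p'\<^esub> y = x + y"
  "x \<otimes>\<^bsub>module_ring p p'\<^esub> y = tens p p' x y"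
  by (simp_all add: module_ring_def tens_def)

lemma frag_extend_add_fun: "frag_extend (\<lambda>i. f i + g i) x = frag_extend f x + frag_extend g x"
  by (simp add: frag_extend_def frag_cmul_distrib2 sum.distrib)

lemma frag_extend_zero_fun: "frag_extend (\<lambda>i. 0) x = 0"
  by (simp add: frag_extend_def)

lemma frag_extend_minus_fun: "frag_extend (\<lambda>i. - f i) x = - frag_extend f x"
  using frag_extend_add_fun[of "\<lambda>i. - f i" f x] by (simp add: frag_extend_zero_fun eq_neg_iff_add_eq_0)

lemma tens_simps:
  "tens p p' 0 y = 0" "tens p p' x 0 = 0"
  "tens p p' (- x) y = - tens p p' x y" "tens p p' x (- y) = - tens p p' x y"
  "tens p p' (x + x') y = tens p p' x y + tens p p' x' y" "tens p p' x (y + y') = tens p p' x y + tens p p' x y'"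
  "tens p p' (x - x') y = tens p p' x y - tens p p' x' y" "tens p p' x (y - y') = tens p p' x y - tens p p' x y'"
  "tens p p' (frag_of V) (frag_of W) = frag_of (tensor_module p p' V W)"
proof -
  show z: "tens p p' 0 y = 0" "tens p p' x 0 = 0"
    by (simp_all add: tens_def frag_extend_zero_fun)
  show m: "tens p p' (- x) y = - tens p p' x y" "tens p p' x (- y) = - tens p p' x y" for x y
    by (simp_all add: tens_def frag_extend_minus frag_extend_minus_fun)
  show a: "tens p p' (x + x') y = tens p p' x y + tens p p' x' y" "tens p p' x (y + y') = tens p p' x y + tens p p' x y'" for x x' y y'
    by (simp_all add: tens_def frag_extend_add frag_extend_add_fun)
  show "tens p p' (x - x') y = tens p p' x y - tens p p' x' y" "tens p p' x (y - y') = tens p p' x y - tens p p' x y'"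
    using a(1)[of x "- x'" y] a(2)[of x y "- y'"] m by simp_all
  show "tens p p' (frag_of V) (frag_of W) = frag_of (tensor_module p p' V W)"
    by (simp add: tens_def)
qed

lemma abelian_group_module_ring: "abelian_group (module_ring p p')"
proof (rule abelian_groupI)
  fix x assume "x \<in> carrier (module_ring p p')"
  then have "- x \<in> carrier (module_ring p p')" by (simp add: module_ring_simps)
  then show "\<exists>y\<in>carrier (module_ring p p'). y \<oplus>\<^bsub>module_ring p p'\<^esub> x = \<zero>\<^bsub>module_ring p p'\<^esub>"
    by (intro bexI[of _ "- x"]) (simp_all add: module_ring_simps)
qed (use Poly_Mapping.keys_add in \<open>fastforce simp: module_ring_simps add_ac\<close>)+

section \<open>Congruence modulo short exact sequences\<close>

locale groth =
  fixes p p' :: nat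
  assumes p: "p \<ge> 1" "p' \<ge> 1" "coprime p p'"
begin

abbreviation "C \<equiv> carrier (module_ring p p')"
abbreviation "J \<equiv> exact_relations p p'"

lemma C_closed:
  "0 \<in> C" "x \<in> C \<Longrightarrow> - x \<in> C" "x \<in> C \<Longrightarrow> y \<in> C \<Longrightarrow> x + y \<in> C" "x \<in> C \<Longrightarrow> y \<in> C \<Longrightarrow> x - y \<in> C"
  "frag_of V \<in> C \<longleftrightarrow> V \<in> modules p p'"
  using Poly_Mapping.keys_add[of x y] keys_diff[of x y] by (auto simp: module_ring_simps)

lemma a_inv: "x \<in> C \<Longrightarrow> inv\<^bsub>add_monoid (module_ring p p')\<^esub> x = - x"
proof -
  interpret abelian_group "module_ring p p'" by (rule abelian_group_module_ring)
  assume "x \<in> C"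
  then show ?thesis
    by (intro group.inv_equality[OF a_group]) (simp_all add: module_ring_simps)
qed

lemma relations_subset:
  "{frag_of V - (frag_of U + frag_of W) |U V W.
        U \<in> modules p p' \<and> V \<in> modules p p' \<and> W \<in> modules p p' \<and> short_exact U V W} \<subseteq> C"
  by (auto simp: C_closed)

lemma abelian_subgroup_J: "abelian_subgroup J (module_ring p p')"
proof -
  interpret abelian_group "module_ring p p'" by (rule abelian_group_module_ring)
  have "subgroup J (add_monoid (module_ring p p'))"
    unfolding exact_relations_def
    by (rule add.generate_is_subgroup) (use relations_subset in simp)
  then show ?thesis
    by (intro abelian_subgroupI3 abelian_group_module_ring) (simp add: additive_subgroup_def)
qed

lemma J_closed:
  "0 \<in> J" "x \<in> J \<Longrightarrow> x \<in> C" "x \<in> J \<Longrightarrow> - x \<in> J" "x \<in> J \<Longrightarrow> y \<in> J \<Longrightarrow> x + y \<in> J" "x \<in> J \<Longrightarrow> y \<in> J \<Longrightarrow> x - y \<in> J"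
proof -
  interpret abelian_subgroup J "module_ring p p'" by (rule abelian_subgroup_J)
  show "0 \<in> J" using additive_subgroup.zero_closed[OF additive_subgroup_axioms] by (simp add: module_ring_simps)
  show c: "x \<in> J \<Longrightarrow> x \<in> C" for x by (rule a_Hcarr)
  show m: "- x \<in> J" if "x \<in> J" for x
    using additive_subgroup.a_inv_closed[OF additive_subgroup_axioms that] a_inv[OF c[OF that]] by (simp add: a_inv_def)
  show a: "x \<in> J \<Longrightarrow> y \<in> J \<Longrightarrow> x + y \<in> J" for x y
    using additive_subgroup.a_closed[OF additive_subgroup_axioms, of x y] by (simp add: module_ring_simps)
  show "x \<in> J \<Longrightarrow> y \<in> J \<Longrightarrow> x - y \<in> J"
    using a[of x "- y"] m[of y] by simp
qed

lemma J_exact: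
  "U \<in> modules p p' \<Longrightarrow> V \<in> modules p p' \<Longrightarrow> W \<in> modules p p' \<Longrightarrow> short_exact U V W \<Longrightarrow>
    frag_of V - (frag_of U + frag_of W) \<in> J"
  unfolding exact_relations_def by (rule generate.incl) blast

lemma J_induct [consumes 1, case_names zero exact minus add]:
  assumes "x \<in> J" and "P 0"
    and "\<And>U V W. U \<in> modules p p' \<Longrightarrow> V \<in> modules p p' \<Longrightarrow> W \<in> modules p p' \<Longrightarrow> short_exact U V W \<Longrightarrow>
      P (frag_of V - (frag_of U + frag_of W))"
    and "\<And>x. P x \<Longrightarrow> P (- x)" "\<And>x y. P x \<Longrightarrow> P y \<Longrightarrow> P (x + y)"
  shows "P x"
  using assms(1) unfolding exact_relations_def
proof (induction rule: generate.induct)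
  case one
  then show ?case using assms by (simp add: module_ring_simps)
next
  case (incl h)
  then show ?case using assms(3) by blast
next
  case (inv h)
  then have "h \<in> C" "P h" using relations_subset assms(3) by blast+
  then show ?case unfolding a_inv[OF \<open>h \<in> C\<close>] by (intro assms(4))
next
  case (eng h1 h2)
  then show ?case using assms(5) by (simp add: module_ring_simps)
qed

text \<open>Equality in the Grothendieck group, stated for representatives: calculations take place
  in the free abelian group and pass to cosets at the end.\<close>

definition equ :: "(fd_module \<Rightarrow>\<^sub>0 int) \<Rightarrow> (fd_module \<Rightarrow>\<^sub>0 int) \<Rightarrow> bool" (infix "\<approx>" 50) where
  "x \<approx> y \<longleftrightarrow> x - y \<in> J"

lemma equ_refl [simp]: "x \<approx> x"
  by (simp add: equ_def J_closed)

lemma equ_sym: "x \<approx> y \<Longrightarrow> y \<approx> x"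
  using J_closed(3)[of "x - y"] by (simp add: equ_def)

lemma equ_trans [trans]: "x \<approx> y \<Longrightarrow> y \<approx> z \<Longrightarrow> x \<approx> z"
  using J_closed(4)[of "x - y" "y - z"] by (simp add: equ_def)

lemma equ_add: "x \<approx> x' \<Longrightarrow> y \<approx> y' \<Longrightarrow> x + y \<approx> x' + y'"
  using J_closed(4)[of "x - x'" "y - y'"] by (simp add: equ_def algebra_simps)

lemma equ_diff: "x \<approx> x' \<Longrightarrow> y \<approx> y' \<Longrightarrow> x - y \<approx> x' - y'"
  using J_closed(5)[of "x - x'" "y - y'"] by (simp add: equ_def algebra_simps)

lemma equ_sum: "(\<And>i. i \<in> A \<Longrightarrow> f i \<approx> g i) \<Longrightarrow> sum f A \<approx> sum g A"
  by (induction A rule: infinite_finite_induct) (auto intro: equ_add)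

lemma equ_exact:
  "U \<in> modules p p' \<Longrightarrow> V \<in> modules p p' \<Longrightarrow> W \<in> modules p p' \<Longrightarrow> short_exact U V W \<Longrightarrow>
    frag_of V \<approx> frag_of U + frag_of W"
  unfolding equ_def by (rule J_exact)

lemma C_induct [consumes 1, case_names zero frag diff]:
  assumes "x \<in> C" "P 0" "\<And>V. V \<in> modules p p' \<Longrightarrow> P (frag_of V)" "\<And>x y. P x \<Longrightarrow> P y \<Longrightarrow> P (x - y)"
  shows "P x"
  using frag_induction[of x "modules p p'" P] assms by (simp add: module_ring_simps)

text \<open>Exactness of the tensor product sends a generating relation to a generating relation
  when the other factor is a single module; biadditivity extends this to all elements of
  \<open>J\<close> and \<open>C\<close>.\<close>

lemma J_ideal:
  assumes x: "x \<in> J" and y: "y \<in> C"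
  shows "tens p p' x y \<in> J" "tens p p' y x \<in> J"
proof -
  show "tens p p' x y \<in> J" using x
  proof (induction x rule: J_induct)
    case (exact U V W)
    show ?case using y
    proof (induction y rule: C_induct)
      case (frag Z)
      then show ?case using exact p
        by (simp add: tens_simps) (intro J_exact tensor_in_modules short_exact_tensor; simp)
    next
      case (diff a b)
      then show ?case by (simp only: tens_simps(8) J_closed(5))
    qed (simp add: tens_simps J_closed)
  qed (simp_all only: tens_simps J_closed)
  show "tens p p' y x \<in> J" using x
  proof (induction x rule: J_induct)
    case (exact U V W)
    show ?case using y
    proof (induction y rule: C_induct)
      case (frag Z)
      then show ?case using exact p
        by (simp add: tens_simps) (intro J_exact tensor_in_modules short_exact_tensor; simp)
    next
      case (diff a b)
      then show ?case by (simp only: tens_simps(7) J_closed(5))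
    qed (simp add: tens_simps J_closed)
  qed (simp_all only: tens_simps J_closed)
qed

text \<open>Write xy - x'y' = (x - x')y + x'(y - y'). The ideal property then asks for y and x' to
  lie in \<open>C\<close>.\<close>

lemma equ_tens:
  assumes "x \<approx> x'" "y \<approx> y'" "x' \<in> C" "y \<in> C"
  shows "tens p p' x y \<approx> tens p p' x' y'"
proof -
  have "tens p p' x y - tens p p' x' y' = tens p p' (x - x') y + tens p p' x' (y - y')"
    by (simp add: tens_simps)
  then show ?thesis
    using assms J_ideal by (auto simp: equ_def intro: J_closed)
qed

lemma tens_assoc: "x \<in> C \<Longrightarrow> y \<in> C \<Longrightarrow> z \<in> C \<Longrightarrow> tens p p' (tens p p' x y) z = tens p p' x (tens p p' y z)"
proof (induction x rule: C_induct)
  case (frag U)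
  from frag(2,3,1) show ?case
  proof (induction y rule: C_induct)
    case (frag V)
    from frag(2,1,3) show ?case
      by (induction z rule: C_induct) (simp_all add: tens_simps tensor_module_assoc[OF p])
  qed (simp_all add: tens_simps)
qed (simp_all add: tens_simps)

section \<open>The quotient ring in terms of cosets\<close>

definition cls :: "(fd_module \<Rightarrow>\<^sub>0 int) \<Rightarrow> (fd_module \<Rightarrow>\<^sub>0 int) set" where
  "cls x = J +>\<^bsub>module_ring p p'\<^esub> x"

lemma cls_eq: "cls x = {y. y \<approx> x}"
proof -
  have "cls x = (\<lambda>h. h + x) ` J"
    by (auto simp: cls_def a_r_coset_def' module_ring_simps)
  also have "\<dots> = {y. y \<approx> x}"
    by (auto simp: equ_def intro: image_eqI[of _ _ "_ - x"])
  finally show ?thesis .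
qed

lemma cls_eqI: "x \<approx> y \<Longrightarrow> cls x = cls y"
  unfolding cls_eq using equ_trans equ_sym by blast

lemma Groth_carrier: "carrier (Groth p p') = cls ` C"
  by (auto simp: Groth_def FactRing_def A_RCOSETS_def' cls_def)

lemma Groth_add:
  assumes "x \<in> C" "y \<in> C" shows "cls x \<oplus>\<^bsub>Groth p p'\<^esub> cls y = cls (x + y)"
proof -
  interpret abelian_subgroup J "module_ring p p'" by (rule abelian_subgroup_J)
  show ?thesis using a_rcos_sum[OF assms]
    by (simp add: Groth_def FactRing_def cls_def module_ring_simps)
qed

lemma Groth_zero: "\<zero>\<^bsub>Groth p p'\<^esub> = cls 0"
  by (simp add: Groth_def FactRing_def cls_eq equ_def)

text \<open>The product of two cosets in a factor ring is a union over all pairs of representatives.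
  Compatibility of the tensor product with congruence makes every member of the union the same
  coset.\<close>

lemma Groth_mult:
  assumes "x \<in> C" "y \<in> C" shows "cls x \<otimes>\<^bsub>Groth p p'\<^esub> cls y = cls (tens p p' x y)"
proof -
  have ne: "cls z \<noteq> {}" for z using equ_refl[of z] by (auto simp: cls_eq simp del: equ_refl)
  have "cls x \<otimes>\<^bsub>Groth p p'\<^esub> cls y = (\<Union>a\<in>cls x. \<Union>b\<in>cls y. cls (tens p p' a b))"
    by (simp add: Groth_def FactRing_def rcoset_mult_def cls_def module_ring_simps)
  also have "\<dots> = (\<Union>a\<in>cls x. \<Union>b\<in>cls y. cls (tens p p' x y))"
  proof (intro SUP_cong refl cls_eqI equ_tens)
    fix b assume "b \<in> cls y"
    then have "b - y \<in> C" by (auto simp: cls_eq equ_def intro: J_closed)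
    then show "b \<in> C" using C_closed(3)[of "b - y" y] assms by simp
  qed (use assms in \<open>auto simp: cls_eq\<close>)
  also have "\<dots> = cls (tens p p' x y)"
    using ne[of x] ne[of y] by simp
  finally show ?thesis .
qed

lemma abelian_monoid_Groth: "abelian_monoid (Groth p p')"
  by (rule abelian_monoidI)
     (auto simp: Groth_carrier Groth_zero Groth_add C_closed add_ac)

text \<open>Membership of the sum in \<open>C\<close> is carried along because the induction step
  adds the cosets of two elements of \<open>C\<close>.\<close>

lemma Groth_finsum:
  assumes "finite A" "\<And>i. i \<in> A \<Longrightarrow> f i \<in> C"
  shows "(\<Oplus>\<^bsub>Groth p p'\<^esub>i\<in>A. cls (f i)) = cls (sum f A) \<and> sum f A \<in> C"
  using assms
proof (induction A rule: finite_induct)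
  case empty
  show ?case using abelian_monoid.finsum_empty[OF abelian_monoid_Groth] by (simp add: Groth_zero C_closed)
next
  case (insert a A)
  have "(\<Oplus>\<^bsub>Groth p p'\<^esub>i\<in>insert a A. cls (f i)) = cls (f a) \<oplus>\<^bsub>Groth p p'\<^esub> (\<Oplus>\<^bsub>Groth p p'\<^esub>i\<in>A. cls (f i))"
    using insert by (intro abelian_monoid.finsum_insert[OF abelian_monoid_Groth]) (auto simp: Groth_carrier)
  then show ?case using insert by (simp add: Groth_add C_closed)
qed

lemma Groth_add_pow:
  "x \<in> C \<Longrightarrow> [(k::nat)] \<cdot>\<^bsub>Groth p p'\<^esub> cls x = cls (frag_cmul (int k) x) \<and> frag_cmul (int k) x \<in> C"
proof (induction k)
  case 0
  then show ?case by (simp add: add_pow_def nat_pow_def Groth_zero C_closed)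
next
  case (Suc k)
  then show ?case
    by (simp add: add_pow_def nat_pow_def Groth_add C_closed frag_cmul_distrib add.commute)
qed

end

section \<open>Band matrices\<close>

text \<open>Rectangular band matrices. The coefficient function is evaluated at the column index,
  also for the off-diagonal bands, so \<open>x j\<close> is the coefficient that appears when the
  operator is applied to the j-th basis vector.\<close>

definition dgr :: "nat \<Rightarrow> nat \<Rightarrow> (nat \<Rightarrow> complex) \<Rightarrow> complex mat" where
  "dgr a b x = mat a b (\<lambda>(i, j). if i = j then x j else 0)"

definition upr :: "nat \<Rightarrow> nat \<Rightarrow> (nat \<Rightarrow> complex) \<Rightarrow> complex mat" where
  "upr a b x = mat a b (\<lambda>(i, j). if Suc i = j then x j else 0)"

definition lor :: "nat \<Rightarrow> nat \<Rightarrow> (nat \<Rightarrow> complex) \<Rightarrow> complex mat" where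
  "lor a b x = mat a b (\<lambda>(i, j). if i = Suc j then x j else 0)"

definition upr2 :: "nat \<Rightarrow> nat \<Rightarrow> (nat \<Rightarrow> complex) \<Rightarrow> complex mat" where
  "upr2 a b x = mat a b (\<lambda>(i, j). if Suc (Suc i) = j then x j else 0)"

lemma band_carrier [simp]:
  "dgr a b x \<in> carrier_mat a b" "upr a b x \<in> carrier_mat a b" "lor a b x \<in> carrier_mat a b" "upr2 a b x \<in> carrier_mat a b"
  by (simp_all add: dgr_def upr_def lor_def upr2_def)

lemma band_index:
  "i < a \<Longrightarrow> j < b \<Longrightarrow> dgr a b x $$ (i, j) = (if i = j then x j else 0)"
  "i < a \<Longrightarrow> j < b \<Longrightarrow> upr a b x $$ (i, j) = (if Suc i = j then x j else 0)"
  "i < a \<Longrightarrow> j < b \<Longrightarrow> lor a b x $$ (i, j) = (if i = Suc j then x j else 0)"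
  "i < a \<Longrightarrow> j < b \<Longrightarrow> upr2 a b x $$ (i, j) = (if Suc (Suc i) = j then x j else 0)"
  by (simp_all add: dgr_def upr_def lor_def upr2_def)

lemma band_dims [simp]:
  "dim_row (dgr a b x) = a" "dim_row (upr a b x) = a" "dim_row (lor a b x) = a" "dim_row (upr2 a b x) = a"
  "dim_col (dgr a b x) = b" "dim_col (upr a b x) = b" "dim_col (lor a b x) = b" "dim_col (upr2 a b x) = b"
  by (simp_all add: dgr_def upr_def lor_def upr2_def)

lemma sum_sparse:
  fixes g :: "nat \<Rightarrow> complex"
  shows "(\<Sum>l<k. (if i = l then f l else 0) * g l) = (if i < k then f i * g i else 0)"
    and "(\<Sum>l<k. (if Suc i = l then f l else 0) * g l) = (if Suc i < k then f (Suc i) * g (Suc i) else 0)"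
    and "(\<Sum>l<k. (if i = Suc l then f l else 0) * g l) = (if 0 < i \<and> i - 1 < k then f (i - 1) * g (i - 1) else 0)"
proof -
  show 1: "(\<Sum>l<k. (if i = l then f l else 0) * g l) = (if i < k then f i * g i else 0)" for i
  proof -
    have "(\<Sum>l<k. (if i = l then f l else 0) * g l) = (\<Sum>l<k. if i = l then f l * g l else 0)"
      by (intro sum.cong) auto
    then show ?thesis by simp
  qed
  show "(\<Sum>l<k. (if Suc i = l then f l else 0) * g l) = (if Suc i < k then f (Suc i) * g (Suc i) else 0)"
    by (rule 1)
  show "(\<Sum>l<k. (if i = Suc l then f l else 0) * g l) = (if 0 < i \<and> i - 1 < k then f (i - 1) * g (i - 1) else 0)"
    using 1[of "i - 1"] by (cases i) (simp_all cong: if_cong)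
qed

text \<open>Each entry of such a product comes from a single middle index; the conditionals say that
  this index must exist and lie below \<open>b\<close>.\<close>

lemma band_mult:
  "dgr a b x * dgr b c y = dgr a c (\<lambda>j. if j < b then x j * y j else 0)"
  "dgr a b x * upr b c y = upr a c (\<lambda>j. if j \<le> b then x (j - 1) * y j else 0)"
  "dgr a b x * lor b c y = lor a c (\<lambda>j. if Suc j < b then x (Suc j) * y j else 0)"
  "upr a b x * dgr b c y = upr a c (\<lambda>j. if j < b then x j * y j else 0)"
  "lor a b x * dgr b c y = lor a c (\<lambda>j. if j < b then x j * y j else 0)"
  "upr a b x * lor b c y = dgr a c (\<lambda>j. if Suc j < b then x (Suc j) * y j else 0)"
  "lor a b x * upr b c y = dgr a c (\<lambda>j. if 0 < j \<and> j \<le> b then x (j - 1) * y j else 0)"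
  "upr a b x * upr b c y = upr2 a c (\<lambda>j. if j \<le> b then x (j - 1) * y j else 0)"
  by (rule eq_matI;
      simp add: mult_mat_index[of _ a b _ c] band_index sum_sparse del: index_mult_mat(1) cong: sum.cong_simp;
      auto)+

lemma band_add:
  "dgr a b x + dgr a b y = dgr a b (\<lambda>j. x j + y j)"
  "upr a b x + upr a b y = upr a b (\<lambda>j. x j + y j)"
  "lor a b x + lor a b y = lor a b (\<lambda>j. x j + y j)"
  by (rule eq_matI; simp add: band_index)+

lemma band_smult:
  "c \<cdot>\<^sub>m dgr a b x = dgr a b (\<lambda>j. c * x j)"
  "c \<cdot>\<^sub>m upr a b x = upr a b (\<lambda>j. c * x j)"
  "c \<cdot>\<^sub>m lor a b x = lor a b (\<lambda>j. c * x j)"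
  "c \<cdot>\<^sub>m upr2 a b x = upr2 a b (\<lambda>j. c * x j)"
  by (rule eq_matI; simp add: band_index)+

lemma band_const:
  "1\<^sub>m a = dgr a a (\<lambda>_. 1)" "0\<^sub>m a b = dgr a b (\<lambda>_. 0)" "0\<^sub>m a b = upr a b (\<lambda>_. 0)" "0\<^sub>m a b = lor a b (\<lambda>_. 0)"
  by (rule eq_matI; simp add: band_index)+

lemma band_cong:
  "(\<And>j. j < a \<Longrightarrow> j < b \<Longrightarrow> x j = y j) \<Longrightarrow> dgr a b x = dgr a b y"
  "(\<And>j. j < a \<Longrightarrow> Suc j < b \<Longrightarrow> x (Suc j) = y (Suc j)) \<Longrightarrow> upr a b x = upr a b y"
  "(\<And>j. Suc j < a \<Longrightarrow> j < b \<Longrightarrow> x j = y j) \<Longrightarrow> lor a b x = lor a b y"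
  "(\<And>j. j < a \<Longrightarrow> Suc (Suc j) < b \<Longrightarrow> x (Suc (Suc j)) = y (Suc (Suc j))) \<Longrightarrow> upr2 a b x = upr2 a b y"
  by (rule eq_matI; auto simp: band_index)+

lemma dgr_pow: "dgr a a x ^\<^sub>m k = dgr a a (\<lambda>j. x j ^ k)"
  by (induction k) (auto simp: band_const band_mult intro!: band_cong)

section \<open>Splitting a tensor product with a two-dimensional module\<close>

definition mat22 :: "complex \<Rightarrow> complex \<Rightarrow> complex \<Rightarrow> complex \<Rightarrow> complex mat" where
  "mat22 a b c d = mat 2 2 (\<lambda>(i, j). if i = 0 then (if j = 0 then a else b) else (if j = 0 then c else d))"

text \<open>Position 2i + k belongs to v_i \<otimes> w_k, so the two blocks are interleaved:
  \<open>stack A B\<close> sends x to Ax \<otimes> w_0 + Bx \<otimes> w_1, and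
  \<open>side A B\<close> acts on v \<otimes> w_0 by A and on v \<otimes> w_1 by B.\<close>

definition stack :: "complex mat \<Rightarrow> complex mat \<Rightarrow> complex mat" where
  "stack A B = mat (dim_row A * 2) (dim_col A) (\<lambda>(i, j). if i mod 2 = 0 then A $$ (i div 2, j) else B $$ (i div 2, j))"

definition side :: "complex mat \<Rightarrow> complex mat \<Rightarrow> complex mat" where
  "side A B = mat (dim_row A) (dim_col A * 2) (\<lambda>(i, j). if j mod 2 = 0 then A $$ (i, j div 2) else B $$ (i, j div 2))"

lemma stack_side_carrier:
  "A \<in> carrier_mat n m \<Longrightarrow> stack A B \<in> carrier_mat (n * 2) m"
  "A \<in> carrier_mat n m \<Longrightarrow> side A B \<in> carrier_mat n (m * 2)"
  by (auto simp: stack_def side_def)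

lemma mat22_carrier [simp]: "mat22 a b c d \<in> carrier_mat 2 2"
  by (simp add: mat22_def)

lemma sum_mod_two: "(\<Sum>l<n * 2. f (l div 2) (l mod 2)) = (\<Sum>x<n. f x 0 + f x (1::nat) :: complex)"
  unfolding sum_div_mod by (simp add: numeral_2_eq_2)

text \<open>Block multiplication: the 2 by 2 factor mixes the two interleaved blocks while U acts
  inside each of them.\<close>

lemma kron_mat22_stack:
  assumes "U \<in> carrier_mat n n" "A \<in> carrier_mat n m" "B \<in> carrier_mat n m"
  shows "kron U (mat22 a b c d) * stack A B = stack (a \<cdot>\<^sub>m (U * A) + b \<cdot>\<^sub>m (U * B)) (c \<cdot>\<^sub>m (U * A) + d \<cdot>\<^sub>m (U * B))"
proof (rule eq_matI)
  fix i j assume "i < dim_row (stack (a \<cdot>\<^sub>m (U * A) + b \<cdot>\<^sub>m (U * B)) (c \<cdot>\<^sub>m (U * A) + d \<cdot>\<^sub>m (U * B)))"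
    "j < dim_col (stack (a \<cdot>\<^sub>m (U * A) + b \<cdot>\<^sub>m (U * B)) (c \<cdot>\<^sub>m (U * A) + d \<cdot>\<^sub>m (U * B)))"
  then have ij: "i < n * 2" "j < m" "i div 2 < n" using assms by (auto simp: stack_def)
  let ?M = "\<lambda>p q. mat22 a b c d $$ (p, q)"
  have "(kron U (mat22 a b c d) * stack A B) $$ (i, j) =
      (\<Sum>l<n * 2. kron U (mat22 a b c d) $$ (i, l) * stack A B $$ (l, j))"
    using assms ij by (intro mult_mat_index) (auto simp: stack_side_carrier)
  also have "\<dots> = (\<Sum>l<n * 2. (U $$ (i div 2, l div 2) * ?M (i mod 2) (l mod 2)) *
      (if l mod 2 = 0 then A $$ (l div 2, j) else B $$ (l div 2, j)))"
    using assms ij by (intro sum.cong) (auto simp: kron_index[of _ n n _ 2 2] stack_def)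
  also have "\<dots> = (\<Sum>x<n. U $$ (i div 2, x) * ?M (i mod 2) 0 * A $$ (x, j) + U $$ (i div 2, x) * ?M (i mod 2) 1 * B $$ (x, j))"
    by (subst sum_mod_two[where f="\<lambda>x y. (U $$ (i div 2, x) * ?M (i mod 2) y) * (if y = 0 then A $$ (x, j) else B $$ (x, j))"]) simp
  also have "\<dots> = ?M (i mod 2) 0 * (U * A) $$ (i div 2, j) + ?M (i mod 2) 1 * (U * B) $$ (i div 2, j)"
    using assms ij
    by (simp add: mult_mat_index[of _ n n _ m] sum.distrib sum_distrib_left mult_ac del: index_mult_mat(1))
  also have "\<dots> = stack (a \<cdot>\<^sub>m (U * A) + b \<cdot>\<^sub>m (U * B)) (c \<cdot>\<^sub>m (U * A) + d \<cdot>\<^sub>m (U * B)) $$ (i, j)"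
    using assms ij by (simp add: stack_def mat22_def del: index_mult_mat(1))
  finally show "(kron U (mat22 a b c d) * stack A B) $$ (i, j) =
    stack (a \<cdot>\<^sub>m (U * A) + b \<cdot>\<^sub>m (U * B)) (c \<cdot>\<^sub>m (U * A) + d \<cdot>\<^sub>m (U * B)) $$ (i, j)" .
qed (use assms in \<open>auto simp: stack_def mat22_def\<close>)

lemma side_kron_mat22:
  assumes "U \<in> carrier_mat n n" "A \<in> carrier_mat m n" "B \<in> carrier_mat m n"
  shows "side A B * kron U (mat22 a b c d) = side (a \<cdot>\<^sub>m (A * U) + c \<cdot>\<^sub>m (B * U)) (b \<cdot>\<^sub>m (A * U) + d \<cdot>\<^sub>m (B * U))"
proof (rule eq_matI)
  fix i j assume "i < dim_row (side (a \<cdot>\<^sub>m (A * U) + c \<cdot>\<^sub>m (B * U)) (b \<cdot>\<^sub>m (A * U) + d \<cdot>\<^sub>m (B * U)))"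
    "j < dim_col (side (a \<cdot>\<^sub>m (A * U) + c \<cdot>\<^sub>m (B * U)) (b \<cdot>\<^sub>m (A * U) + d \<cdot>\<^sub>m (B * U)))"
  then have ij: "i < m" "j < n * 2" "j div 2 < n" using assms by (auto simp: side_def)
  let ?M = "\<lambda>p q. mat22 a b c d $$ (p, q)"
  have "(side A B * kron U (mat22 a b c d)) $$ (i, j) =
      (\<Sum>l<n * 2. side A B $$ (i, l) * kron U (mat22 a b c d) $$ (l, j))"
    using assms ij by (intro mult_mat_index) (auto simp: stack_side_carrier)
  also have "\<dots> = (\<Sum>l<n * 2. (if l mod 2 = 0 then A $$ (i, l div 2) else B $$ (i, l div 2)) *
      (U $$ (l div 2, j div 2) * ?M (l mod 2) (j mod 2)))"
    using assms ij by (intro sum.cong) (auto simp: kron_index[of _ n n _ 2 2] side_def)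
  also have "\<dots> = (\<Sum>x<n. A $$ (i, x) * (U $$ (x, j div 2) * ?M 0 (j mod 2)) + B $$ (i, x) * (U $$ (x, j div 2) * ?M 1 (j mod 2)))"
    by (subst sum_mod_two[where f="\<lambda>x y. (if y = 0 then A $$ (i, x) else B $$ (i, x)) * (U $$ (x, j div 2) * ?M y (j mod 2))"]) simp
  also have "\<dots> = ?M 0 (j mod 2) * (A * U) $$ (i, j div 2) + ?M 1 (j mod 2) * (B * U) $$ (i, j div 2)"
    using assms ij
    by (simp add: mult_mat_index[of _ m n _ n] sum.distrib sum_distrib_left mult_ac del: index_mult_mat(1))
  also have "\<dots> = side (a \<cdot>\<^sub>m (A * U) + c \<cdot>\<^sub>m (B * U)) (b \<cdot>\<^sub>m (A * U) + d \<cdot>\<^sub>m (B * U)) $$ (i, j)"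
    using assms ij by (simp add: side_def mat22_def del: index_mult_mat(1))
  finally show "(side A B * kron U (mat22 a b c d)) $$ (i, j) =
    side (a \<cdot>\<^sub>m (A * U) + c \<cdot>\<^sub>m (B * U)) (b \<cdot>\<^sub>m (A * U) + d \<cdot>\<^sub>m (B * U)) $$ (i, j)" .
qed (use assms in \<open>auto simp: side_def mat22_def\<close>)

lemma stack_mult:
  assumes "A \<in> carrier_mat n m" "B \<in> carrier_mat n m" "L \<in> carrier_mat m k"
  shows "stack A B * L = stack (A * L) (B * L)"
proof (rule eq_matI)
  fix i j assume "i < dim_row (stack (A * L) (B * L))" "j < dim_col (stack (A * L) (B * L))"
  then have ij: "i < n * 2" "j < k" "i div 2 < n" using assms by (auto simp: stack_def)
  then show "(stack A B * L) $$ (i, j) = stack (A * L) (B * L) $$ (i, j)"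
    using assms
    by (simp add: mult_mat_index[of _ "n * 2" m _ k] stack_side_carrier del: index_mult_mat(1))
       (simp add: stack_def mult_mat_index[of _ n m _ k] del: index_mult_mat(1))
qed (use assms in \<open>auto simp: stack_def\<close>)

lemma mult_side:
  assumes "A \<in> carrier_mat n m" "B \<in> carrier_mat n m" "L \<in> carrier_mat k n"
  shows "L * side A B = side (L * A) (L * B)"
proof (rule eq_matI)
  fix i j assume "i < dim_row (side (L * A) (L * B))" "j < dim_col (side (L * A) (L * B))"
  then have ij: "i < k" "j < m * 2" "j div 2 < m" using assms by (auto simp: side_def)
  then show "(L * side A B) $$ (i, j) = side (L * A) (L * B) $$ (i, j)"
    using assms
    by (simp add: mult_mat_index[of _ k n _ "m * 2"] stack_side_carrier del: index_mult_mat(1))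
       (simp add: side_def mult_mat_index[of _ k n _ m] del: index_mult_mat(1))
qed (use assms in \<open>auto simp: side_def\<close>)

lemma stack_add:
  "A \<in> carrier_mat n m \<Longrightarrow> A' \<in> carrier_mat n m \<Longrightarrow> B \<in> carrier_mat n m \<Longrightarrow> B' \<in> carrier_mat n m \<Longrightarrow>
    stack A B + stack A' B' = stack (A + A') (B + B')"
  by (rule eq_matI) (auto simp: stack_def less_mult_imp_div_less)

lemma side_add:
  "A \<in> carrier_mat n m \<Longrightarrow> A' \<in> carrier_mat n m \<Longrightarrow> B \<in> carrier_mat n m \<Longrightarrow> B' \<in> carrier_mat n m \<Longrightarrow>
    side A B + side A' B' = side (A + A') (B + B')"
  by (rule eq_matI) (auto simp: side_def less_mult_imp_div_less)

lemma side_stack_mult: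
  assumes "A \<in> carrier_mat k n" "B \<in> carrier_mat k n" "A' \<in> carrier_mat n m" "B' \<in> carrier_mat n m"
  shows "side A B * stack A' B' = A * A' + B * B'"
proof (rule eq_matI)
  fix i j assume "i < dim_row (A * A' + B * B')" "j < dim_col (A * A' + B * B')"
  then have ij: "i < k" "j < m" using assms by auto
  have "(side A B * stack A' B') $$ (i, j) = (\<Sum>l<n * 2. side A B $$ (i, l) * stack A' B' $$ (l, j))"
    using assms ij by (intro mult_mat_index) (auto simp: stack_side_carrier)
  also have "\<dots> = (\<Sum>l<n * 2. (if l mod 2 = 0 then A $$ (i, l div 2) else B $$ (i, l div 2)) *
      (if l mod 2 = 0 then A' $$ (l div 2, j) else B' $$ (l div 2, j)))"
    using assms ij by (intro sum.cong) (auto simp: side_def stack_def)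
  also have "\<dots> = (\<Sum>x<n. A $$ (i, x) * A' $$ (x, j) + B $$ (i, x) * B' $$ (x, j))"
    by (subst sum_mod_two[where f="\<lambda>x y. (if y = 0 then A $$ (i, x) else B $$ (i, x)) * (if y = 0 then A' $$ (x, j) else B' $$ (x, j))"]) simp
  also have "\<dots> = (A * A' + B * B') $$ (i, j)"
    using assms ij by (simp add: mult_mat_index[of _ k n _ m] sum.distrib del: index_mult_mat(1))
  finally show "(side A B * stack A' B') $$ (i, j) = (A * A' + B * B') $$ (i, j)" .
qed (use assms in \<open>auto simp: side_def stack_def\<close>)

lemma stack_side_mult:
  assumes "A \<in> carrier_mat n k" "B \<in> carrier_mat n k" "A' \<in> carrier_mat k n" "B' \<in> carrier_mat k n"
    and "i < n * 2" "j < n * 2"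
  shows "(stack A B * side A' B') $$ (i, j) =
    ((if i mod 2 = 0 then A else B) * (if j mod 2 = 0 then A' else B')) $$ (i div 2, j div 2)"
proof -
  have d: "i div 2 < n" "j div 2 < n" using assms by auto
  have "(stack A B * side A' B') $$ (i, j) = (\<Sum>l<k. stack A B $$ (i, l) * side A' B' $$ (l, j))"
    using assms by (intro mult_mat_index) (auto simp: stack_side_carrier)
  also have "\<dots> = (\<Sum>l<k. (if i mod 2 = 0 then A else B) $$ (i div 2, l) * (if j mod 2 = 0 then A' else B') $$ (l, j div 2))"
    using assms d by (intro sum.cong) (auto simp: side_def stack_def)
  also have "\<dots> = ((if i mod 2 = 0 then A else B) * (if j mod 2 = 0 then A' else B')) $$ (i div 2, j div 2)"
    using assms d by (intro mult_mat_index[symmetric]) auto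
  finally show ?thesis .
qed

text \<open>The identities of \<open>split_maps\<close>, read block by block, for a middle space
  with a two-dimensional second tensor factor. The section of the quotient map has first block zero:
  vectors of the form v \<otimes> w_1 already reach the whole quotient.\<close>

definition block_split :: "nat \<Rightarrow> nat \<Rightarrow> nat \<Rightarrow> complex mat \<Rightarrow> complex mat \<Rightarrow> complex mat \<Rightarrow> complex mat \<Rightarrow>
    complex mat \<Rightarrow> complex mat \<Rightarrow> complex mat \<Rightarrow> bool" where
  "block_split u n w a0 a1 a0' a1' b0 b1 b1' \<longleftrightarrow>
     a0 \<in> carrier_mat n u \<and> a1 \<in> carrier_mat n u \<and> a0' \<in> carrier_mat u n \<and> a1' \<in> carrier_mat u n \<and>
     b0 \<in> carrier_mat w n \<and> b1 \<in> carrier_mat w n \<and> b1' \<in> carrier_mat n w \<and>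
     a0' * a0 + a1' * a1 = 1\<^sub>m u \<and> b1 * b1' = 1\<^sub>m w \<and> b0 * a0 + b1 * a1 = 0\<^sub>m w u \<and>
     a0 * a0' = 1\<^sub>m n \<and> a0 * a1' = 0\<^sub>m n n \<and> a1 * a0' + b1' * b0 = 0\<^sub>m n n \<and> a1 * a1' + b1' * b1 = 1\<^sub>m n"

lemma block_split_maps:
  assumes "block_split u n w a0 a1 a0' a1' b0 b1 b1'"
  shows "split_maps u (n * 2) w (stack a0 a1) (side a0' a1') (side b0 b1) (stack (0\<^sub>m n w) b1')"
proof -
  have c: "a0 \<in> carrier_mat n u" "a1 \<in> carrier_mat n u" "a0' \<in> carrier_mat u n" "a1' \<in> carrier_mat u n"
     "b0 \<in> carrier_mat w n" "b1 \<in> carrier_mat w n" "b1' \<in> carrier_mat n w" "0\<^sub>m n w \<in> carrier_mat n w"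
    and e: "a0' * a0 + a1' * a1 = 1\<^sub>m u" "b1 * b1' = 1\<^sub>m w" "b0 * a0 + b1 * a1 = 0\<^sub>m w u"
     "a0 * a0' = 1\<^sub>m n" "a0 * a1' = 0\<^sub>m n n" "a1 * a0' + b1' * b0 = 0\<^sub>m n n" "a1 * a1' + b1' * b1 = 1\<^sub>m n"
    using assms by (simp_all add: block_split_def)
  have z: "b0 * 0\<^sub>m n w + b1 * b1' = 1\<^sub>m w" using c e by simp
  have "stack a0 a1 * side a0' a1' + stack (0\<^sub>m n w) b1' * side b0 b1 = 1\<^sub>m (n * 2)"
  proof (rule eq_matI)
    fix i j assume "i < dim_row (1\<^sub>m (n * 2) :: complex mat)" "j < dim_col (1\<^sub>m (n * 2) :: complex mat)"
    then have ij: "i < n * 2" "j < n * 2" "i div 2 < n" "j div 2 < n" by auto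
    \<comment> \<open>The parities of i and j select one of the four blocks of the identity.\<close>
    let ?P = "(if i mod 2 = 0 then a0 else a1) * (if j mod 2 = 0 then a0' else a1') +
        (if i mod 2 = 0 then 0\<^sub>m n w else b1') * (if j mod 2 = 0 then b0 else b1)"
    have "(stack a0 a1 * side a0' a1' + stack (0\<^sub>m n w) b1' * side b0 b1) $$ (i, j) = ?P $$ (i div 2, j div 2)"
    proof -
      have "(stack a0 a1 * side a0' a1' + stack (0\<^sub>m n w) b1' * side b0 b1) $$ (i, j) =
          (stack a0 a1 * side a0' a1') $$ (i, j) + (stack (0\<^sub>m n w) b1' * side b0 b1) $$ (i, j)"
        using c ij by (intro index_add_mat(1)) (simp_all add: stack_def side_def)
      also have "\<dots> = ?P $$ (i div 2, j div 2)"
        unfolding stack_side_mult[OF c(1-4) ij(1,2)] stack_side_mult[OF c(8,7,5,6) ij(1,2)]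
        using c ij by (intro index_add_mat(1)[symmetric]) auto
      finally show ?thesis .
    qed
    also have "?P = (if i mod 2 = j mod 2 then 1\<^sub>m n else 0\<^sub>m n n)"
      using c e by (auto simp: left_mult_zero_mat[of _ w n])
    also have "\<dots> $$ (i div 2, j div 2) = (1\<^sub>m (n * 2) :: complex mat) $$ (i, j)"
      using ij by (auto simp del: mod2_eq_if) (metis div_mult_mod_eq)
    finally show "(stack a0 a1 * side a0' a1' + stack (0\<^sub>m n w) b1' * side b0 b1) $$ (i, j) = (1\<^sub>m (n * 2) :: complex mat) $$ (i, j)" .
  qed (use c in \<open>auto simp: stack_def side_def\<close>)
  then show ?thesis
    unfolding split_maps_def side_stack_mult[OF c(3,4,1,2)] side_stack_mult[OF c(5,6,8,7)] side_stack_mult[OF c(5,6,1,2)] e z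
    using c by (simp add: stack_side_carrier)
qed

text \<open>An involution D cancels in every product of two of the maps, just as an identity matrix
  would. The freedom to choose D different from 1 serves to correct signs.\<close>

lemma block_split_kron:
  assumes "block_split u n w a0 a1 a0' a1' b0 b1 b1'" and D: "D \<in> carrier_mat k k" "D * D = 1\<^sub>m k"
  shows "block_split (u * k) (n * k) (w * k) (kron a0 D) (kron a1 D) (kron a0' D) (kron a1' D) (kron b0 D) (kron b1 D) (kron b1' D)"
    and "block_split (k * u) (k * n) (k * w) (kron D a0) (kron D a1) (kron D a0') (kron D a1') (kron D b0) (kron D b1) (kron D b1')"
proof -
  have c: "a0 \<in> carrier_mat n u" "a1 \<in> carrier_mat n u" "a0' \<in> carrier_mat u n" "a1' \<in> carrier_mat u n"
     "b0 \<in> carrier_mat w n" "b1 \<in> carrier_mat w n" "b1' \<in> carrier_mat n w"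
    and e: "a0' * a0 + a1' * a1 = 1\<^sub>m u" "b1 * b1' = 1\<^sub>m w" "b0 * a0 + b1 * a1 = 0\<^sub>m w u"
     "a0 * a0' = 1\<^sub>m n" "a0 * a1' = 0\<^sub>m n n" "a1 * a0' + b1' * b0 = 0\<^sub>m n n" "a1 * a1' + b1' * b1 = 1\<^sub>m n"
    using assms by (simp_all add: block_split_def)
  have m: "kron A D * kron B D = kron (A * B) (1\<^sub>m k)" "kron D A * kron D B = kron (1\<^sub>m k) (A * B)"
    if "dim_col A = dim_row B" for A B
  proof -
    have A: "A \<in> carrier_mat (dim_row A) (dim_row B)" using that by (intro carrier_matI) simp_all
    show "kron A D * kron B D = kron (A * B) (1\<^sub>m k)" "kron D A * kron D B = kron (1\<^sub>m k) (A * B)"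
      by (simp_all only: kron_mult[OF A D(1) carrier_mat_triv D(1)] kron_mult[OF D(1) A D(1) carrier_mat_triv] D(2))
  qed
  have al: "kron A (1\<^sub>m k) + kron B (1\<^sub>m k) = kron (A + B) (1\<^sub>m k)" "kron (1\<^sub>m k) A + kron (1\<^sub>m k) B = kron (1\<^sub>m k) (A + B)"
    if "dim_row A = dim_row B" "dim_col A = dim_col B" for A B
  proof -
    have A: "A \<in> carrier_mat (dim_row B) (dim_col B)" using that by (intro carrier_matI) simp_all
    show "kron A (1\<^sub>m k) + kron B (1\<^sub>m k) = kron (A + B) (1\<^sub>m k)" "kron (1\<^sub>m k) A + kron (1\<^sub>m k) B = kron (1\<^sub>m k) (A + B)"
      by (simp_all only: kron_add_left[OF A carrier_mat_triv one_carrier_mat] kron_add_right[OF one_carrier_mat A carrier_mat_triv])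
  qed
  show "block_split (u * k) (n * k) (w * k) (kron a0 D) (kron a1 D) (kron a0' D) (kron a1' D) (kron b0 D) (kron b1 D) (kron b1' D)"
    unfolding block_split_def using c D
    by (simp add: m al e kron_one kron_zero_left)
  show "block_split (k * u) (k * n) (k * w) (kron D a0) (kron D a1) (kron D a0') (kron D a1') (kron D b0) (kron D b1) (kron D b1')"
    unfolding block_split_def using c D
    by (simp add: m al e kron_one kron_zero_right)
qed

section \<open>Quantum integers\<close>

lemma qnum_eq: "qnum Q n = (Q ^ n - 1 / Q ^ n) / (Q - inverse Q)"
  by (simp add: qnum_def power_int_minus inverse_eq_divide)

lemma qnum_0 [simp]: "qnum Q 0 = 0"
  by (simp add: qnum_eq)

lemma qnum_1: "Q - inverse Q \<noteq> 0 \<Longrightarrow> qnum Q (Suc 0) = 1"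
  by (simp add: qnum_eq inverse_eq_divide)

lemma qnum_Suc:
  assumes "Q \<noteq> 0" "Q - inverse Q \<noteq> 0"
  shows "Q * qnum Q (Suc k) = qnum Q k + Q ^ Suc k" "qnum Q (Suc k) = Q * qnum Q k + 1 / Q ^ k"
proof -
  have "Q * (Q ^ Suc k - 1 / Q ^ Suc k) = (Q ^ k - 1 / Q ^ k) + Q ^ Suc k * (Q - inverse Q)"
    using assms(1) by (simp add: field_simps)
  then show "Q * qnum Q (Suc k) = qnum Q k + Q ^ Suc k"
    using assms unfolding qnum_eq by (simp add: add_divide_distrib)
  have "Q ^ Suc k - 1 / Q ^ Suc k = Q * (Q ^ k - 1 / Q ^ k) + 1 / Q ^ k * (Q - inverse Q)"
    using assms(1) by (simp add: field_simps)
  then show "qnum Q (Suc k) = Q * qnum Q k + 1 / Q ^ k"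
    using assms unfolding qnum_eq by (simp add: add_divide_distrib)
qed

lemma Qpar_sq: "a \<ge> 1 \<Longrightarrow> Qpar a b ^ a * Qpar a b ^ a = 1"
  using Qpar_pow[of a b] by (simp add: power2_eq_square power_mult_distrib)

lemma Qpar_diff:
  assumes "a \<ge> 2" "coprime a b" shows "Qpar a b - inverse (Qpar a b) \<noteq> 0"
proof
  assume "Qpar a b - inverse (Qpar a b) = 0"
  then have "Qpar a b * Qpar a b = 1" by (simp add: field_simps)
  then have "(Qpar a b)\<^sup>2 ^ 1 = 1" by (simp add: power2_eq_square)
  then show False using Qpar_primitive[of a b 1] assms by simp
qed

text \<open>[n] vanishes exactly when Q^(2n) = 1, and Q^2 has order a.\<close>

lemma qnum_eq_0_iff:
  assumes "a \<ge> 2" "coprime a b" "0 < n" "n \<le> a" shows "qnum (Qpar a b) n = 0 \<longleftrightarrow> n = a"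
proof -
  let ?Q = "Qpar a b"
  have "qnum ?Q n = 0 \<longleftrightarrow> ?Q ^ n * ?Q ^ n = 1"
    using Qpar_diff[OF assms(1,2)] by (simp add: qnum_eq field_simps)
  also have "\<dots> \<longleftrightarrow> ?Q\<^sup>2 ^ n = 1" by (simp add: power2_eq_square power_mult_distrib)
  also have "\<dots> \<longleftrightarrow> n = a"
    using Qpar_primitive[of a b n] Qpar_pow[of a b] assms by (cases "n = a") auto
  finally show ?thesis .
qed

text \<open>Q^a is its own inverse, so [a - n] = (Q^a Q^(-n) - Q^a Q^n) / (Q - Q^(-1)).\<close>

lemma qnum_reflect:
  assumes "a \<ge> 1" "n \<le> a"
  shows "qnum (Qpar a b) (a - n) = - (Qpar a b ^ a) * qnum (Qpar a b) n"
proof -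
  let ?Q = "Qpar a b"
  have s: "?Q ^ a * ?Q ^ a = 1" by (rule Qpar_sq[OF assms(1)])
  have "?Q ^ a = ?Q ^ (a - n) * ?Q ^ n" using assms by (simp flip: power_add)
  then have e: "?Q ^ (a - n) = ?Q ^ a / ?Q ^ n" by simp
  have inv: "1 / ?Q ^ (a - n) = ?Q ^ a * ?Q ^ n" unfolding e using s by (simp add: field_simps)
  have "?Q ^ (a - n) - 1 / ?Q ^ (a - n) = - (?Q ^ a) * (?Q ^ n - 1 / ?Q ^ n)"
    unfolding inv unfolding e by (simp add: algebra_simps)
  then show ?thesis unfolding qnum_eq by (simp only: times_divide_eq_right)
qed

section \<open>The matrices of the irreducible modules\<close>

text \<open>The weight q^(r-1-2j), written as a quotient of natural powers so that both indices can
  be shifted by plain algebra.\<close>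

definition wK :: "complex \<Rightarrow> nat \<Rightarrow> nat \<Rightarrow> complex" where
  "wK q r j = q ^ r / q ^ Suc (2 * j)"

text \<open>For j >= r the truncated difference is 0 and so is the value; the boundary cases of the
  band identities rely on this.\<close>

definition wE :: "complex \<Rightarrow> nat \<Rightarrow> nat \<Rightarrow> complex" where
  "wE Q r j = qnum Q j * qnum Q (r - j)"

text \<open>The formulas defining $\mathsf X^\alpha_{r,r'}$, truncated to \<open>n < d\<close> and \<open>n' < d'\<close>.
  Besides the irreducible modules (\<open>d = r\<close>, \<open>d' = r'\<close>) they give the baby Verma modules
  that occur as factors of $\mathsf X^\alpha_{p_+,r'} \otimes \mathsf X^+_{2,1}$ (\<open>d = p\<close>, \<open>r = p \<plusminus> 1\<close>).
  Writing the signs as $(-1)^{r+1}$ keeps them alternating down to \<open>r = 0\<close>.\<close>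

definition band_mats :: "nat \<Rightarrow> nat \<Rightarrow> int \<Rightarrow> nat \<Rightarrow> nat \<Rightarrow> nat \<Rightarrow> nat \<Rightarrow> gen \<Rightarrow> complex mat" where
  "band_mats p p' \<alpha> r d r' d' g = (case g of
     KK \<Rightarrow> kron (dgr d d (\<lambda>j. of_int \<alpha> * wK (qroot p) r j)) (dgr d' d' (wK (qroot p') r'))
   | EP \<Rightarrow> kron (upr d d (\<lambda>j. of_int (\<alpha> ^ p') * (- 1) ^ Suc r' * wE (Qpar p p') r j)) (1\<^sub>m d')
   | FP \<Rightarrow> kron (lor d d (\<lambda>_. 1)) (1\<^sub>m d')
   | EM \<Rightarrow> kron (1\<^sub>m d) (upr d' d' (\<lambda>j. of_int (\<alpha> ^ p) * (- 1) ^ Suc r * wE (Qpar p' p) r' j))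
   | FM \<Rightarrow> kron (1\<^sub>m d) (lor d' d' (\<lambda>_. 1)))"

lemma band_mats_carrier: "band_mats p p' \<alpha> r d r' d' g \<in> carrier_mat (d * d') (d * d')"
  by (cases g) (simp_all add: band_mats_def)

lemma band_mats_dims [simp]:
  "dim_row (band_mats p p' \<alpha> r d r' d' g) = d * d'" "dim_col (band_mats p p' \<alpha> r d r' d' g) = d * d'"
  using band_mats_carrier[of p p' \<alpha> r d r' d' g] by auto

lemma irr_module_eq: "irr_module p p' \<alpha> r r' = mk_module (r * r') (irr_mat p p' \<alpha> r r')"
  by (simp add: irr_module_def mk_module_def lin_def word_mat_def fun_eq_iff)

lemma wK_powi: "q \<noteq> 0 \<Longrightarrow> q powi (int r - 1 - 2 * int j) = wK q r j"
proof -
  assume q: "q \<noteq> 0"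
  have "q powi (int r - 1 - 2 * int j) = q powi (int r - int (Suc (2 * j)))"
    by (intro arg_cong[of _ _ "\<lambda>k. q powi k"]) simp
  also have "\<dots> = q powi int r / q powi int (Suc (2 * j))" by (rule power_int_diff) (use q in auto)
  finally show ?thesis by (simp only: power_int_of_nat wK_def)
qed

lemma irr_mat_eq:
  assumes "r \<ge> 1" "r' \<ge> 1"
  shows "irr_mat p p' \<alpha> r r' = band_mats p p' \<alpha> r r r' r'"
proof (rule ext, rule eq_matI)
  fix g i j assume "i < dim_row (band_mats p p' \<alpha> r r r' r' g)" "j < dim_col (band_mats p p' \<alpha> r r r' r' g)"
  then have ij: "i < r * r'" "j < r * r'" using band_mats_carrier[of p p' \<alpha> r r r' r' g] by auto
  then have d: "i div r' < r" "j div r' < r" "i mod r' < r'" "j mod r' < r'"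
    using assms by (auto simp: less_mult_imp_div_less)
  have s: "(- 1 :: complex) ^ (k - Suc 0) = - ((- 1) ^ k)" if "k \<ge> 1" for k
    using that by (cases k) auto
  show "irr_mat p p' \<alpha> r r' g $$ (i, j) = band_mats p p' \<alpha> r r r' r' g $$ (i, j)"
    using ij d unfolding irr_mat_def irr_coeff_def band_mats_def
    by (cases g) (simp_all add: kron_index[of _ r r _ r' r'] band_index wK_powi wE_def s[OF assms(1)] s[OF assms(2)])
qed (simp_all add: irr_mat_def)

section \<open>Modules of dimension one and two\<close>

lemma irr_mat_21:
  assumes "p \<ge> 2" "coprime p p'"
  shows "irr_mat p p' 1 2 1 KK = mat22 (qroot p) 0 0 (1 / qroot p)" "irr_mat p p' 1 2 1 EP = mat22 0 1 0 0"
    "irr_mat p p' 1 2 1 FP = mat22 0 0 1 0" "irr_mat p p' 1 2 1 EM = mat22 0 0 0 0" "irr_mat p p' 1 2 1 FM = mat22 0 0 0 0"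
proof -
  have q: "qnum (Qpar p p') (Suc 0) = 1" using qnum_1 Qpar_diff[OF assms] by blast
  have lt: "i < 2 \<longleftrightarrow> i = 0 \<or> i = Suc 0" for i :: nat by auto
  show "irr_mat p p' 1 2 1 KK = mat22 (qroot p) 0 0 (1 / qroot p)" "irr_mat p p' 1 2 1 EP = mat22 0 1 0 0"
    "irr_mat p p' 1 2 1 FP = mat22 0 0 1 0" "irr_mat p p' 1 2 1 EM = mat22 0 0 0 0" "irr_mat p p' 1 2 1 FM = mat22 0 0 0 0"
    by (rule eq_matI; auto simp: irr_mat_def irr_coeff_def mat22_def lt q power_int_minus inverse_eq_divide)+
qed

lemma irr_mat_12:
  assumes "p' \<ge> 2" "coprime p p'"
  shows "irr_mat p p' 1 1 2 KK = mat22 (qroot p') 0 0 (1 / qroot p')" "irr_mat p p' 1 1 2 EM = mat22 0 1 0 0"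
    "irr_mat p p' 1 1 2 FM = mat22 0 0 1 0" "irr_mat p p' 1 1 2 EP = mat22 0 0 0 0" "irr_mat p p' 1 1 2 FP = mat22 0 0 0 0"
proof -
  have q: "qnum (Qpar p' p) (Suc 0) = 1" using qnum_1 Qpar_diff[of p' p] assms by (simp add: coprime_commute)
  have lt: "i < 2 \<longleftrightarrow> i = 0 \<or> i = Suc 0" for i :: nat by auto
  show "irr_mat p p' 1 1 2 KK = mat22 (qroot p') 0 0 (1 / qroot p')" "irr_mat p p' 1 1 2 EM = mat22 0 1 0 0"
    "irr_mat p p' 1 1 2 FM = mat22 0 0 1 0" "irr_mat p p' 1 1 2 EP = mat22 0 0 0 0" "irr_mat p p' 1 1 2 FP = mat22 0 0 0 0"
    by (rule eq_matI; auto simp: irr_mat_def irr_coeff_def mat22_def lt q power_int_minus inverse_eq_divide)+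
qed

lemma mat22_one: "1\<^sub>m 2 = mat22 1 0 0 1"
  by (rule eq_matI) (auto simp: mat22_def)

lemma mat22_mult: "mat22 a b c d * mat22 a' b' c' d' = mat22 (a * a' + b * c') (a * b' + b * d') (c * a' + d * c') (c * b' + d * d')"
proof (rule eq_matI)
  fix i j assume "i < dim_row (mat22 (a * a' + b * c') (a * b' + b * d') (c * a' + d * c') (c * b' + d * d'))"
    "j < dim_col (mat22 (a * a' + b * c') (a * b' + b * d') (c * a' + d * c') (c * b' + d * d'))"
  then have ij: "i < 2" "j < 2" by (simp_all add: mat22_def)
  have "(mat22 a b c d * mat22 a' b' c' d') $$ (i, j) = (\<Sum>k<2. mat22 a b c d $$ (i, k) * mat22 a' b' c' d' $$ (k, j))"
    using ij by (intro mult_mat_index) auto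
  also have "\<dots> = mat22 (a * a' + b * c') (a * b' + b * d') (c * a' + d * c') (c * b' + d * d') $$ (i, j)"
    using ij by (simp add: numeral_2_eq_2) (auto simp: mat22_def)
  finally show "(mat22 a b c d * mat22 a' b' c' d') $$ (i, j) =
    mat22 (a * a' + b * c') (a * b' + b * d') (c * a' + d * c') (c * b' + d * d') $$ (i, j)" .
qed (simp_all add: mat22_def)

lemma mat22_pow: "mat22 a 0 0 d ^\<^sub>m k = mat22 (a ^ k) 0 0 (d ^ k)"
  by (induction k) (simp_all add: mat22_mult mat22_one carrier_matD[OF mat22_carrier] mult.commute)

lemma mat22_smult: "x \<cdot>\<^sub>m mat22 a b c d = mat22 (x * a) (x * b) (x * c) (x * d)"
  by (rule eq_matI) (auto simp: mat22_def)

lemma mat22_diff: "mat22 a b c d - mat22 a' b' c' d' = mat22 (a - a') (b - b') (c - c') (d - d')"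
  by (rule eq_matI) (auto simp: mat22_def)

lemma mat22_zero: "0\<^sub>m 2 2 = mat22 0 0 0 0"
  by (rule eq_matI) (auto simp: mat22_def)

text \<open>Evaluates the exponents \<open>2 * p * p' - k\<close> that stand for -k.\<close>

lemma pow_complement:
  fixes x :: complex
  assumes "x ^ m = 1" "a \<le> m" shows "x ^ (m - a) = 1 / x ^ a"
proof -
  have "x ^ (m - a) * x ^ a = 1" using assms by (simp flip: power_add)
  then show ?thesis by (metis eq_divide_imp mult_zero_right zero_neq_one)
qed

lemma exponents_le: "(p::nat) \<ge> 1 \<Longrightarrow> p' \<ge> 1 \<Longrightarrow> p' \<le> 2 * p * p' \<and> p \<le> 2 * p * p'"
  by auto

lemma qroot_full: "p \<ge> 1 \<Longrightarrow> p' \<ge> 1 \<Longrightarrow> qroot p ^ (2 * p * p') = 1 \<and> qroot p' ^ (2 * p * p') = 1"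
  using qroot_pow_double[of p p'] qroot_pow_double[of p' p] by (simp add: mult_ac)

text \<open>Here K^(p_-) = diag(Q, 1/Q) and K^(p_+) = -1, so the plus bracket is diag(1, -1) and the
  minus bracket is 0. The squares of e_+ and f_+ vanish, which gives nilpotency of order p because p
  \<ge> 2.\<close>

lemma X21_in_modules:
  assumes "p \<ge> 2" "p' \<ge> 1" "coprime p p'" shows "irr_module p p' 1 2 1 \<in> modules p p'"
proof -
  let ?q = "qroot p" and ?Q = "Qpar p p'"
  have p: "p \<ge> 1" using assms by simp
  define M where "M = irr_mat p p' 1 2 1"
  note m = irr_mat_21[OF assms(1,3), folded M_def] and le = exponents_le[OF p assms(2)] and full = qroot_full[OF p assms(2)]
  have E: "mat22 0 1 0 0 ^\<^sub>m p = mat22 0 0 0 0" "mat22 0 0 1 0 ^\<^sub>m p = mat22 0 0 0 0"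
  proof -
    obtain k where "p = Suc (Suc k)" using assms(1) by (metis add_2_eq_Suc le_Suc_ex)
    moreover have "mat22 0 1 0 0 * mat22 0 1 0 0 = mat22 0 0 0 0" "mat22 0 0 1 0 * mat22 0 0 1 0 = mat22 0 0 0 0"
      by (simp_all add: mat22_mult)
    ultimately show "mat22 0 1 0 0 ^\<^sub>m p = mat22 0 0 0 0" "mat22 0 0 1 0 ^\<^sub>m p = mat22 0 0 0 0"
      by (simp_all add: mat_assoc carrier_matD[OF mat22_carrier] flip: mat22_zero)
  qed
  have Z: "(0::complex) ^ p' = 0" using assms(2) by simp
  have Q: "?q ^ p' = ?Q" by (simp add: Qpar_def)
  have l: "?q ^ p = - 1" by (rule qroot_pow_self[OF p])
  have pc: "?q ^ (2 * p * p' - p') = 1 / ?Q" "?q ^ (2 * p * p' - p) = - 1"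
    using pow_complement[of ?q "2 * p * p'" p'] pow_complement[of ?q "2 * p * p'" p] full le by (simp_all add: Q l)
  have D: "?Q - 1 / ?Q \<noteq> 0" using Qpar_diff[OF assms(1,3)] by (simp add: inverse_eq_divide)
  have D': "(1 / ?Q - ?Q) / (?Q - 1 / ?Q) = - 1" using D by (simp add: divide_eq_eq)
  have "mod_rels p p' 2 M"
    unfolding mod_rels_def
  proof (intro conjI allI impI)
    fix g show "M g \<in> carrier_mat 2 2" by (simp add: M_def irr_mat_def)
  next
    show "M EP * M FP - M FP * M EP =
      (1 / (?Q - inverse ?Q)) \<cdot>\<^sub>m (M KK ^\<^sub>m p' - M KK ^\<^sub>m (2 * p * p' - p'))"
      unfolding m mat22_pow mat22_mult mat22_diff mat22_smult power_divide power_one pc Q inverse_eq_divide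
      using D by (simp add: D')
  qed (use full l in \<open>simp_all add: m mat22_pow mat22_mult mat22_diff mat22_smult E Z mat22_zero mat22_one power_divide pc Q
      power2_eq_square inverse_eq_divide\<close>)
  then show ?thesis unfolding irr_module_eq using mk_module_in_modules[OF p assms(2), of 2] by (simp add: M_def)
qed

lemma X12_in_modules:
  assumes "p \<ge> 1" "p' \<ge> 2" "coprime p p'" shows "irr_module p p' 1 1 2 \<in> modules p p'"
proof -
  let ?q = "qroot p'" and ?Q = "Qpar p' p"
  have p: "p' \<ge> 1" using assms by simp
  define M where "M = irr_mat p p' 1 1 2"
  note m = irr_mat_12[OF assms(2,3), folded M_def] and le = exponents_le[OF assms(1) p] and full = qroot_full[OF assms(1) p]
  have E: "mat22 0 1 0 0 ^\<^sub>m p' = mat22 0 0 0 0" "mat22 0 0 1 0 ^\<^sub>m p' = mat22 0 0 0 0"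
  proof -
    obtain k where "p' = Suc (Suc k)" using assms(2) by (metis add_2_eq_Suc le_Suc_ex)
    moreover have "mat22 0 1 0 0 * mat22 0 1 0 0 = mat22 0 0 0 0" "mat22 0 0 1 0 * mat22 0 0 1 0 = mat22 0 0 0 0"
      by (simp_all add: mat22_mult)
    ultimately show "mat22 0 1 0 0 ^\<^sub>m p' = mat22 0 0 0 0" "mat22 0 0 1 0 ^\<^sub>m p' = mat22 0 0 0 0"
      by (simp_all add: mat_assoc carrier_matD[OF mat22_carrier] flip: mat22_zero)
  qed
  have Z: "(0::complex) ^ p = 0" using assms(1) by simp
  have Q: "?q ^ p = ?Q" by (simp add: Qpar_def)
  have l: "?q ^ p' = - 1" by (rule qroot_pow_self[OF p])
  have pc: "?q ^ (2 * p * p' - p) = 1 / ?Q" "?q ^ (2 * p * p' - p') = - 1"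
    using pow_complement[of ?q "2 * p * p'" p'] pow_complement[of ?q "2 * p * p'" p] full le by (simp_all add: Q l)
  have D: "?Q - 1 / ?Q \<noteq> 0" using Qpar_diff[of p' p] assms by (simp add: inverse_eq_divide coprime_commute)
  have D': "(1 / ?Q - ?Q) / (?Q - 1 / ?Q) = - 1" using D by (simp add: divide_eq_eq)
  have "mod_rels p p' 2 M"
    unfolding mod_rels_def
  proof (intro conjI allI impI)
    fix g show "M g \<in> carrier_mat 2 2" by (simp add: M_def irr_mat_def)
  next
    show "M EM * M FM - M FM * M EM =
      (1 / (?Q - inverse ?Q)) \<cdot>\<^sub>m (M KK ^\<^sub>m p - M KK ^\<^sub>m (2 * p * p' - p))"
      unfolding m mat22_pow mat22_mult mat22_diff mat22_smult power_divide power_one pc Q inverse_eq_divide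
      using D by (simp add: D')
  qed (use full l in \<open>simp_all add: m mat22_pow mat22_mult mat22_diff mat22_smult E Z mat22_zero mat22_one power_divide pc Q
      power2_eq_square inverse_eq_divide\<close>)
  then show ?thesis unfolding irr_module_eq using mk_module_in_modules[OF assms(1) p, of 2] by (simp add: M_def)
qed

text \<open>K acts by the sign \<alpha>, so K^k = K^(-k), and the right-hand sides of both bracket
  relations vanish together with all e and f.\<close>

lemma one_dim_in_modules:
  assumes p: "p \<ge> 1" "p' \<ge> 1" and a: "\<alpha> \<in> {1, -1}"
  shows "irr_module p p' \<alpha> 1 1 \<in> modules p p'"
    "irr_mat p p' \<alpha> 1 1 KK = of_int \<alpha> \<cdot>\<^sub>m 1\<^sub>m 1" "g \<noteq> KK \<Longrightarrow> irr_mat p p' \<alpha> 1 1 g = 0\<^sub>m 1 1"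
proof -
  show K: "irr_mat p p' \<alpha> 1 1 KK = of_int \<alpha> \<cdot>\<^sub>m 1\<^sub>m 1"
    by (rule eq_matI) (auto simp: irr_mat_def irr_coeff_def)
  show Z: "irr_mat p p' \<alpha> 1 1 g = 0\<^sub>m 1 1" if "g \<noteq> KK" for g
    using that by (cases g; intro eq_matI) (auto simp: irr_mat_def irr_coeff_def)
  have Kp: "irr_mat p p' \<alpha> 1 1 KK ^\<^sub>m k = (of_int \<alpha> ^ k) \<cdot>\<^sub>m 1\<^sub>m 1" for k
  proof (induction k)
    case (Suc k)
    then show ?case unfolding pow_mat.simps K
      by (simp add: mat_smult_left smult_smult_mat mult.commute)
  qed (auto simp: irr_mat_def intro!: eq_matI)
  have zp: "0\<^sub>m 1 1 ^\<^sub>m k = (0\<^sub>m 1 1 :: complex mat)" if "k \<ge> 1" for k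
    using that by (cases k) (auto simp del: One_nat_def)
  have a2: "(of_int \<alpha> :: complex) ^ (2 * p * p') = 1"
    using a by (auto simp: power_mult)
  have sub: "(of_int \<alpha> :: complex) ^ (2 * p * p' - k) = of_int \<alpha> ^ k" if "k \<le> 2 * p * p'" for k
    using pow_complement[OF a2 that] a by (auto simp: minus_one_power_iff)
  note le = exponents_le[OF p]
  define M where "M = irr_mat p p' \<alpha> 1 1"
  have ZM: "M EP = 0\<^sub>m 1 1" "M FP = 0\<^sub>m 1 1" "M EM = 0\<^sub>m 1 1" "M FM = 0\<^sub>m 1 1"
    unfolding M_def by (simp_all add: Z del: One_nat_def)
  have KM: "M KK ^\<^sub>m k = (of_int \<alpha> ^ k) \<cdot>\<^sub>m 1\<^sub>m 1" "M KK = of_int \<alpha> \<cdot>\<^sub>m 1\<^sub>m 1" for k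
    unfolding M_def using Kp K by simp_all
  have s0: "c \<cdot>\<^sub>m 0\<^sub>m 1 1 = 0\<^sub>m 1 1" "0\<^sub>m 1 1 * (c \<cdot>\<^sub>m 1\<^sub>m 1) = 0\<^sub>m 1 1" "(c \<cdot>\<^sub>m 1\<^sub>m 1) * 0\<^sub>m 1 1 = 0\<^sub>m 1 1"
    "0\<^sub>m 1 1 * 0\<^sub>m 1 1 = (0\<^sub>m 1 1 :: complex mat)" "A - A = 0\<^sub>m 1 1" if "A \<in> carrier_mat 1 1" for c :: complex and A :: "complex mat"
    using that by (auto intro!: eq_matI)
  have u: "1 \<cdot>\<^sub>m 1\<^sub>m 1 = (1\<^sub>m 1 :: complex mat)" "x \<cdot>\<^sub>m 1\<^sub>m 1 \<in> carrier_mat 1 1"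
    "0\<^sub>m 1 1 \<in> carrier_mat 1 1" for x :: complex by (auto intro!: eq_matI)
  have MC: "\<forall>g. M g \<in> carrier_mat 1 1" unfolding M_def by (simp add: irr_mat_def)
  have "mod_rels p p' 1 M"
    unfolding mod_rels_def ZM KM(1) unfolding KM(2) a2 u(1) using le p MC
    by (simp add: ZM zp sub s0(5)[OF u(2)] s0(1-4)[OF u(3)] s0(5)[OF u(3)] del: One_nat_def)
  then show "irr_module p p' \<alpha> 1 1 \<in> modules p p'"
    unfolding irr_module_eq using mk_module_in_modules[OF p, of 1] by (simp add: M_def)
qed

section \<open>Splitting maps built from band matrices\<close>

lemma band_zeroI:
  "(\<And>j. j < a \<Longrightarrow> j < b \<Longrightarrow> x j = 0) \<Longrightarrow> dgr a b x = 0\<^sub>m a b"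
  "(\<And>j. j < a \<Longrightarrow> Suc j < b \<Longrightarrow> x (Suc j) = 0) \<Longrightarrow> upr a b x = 0\<^sub>m a b"
  "(\<And>j. Suc j < a \<Longrightarrow> j < b \<Longrightarrow> x j = 0) \<Longrightarrow> lor a b x = 0\<^sub>m a b"
  by (rule eq_matI; auto simp: band_index)+

lemma dgr_oneI: "(\<And>j. j < a \<Longrightarrow> x j = 1) \<Longrightarrow> dgr a a x = 1\<^sub>m a"
  by (rule eq_matI; auto simp: band_index)

text \<open>When the dimensions are d + 1 and d - 1, the last column of the inclusion has the single
  entry \<open>y d\<close>, in its upper band, whence the entry \<open>1 / y d\<close> of the
  retraction. The off-diagonal part of the projection is forced by the vanishing of the
  composite.\<close>

lemma band_block_split:
  assumes "\<And>j. x j \<noteq> 0" "\<And>j. z j \<noteq> 0"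
    and "(d1 = Suc d \<and> d2 = d - 1 \<and> y d \<noteq> 0 \<and> 0 < d) \<or> (d1 = d \<and> d2 = d)"
  shows "block_split d1 d d2 (dgr d d1 x) (upr d d1 y) (dgr d1 d (\<lambda>j. 1 / x j))
     (lor d1 d (\<lambda>j. if Suc j = d then 1 / y d else 0))
     (upr d2 d (\<lambda>j. - (z (j - 1) * y j / x j))) (dgr d2 d z) (dgr d d2 (\<lambda>j. 1 / z j))"
  unfolding block_split_def band_mult band_add
  by (intro conjI band_carrier; (rule dgr_oneI | rule band_zeroI); use assms in auto)

text \<open>In the following four lemmas \<open>D = 1\<close> or \<open>D = diag((-1)\<^sup>n)\<close>: it commutes past the factor that is
  not affected by the tensor product, up to the sign by which the two actions differ.\<close>

lemma kron_mat22_stack_left: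
  assumes "K \<in> carrier_mat d d" "Y \<in> carrier_mat d' d'" "a0 \<in> carrier_mat d u" "a1 \<in> carrier_mat d u" "D \<in> carrier_mat d' d'"
  shows "kron (kron K Y) (mat22 a b c e) * stack (kron a0 D) (kron a1 D) =
     stack (kron (a \<cdot>\<^sub>m (K * a0) + b \<cdot>\<^sub>m (K * a1)) (Y * D)) (kron (c \<cdot>\<^sub>m (K * a0) + e \<cdot>\<^sub>m (K * a1)) (Y * D))"
proof -
  have k: "kron K Y \<in> carrier_mat (d * d') (d * d')" "kron a0 D \<in> carrier_mat (d * d') (u * d')" "kron a1 D \<in> carrier_mat (d * d') (u * d')"
    using assms by simp_all
  have c: "x \<cdot>\<^sub>m (K * a0) \<in> carrier_mat d u" "x \<cdot>\<^sub>m (K * a1) \<in> carrier_mat d u" "Y * D \<in> carrier_mat d' d'" for x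
    using assms by auto
  show ?thesis
    unfolding kron_mat22_stack[OF k] kron_mult[OF assms(1,2,3,5)] kron_mult[OF assms(1,2,4,5)]
      kron_add_left[OF c(1,2,3)] kron_smult_left ..
qed

lemma kron_mat22_stack_right:
  assumes "K \<in> carrier_mat d d" "Y \<in> carrier_mat d' d'" "a0 \<in> carrier_mat d' u" "a1 \<in> carrier_mat d' u" "D \<in> carrier_mat d d"
  shows "kron (kron K Y) (mat22 a b c e) * stack (kron D a0) (kron D a1) =
     stack (kron (K * D) (a \<cdot>\<^sub>m (Y * a0) + b \<cdot>\<^sub>m (Y * a1))) (kron (K * D) (c \<cdot>\<^sub>m (Y * a0) + e \<cdot>\<^sub>m (Y * a1)))"
proof -
  have k: "kron K Y \<in> carrier_mat (d * d') (d * d')" "kron D a0 \<in> carrier_mat (d * d') (d * u)" "kron D a1 \<in> carrier_mat (d * d') (d * u)"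
    using assms by simp_all
  have c: "x \<cdot>\<^sub>m (Y * a0) \<in> carrier_mat d' u" "x \<cdot>\<^sub>m (Y * a1) \<in> carrier_mat d' u" "K * D \<in> carrier_mat d d" for x
    using assms by auto
  show ?thesis
    unfolding kron_mat22_stack[OF k] kron_mult[OF assms(1,2,5,3)] kron_mult[OF assms(1,2,5,4)]
      kron_add_right[OF c(3,1,2)] kron_smult_right ..
qed

lemma side_kron_mat22_left:
  assumes "K \<in> carrier_mat d d" "Y \<in> carrier_mat d' d'" "b0 \<in> carrier_mat w d" "b1 \<in> carrier_mat w d" "D \<in> carrier_mat d' d'"
  shows "side (kron b0 D) (kron b1 D) * kron (kron K Y) (mat22 a b c e) =
     side (kron (a \<cdot>\<^sub>m (b0 * K) + c \<cdot>\<^sub>m (b1 * K)) (D * Y)) (kron (b \<cdot>\<^sub>m (b0 * K) + e \<cdot>\<^sub>m (b1 * K)) (D * Y))"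
proof -
  have k: "kron K Y \<in> carrier_mat (d * d') (d * d')" "kron b0 D \<in> carrier_mat (w * d') (d * d')" "kron b1 D \<in> carrier_mat (w * d') (d * d')"
    using assms by simp_all
  have c: "x \<cdot>\<^sub>m (b0 * K) \<in> carrier_mat w d" "x \<cdot>\<^sub>m (b1 * K) \<in> carrier_mat w d" "D * Y \<in> carrier_mat d' d'" for x
    using assms by auto
  show ?thesis
    unfolding side_kron_mat22[OF k] kron_mult[OF assms(3,5,1,2)] kron_mult[OF assms(4,5,1,2)]
      kron_add_left[OF c(1,2,3)] kron_smult_left ..
qed

lemma side_kron_mat22_right:
  assumes "K \<in> carrier_mat d d" "Y \<in> carrier_mat d' d'" "b0 \<in> carrier_mat w d'" "b1 \<in> carrier_mat w d'" "D \<in> carrier_mat d d"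
  shows "side (kron D b0) (kron D b1) * kron (kron K Y) (mat22 a b c e) =
     side (kron (D * K) (a \<cdot>\<^sub>m (b0 * Y) + c \<cdot>\<^sub>m (b1 * Y))) (kron (D * K) (b \<cdot>\<^sub>m (b0 * Y) + e \<cdot>\<^sub>m (b1 * Y)))"
proof -
  have k: "kron K Y \<in> carrier_mat (d * d') (d * d')" "kron D b0 \<in> carrier_mat (d * w) (d * d')" "kron D b1 \<in> carrier_mat (d * w) (d * d')"
    using assms by simp_all
  have c: "x \<cdot>\<^sub>m (b0 * Y) \<in> carrier_mat w d'" "x \<cdot>\<^sub>m (b1 * Y) \<in> carrier_mat w d'" "D * K \<in> carrier_mat d d" for x
    using assms by auto
  show ?thesis
    unfolding side_kron_mat22[OF k] kron_mult[OF assms(5,3,1,2)] kron_mult[OF assms(5,4,1,2)]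
      kron_add_right[OF c(3,1,2)] kron_smult_right ..
qed

lemma stack_kron_mult:
  assumes "a0 \<in> carrier_mat a b" "a1 \<in> carrier_mat a b" "D \<in> carrier_mat c e" "K \<in> carrier_mat b f" "Y \<in> carrier_mat e g"
  shows "stack (kron a0 D) (kron a1 D) * kron K Y = stack (kron (a0 * K) (D * Y)) (kron (a1 * K) (D * Y))"
    and "stack (kron D a0) (kron D a1) * kron Y K = stack (kron (D * Y) (a0 * K)) (kron (D * Y) (a1 * K))"
  using assms
  by (simp_all add: stack_mult[of _ "a * c" "b * e" _ _ "f * g"] stack_mult[of _ "c * a" "e * b" _ _ "g * f"]
      kron_mult[of _ a b _ c e _ f _ g] kron_mult[of _ c e _ a b _ g _ f])

lemma kron_mult_side:
  assumes "a0 \<in> carrier_mat a b" "a1 \<in> carrier_mat a b" "D \<in> carrier_mat c e" "K \<in> carrier_mat f a" "Y \<in> carrier_mat g c"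
  shows "kron K Y * side (kron a0 D) (kron a1 D) = side (kron (K * a0) (Y * D)) (kron (K * a1) (Y * D))"
    and "kron Y K * side (kron D a0) (kron D a1) = side (kron (Y * D) (K * a0)) (kron (Y * D) (K * a1))"
  using assms
  by (simp_all add: mult_side[of _ "a * c" "b * e" _ _ "f * g"] mult_side[of _ "c * a" "e * b" _ _ "g * f"]
      kron_mult[of _ f a _ g c _ b _ e] kron_mult[of _ g c _ f a _ e _ b])

lemma stack_kron_add:
  assumes "a \<in> carrier_mat n m" "a' \<in> carrier_mat n m" "b \<in> carrier_mat n m" "b' \<in> carrier_mat n m" "Y \<in> carrier_mat k l"
  shows "stack (kron a Y) (kron b Y) + stack (kron a' Y) (kron b' Y) = stack (kron (a + a') Y) (kron (b + b') Y)"
    and "stack (kron Y a) (kron Y b) + stack (kron Y a') (kron Y b') = stack (kron Y (a + a')) (kron Y (b + b'))"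
    and "side (kron a Y) (kron b Y) + side (kron a' Y) (kron b' Y) = side (kron (a + a') Y) (kron (b + b') Y)"
    and "side (kron Y a) (kron Y b) + side (kron Y a') (kron Y b') = side (kron Y (a + a')) (kron Y (b + b'))"
  using assms
  by (simp_all add: stack_add[of _ "n * k" "m * l"] stack_add[of _ "k * n" "l * m"] side_add[of _ "n * k" "m * l"] side_add[of _ "k * n" "l * m"]
      kron_add_left[of _ n m _ _ k l] kron_add_right[of _ k l _ n m])

lemma sign_square: "\<alpha> \<in> {1, -1} \<Longrightarrow> of_int \<alpha> * of_int \<alpha> = (1::complex)"
  "(\<alpha>::int) \<in> {1, -1} \<Longrightarrow> (of_int (\<alpha> ^ k) * (- 1) ^ l) * (of_int (\<alpha> ^ k) * (- 1) ^ l) = (1::complex)"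
proof -
  show 1: "\<alpha> \<in> {1, -1} \<Longrightarrow> of_int \<alpha> * of_int \<alpha> = (1::complex)" by auto
  assume a: "(\<alpha>::int) \<in> {1, -1}"
  have "(of_int (\<alpha> ^ k) * (- 1) ^ l) * (of_int (\<alpha> ^ k) * (- 1) ^ l) = (of_int \<alpha> * of_int \<alpha>) ^ k * ((- 1) * (- 1 :: complex)) ^ l"
    unfolding power_mult_distrib by (simp add: mult_ac)
  then show "(of_int (\<alpha> ^ k) * (- 1) ^ l) * (of_int (\<alpha> ^ k) * (- 1) ^ l) = (1::complex)" unfolding 1[OF a] by simp
qed

lemma wK_pow: "wK q r j ^ k = wK (q ^ k) r j"
  by (simp only: wK_def power_divide power_mult[symmetric] mult.commute)

lemma wK_minus_one: "wK (- 1) r j = (- 1) ^ Suc r"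
  by (simp add: wK_def)

lemma kron_dgr_const: "kron (dgr d d x) (dgr d' d' (\<lambda>_. c)) = kron (dgr d d (\<lambda>j. c * x j)) (1\<^sub>m d')"
  "kron (dgr d d (\<lambda>_. c)) (dgr d' d' x) = kron (1\<^sub>m d) (dgr d' d' (\<lambda>j. c * x j))"
proof -
  have "dgr k k (\<lambda>_. c) = c \<cdot>\<^sub>m 1\<^sub>m k" for k by (simp add: band_const band_smult)
  then show "kron (dgr d d x) (dgr d' d' (\<lambda>_. c)) = kron (dgr d d (\<lambda>j. c * x j)) (1\<^sub>m d')"
    "kron (dgr d d (\<lambda>_. c)) (dgr d' d' x) = kron (1\<^sub>m d) (dgr d' d' (\<lambda>j. c * x j))"
    by (simp_all add: kron_smult_left kron_smult_right flip: band_smult)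
qed

text \<open>Raising K to the power p_- turns its factor on the second index into the scalar
  (-1)^(r'-1), because q_-^(p_-) = -1, and replaces q_+ by Q_+ on the first index. This is the
  origin of the sign in the action of e_+; K^(-p_+) behaves symmetrically.\<close>

lemma band_mats_KK_pow:
  assumes p: "p \<ge> 1" "p' \<ge> 1" and a: "\<alpha> \<in> {1, -1}"
  shows "band_mats p p' \<alpha> r d r' d' KK ^\<^sub>m p' =
      kron (dgr d d (\<lambda>j. of_int (\<alpha> ^ p') * (- 1) ^ Suc r' * wK (Qpar p p') r j)) (1\<^sub>m d')"
    and "band_mats p p' \<alpha> r d r' d' KK ^\<^sub>m (2 * p * p' - p) =
      kron (1\<^sub>m d) (dgr d' d' (\<lambda>j. of_int (\<alpha> ^ p) * (- 1) ^ Suc r / wK (Qpar p' p) r' j))"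
proof -
  have k: "band_mats p p' \<alpha> r d r' d' KK ^\<^sub>m k = kron (dgr d d (\<lambda>j. of_int \<alpha> ^ k * wK (qroot p ^ k) r j)) (dgr d' d' (wK (qroot p' ^ k) r'))" for k
    unfolding band_mats_def gen.case
    by (subst kron_pow[of _ d _ d']) (simp_all add: dgr_pow power_mult_distrib wK_pow)
  have Q: "qroot p ^ p' = Qpar p p'" "qroot p' ^ p = Qpar p' p" by (simp_all add: Qpar_def)
  note l = qroot_pow_self[OF p(1)] qroot_pow_self[OF p(2)]
  have eta: "wK (- 1) r' = (\<lambda>_. (- 1) ^ Suc r')" by (rule ext) (rule wK_minus_one)
  show "band_mats p p' \<alpha> r d r' d' KK ^\<^sub>m p' =
      kron (dgr d d (\<lambda>j. of_int (\<alpha> ^ p') * (- 1) ^ Suc r' * wK (Qpar p p') r j)) (1\<^sub>m d')"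
    unfolding k Q l eta kron_dgr_const of_int_power by (simp add: mult_ac)
  have a2: "(of_int \<alpha> :: complex) ^ (2 * p * p') = 1" using a by (auto simp: power_mult)
  note full = qroot_full[OF p] and le = exponents_le[OF p]
  have c: "of_int \<alpha> ^ (2 * p * p' - p) = 1 / (of_int \<alpha> :: complex) ^ p" "qroot p ^ (2 * p * p' - p) = - 1"
    "qroot p' ^ (2 * p * p' - p) = 1 / Qpar p' p"
    using pow_complement[OF a2, of p] pow_complement[of "qroot p" "2 * p * p'" p] pow_complement[of "qroot p'" "2 * p * p'" p] full le
    by (simp_all add: l Q)
  have i: "1 / (of_int \<alpha> :: complex) ^ p = of_int \<alpha> ^ p" using a by (auto simp: minus_one_power_iff)
  have w: "wK (1 / x) r' j = 1 / wK x r' j" for x j by (simp add: wK_def power_divide)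
  show "band_mats p p' \<alpha> r d r' d' KK ^\<^sub>m (2 * p * p' - p) =
      kron (1\<^sub>m d) (dgr d' d' (\<lambda>j. of_int (\<alpha> ^ p) * (- 1) ^ Suc r / wK (Qpar p' p) r' j))"
    unfolding k c i wK_minus_one kron_dgr_const of_int_power by (simp add: w)
qed

lemma smult_zero_one: "0 \<cdot>\<^sub>m A = 0\<^sub>m (dim_row A) (dim_col A)" "1 \<cdot>\<^sub>m A = (A :: complex mat)"
  by (auto intro!: eq_matI)

section \<open>Tensoring with X_{2,1} and with X_{1,2}\<close>

text \<open>Separates the affected index from the other one: the premises \<open>A\<close> and
  \<open>B\<close> concern the first index only, and \<open>k\<close>, \<open>e\<close>,
  \<open>f\<close>, \<open>h\<close> are the factors of K, e_+, f_+, K^(p_-) on it. K^(p_+) is -1 on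
  X_{2,1}, so e_- changes sign, as recorded by \<open>e''\<close>; irreducible modules with r
  shifted by one carry the same sign, and D = 1 works.\<close>

lemma plus_intertwine:
  assumes c: "a0 \<in> carrier_mat d u" "a1 \<in> carrier_mat d u" "b0 \<in> carrier_mat w d" "b1 \<in> carrier_mat w d"
    "k \<in> carrier_mat d d" "e \<in> carrier_mat d d" "f \<in> carrier_mat d d" "h \<in> carrier_mat d d"
    "kU \<in> carrier_mat u u" "eU \<in> carrier_mat u u" "fU \<in> carrier_mat u u"
    "kW \<in> carrier_mat w w" "eW \<in> carrier_mat w w" "fW \<in> carrier_mat w w"
    "k' \<in> carrier_mat d' d'" "e' \<in> carrier_mat d' d'" "f' \<in> carrier_mat d' d'" "e'' \<in> carrier_mat d' d'"
    and A: "a0 * kU = q \<cdot>\<^sub>m (k * a0)" "a1 * kU = (1 / q) \<cdot>\<^sub>m (k * a1)" "a0 * eU = e * a0 + h * a1" "a1 * eU = e * a1"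
      "a0 * fU = (1 / Q) \<cdot>\<^sub>m (f * a0)" "a1 * fU = Q \<cdot>\<^sub>m (f * a1) + a0"
    and B: "kW * b0 = q \<cdot>\<^sub>m (b0 * k)" "kW * b1 = (1 / q) \<cdot>\<^sub>m (b1 * k)" "eW * b0 = b0 * e" "eW * b1 = b1 * e + b0 * h"
      "fW * b0 = (1 / Q) \<cdot>\<^sub>m (b0 * f) + b1" "fW * b1 = Q \<cdot>\<^sub>m (b1 * f)"
    and e'': "e'' = (- 1) \<cdot>\<^sub>m e'"
    and T: "T KK = kron (kron k k') (mat22 q 0 0 (1 / q))"
      "T EP = kron (kron e (1\<^sub>m d')) (mat22 1 0 0 1) + kron (kron h (1\<^sub>m d')) (mat22 0 1 0 0)"
      "T FP = kron (kron f (1\<^sub>m d')) (mat22 (1 / Q) 0 0 Q) + kron (kron (1\<^sub>m d) (1\<^sub>m d')) (mat22 0 0 1 0)"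
      "T EM = kron (kron (1\<^sub>m d) e') (mat22 (- 1) 0 0 (- 1))" "T FM = kron (kron (1\<^sub>m d) f') (mat22 1 0 0 1)"
    and L: "L KK = kron kU k'" "L EP = kron eU (1\<^sub>m d')" "L FP = kron fU (1\<^sub>m d')" "L EM = kron (1\<^sub>m u) e''" "L FM = kron (1\<^sub>m u) f'"
    and N: "N KK = kron kW k'" "N EP = kron eW (1\<^sub>m d')" "N FP = kron fW (1\<^sub>m d')" "N EM = kron (1\<^sub>m w) e''" "N FM = kron (1\<^sub>m w) f'"
  shows "stack (kron a0 (1\<^sub>m d')) (kron a1 (1\<^sub>m d')) * L g = T g * stack (kron a0 (1\<^sub>m d')) (kron a1 (1\<^sub>m d'))"
    and "side (kron b0 (1\<^sub>m d')) (kron b1 (1\<^sub>m d')) * T g = N g * side (kron b0 (1\<^sub>m d')) (kron b1 (1\<^sub>m d'))"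
proof -
  let ?A = "stack (kron a0 (1\<^sub>m d')) (kron a1 (1\<^sub>m d'))" and ?B = "side (kron b0 (1\<^sub>m d')) (kron b1 (1\<^sub>m d'))"
  note o = one_carrier_mat
  have cA: "?A \<in> carrier_mat (d * d' * 2) (u * d')" and cB: "?B \<in> carrier_mat (w * d') (d * d' * 2)"
    using c(1-4) by (auto intro!: stack_side_carrier)
  have kk: "kron (kron U Y) (mat22 x1 x2 x3 x4) \<in> carrier_mat (d * d' * 2) (d * d' * 2)"
    if "U \<in> carrier_mat d d" "Y \<in> carrier_mat d' d'" for U Y x1 x2 x3 x4
    using that by simp
  have oY: "1\<^sub>m d' * Y = Y" "Y * 1\<^sub>m d' = Y" if "Y \<in> carrier_mat d' d'" for Y :: "complex mat" using that by simp_all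
  have da: "U * a0 \<in> carrier_mat d u" "U * a1 \<in> carrier_mat d u" "b0 * U \<in> carrier_mat w d" "b1 * U \<in> carrier_mat w d"
    if "U \<in> carrier_mat d d" for U using c that by auto
  have S: "kron (kron U Y) (mat22 x 0 0 y) * ?A = stack (kron (x \<cdot>\<^sub>m (U * a0)) Y) (kron (y \<cdot>\<^sub>m (U * a1)) Y)"
    "kron (kron U Y) (mat22 0 1 0 0) * ?A = stack (kron (U * a1) Y) (kron (0\<^sub>m d u) Y)"
    "kron (kron U Y) (mat22 0 0 1 0) * ?A = stack (kron (0\<^sub>m d u) Y) (kron (U * a0) Y)"
    "?B * kron (kron U Y) (mat22 x 0 0 y) = side (kron (x \<cdot>\<^sub>m (b0 * U)) Y) (kron (y \<cdot>\<^sub>m (b1 * U)) Y)"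
    "?B * kron (kron U Y) (mat22 0 1 0 0) = side (kron (0\<^sub>m w d) Y) (kron (b0 * U) Y)"
    "?B * kron (kron U Y) (mat22 0 0 1 0) = side (kron (b1 * U) Y) (kron (0\<^sub>m w d) Y)"
    if U: "U \<in> carrier_mat d d" and Y: "Y \<in> carrier_mat d' d'" for U Y x y
    unfolding kron_mat22_stack_left[OF U Y c(1,2) o] side_kron_mat22_left[OF U Y c(3,4) o] oY[OF Y]
    using da[OF U] c(1-4) U by (simp_all add: smult_zero_one)
  note KL = stack_kron_mult(1)[OF c(1,2) o[of d']] and KR = kron_mult_side(1)[OF c(3,4) o[of d']]
  have sc: "x \<cdot>\<^sub>m U \<in> carrier_mat n m" if "U \<in> carrier_mat n m" for x :: complex and U n m using that by simp
  have id: "a0 * 1\<^sub>m u = a0" "a1 * 1\<^sub>m u = a1" "1\<^sub>m d * a0 = a0" "1\<^sub>m d * a1 = a1" "1\<^sub>m w * b0 = b0" "1\<^sub>m w * b1 = b1"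
    "b0 * 1\<^sub>m d = b0" "b1 * 1\<^sub>m d = b1"
    using c(1-4) by simp_all
  show "?A * L g = T g * ?A"
  proof (cases g)
    case KK
    show ?thesis unfolding KK L T KL[OF c(9,15)] S[OF c(5,15)] A oY[OF c(15)] ..
  next
    case EP
    show ?thesis unfolding EP L T KL[OF c(10) o] add_mult_distrib_mat[OF kk[OF c(6) o] kk[OF c(8) o] cA]
        S[OF c(6) o] S[OF c(8) o] A oY[OF o] stack_kron_add(1)[OF sc[OF da(1)[OF c(6)]] da(2)[OF c(8)] sc[OF da(2)[OF c(6)]] zero_carrier_mat o]
      using da[OF c(6)] by (simp add: smult_zero_one)
  next
    case FP
    show ?thesis unfolding FP L T KL[OF c(11) o] add_mult_distrib_mat[OF kk[OF c(7) o] kk[OF o o] cA]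
        S[OF c(7) o] S[OF o o] A oY[OF o] id stack_kron_add(1)[OF sc[OF da(1)[OF c(7)]] zero_carrier_mat sc[OF da(2)[OF c(7)]] c(1) o]
      using da[OF c(7)] by simp
  next
    case EM
    show ?thesis unfolding EM L T KL[OF o c(18)] S[OF o c(16)] id oY[OF c(18)] unfolding e'' kron_smult_right kron_smult_left ..
  next
    case FM
    show ?thesis unfolding FM L T KL[OF o c(17)] S[OF o c(17)] id oY[OF c(17)] smult_zero_one ..
  qed
  show "?B * T g = N g * ?B"
  proof (cases g)
    case KK
    show ?thesis unfolding KK N T KR[OF c(12,15)] S[OF c(5,15)] B oY[OF c(15)] ..
  next
    case EP
    show ?thesis unfolding EP N T KR[OF c(13) o] mult_add_distrib_mat[OF cB kk[OF c(6) o] kk[OF c(8) o]]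
        S[OF c(6) o] S[OF c(8) o] B oY[OF o] stack_kron_add(3)[OF sc[OF da(3)[OF c(6)]] zero_carrier_mat sc[OF da(4)[OF c(6)]] da(3)[OF c(8)] o]
      using da[OF c(6)] by (simp add: smult_zero_one)
  next
    case FP
    show ?thesis unfolding FP N T KR[OF c(14) o] mult_add_distrib_mat[OF cB kk[OF c(7) o] kk[OF o o]]
        S[OF c(7) o] S[OF o o] B oY[OF o] id stack_kron_add(3)[OF sc[OF da(3)[OF c(7)]] c(4) sc[OF da(4)[OF c(7)]] zero_carrier_mat o]
      using da[OF c(7)] by simp
  next
    case EM
    show ?thesis unfolding EM N T KR[OF o c(18)] S[OF o c(16)] id oY[OF c(18)] unfolding e'' kron_smult_right kron_smult_left ..
  next
    case FM
    show ?thesis unfolding FM N T KR[OF o c(17)] S[OF o c(17)] id oY[OF c(17)] smult_zero_one ..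
  qed
qed

text \<open>On X_{1,2} the sign of K^(-p_-) = -1 falls on f_+, which has coefficients 1 in the
  target, whereas there the sign of e_+ has changed instead. A diagonal D with alternating signs on
  the first index anticommutes with both shifts and repairs both. The factor \<open>h\<close> is
  that of K^(-p_+).\<close>

lemma minus_intertwine:
  assumes c: "a0 \<in> carrier_mat d' u" "a1 \<in> carrier_mat d' u" "b0 \<in> carrier_mat w d'" "b1 \<in> carrier_mat w d'"
    "k' \<in> carrier_mat d' d'" "e' \<in> carrier_mat d' d'" "f' \<in> carrier_mat d' d'" "h \<in> carrier_mat d' d'"
    "kU \<in> carrier_mat u u" "eU \<in> carrier_mat u u" "fU \<in> carrier_mat u u"
    "kW \<in> carrier_mat w w" "eW \<in> carrier_mat w w" "fW \<in> carrier_mat w w"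
    "k \<in> carrier_mat d d" "e \<in> carrier_mat d d" "f \<in> carrier_mat d d" "e'' \<in> carrier_mat d d" "D \<in> carrier_mat d d"
    and A: "a0 * kU = q \<cdot>\<^sub>m (k' * a0)" "a1 * kU = (1 / q) \<cdot>\<^sub>m (k' * a1)" "a0 * eU = Q \<cdot>\<^sub>m (e' * a0) + a1" "a1 * eU = (1 / Q) \<cdot>\<^sub>m (e' * a1)"
      "a0 * fU = f' * a0" "a1 * fU = f' * a1 + h * a0"
    and B: "kW * b0 = q \<cdot>\<^sub>m (b0 * k')" "kW * b1 = (1 / q) \<cdot>\<^sub>m (b1 * k')" "eW * b0 = Q \<cdot>\<^sub>m (b0 * e')" "eW * b1 = (1 / Q) \<cdot>\<^sub>m (b1 * e') + b0"
      "fW * b0 = b0 * f' + b1 * h" "fW * b1 = b1 * f'"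
    and D: "D * k = k * D" "D * e'' = e * D" "e'' * D = D * e" "D * f = (- 1) \<cdot>\<^sub>m (f * D)"
    and T: "T KK = kron (kron k k') (mat22 q 0 0 (1 / q))"
      "T EP = kron (kron e (1\<^sub>m d')) (mat22 1 0 0 1)" "T FP = kron (kron f (1\<^sub>m d')) (mat22 (- 1) 0 0 (- 1))"
      "T EM = kron (kron (1\<^sub>m d) e') (mat22 Q 0 0 (1 / Q)) + kron (kron (1\<^sub>m d) (1\<^sub>m d')) (mat22 0 1 0 0)"
      "T FM = kron (kron (1\<^sub>m d) f') (mat22 1 0 0 1) + kron (kron (1\<^sub>m d) h) (mat22 0 0 1 0)"
    and L: "L KK = kron k kU" "L EP = kron e'' (1\<^sub>m u)" "L FP = kron f (1\<^sub>m u)" "L EM = kron (1\<^sub>m d) eU" "L FM = kron (1\<^sub>m d) fU"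
    and N: "N KK = kron k kW" "N EP = kron e'' (1\<^sub>m w)" "N FP = kron f (1\<^sub>m w)" "N EM = kron (1\<^sub>m d) eW" "N FM = kron (1\<^sub>m d) fW"
  shows "stack (kron D a0) (kron D a1) * L g = T g * stack (kron D a0) (kron D a1)"
    and "side (kron D b0) (kron D b1) * T g = N g * side (kron D b0) (kron D b1)"
proof -
  let ?A = "stack (kron D a0) (kron D a1)" and ?B = "side (kron D b0) (kron D b1)"
  note o = one_carrier_mat
  have cA: "?A \<in> carrier_mat (d * d' * 2) (d * u)" and cB: "?B \<in> carrier_mat (d * w) (d * d' * 2)"
    using c(1-4,19) by (auto intro!: stack_side_carrier)
  have kk: "kron (kron U Y) (mat22 x1 x2 x3 x4) \<in> carrier_mat (d * d' * 2) (d * d' * 2)"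
    if "U \<in> carrier_mat d d" "Y \<in> carrier_mat d' d'" for U Y x1 x2 x3 x4
    using that by simp
  have oD: "1\<^sub>m d * D = D" "D * 1\<^sub>m d = D" using c(19) by simp_all
  have da: "U * a0 \<in> carrier_mat d' u" "U * a1 \<in> carrier_mat d' u" "b0 * U \<in> carrier_mat w d'" "b1 * U \<in> carrier_mat w d'"
    if "U \<in> carrier_mat d' d'" for U using c that by auto
  have S: "kron (kron U Y) (mat22 x 0 0 y) * ?A = stack (kron (U * D) (x \<cdot>\<^sub>m (Y * a0))) (kron (U * D) (y \<cdot>\<^sub>m (Y * a1)))"
    "kron (kron U Y) (mat22 0 1 0 0) * ?A = stack (kron (U * D) (Y * a1)) (kron (U * D) (0\<^sub>m d' u))"
    "kron (kron U Y) (mat22 0 0 1 0) * ?A = stack (kron (U * D) (0\<^sub>m d' u)) (kron (U * D) (Y * a0))"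
    "?B * kron (kron U Y) (mat22 x 0 0 y) = side (kron (D * U) (x \<cdot>\<^sub>m (b0 * Y))) (kron (D * U) (y \<cdot>\<^sub>m (b1 * Y)))"
    "?B * kron (kron U Y) (mat22 0 1 0 0) = side (kron (D * U) (0\<^sub>m w d')) (kron (D * U) (b0 * Y))"
    "?B * kron (kron U Y) (mat22 0 0 1 0) = side (kron (D * U) (b1 * Y)) (kron (D * U) (0\<^sub>m w d'))"
    if U: "U \<in> carrier_mat d d" and Y: "Y \<in> carrier_mat d' d'" for U Y x y
    unfolding kron_mat22_stack_right[OF U Y c(1,2,19)] side_kron_mat22_right[OF U Y c(3,4,19)]
    using da[OF Y] c(1-4) Y by (simp_all add: smult_zero_one)
  note KL = stack_kron_mult(2)[OF c(1,2,19)] and KR = kron_mult_side(2)[OF c(3,4,19)]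
  have sc: "x \<cdot>\<^sub>m U \<in> carrier_mat n m" if "U \<in> carrier_mat n m" for x :: complex and U n m using that by simp
  have id: "a0 * 1\<^sub>m u = a0" "a1 * 1\<^sub>m u = a1" "1\<^sub>m d' * a0 = a0" "1\<^sub>m d' * a1 = a1" "1\<^sub>m w * b0 = b0" "1\<^sub>m w * b1 = b1"
    "b0 * 1\<^sub>m d' = b0" "b1 * 1\<^sub>m d' = b1"
    using c(1-4) by simp_all
  show "?A * L g = T g * ?A"
  proof (cases g)
    case KK
    show ?thesis unfolding KK L T KL[OF c(9,15)] S[OF c(15,5)] A D ..
  next
    case EP
    show ?thesis unfolding EP L T KL[OF o c(18)] S[OF c(16) o] id D smult_zero_one ..
  next
    case FP
    show ?thesis unfolding FP L T KL[OF o c(17)] S[OF c(17) o] id D kron_smult_right kron_smult_left ..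
  next
    case EM
    show ?thesis unfolding EM L T KL[OF c(10) o] add_mult_distrib_mat[OF kk[OF o c(6)] kk[OF o o] cA]
        S[OF o c(6)] S[OF o o] A oD id stack_kron_add(2)[OF sc[OF da(1)[OF c(6)]] c(2) sc[OF da(2)[OF c(6)]] zero_carrier_mat c(19)]
      using da[OF c(6)] by simp
  next
    case FM
    show ?thesis unfolding FM L T KL[OF c(11) o] add_mult_distrib_mat[OF kk[OF o c(7)] kk[OF o c(8)] cA]
        S[OF o c(7)] S[OF o c(8)] A oD id stack_kron_add(2)[OF sc[OF da(1)[OF c(7)]] zero_carrier_mat sc[OF da(2)[OF c(7)]] da(1)[OF c(8)] c(19)]
      using da[OF c(7)] by (simp add: smult_zero_one)
  qed
  show "?B * T g = N g * ?B"
  proof (cases g)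
    case KK
    show ?thesis unfolding KK N T KR[OF c(12,15)] S[OF c(15,5)] B D ..
  next
    case EP
    show ?thesis unfolding EP N T KR[OF o c(18)] S[OF c(16) o] id D smult_zero_one ..
  next
    case FP
    have "f * D = (- 1) \<cdot>\<^sub>m (D * f)" unfolding D smult_smult_mat by (simp add: smult_zero_one)
    then show ?thesis unfolding FP N T KR[OF o c(17)] S[OF c(17) o] id kron_smult_right by (simp only: kron_smult_left)
  next
    case EM
    show ?thesis unfolding EM N T KR[OF c(13) o] mult_add_distrib_mat[OF cB kk[OF o c(6)] kk[OF o o]]
        S[OF o c(6)] S[OF o o] B oD id stack_kron_add(4)[OF sc[OF da(3)[OF c(6)]] zero_carrier_mat sc[OF da(4)[OF c(6)]] c(3) c(19)]
      using da[OF c(6)] by simp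
  next
    case FM
    show ?thesis unfolding FM N T KR[OF c(14) o] mult_add_distrib_mat[OF cB kk[OF o c(7)] kk[OF o c(8)]]
        S[OF o c(7)] S[OF o c(8)] B oD id stack_kron_add(4)[OF sc[OF da(3)[OF c(7)]] da(4)[OF c(8)] sc[OF da(4)[OF c(7)]] zero_carrier_mat c(19)]
      using da[OF c(7)] by (simp add: smult_zero_one)
  qed
qed

lemma wK_Suc: "q \<noteq> 0 \<Longrightarrow> wK q (Suc r) j = q * wK q r j" "q \<noteq> 0 \<Longrightarrow> wK q r (Suc j) = wK q r j / (q * q)"
  by (simp_all add: wK_def field_simps)

lemma wK_add: "q \<noteq> 0 \<Longrightarrow> wK q (Suc j + k) j = q ^ k / q ^ j"
  by (simp add: wK_def power_add mult_2)

text \<open>With r = j + 1 + k in the first part and r = j + 2 + k in the second, multiplication by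
  Q^(j+1) reduces both to Q [k+1] = [k] + Q^(k+1).\<close>

lemma plus_scalars:
  assumes Q: "Q \<noteq> 0" "Q - inverse Q \<noteq> 0"
  shows "j < r \<Longrightarrow> 1 / Q ^ j * wE Q (Suc r) (Suc j) = wE Q r (Suc j) * (1 / Q ^ Suc j) + wK Q r j * qnum Q (Suc j)"
    and "Suc j < r \<Longrightarrow> wE Q (r - 1) (Suc j) * (1 / Q ^ Suc j) = 1 / Q ^ j * wE Q r (Suc j) - Q * qnum Q (Suc j) * wK Q r (Suc j)"
proof -
  have cancel: "x = y" if "Q ^ Suc j * x = Q ^ Suc j * y" for x y using that Q by simp
  assume "j < r"
  then obtain k where r: "r = Suc j + k" using less_iff_Suc_add by auto
  have w: "wK Q r j = Q ^ k / Q ^ j" unfolding r by (rule wK_add[OF Q(1)])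
  have "Q ^ Suc j * (1 / Q ^ j * (qnum Q (Suc j) * qnum Q (Suc k))) = qnum Q (Suc j) * (Q * qnum Q (Suc k))"
    using Q by simp
  also have "\<dots> = Q ^ Suc j * (qnum Q (Suc j) * qnum Q k * (1 / Q ^ Suc j) + Q ^ k / Q ^ j * qnum Q (Suc j))"
    unfolding qnum_Suc(1)[OF Q] using Q by (simp add: algebra_simps)
  finally have "1 / Q ^ j * (qnum Q (Suc j) * qnum Q (Suc k)) =
      qnum Q (Suc j) * qnum Q k * (1 / Q ^ Suc j) + Q ^ k / Q ^ j * qnum Q (Suc j)" by (rule cancel)
  moreover have "Suc r - Suc j = Suc k" "r - Suc j = k" using r by simp_all
  ultimately show "1 / Q ^ j * wE Q (Suc r) (Suc j) = wE Q r (Suc j) * (1 / Q ^ Suc j) + wK Q r j * qnum Q (Suc j)"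
    unfolding wE_def w by (simp only:)
next
  have cancel: "x = y" if "Q ^ Suc j * x = Q ^ Suc j * y" for x y using that Q by simp
  assume "Suc j < r"
  then obtain k where r: "r = Suc (Suc j) + k" using less_iff_Suc_add by auto
  have w: "wK Q r (Suc j) = Q ^ k / Q ^ Suc j" unfolding r by (rule wK_add[OF Q(1)])
  have "Q ^ Suc j * (1 / Q ^ j * (qnum Q (Suc j) * qnum Q (Suc k)) - Q * qnum Q (Suc j) * (Q ^ k / Q ^ Suc j))
      = qnum Q (Suc j) * (Q * qnum Q (Suc k)) - qnum Q (Suc j) * Q ^ Suc k"
    using Q by (simp add: algebra_simps)
  also have "\<dots> = Q ^ Suc j * (qnum Q (Suc j) * qnum Q k * (1 / Q ^ Suc j))"
    unfolding qnum_Suc(1)[OF Q] using Q by (simp add: algebra_simps)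
  finally have "1 / Q ^ j * (qnum Q (Suc j) * qnum Q (Suc k)) - Q * qnum Q (Suc j) * (Q ^ k / Q ^ Suc j) =
      qnum Q (Suc j) * qnum Q k * (1 / Q ^ Suc j)" by (rule cancel)
  moreover have "r - 1 - Suc j = k" "r - Suc j = Suc k" using r by simp_all
  ultimately show "wE Q (r - 1) (Suc j) * (1 / Q ^ Suc j) = 1 / Q ^ j * wE Q r (Suc j) - Q * qnum Q (Suc j) * wK Q r (Suc j)"
    unfolding wE_def w by (simp only:)
qed

text \<open>The coefficients come from the highest weight vector: f_+^j sends v_0 \<otimes> w_0 to
  Q^(-j) v_j \<otimes> w_0 + [j] v_(j-1) \<otimes> w_1, by the recursion [j+1] = Q [j] + Q^(-j). The
  projection takes v_j \<otimes> w_1 to Q^(-j) times a basis vector and is completed so as to kill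
  this submodule. In the second case of \<open>d\<close> the coefficient [r] is zero and the
  submodule stops one step earlier.\<close>

lemma plus_band_relations:
  fixes c s :: complex
  assumes Q: "Q \<noteq> 0" "Q - inverse Q \<noteq> 0" and q: "q \<noteq> 0" and r: "1 \<le> r"
    and d: "(d1 = Suc r \<and> d2 = r - 1) \<or> (d1 = r \<and> d2 = r \<and> qnum Q r = 0)"
  defines "a0 \<equiv> dgr r d1 (\<lambda>j. 1 / Q ^ j)" and "a1 \<equiv> upr r d1 (qnum Q)"
    and "b0 \<equiv> upr d2 r (\<lambda>j. - (Q * qnum Q j))" and "b1 \<equiv> dgr d2 r (\<lambda>j. 1 / Q ^ j)"
    and "k \<equiv> dgr r r (\<lambda>j. c * wK q r j)" and "e \<equiv> upr r r (\<lambda>j. s * wE Q r j)" and "f \<equiv> lor r r (\<lambda>_. 1)"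
    and "h \<equiv> dgr r r (\<lambda>j. s * wK Q r j)"
    and "kU \<equiv> dgr d1 d1 (\<lambda>j. c * wK q (Suc r) j)" and "eU \<equiv> upr d1 d1 (\<lambda>j. s * wE Q (Suc r) j)" and "fU \<equiv> lor d1 d1 (\<lambda>_. 1)"
    and "kW \<equiv> dgr d2 d2 (\<lambda>j. c * wK q (r - 1) j)" and "eW \<equiv> upr d2 d2 (\<lambda>j. s * wE Q (r - 1) j)" and "fW \<equiv> lor d2 d2 (\<lambda>_. 1)"
  shows "a0 * kU = q \<cdot>\<^sub>m (k * a0)" "a1 * kU = (1 / q) \<cdot>\<^sub>m (k * a1)" "a0 * eU = e * a0 + h * a1" "a1 * eU = e * a1"
      "a0 * fU = (1 / Q) \<cdot>\<^sub>m (f * a0)" "a1 * fU = Q \<cdot>\<^sub>m (f * a1) + a0"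
    and "kW * b0 = q \<cdot>\<^sub>m (b0 * k)" "kW * b1 = (1 / q) \<cdot>\<^sub>m (b1 * k)" "eW * b0 = b0 * e" "eW * b1 = b1 * e + b0 * h"
      "fW * b0 = (1 / Q) \<cdot>\<^sub>m (b0 * f) + b1" "fW * b1 = Q \<cdot>\<^sub>m (b1 * f)"
proof -
  note defs = a0_def a1_def b0_def b1_def k_def e_def f_def h_def kU_def eU_def fU_def kW_def eW_def fW_def
  obtain r' where r': "r = Suc r'" using r by (cases r) auto
  note P = plus_scalars[OF Q]
  have P1: "1 / Q ^ j * (s * wE Q (Suc r) (Suc j)) = s * wE Q r (Suc j) * (1 / Q ^ Suc j) + s * wK Q r j * qnum Q (Suc j)" if "j < r" for j
    using arg_cong[OF P(1)[OF that], of "\<lambda>x. s * x"] by (simp add: algebra_simps)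
  have P2: "s * wE Q (r - 1) (Suc j) * (1 / Q ^ Suc j) = 1 / Q ^ j * (s * wE Q r (Suc j)) + - (Q * qnum Q (Suc j)) * (s * wK Q r (Suc j))" if "Suc j < r" for j
    using arg_cong[OF P(2)[OF that], of "\<lambda>x. s * x"] by (simp add: algebra_simps)
  show "a0 * kU = q \<cdot>\<^sub>m (k * a0)" "a1 * kU = (1 / q) \<cdot>\<^sub>m (k * a1)"
    unfolding defs band_mult band_smult
    by (rule band_cong; use d q in \<open>auto simp: wK_Suc\<close>)+
  show "kW * b0 = q \<cdot>\<^sub>m (b0 * k)" "kW * b1 = (1 / q) \<cdot>\<^sub>m (b1 * k)"
    unfolding defs band_mult band_smult
    by (rule band_cong; use d q r' in \<open>auto simp: wK_Suc\<close>)+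
  show "a0 * eU = e * a0 + h * a1"
    unfolding defs band_mult band_smult band_add
  proof (rule band_cong(2))
    fix j assume j: "j < r" "Suc j < d1"
    have "wE Q r (Suc j) = 0" if "\<not> Suc j < r" using that by (simp add: wE_def)
    then show "(if Suc j \<le> d1 then 1 / Q ^ (Suc j - 1) * (s * wE Q (Suc r) (Suc j)) else 0) =
         (if Suc j < r then s * wE Q r (Suc j) * (1 / Q ^ Suc j) else 0) +
         (if Suc j \<le> r then s * wK Q r (Suc j - 1) * qnum Q (Suc j) else 0)"
      using j P1[OF j(1)] by auto
  qed
  show "a1 * eU = e * a1" unfolding defs band_mult
    by (rule band_cong; use d in \<open>auto simp: wE_def\<close>)
  show "a0 * fU = (1 / Q) \<cdot>\<^sub>m (f * a0)" unfolding defs band_mult band_smult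
    by (rule band_cong; use d Q in auto)
  show "a1 * fU = Q \<cdot>\<^sub>m (f * a1) + a0" unfolding defs band_mult band_smult band_add
  proof (rule band_cong(1))
    fix j assume j: "j < r" "j < d1"
    \<comment> \<open>A term is cut off only if d1 = r, and its coefficient is then [r] = 0; for d1
      = r + 1 the assumption is contradictory.\<close>
    have "qnum Q (Suc j) = 0" if "\<not> Suc j < d1" proof -
      have "Suc j = d1" using that j by simp
      then show ?thesis using d j by auto
    qed
    then show "(if Suc j < d1 then qnum Q (Suc j) * 1 else 0) = Q * (if 0 < j \<and> j \<le> r then 1 * qnum Q j else 0) + 1 / Q ^ j"
      using j qnum_Suc(2)[OF Q, of j] by (cases "j = 0") auto
  qed
  show "eW * b0 = b0 * e" unfolding defs band_mult
    by (rule band_cong; use d r' in \<open>auto simp: wE_def\<close>)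
  show "eW * b1 = b1 * e + b0 * h" unfolding defs band_mult band_add
  proof (rule band_cong(2))
    fix j assume j: "j < d2" "Suc j < r"
    have "wE Q (r - 1) (Suc j) = 0" if "\<not> Suc j < d2" using that d j by (auto simp: wE_def)
    then show "(if Suc j < d2 then s * wE Q (r - 1) (Suc j) * (1 / Q ^ Suc j) else 0) =
         (if Suc j \<le> r then 1 / Q ^ (Suc j - 1) * (s * wE Q r (Suc j)) else 0) +
         (if Suc j < r then - (Q * qnum Q (Suc j)) * (s * wK Q r (Suc j)) else 0)"
      using j P2[OF j(2)] by auto
  qed
  show "fW * b0 = (1 / Q) \<cdot>\<^sub>m (b0 * f) + b1" unfolding defs band_mult band_smult band_add
  proof (rule band_cong(1))
    fix j assume j: "j < d2" "j < r"
    \<comment> \<open>The index j = r - 1 is below d2 only if d2 = r, and in that case [r] =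
      0.\<close>
    have "qnum Q (Suc j) = 0" if "\<not> Suc j < r" proof -
      have "Suc j = r" using that j by simp
      then show ?thesis using d j by auto
    qed
    moreover have "- (Q * qnum Q j) = 1 / Q * - (Q * qnum Q (Suc j)) + 1 / Q ^ j"
      using qnum_Suc(2)[OF Q, of j] Q by simp
    ultimately show "(if 0 < j \<and> j \<le> d2 then 1 * - (Q * qnum Q j) else 0) =
         1 / Q * (if Suc j < r then - (Q * qnum Q (Suc j)) * 1 else 0) + 1 / Q ^ j"
      using j Q by (cases "j = 0"; cases "Suc j < r") simp_all
  qed
  show "fW * b1 = Q \<cdot>\<^sub>m (b1 * f)" unfolding defs band_mult band_smult
    by (rule band_cong; use d Q in auto)
qed

text \<open>The outer terms are certified as modules along with the exactness; the irreducible
  modules themselves are obtained from this part of the conclusion.\<close>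

lemma plus_step:
  assumes p: "p \<ge> 2" "p' \<ge> 1" "coprime p p'" and a: "\<alpha> \<in> {1, -1}" and r: "1 \<le> r" "1 \<le> r'"
    and d: "(d1 = Suc r \<and> d2 = r - 1 \<and> r < p) \<or> (d1 = r \<and> d2 = r \<and> r = p)"
    and V: "irr_module p p' \<alpha> r r' \<in> modules p p'"
  defines "U \<equiv> mk_module (d1 * r') (band_mats p p' \<alpha> (Suc r) d1 r' r')"
    and "W \<equiv> mk_module (d2 * r') (band_mats p p' \<alpha> (r - 1) d2 r' r')"
  shows "U \<in> modules p p'" "W \<in> modules p p'"
    "short_exact U (tensor_module p p' (irr_module p p' \<alpha> r r') (irr_module p p' 1 2 1)) W"
proof -
  let ?q = "qroot p" and ?Q = "Qpar p p'" and ?s = "of_int (\<alpha> ^ p') * (- 1) ^ Suc r' :: complex" and ?t = "of_int (\<alpha> ^ p) * (- 1) ^ Suc r :: complex"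
  have p1: "p \<ge> 1" using p by simp
  let ?M = "band_mats p p' \<alpha> r r r' r'" and ?N = "irr_mat p p' 1 2 1"
  let ?T = "tgen p p' (r * r') ?M 2 ?N"
  note D = Qpar_diff[OF p(1,3)] and Q0 = Qpar_nonzero[of p p']
  define a0 where "a0 = dgr r d1 (\<lambda>j. 1 / ?Q ^ j)"
  define a1 where "a1 = upr r d1 (qnum ?Q)"
  define b0 where "b0 = upr d2 r (\<lambda>j. - (?Q * qnum ?Q j))"
  define b1 where "b1 = dgr d2 r (\<lambda>j. 1 / ?Q ^ j)"
  \<comment> \<open>The only possible zero of [r] in this range is r = p, which decides between the
    two dimension patterns.\<close>
  have y: "qnum ?Q r \<noteq> 0 \<longleftrightarrow> r \<noteq> p" using qnum_eq_0_iff[OF p(1,3), of r] r d by auto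
  have "block_split d1 r d2 a0 a1 (dgr d1 r (\<lambda>j. 1 / (1 / ?Q ^ j))) (lor d1 r (\<lambda>j. if Suc j = r then 1 / qnum ?Q r else 0))
     b0 b1 (dgr r d2 (\<lambda>j. 1 / (1 / ?Q ^ j)))"
  proof -
    \<comment> \<open>The value -Q [j] is the one forced by the diagonal entries Q^(-j). The two
      expressions agree for j >= 1, and an upper band has no entry in column 0.\<close>
    have "b0 = upr d2 r (\<lambda>j. - (1 / ?Q ^ (j - 1) * qnum ?Q j / (1 / ?Q ^ j)))"
      unfolding b0_def by (rule band_cong(2)) simp
    then show ?thesis unfolding a0_def a1_def b1_def
      by (simp only:) (rule band_block_split; use d y r in auto)
  qed
  from block_split_kron(1)[OF this one_carrier_mat[of r']]
  obtain A' B' where split: "split_maps (d1 * r') (r * r' * 2) (d2 * r') (stack (kron a0 (1\<^sub>m r')) (kron a1 (1\<^sub>m r'))) A'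
      (side (kron b0 (1\<^sub>m r')) (kron b1 (1\<^sub>m r'))) B'"
    using block_split_maps by fastforce
  have c: "a0 \<in> carrier_mat r d1" "a1 \<in> carrier_mat r d1" "b0 \<in> carrier_mat d2 r" "b1 \<in> carrier_mat d2 r"
    by (simp_all add: a0_def a1_def b0_def b1_def)
  have le: "p' \<le> 2 * p * p'" "p \<le> 2 * p * p'" using exponents_le[OF p1 p(2)] by auto
  have q: "?q ^ p' = ?Q" "?q ^ p = - 1" "?q ^ (2 * p * p' - p') = 1 / ?Q"
    using pow_complement[of ?q "2 * p * p'" p'] qroot_full[OF p1 p(2)] le qroot_pow_self[OF p1]
    by (simp_all add: Qpar_def)
  note N = irr_mat_21[OF p(1,3)]
  have zero: "mat22 0 0 0 0 = 0\<^sub>m 2 2" by (rule mat22_zero[symmetric])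
  have T: "?T KK = kron (?M KK) (mat22 ?q 0 0 (1 / ?q))"
    "?T EP = kron (?M EP) (mat22 1 0 0 1) + kron (?M KK ^\<^sub>m p') (mat22 0 1 0 0)"
    "?T FP = kron (?M FP) (mat22 (1 / ?Q) 0 0 ?Q) + kron (kron (1\<^sub>m r) (1\<^sub>m r')) (mat22 0 0 1 0)"
    "?T EM = kron (?M EM) (mat22 (- 1) 0 0 (- 1))"
    "?T FM = kron (?M FM) (mat22 1 0 0 1)"
    by (simp_all add: tgen_def N mat22_pow power_divide q mat22_one kron_one zero kron_zero_right band_mats_carrier
        pow_carrier_mat[OF band_mats_carrier] del: One_nat_def)
  note Me = band_mats_def[of p p' \<alpha> r r r' r'] and Ue = band_mats_def[of p p' \<alpha> "Suc r" d1 r' r'] and We = band_mats_def[of p p' \<alpha> "r - 1" d2 r' r']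
  have d': "(d1 = Suc r \<and> d2 = r - 1) \<or> (d1 = r \<and> d2 = r \<and> qnum ?Q r = 0)" using d y by auto
  note R = plus_band_relations[OF Q0 D qroot_nonzero r(1) d', folded a0_def a1_def b0_def b1_def]
  have e'': "upr r' r' (\<lambda>j. of_int (\<alpha> ^ p) * (- 1) ^ Suc (Suc r) * wE (Qpar p' p) r' j) =
      - 1 \<cdot>\<^sub>m upr r' r' (\<lambda>j. of_int (\<alpha> ^ p) * (- 1) ^ Suc r * wE (Qpar p' p) r' j)"
    by (simp add: band_smult)
  \<comment> \<open>The submodule and the quotient belong to r + 1 and r - 1, which have equal
    parity, so e_- has the same sign on both.\<close>
  have e: "upr r' r' (\<lambda>j. of_int (\<alpha> ^ p) * (- 1) ^ Suc (Suc r) * wE (Qpar p' p) r' j) =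
      upr r' r' (\<lambda>j. of_int (\<alpha> ^ p) * (- 1) ^ Suc (r - 1) * wE (Qpar p' p) r' j)"
    using r by (cases r) auto
  note KKp = band_mats_KK_pow(1)[OF p1 p(2) a, of r r r' r']
  have T': "?T KK = kron (kron (dgr r r (\<lambda>j. of_int \<alpha> * wK ?q r j)) (dgr r' r' (wK (qroot p') r'))) (mat22 ?q 0 0 (1 / ?q))"
    "?T EP = kron (kron (upr r r (\<lambda>j. ?s * wE ?Q r j)) (1\<^sub>m r')) (mat22 1 0 0 1) + kron (kron (dgr r r (\<lambda>j. ?s * wK ?Q r j)) (1\<^sub>m r')) (mat22 0 1 0 0)"
    "?T FP = kron (kron (lor r r (\<lambda>_. 1)) (1\<^sub>m r')) (mat22 (1 / ?Q) 0 0 ?Q) + kron (kron (1\<^sub>m r) (1\<^sub>m r')) (mat22 0 0 1 0)"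
    "?T EM = kron (kron (1\<^sub>m r) (upr r' r' (\<lambda>j. ?t * wE (Qpar p' p) r' j))) (mat22 (- 1) 0 0 (- 1))"
    "?T FM = kron (kron (1\<^sub>m r) (lor r' r' (\<lambda>_. 1))) (mat22 1 0 0 1)"
    unfolding T KKp unfolding Me gen.case by (rule refl)+
  note I = plus_intertwine[where T = ?T and L = "band_mats p p' \<alpha> (Suc r) d1 r' r'" and N = "band_mats p p' \<alpha> (r - 1) d2 r' r'",
      OF c band_carrier(1) band_carrier(2) band_carrier(3) band_carrier(1)
      band_carrier(1) band_carrier(2) band_carrier(3) band_carrier(1) band_carrier(2) band_carrier(3)
      band_carrier(1) band_carrier(2) band_carrier(3) band_carrier(2) R e'' T']
  have iA: "stack (kron a0 (1\<^sub>m r')) (kron a1 (1\<^sub>m r')) * band_mats p p' \<alpha> (Suc r) d1 r' r' g =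
      ?T g * stack (kron a0 (1\<^sub>m r')) (kron a1 (1\<^sub>m r'))" for g
    by (rule I(1); simp only: Ue We gen.case e simp_thms)
  have iB: "side (kron b0 (1\<^sub>m r')) (kron b1 (1\<^sub>m r')) * ?T g =
     band_mats p p' \<alpha> (r - 1) d2 r' r' g * side (kron b0 (1\<^sub>m r')) (kron b1 (1\<^sub>m r'))" for g
    by (rule I(2); simp only: Ue We gen.case e simp_thms)
  have X21: "irr_module p p' 1 2 1 \<in> modules p p'" by (rule X21_in_modules[OF p])
  have VM: "irr_module p p' \<alpha> r r' = mk_module (r * r') ?M" "gens (irr_module p p' \<alpha> r r') = ?M"
    unfolding irr_module_eq irr_mat_eq[OF r] by (simp_all add: gens_mk_module[OF band_mats_carrier])
  have XM: "fst (irr_module p p' 1 2 1) = 2" "gens (irr_module p p' 1 2 1) = ?N"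
    unfolding irr_module_eq by (auto simp: irr_mat_def intro!: gens_mk_module)
  have T2: "tensor_module p p' (irr_module p p' \<alpha> r r') (irr_module p p' 1 2 1) = mk_module (r * r' * 2) ?T"
    unfolding tensor_module_eq[OF p1 p(2) V X21] VM(2) XM unfolding VM(1) by simp
  have TV: "mk_module (r * r' * 2) ?T \<in> modules p p'"
    using tensor_in_modules[OF p1 p(2,3) V X21] unfolding T2 .
  have cT: "?T g \<in> carrier_mat (r * r' * 2) (r * r' * 2)" for g
    by (rule tgen_carrier) (simp_all add: band_mats_carrier irr_mat_def)
  note res = split_maps_mk_module[OF p1 p(2) split TV cT band_mats_carrier band_mats_carrier iA iB]
  show "U \<in> modules p p'" "W \<in> modules p p'"
    "short_exact U (tensor_module p p' (irr_module p p' \<alpha> r r') (irr_module p p' 1 2 1)) W"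
    unfolding U_def W_def T2 by (rule res)+
qed

text \<open>The third part says that Q^(j-r) [j] is the sum of Q^(-(r-1-2i)) over i < j; up to a
  sign these summands are the eigenvalues of K^(-p_+). The other two parts come from [k+1] = Q [k] +
  Q^(-k).\<close>

lemma minus_scalars:
  assumes Q: "Q \<noteq> 0" "Q - inverse Q \<noteq> 0"
  shows "j < r \<Longrightarrow> wE Q (Suc r) (Suc j) = Q * wE Q r (Suc j) + Q ^ Suc j / Q ^ r * qnum Q (Suc j)"
    and "Suc j < r \<Longrightarrow> wE Q (r - 1) (Suc j) = 1 / Q * wE Q r (Suc j) - Q ^ Suc j / Q ^ r * qnum Q (Suc j)"
    and "Q ^ Suc j / Q ^ r * qnum Q (Suc j) = Q ^ j / Q ^ r * qnum Q j + 1 / wK Q r j"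
proof -
  have w: "Q ^ n / Q ^ (n + k) = 1 / Q ^ k" for n k using Q by (simp add: power_add)
  assume "j < r"
  then obtain k where r: "r = Suc j + k" using less_iff_Suc_add by auto
  have "Suc r - Suc j = Suc k" "r - Suc j = k" using r by simp_all
  then show "wE Q (Suc r) (Suc j) = Q * wE Q r (Suc j) + Q ^ Suc j / Q ^ r * qnum Q (Suc j)"
    unfolding wE_def r w by (simp add: qnum_Suc(2)[OF Q, of k] algebra_simps)
next
  have w: "Q ^ n / Q ^ (n + k) = 1 / Q ^ k" for n k using Q by (simp add: power_add)
  assume "Suc j < r"
  then obtain k where r: "r = Suc (Suc j) + k" using less_iff_Suc_add by auto
  have e: "r - 1 - Suc j = k" "r - Suc j = Suc k" using r by simp_all
  have v: "Q ^ Suc j / Q ^ r = 1 / Q ^ Suc k" using w[of "Suc j" "Suc k"] r by simp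
  have h: "qnum Q k = 1 / Q * qnum Q (Suc k) - 1 / Q ^ Suc k"
    unfolding qnum_Suc(2)[OF Q, of k] using Q(1) by (simp add: distrib_left)
  have "qnum Q (Suc j) * qnum Q k = 1 / Q * (qnum Q (Suc j) * qnum Q (Suc k)) - 1 / Q ^ Suc k * qnum Q (Suc j)"
    unfolding h by (simp only: right_diff_distrib mult_ac)
  then show "wE Q (r - 1) (Suc j) = 1 / Q * wE Q r (Suc j) - Q ^ Suc j / Q ^ r * qnum Q (Suc j)"
    unfolding wE_def e v .
next
  have "Q ^ Suc j / Q ^ r * qnum Q (Suc j) = Q ^ j / Q ^ r * (Q * qnum Q (Suc j))" by simp
  also have "\<dots> = Q ^ j / Q ^ r * qnum Q j + Q ^ j * Q ^ Suc j / Q ^ r"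
    unfolding qnum_Suc(1)[OF Q] by (simp add: algebra_simps)
  also have "Q ^ j * Q ^ Suc j / Q ^ r = 1 / wK Q r j" by (simp add: wK_def mult_2 power_add)
  finally show "Q ^ Suc j / Q ^ r * qnum Q (Suc j) = Q ^ j / Q ^ r * qnum Q j + 1 / wK Q r j" .
qed

text \<open>Again the orbit of v_0 \<otimes> w_0, now under f_-, whose coproduct is f_- \<otimes> 1
  + K^(-p_+) \<otimes> f_-. Its j-th vector is v_j \<otimes> w_0 + y_j v_(j-1) \<otimes> w_1, where
  y_j sums the eigenvalues \<open>t / wK Q r i\<close> of K^(-p_+) over i < j. The diagonal
  coefficients are 1 because the first summand of the coproduct carries no power of K.\<close>

lemma minus_band_relations:
  fixes t :: complex
  assumes Q: "Q \<noteq> 0" "Q - inverse Q \<noteq> 0" and q: "q \<noteq> 0" and r: "1 \<le> r" and t: "t * t = 1"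
    and d: "(d1 = Suc r \<and> d2 = r - 1) \<or> (d1 = r \<and> d2 = r \<and> qnum Q r = 0)"
  defines "y \<equiv> \<lambda>j. t * (Q ^ j / Q ^ r * qnum Q j)"
  defines "a0 \<equiv> dgr r d1 (\<lambda>_. 1)" and "a1 \<equiv> upr r d1 y"
    and "b0 \<equiv> upr d2 r (\<lambda>j. - y j)" and "b1 \<equiv> dgr d2 r (\<lambda>_. 1)"
    and "k \<equiv> dgr r r (wK q r)" and "e \<equiv> upr r r (\<lambda>j. t * wE Q r j)" and "f \<equiv> lor r r (\<lambda>_. 1)"
    and "h \<equiv> dgr r r (\<lambda>j. t / wK Q r j)"
    and "kU \<equiv> dgr d1 d1 (wK q (Suc r))" and "eU \<equiv> upr d1 d1 (\<lambda>j. t * wE Q (Suc r) j)" and "fU \<equiv> lor d1 d1 (\<lambda>_. 1)"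
    and "kW \<equiv> dgr d2 d2 (wK q (r - 1))" and "eW \<equiv> upr d2 d2 (\<lambda>j. t * wE Q (r - 1) j)" and "fW \<equiv> lor d2 d2 (\<lambda>_. 1)"
  shows "a0 * kU = q \<cdot>\<^sub>m (k * a0)" "a1 * kU = (1 / q) \<cdot>\<^sub>m (k * a1)" "a0 * eU = Q \<cdot>\<^sub>m (e * a0) + a1" "a1 * eU = (1 / Q) \<cdot>\<^sub>m (e * a1)"
      "a0 * fU = f * a0" "a1 * fU = f * a1 + h * a0"
    and "kW * b0 = q \<cdot>\<^sub>m (b0 * k)" "kW * b1 = (1 / q) \<cdot>\<^sub>m (b1 * k)" "eW * b0 = Q \<cdot>\<^sub>m (b0 * e)" "eW * b1 = (1 / Q) \<cdot>\<^sub>m (b1 * e) + b0"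
      "fW * b0 = b0 * f + b1 * h" "fW * b1 = b1 * f"
proof -
  note defs = a0_def a1_def b0_def b1_def k_def e_def f_def h_def kU_def eU_def fU_def kW_def eW_def fW_def
  obtain r' where r': "r = Suc r'" using r by (cases r) auto
  note P = minus_scalars[OF Q]
  have P1: "t * wE Q (Suc r) (Suc j) = Q * (t * wE Q r (Suc j)) + y (Suc j)" if "j < r" for j
    unfolding y_def P(1)[OF that] by (simp only: algebra_simps)
  have P2: "t * wE Q (r - 1) (Suc j) = 1 / Q * (t * wE Q r (Suc j)) + - y (Suc j)" if "Suc j < r" for j
    unfolding y_def P(2)[OF that] by (simp only: right_diff_distrib mult_ac add_uminus_conv_diff)
  have P3: "y (Suc j) = y j + t / wK Q r j" for j
    unfolding y_def P(3) by (simp add: algebra_simps)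
  have y0: "y 0 = 0" "y r = 0" if "d1 = r" unfolding y_def using d that by auto
  have y0': "y 0 = 0" unfolding y_def by simp
  \<comment> \<open>Both sides equal t Q^(j+2-r) [j+1] [j+2]. This settles the entries two places
    above the diagonal.\<close>
  have yS: "y (Suc (Suc j)) * qnum Q (Suc j) = Q * (y (Suc j) * qnum Q (Suc (Suc j)))" for j unfolding y_def by simp
  show "a0 * kU = q \<cdot>\<^sub>m (k * a0)" "a1 * kU = (1 / q) \<cdot>\<^sub>m (k * a1)"
    unfolding defs band_mult band_smult
    by (rule band_cong; use d q in \<open>auto simp: wK_Suc\<close>)+
  show "kW * b0 = q \<cdot>\<^sub>m (b0 * k)" "kW * b1 = (1 / q) \<cdot>\<^sub>m (b1 * k)"
    unfolding defs band_mult band_smult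
    by (rule band_cong; use d q r' in \<open>auto simp: wK_Suc\<close>)+
  show "a0 * eU = Q \<cdot>\<^sub>m (e * a0) + a1"
    unfolding defs band_mult band_smult band_add
  proof (rule band_cong(2))
    fix j assume j: "j < r" "Suc j < d1"
    have "wE Q r (Suc j) = 0" if "\<not> Suc j < r" using that by (simp add: wE_def)
    then show "(if Suc j \<le> d1 then 1 * (t * wE Q (Suc r) (Suc j)) else 0) =
         Q * (if Suc j < r then t * wE Q r (Suc j) * 1 else 0) + y (Suc j)"
      using j P1[OF j(1)] by auto
  qed
  show "a1 * eU = (1 / Q) \<cdot>\<^sub>m (e * a1)" unfolding defs band_mult band_smult
  proof (rule band_cong(4))
    fix j assume j: "j < r" "Suc (Suc j) < d1"
    then have "Suc j < r" using d by auto
    moreover have "y (Suc j) * (t * wE Q (Suc r) (Suc (Suc j))) = 1 / Q * (t * wE Q r (Suc j) * y (Suc (Suc j)))"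
    proof -
      have "1 / Q * (t * wE Q r (Suc j) * y (Suc (Suc j))) = 1 / Q * (t * qnum Q (r - Suc j) * (y (Suc (Suc j)) * qnum Q (Suc j)))"
        by (simp add: wE_def)
      also have "\<dots> = y (Suc j) * (t * wE Q (Suc r) (Suc (Suc j)))"
        unfolding yS using Q by (simp add: wE_def)
      finally show ?thesis by simp
    qed
    ultimately show "(if Suc (Suc j) \<le> d1 then y (Suc (Suc j) - 1) * (t * wE Q (Suc r) (Suc (Suc j))) else 0) =
         1 / Q * (if Suc (Suc j) \<le> r then t * wE Q r (Suc (Suc j) - 1) * y (Suc (Suc j)) else 0)"
      using j by simp
  qed
  show "a0 * fU = f * a0" unfolding defs band_mult
    by (rule band_cong; use d in auto)
  show "a1 * fU = f * a1 + h * a0" unfolding defs band_mult band_add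
  proof (rule band_cong(1))
    fix j assume j: "j < r" "j < d1"
    have "y (Suc j) = 0" if "\<not> Suc j < d1"
    proof -
      have "Suc j = d1" using that j by simp
      then show ?thesis using d j y0 by auto
    qed
    then show "(if Suc j < d1 then y (Suc j) * 1 else 0) = (if 0 < j \<and> j \<le> r then 1 * y j else 0) + (if j < r then t / wK Q r j * 1 else 0)"
      using j P3[of j] y0' by (cases "j = 0"; cases "Suc j < d1") simp_all
  qed
  show "eW * b0 = Q \<cdot>\<^sub>m (b0 * e)" unfolding defs band_mult band_smult
  proof (rule band_cong(4))
    fix j assume j: "j < d2" "Suc (Suc j) < r"
    then have "Suc j < d2" using d by auto
    moreover have "t * wE Q (r - 1) (Suc j) * - y (Suc (Suc j)) = Q * (- y (Suc j) * (t * wE Q r (Suc (Suc j))))"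
    proof -
      have "t * wE Q (r - 1) (Suc j) * - y (Suc (Suc j)) = - (t * qnum Q (r - 1 - Suc j) * (y (Suc (Suc j)) * qnum Q (Suc j)))"
        by (simp add: wE_def)
      also have "\<dots> = Q * (- y (Suc j) * (t * wE Q r (Suc (Suc j))))"
        unfolding yS by (simp add: wE_def)
      finally show ?thesis .
    qed
    ultimately show "(if Suc (Suc j) \<le> d2 then t * wE Q (r - 1) (Suc (Suc j) - 1) * - y (Suc (Suc j)) else 0) =
         Q * (if Suc (Suc j) \<le> r then - y (Suc (Suc j) - 1) * (t * wE Q r (Suc (Suc j))) else 0)"
      using j by simp
  qed
  show "eW * b1 = (1 / Q) \<cdot>\<^sub>m (b1 * e) + b0" unfolding defs band_mult band_smult band_add
  proof (rule band_cong(2))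
    fix j assume j: "j < d2" "Suc j < r"
    have "wE Q (r - 1) (Suc j) = 0" if "\<not> Suc j < d2" using that d j by (auto simp: wE_def)
    then show "(if Suc j < d2 then t * wE Q (r - 1) (Suc j) * 1 else 0) =
         1 / Q * (if Suc j \<le> r then 1 * (t * wE Q r (Suc j)) else 0) + - y (Suc j)"
      using j P2[OF j(2)] by auto
  qed
  show "fW * b0 = b0 * f + b1 * h" unfolding defs band_mult band_add
  proof (rule band_cong(1))
    fix j assume j: "j < d2" "j < r"
    have "y (Suc j) = 0" if "\<not> Suc j < r"
    proof -
      have "Suc j = r" using that j by simp
      then show ?thesis using d j y0 by auto
    qed
    then have R: "(if Suc j < r then - y (Suc j) * 1 else 0) + (if j < r then 1 * (t / wK Q r j) else 0) = - y (Suc j) + t / wK Q r j"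
      using j by (cases "Suc j < r") simp_all
    have L: "(if 0 < j \<and> j \<le> d2 then 1 * - y j else 0) = - y j" using j y0' by (cases "j = 0") simp_all
    show "(if 0 < j \<and> j \<le> d2 then 1 * - y j else 0) =
         (if Suc j < r then - y (Suc j) * 1 else 0) + (if j < r then 1 * (t / wK Q r j) else 0)"
      unfolding L R by (simp add: P3)
  qed
  show "fW * b1 = b1 * f" unfolding defs band_mult
    by (rule band_cong; use d in auto)
qed

lemma minus_step:
  assumes p: "p \<ge> 1" "p' \<ge> 2" "coprime p p'" and a: "\<alpha> \<in> {1, -1}" and r: "1 \<le> r" "1 \<le> r'"
    and d: "(d1 = Suc r' \<and> d2 = r' - 1 \<and> r' < p') \<or> (d1 = r' \<and> d2 = r' \<and> r' = p')"
    and V: "irr_module p p' \<alpha> r r' \<in> modules p p'"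
  defines "U \<equiv> mk_module (r * d1) (band_mats p p' \<alpha> r r (Suc r') d1)"
    and "W \<equiv> mk_module (r * d2) (band_mats p p' \<alpha> r r (r' - 1) d2)"
  shows "U \<in> modules p p'" "W \<in> modules p p'"
    "short_exact U (tensor_module p p' (irr_module p p' \<alpha> r r') (irr_module p p' 1 1 2)) W"
proof -
  let ?q = "qroot p'" and ?Q = "Qpar p' p" and ?s = "of_int (\<alpha> ^ p') * (- 1) ^ Suc r' :: complex" and ?t = "of_int (\<alpha> ^ p) * (- 1) ^ Suc r :: complex"
  have p1: "p' \<ge> 1" and cop: "coprime p' p" using p by (simp_all add: coprime_commute)
  let ?M = "band_mats p p' \<alpha> r r r' r'" and ?N = "irr_mat p p' 1 1 2"
  let ?T = "tgen p p' (r * r') ?M 2 ?N"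
  let ?D = "dgr r r (\<lambda>j. (- 1) ^ j)"
  note D = Qpar_diff[OF p(2) cop] and Q0 = Qpar_nonzero[of p' p]
  have t: "?t * ?t = 1" by (rule sign_square(2)[OF a])
  define y where "y j = ?t * (?Q ^ j / ?Q ^ r' * qnum ?Q j)" for j
  define a0 where "a0 = dgr r' d1 (\<lambda>_. 1)"
  define a1 where "a1 = upr r' d1 y"
  define b0 where "b0 = upr d2 r' (\<lambda>j. - y j)"
  define b1 where "b1 = dgr d2 r' (\<lambda>_. 1)"
  have t0: "?t \<noteq> 0" using t by (metis mult_zero_left zero_neq_one)
  have y: "y r' \<noteq> 0 \<longleftrightarrow> r' \<noteq> p'" using qnum_eq_0_iff[OF p(2) cop, of r'] r d t0 unfolding y_def by auto
  have "block_split d1 r' d2 a0 a1 (dgr d1 r' (\<lambda>j. 1 / 1)) (lor d1 r' (\<lambda>j. if Suc j = r' then 1 / y r' else 0))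
     b0 b1 (dgr r' d2 (\<lambda>j. 1 / 1))"
  proof -
    have "b0 = upr d2 r' (\<lambda>j. - (1 * y j / 1))" unfolding b0_def by simp
    then show ?thesis unfolding a0_def a1_def b1_def
      by (simp only:) (rule band_block_split; use d y r in auto)
  qed
  from block_split_kron(2)[OF this, of ?D r]
  obtain A' B' where split: "split_maps (r * d1) (r * r' * 2) (r * d2) (stack (kron ?D a0) (kron ?D a1)) A'
      (side (kron ?D b0) (kron ?D b1)) B'"
  proof -
    have "?D * ?D = 1\<^sub>m r" unfolding band_mult by (rule dgr_oneI) (simp flip: power_mult_distrib)
    then show ?thesis using block_split_kron(2)[OF \<open>block_split _ _ _ _ _ _ _ _ _ _\<close>, of ?D r] block_split_maps that by fastforce
  qed
  have c: "a0 \<in> carrier_mat r' d1" "a1 \<in> carrier_mat r' d1" "b0 \<in> carrier_mat d2 r'" "b1 \<in> carrier_mat d2 r'"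
    by (simp_all add: a0_def a1_def b0_def b1_def)
  have le: "p' \<le> 2 * p * p'" "p \<le> 2 * p * p'" using exponents_le[OF p(1) p1] by auto
  have q: "?q ^ p = ?Q" "?q ^ p' = - 1" "?q ^ (2 * p * p' - p') = - 1"
    using pow_complement[of ?q "2 * p * p'" p'] qroot_full[OF p(1) p1] le qroot_pow_self[OF p1]
    by (simp_all add: Qpar_def)
  note N = irr_mat_12[OF p(2,3)]
  have zero: "mat22 0 0 0 0 = 0\<^sub>m 2 2" by (rule mat22_zero[symmetric])
  have T: "?T KK = kron (?M KK) (mat22 ?q 0 0 (1 / ?q))"
    "?T EP = kron (?M EP) (mat22 1 0 0 1)"
    "?T FP = kron (?M FP) (mat22 (- 1) 0 0 (- 1))"
    "?T EM = kron (?M EM) (mat22 ?Q 0 0 (1 / ?Q)) + kron (kron (1\<^sub>m r) (1\<^sub>m r')) (mat22 0 1 0 0)"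
    "?T FM = kron (?M FM) (mat22 1 0 0 1) + kron (?M KK ^\<^sub>m (2 * p * p' - p)) (mat22 0 0 1 0)"
    by (simp_all add: tgen_def N mat22_pow power_divide q mat22_one kron_one zero kron_zero_right band_mats_carrier
        pow_carrier_mat[OF band_mats_carrier] del: One_nat_def)
  note Me = band_mats_def[of p p' \<alpha> r r r' r'] and Ue = band_mats_def[of p p' \<alpha> r r "Suc r'" d1] and We = band_mats_def[of p p' \<alpha> r r "r' - 1" d2]
  have d': "(d1 = Suc r' \<and> d2 = r' - 1) \<or> (d1 = r' \<and> d2 = r' \<and> qnum ?Q r' = 0)"
    using d y t0 unfolding y_def by auto
  note R = minus_band_relations[OF Q0 D qroot_nonzero r(2) t d', folded y_def, folded a0_def a1_def b0_def b1_def]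
  let ?e = "upr r r (\<lambda>j. ?s * wE (Qpar p p') r j)" and ?e'' = "upr r r (\<lambda>j. of_int (\<alpha> ^ p') * (- 1) ^ Suc (Suc r') * wE (Qpar p p') r j)"
    and ?k = "dgr r r (\<lambda>j. of_int \<alpha> * wK (qroot p) r j)" and ?f = "lor r r (\<lambda>_. 1)"
  have E: "upr r r (\<lambda>j. of_int (\<alpha> ^ p') * (- 1) ^ Suc (Suc r') * wE (Qpar p p') r j) =
      upr r r (\<lambda>j. of_int (\<alpha> ^ p') * (- 1) ^ Suc (r' - 1) * wE (Qpar p p') r j)"
    using r by (cases r') auto
  have DR: "?D * ?k = ?k * ?D" "?D * ?e'' = ?e * ?D" "?e'' * ?D = ?D * ?e" "?D * ?f = (- 1) \<cdot>\<^sub>m (?f * ?D)"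
    unfolding band_mult band_smult by (rule band_cong; simp)+
  note KKp = band_mats_KK_pow(2)[OF p(1) p1 a, of r r r' r']
  have T': "?T KK = kron (kron ?k (dgr r' r' (wK ?q r'))) (mat22 ?q 0 0 (1 / ?q))"
    "?T EP = kron (kron ?e (1\<^sub>m r')) (mat22 1 0 0 1)"
    "?T FP = kron (kron ?f (1\<^sub>m r')) (mat22 (- 1) 0 0 (- 1))"
    "?T EM = kron (kron (1\<^sub>m r) (upr r' r' (\<lambda>j. ?t * wE ?Q r' j))) (mat22 ?Q 0 0 (1 / ?Q)) + kron (kron (1\<^sub>m r) (1\<^sub>m r')) (mat22 0 1 0 0)"
    "?T FM = kron (kron (1\<^sub>m r) (lor r' r' (\<lambda>_. 1))) (mat22 1 0 0 1) + kron (kron (1\<^sub>m r) (dgr r' r' (\<lambda>j. ?t / wK ?Q r' j))) (mat22 0 0 1 0)"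
    unfolding T KKp unfolding Me gen.case by (rule refl)+
  note I = minus_intertwine[where T = ?T and L = "band_mats p p' \<alpha> r r (Suc r') d1" and N = "band_mats p p' \<alpha> r r (r' - 1) d2",
      OF c band_carrier(1) band_carrier(2) band_carrier(3) band_carrier(1)
      band_carrier(1) band_carrier(2) band_carrier(3) band_carrier(1) band_carrier(2) band_carrier(3)
      band_carrier(1) band_carrier(2) band_carrier(3) band_carrier(2) band_carrier(1) R DR T']
  have iA: "stack (kron ?D a0) (kron ?D a1) * band_mats p p' \<alpha> r r (Suc r') d1 g = ?T g * stack (kron ?D a0) (kron ?D a1)" for g
    by (rule I(1); simp only: Ue We gen.case E simp_thms)
  have iB: "side (kron ?D b0) (kron ?D b1) * ?T g = band_mats p p' \<alpha> r r (r' - 1) d2 g * side (kron ?D b0) (kron ?D b1)" for g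
    by (rule I(2); simp only: Ue We gen.case E simp_thms)
  have X12: "irr_module p p' 1 1 2 \<in> modules p p'" by (rule X12_in_modules[OF p])
  have VM: "irr_module p p' \<alpha> r r' = mk_module (r * r') ?M" "gens (irr_module p p' \<alpha> r r') = ?M"
    unfolding irr_module_eq irr_mat_eq[OF r] by (simp_all add: gens_mk_module[OF band_mats_carrier])
  have XM: "fst (irr_module p p' 1 1 2) = 2" "gens (irr_module p p' 1 1 2) = ?N"
    unfolding irr_module_eq by (auto simp: irr_mat_def intro!: gens_mk_module)
  have T2: "tensor_module p p' (irr_module p p' \<alpha> r r') (irr_module p p' 1 1 2) = mk_module (r * r' * 2) ?T"
    unfolding tensor_module_eq[OF p(1) p1 V X12] VM(2) XM unfolding VM(1) by simp
  have TV: "mk_module (r * r' * 2) ?T \<in> modules p p'"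
    using tensor_in_modules[OF p(1) p1 p(3) V X12] unfolding T2 .
  have cT: "?T g \<in> carrier_mat (r * r' * 2) (r * r' * 2)" for g
    by (rule tgen_carrier) (simp_all add: band_mats_carrier irr_mat_def)
  note res = split_maps_mk_module[OF p(1) p1 split TV cT band_mats_carrier band_mats_carrier iA iB]
  show "U \<in> modules p p'" "W \<in> modules p p'"
    "short_exact U (tensor_module p p' (irr_module p p' \<alpha> r r') (irr_module p p' 1 1 2)) W"
    unfolding U_def W_def T2 by (rule res)+
qed

section \<open>Exact sequences that live in one index\<close>

text \<open>The maps of a sequence in the first index are tensored with the identity of the second
  index. This works because \<open>k'\<close>, \<open>e'\<close> and \<open>f'\<close> are the same
  in all three modules.\<close>

lemma split_maps_kron_left:
  assumes p: "p \<ge> 1" "p' \<ge> 1" and s: "split_maps u v w A A' B B'"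
    and c: "k \<in> carrier_mat v v" "e \<in> carrier_mat v v" "f \<in> carrier_mat v v"
      "kU \<in> carrier_mat u u" "eU \<in> carrier_mat u u" "fU \<in> carrier_mat u u"
      "kW \<in> carrier_mat w w" "eW \<in> carrier_mat w w" "fW \<in> carrier_mat w w"
      "k' \<in> carrier_mat z z" "e' \<in> carrier_mat z z" "f' \<in> carrier_mat z z"
    and A: "A * kU = k * A" "A * eU = e * A" "A * fU = f * A" and B: "B * k = kW * B" "B * e = eW * B" "B * f = fW * B"
    and M: "M KK = kron k k'" "M EP = kron e (1\<^sub>m z)" "M FP = kron f (1\<^sub>m z)" "M EM = kron (1\<^sub>m v) e'" "M FM = kron (1\<^sub>m v) f'"
    and L: "L KK = kron kU k'" "L EP = kron eU (1\<^sub>m z)" "L FP = kron fU (1\<^sub>m z)" "L EM = kron (1\<^sub>m u) e'" "L FM = kron (1\<^sub>m u) f'"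
    and N: "N KK = kron kW k'" "N EP = kron eW (1\<^sub>m z)" "N FP = kron fW (1\<^sub>m z)" "N EM = kron (1\<^sub>m w) e'" "N FM = kron (1\<^sub>m w) f'"
    and V: "mk_module (v * z) M \<in> modules p p'"
  shows "mk_module (u * z) L \<in> modules p p'" "mk_module (w * z) N \<in> modules p p'"
    "short_exact (mk_module (u * z) L) (mk_module (v * z) M) (mk_module (w * z) N)"
proof -
  have cA: "A \<in> carrier_mat v u" "B \<in> carrier_mat w v" using s by (simp_all add: split_maps_def)
  note o = one_carrier_mat
  have id: "A * 1\<^sub>m u = A" "1\<^sub>m v * A = A" "B * 1\<^sub>m v = B" "1\<^sub>m w * B = B" using cA by simp_all
  have cM: "M g \<in> carrier_mat (v * z) (v * z)" for g using c by (cases g) (simp_all add: M)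
  have cL: "L g \<in> carrier_mat (u * z) (u * z)" for g using c by (cases g) (simp_all add: L)
  have cN: "N g \<in> carrier_mat (w * z) (w * z)" for g using c by (cases g) (simp_all add: N)
  have iA: "kron A (1\<^sub>m z) * L g = M g * kron A (1\<^sub>m z)" for g
    by (cases g; simp only: M L kron_one_mult(1,2)[OF cA(1)] c o A id)
  have iB: "kron B (1\<^sub>m z) * M g = N g * kron B (1\<^sub>m z)" for g
    by (cases g; simp only: M N kron_one_mult(1,2)[OF cA(2)] c o B id)
  show "mk_module (u * z) L \<in> modules p p'" "mk_module (w * z) N \<in> modules p p'"
    "short_exact (mk_module (u * z) L) (mk_module (v * z) M) (mk_module (w * z) N)"
    by (rule split_maps_mk_module[OF p kron_split_maps(1)[OF s, of z] V cM cL cN iA iB])+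
qed

lemma split_maps_kron_right:
  assumes p: "p \<ge> 1" "p' \<ge> 1" and s: "split_maps u v w A A' B B'"
    and c: "k' \<in> carrier_mat v v" "e' \<in> carrier_mat v v" "f' \<in> carrier_mat v v"
      "kU \<in> carrier_mat u u" "eU \<in> carrier_mat u u" "fU \<in> carrier_mat u u"
      "kW \<in> carrier_mat w w" "eW \<in> carrier_mat w w" "fW \<in> carrier_mat w w"
      "k \<in> carrier_mat z z" "e \<in> carrier_mat z z" "f \<in> carrier_mat z z"
    and A: "A * kU = k' * A" "A * eU = e' * A" "A * fU = f' * A" and B: "B * k' = kW * B" "B * e' = eW * B" "B * f' = fW * B"
    and M: "M KK = kron k k'" "M EP = kron e (1\<^sub>m v)" "M FP = kron f (1\<^sub>m v)" "M EM = kron (1\<^sub>m z) e'" "M FM = kron (1\<^sub>m z) f'"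
    and L: "L KK = kron k kU" "L EP = kron e (1\<^sub>m u)" "L FP = kron f (1\<^sub>m u)" "L EM = kron (1\<^sub>m z) eU" "L FM = kron (1\<^sub>m z) fU"
    and N: "N KK = kron k kW" "N EP = kron e (1\<^sub>m w)" "N FP = kron f (1\<^sub>m w)" "N EM = kron (1\<^sub>m z) eW" "N FM = kron (1\<^sub>m z) fW"
    and V: "mk_module (z * v) M \<in> modules p p'"
  shows "mk_module (z * u) L \<in> modules p p'" "mk_module (z * w) N \<in> modules p p'"
    "short_exact (mk_module (z * u) L) (mk_module (z * v) M) (mk_module (z * w) N)"
proof -
  have cA: "A \<in> carrier_mat v u" "B \<in> carrier_mat w v" using s by (simp_all add: split_maps_def)
  note o = one_carrier_mat
  have id: "A * 1\<^sub>m u = A" "1\<^sub>m v * A = A" "B * 1\<^sub>m v = B" "1\<^sub>m w * B = B" using cA by simp_all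
  have cM: "M g \<in> carrier_mat (z * v) (z * v)" for g using c by (cases g) (simp_all add: M)
  have cL: "L g \<in> carrier_mat (z * u) (z * u)" for g using c by (cases g) (simp_all add: L)
  have cN: "N g \<in> carrier_mat (z * w) (z * w)" for g using c by (cases g) (simp_all add: N)
  have iA: "kron (1\<^sub>m z) A * L g = M g * kron (1\<^sub>m z) A" for g
    by (cases g; simp only: M L kron_one_mult(3,4)[OF cA(1)] c o A id)
  have iB: "kron (1\<^sub>m z) B * M g = N g * kron (1\<^sub>m z) B" for g
    by (cases g; simp only: M N kron_one_mult(3,4)[OF cA(2)] c o B id)
  show "mk_module (z * u) L \<in> modules p p'" "mk_module (z * w) N \<in> modules p p'"
    "short_exact (mk_module (z * u) L) (mk_module (z * v) M) (mk_module (z * w) N)"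
    by (rule split_maps_mk_module[OF p kron_split_maps(2)[OF s, of z] V cM cL cN iA iB])+
qed

section \<open>Baby Verma modules\<close>

lemma lor_lor: "lor a b x * lor b c y = mat a c (\<lambda>(i, j). if i = Suc (Suc j) \<and> Suc j < b then x (Suc j) * y j else 0)"
  by (rule eq_matI; simp add: mult_mat_index[of _ a b _ c] band_index sum_sparse del: index_mult_mat(1) cong: sum.cong_simp; auto)

text \<open>The highest weight vector of the first baby Verma module spans a quotient, and its other basis
  vectors a submodule; in the second one the lowest weight vector spans a submodule.\<close>

lemma baby_verma_band:
  fixes c s s' :: complex
  assumes Q: "\<forall>n\<le>m. qnum Q (Suc m - n) = - x * qnum Q n" "x * x = 1" "qnum Q (Suc m) = 0" and q: "q ^ Suc m = - 1"
  defines "f \<equiv> \<lambda>d. lor d d (\<lambda>_. 1)"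
    and "k \<equiv> \<lambda>r d. dgr d d (\<lambda>j. c * wK q r j)" and "e \<equiv> \<lambda>r d. upr d d (\<lambda>j. s * wE Q r j)"
    and "kW \<equiv> dgr 1 1 (\<lambda>j. - c * wK q 1 j)" and "eW \<equiv> upr 1 1 (\<lambda>j. s' * wE Q 1 j)"
  shows "\<exists>A A' B B'. split_maps m (Suc m) 1 A A' B B' \<and>
      A * k m m = k (Suc (Suc m)) (Suc m) * A \<and> A * e m m = e (Suc (Suc m)) (Suc m) * A \<and> A * f m = f (Suc m) * A \<and>
      B * k (Suc (Suc m)) (Suc m) = kW * B \<and> B * e (Suc (Suc m)) (Suc m) = eW * B \<and> B * f (Suc m) = f 1 * B"
    and "\<exists>A A' B B'. split_maps 1 (Suc m) m A A' B B' \<and>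
      A * kW = k m (Suc m) * A \<and> A * eW = e m (Suc m) * A \<and> A * f 1 = f (Suc m) * A \<and>
      B * k m (Suc m) = k m m * B \<and> B * e m (Suc m) = e m m * B \<and> B * f (Suc m) = f m * B"
proof -
  note defs = f_def k_def e_def kW_def eW_def
  have q0: "q \<noteq> 0" using q by auto
  \<comment> \<open>Each of the two quantum integers is reflected once, and the resulting factor is
    x * x = 1.\<close>
  have wE_sym: "wE Q (Suc (Suc m)) (Suc j) = wE Q m j" if "j < m" for j
  proof -
    have "qnum Q (Suc j) = - x * qnum Q (m - j)" using Q(1)[rule_format, of "m - j"] that by (simp add: Suc_diff_le)
    moreover have "qnum Q (Suc m - j) = - x * qnum Q j" using Q(1)[rule_format, of j] that by simp
    ultimately have "qnum Q (Suc j) * qnum Q (Suc m - j) = (x * x) * (qnum Q j * qnum Q (m - j))" by (simp only: mult_ac mult_minus_left mult_minus_right minus_minus)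
    then show ?thesis unfolding wE_def Q(2) by simp
  qed
  \<comment> \<open>The weights for r = m + 2 begin with q^(m+1) = -1, the negative of the only
    weight for r = 1. This is where the sign \<alpha> flips; the last weight for r = m is -1 for the
    same reason.\<close>
  have wK1: "wK q (Suc (Suc m)) 0 = - 1" "wK q 1 0 = 1" using q q0 by (simp_all add: wK_def)
  have wKm: "wK q m m = - 1"
  proof -
    have "q ^ m / q ^ Suc (2 * m) = 1 / q ^ Suc m" using q0 by (simp add: mult_2 power_add)
    then show ?thesis unfolding wK_def q by simp
  qed
  have wKs: "wK q (Suc (Suc m)) (Suc j) = wK q m j" for j using q0 by (simp add: wK_Suc)
  show "\<exists>A A' B B'. split_maps m (Suc m) 1 A A' B B' \<and>
      A * k m m = k (Suc (Suc m)) (Suc m) * A \<and> A * e m m = e (Suc (Suc m)) (Suc m) * A \<and> A * f m = f (Suc m) * A \<and>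
      B * k (Suc (Suc m)) (Suc m) = kW * B \<and> B * e (Suc (Suc m)) (Suc m) = eW * B \<and> B * f (Suc m) = f 1 * B"
  proof (intro exI conjI)
    let ?A = "lor (Suc m) m (\<lambda>_. 1)" and ?A' = "upr m (Suc m) (\<lambda>_. 1)" and ?B = "dgr 1 (Suc m) (\<lambda>_. 1)" and ?B' = "dgr (Suc m) 1 (\<lambda>_. 1)"
    show "split_maps m (Suc m) 1 ?A ?A' ?B ?B'" unfolding split_maps_def band_mult band_add
      by (intro conjI band_carrier; (rule dgr_oneI | rule band_zeroI); auto)
    show "?A * k m m = k (Suc (Suc m)) (Suc m) * ?A" unfolding defs band_mult by (rule band_cong) (simp add: wKs)
    show "?A * e m m = e (Suc (Suc m)) (Suc m) * ?A" unfolding defs band_mult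
      by (rule band_cong) (auto simp: wE_sym, simp add: wE_def)
    show "?A * f m = f (Suc m) * ?A" unfolding defs lor_lor by (rule eq_matI) auto
    show "?B * k (Suc (Suc m)) (Suc m) = kW * ?B" unfolding defs band_mult by (rule band_cong) (use wK1 in auto)
    show "?B * e (Suc (Suc m)) (Suc m) = eW * ?B" unfolding defs band_mult by (rule band_cong) (use Q in \<open>auto simp: wE_def\<close>)
    show "?B * f (Suc m) = f 1 * ?B" unfolding defs band_mult by (rule band_cong) auto
  qed
  show "\<exists>A A' B B'. split_maps 1 (Suc m) m A A' B B' \<and>
      A * kW = k m (Suc m) * A \<and> A * eW = e m (Suc m) * A \<and> A * f 1 = f (Suc m) * A \<and>
      B * k m (Suc m) = k m m * B \<and> B * e m (Suc m) = e m m * B \<and> B * f (Suc m) = f m * B"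
  proof (intro exI conjI)
    \<comment> \<open>The inclusion hits the last basis vector and fits none of the bands near the
      diagonal, hence the separate computations of columns and of the outer product.\<close>
    let ?A = "mat (Suc m) 1 (\<lambda>(i, j). if i = m then 1 else 0) :: complex mat" and ?A' = "mat 1 (Suc m) (\<lambda>(i, j). if j = m then 1 else 0) :: complex mat"
    let ?B = "dgr m (Suc m) (\<lambda>_. 1)" and ?B' = "dgr (Suc m) m (\<lambda>_. 1)"
    have cA: "?A \<in> carrier_mat (Suc m) 1" "?A' \<in> carrier_mat 1 (Suc m)" by simp_all
    have col: "M * ?A = mat n 1 (\<lambda>(i, j). M $$ (i, m))" if "M \<in> carrier_mat n (Suc m)" for M n
    proof (rule eq_matI)
      fix i j assume "i < dim_row (mat n 1 (\<lambda>(i, j). M $$ (i, m)))" "j < dim_col (mat n 1 (\<lambda>(i, j). M $$ (i, m)))"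
      then have ij: "i < n" "j < 1" by auto
      have "(M * ?A) $$ (i, j) = (\<Sum>l<Suc m. M $$ (i, l) * ?A $$ (l, j))" by (rule mult_mat_index[OF that cA(1) ij])
      also have "\<dots> = (\<Sum>l<Suc m. if l = m then M $$ (i, l) else 0)" using ij by (intro sum.cong) auto
      finally show "(M * ?A) $$ (i, j) = mat n 1 (\<lambda>(i, j). M $$ (i, m)) $$ (i, j)" using ij by simp
    qed (use that in auto)
    have one: "?A * M = mat (Suc m) 1 (\<lambda>(i, j). if i = m then M $$ (0, 0) else 0)" if "M \<in> carrier_mat 1 1" for M
      using that by (intro eq_matI) (auto simp: mult_mat_index[of _ "Suc m" 1 _ 1] simp del: index_mult_mat(1))
    have outer: "?A * ?A' = mat (Suc m) (Suc m) (\<lambda>(i, j). if i = m \<and> j = m then 1 else 0)"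
      by (intro eq_matI) (auto simp: mult_mat_index[of _ "Suc m" 1 _ "Suc m"] simp del: index_mult_mat(1))
    show "split_maps 1 (Suc m) m ?A ?A' ?B ?B'" unfolding split_maps_def outer col[OF cA(2)] col[OF band_carrier(1)] band_mult
      by (intro conjI cA band_carrier; (rule dgr_oneI)?; (rule eq_matI)?; auto simp: band_index)
    have cK: "kW \<in> carrier_mat 1 1" "eW \<in> carrier_mat 1 1" "f 1 \<in> carrier_mat 1 1"
      "k m (Suc m) \<in> carrier_mat (Suc m) (Suc m)" "e m (Suc m) \<in> carrier_mat (Suc m) (Suc m)" "f (Suc m) \<in> carrier_mat (Suc m) (Suc m)"
      unfolding defs by simp_all
    show "?A * kW = k m (Suc m) * ?A" unfolding one[OF cK(1)] col[OF cK(4)]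
      by (rule eq_matI) (use wK1 wKm in \<open>auto simp: defs band_index\<close>)
    show "?A * eW = e m (Suc m) * ?A" unfolding one[OF cK(2)] col[OF cK(5)]
      by (rule eq_matI) (auto simp: defs band_index wE_def)
    show "?A * f 1 = f (Suc m) * ?A" unfolding one[OF cK(3)] col[OF cK(6)]
      by (rule eq_matI) (auto simp: defs band_index)
    show "?B * k m (Suc m) = k m m * ?B" unfolding defs band_mult by (rule band_cong) auto
    show "?B * e m (Suc m) = e m m * ?B" unfolding defs band_mult
    proof (rule band_cong)
      fix j assume "j < m" "Suc j < Suc m"
      then show "(if Suc j \<le> Suc m then 1 * (s * wE Q m (Suc j)) else 0) = (if Suc j < m then s * wE Q m (Suc j) * 1 else 0)"
        by (auto simp: wE_def)
    qed
    show "?B * f (Suc m) = f m * ?B" unfolding defs band_mult by (rule band_cong) auto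
  qed
qed

text \<open>The second index is a spectator, so e_- must act on it by one and the same matrix in all
  three modules. The signs in the action of e_- are made for this: (-\<alpha>)^(p_+) for r = 1
  equals \<alpha>^(p_+) (-1)^(p_+), which is the sign for r = p_+ - 1.\<close>

lemma baby_verma_plus:
  fixes m :: nat
  assumes m: "1 \<le> m" and p: "p' \<ge> 1" "coprime (Suc m) p'" and r': "1 \<le> r'"
  shows "mk_module (Suc m * r') (band_mats (Suc m) p' \<alpha> (Suc (Suc m)) (Suc m) r' r') \<in> modules (Suc m) p' \<Longrightarrow>
      irr_module (Suc m) p' \<alpha> m r' \<in> modules (Suc m) p' \<and> irr_module (Suc m) p' (- \<alpha>) 1 r' \<in> modules (Suc m) p' \<and>
      short_exact (irr_module (Suc m) p' \<alpha> m r') (mk_module (Suc m * r') (band_mats (Suc m) p' \<alpha> (Suc (Suc m)) (Suc m) r' r'))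
        (irr_module (Suc m) p' (- \<alpha>) 1 r')"
    and "mk_module (Suc m * r') (band_mats (Suc m) p' \<alpha> m (Suc m) r' r') \<in> modules (Suc m) p' \<Longrightarrow>
      short_exact (irr_module (Suc m) p' (- \<alpha>) 1 r') (mk_module (Suc m * r') (band_mats (Suc m) p' \<alpha> m (Suc m) r' r'))
        (irr_module (Suc m) p' \<alpha> m r')"
proof -
  have p1: "Suc m \<ge> 1" "Suc m \<ge> 2" using m by simp_all
  let ?Q = "Qpar (Suc m) p'" and ?q = "qroot (Suc m)"
  have Q: "\<forall>n\<le>m. qnum ?Q (Suc m - n) = - (?Q ^ Suc m) * qnum ?Q n"
    using qnum_reflect[of "Suc m" _ p'] by simp
  have xx: "?Q ^ Suc m * ?Q ^ Suc m = 1" by (rule Qpar_sq[OF p1(1)])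
  have Qp: "qnum ?Q (Suc m) = 0" using qnum_eq_0_iff[OF p1(2) p(2), of "Suc m"] by simp
  have q: "?q ^ Suc m = - 1" by (rule qroot_pow_self[OF p1(1)])
  note BV = baby_verma_band[where c = "of_int \<alpha>" and s = "of_int (\<alpha> ^ p') * (- 1) ^ Suc r'" and s' = "of_int ((- \<alpha>) ^ p') * (- 1) ^ Suc r'",
      OF Q xx Qp q]
  have irr: "irr_module (Suc m) p' \<alpha> m r' = mk_module (m * r') (band_mats (Suc m) p' \<alpha> m m r' r')"
    "irr_module (Suc m) p' (- \<alpha>) 1 r' = mk_module (1 * r') (band_mats (Suc m) p' (- \<alpha>) 1 1 r' r')"
    unfolding irr_module_eq using irr_mat_eq[OF m r'] irr_mat_eq[OF le_refl r'] by simp_all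
  let ?e' = "upr r' r' (\<lambda>j. of_int (\<alpha> ^ Suc m) * (- 1) ^ Suc m * wE (Qpar p' (Suc m)) r' j)"
  have sign: "of_int (\<alpha> ^ Suc m) * (- 1) ^ Suc (Suc (Suc m)) = (of_int (\<alpha> ^ Suc m) * (- 1) ^ Suc m :: complex)"
    "of_int ((- \<alpha>) ^ Suc m) * (- 1) ^ Suc 1 = (of_int (\<alpha> ^ Suc m) * (- 1) ^ Suc m :: complex)"
    by (simp_all add: power_minus[of "of_int \<alpha>"])
  have M: "band_mats (Suc m) p' \<alpha> a d r' r' KK = kron (dgr d d (\<lambda>j. of_int \<alpha> * wK ?q a j)) (dgr r' r' (wK (qroot p') r'))"
    "band_mats (Suc m) p' \<alpha> a d r' r' EP = kron (upr d d (\<lambda>j. of_int (\<alpha> ^ p') * (- 1) ^ Suc r' * wE ?Q a j)) (1\<^sub>m r')"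
    "band_mats (Suc m) p' \<alpha> a d r' r' FP = kron (lor d d (\<lambda>_. 1)) (1\<^sub>m r')"
    "band_mats (Suc m) p' \<alpha> a d r' r' FM = kron (1\<^sub>m d) (lor r' r' (\<lambda>_. 1))" for a d
    by (simp_all add: band_mats_def)
  have ME: "band_mats (Suc m) p' \<alpha> (Suc (Suc m)) d r' r' EM = kron (1\<^sub>m d) ?e'" "band_mats (Suc m) p' \<alpha> m d r' r' EM = kron (1\<^sub>m d) ?e'" for d
    unfolding band_mats_def gen.case sign by (rule refl)+
  have N: "band_mats (Suc m) p' (- \<alpha>) 1 1 r' r' KK = kron (dgr 1 1 (\<lambda>j. - of_int \<alpha> * wK ?q 1 j)) (dgr r' r' (wK (qroot p') r'))"
    "band_mats (Suc m) p' (- \<alpha>) 1 1 r' r' EP = kron (upr 1 1 (\<lambda>j. of_int ((- \<alpha>) ^ p') * (- 1) ^ Suc r' * wE ?Q 1 j)) (1\<^sub>m r')"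
    "band_mats (Suc m) p' (- \<alpha>) 1 1 r' r' FP = kron (lor 1 1 (\<lambda>_. 1)) (1\<^sub>m r')"
    "band_mats (Suc m) p' (- \<alpha>) 1 1 r' r' EM = kron (1\<^sub>m 1) ?e'"
    "band_mats (Suc m) p' (- \<alpha>) 1 1 r' r' FM = kron (1\<^sub>m 1) (lor r' r' (\<lambda>_. 1))"
    unfolding band_mats_def gen.case sign by (simp_all only: of_int_minus)
  note bc = band_carrier
  note M1 = M(1-3)[of "Suc (Suc m)" "Suc m"] ME(1)[of "Suc m"] M(4)[of "Suc (Suc m)" "Suc m"]
    and M2 = M(1-3)[of m "Suc m"] ME(2)[of "Suc m"] M(4)[of m "Suc m"]
    and L = M(1-3)[of m m] ME(2)[of m] M(4)[of m m]
  show "irr_module (Suc m) p' \<alpha> m r' \<in> modules (Suc m) p' \<and> irr_module (Suc m) p' (- \<alpha>) 1 r' \<in> modules (Suc m) p' \<and>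
      short_exact (irr_module (Suc m) p' \<alpha> m r') (mk_module (Suc m * r') (band_mats (Suc m) p' \<alpha> (Suc (Suc m)) (Suc m) r' r'))
        (irr_module (Suc m) p' (- \<alpha>) 1 r')"
    if V: "mk_module (Suc m * r') (band_mats (Suc m) p' \<alpha> (Suc (Suc m)) (Suc m) r' r') \<in> modules (Suc m) p'"
    using BV(1)
  proof (elim exE conjE, goal_cases)
    case (1 A A' B B')
    from split_maps_kron_left[where M = "band_mats (Suc m) p' \<alpha> (Suc (Suc m)) (Suc m) r' r'" and L = "band_mats (Suc m) p' \<alpha> m m r' r'"
        and N = "band_mats (Suc m) p' (- \<alpha>) 1 1 r' r'",
        OF p1(1) p(1) 1(1) bc(1) bc(2) bc(3) bc(1) bc(2) bc(3) bc(1) bc(2) bc(3) bc(1) bc(2) bc(3) 1(2-7) M1 L N V]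
    show ?case unfolding irr by blast
  qed
  show "short_exact (irr_module (Suc m) p' (- \<alpha>) 1 r') (mk_module (Suc m * r') (band_mats (Suc m) p' \<alpha> m (Suc m) r' r'))
        (irr_module (Suc m) p' \<alpha> m r')"
    if V: "mk_module (Suc m * r') (band_mats (Suc m) p' \<alpha> m (Suc m) r' r') \<in> modules (Suc m) p'"
    using BV(2)
  proof (elim exE conjE, goal_cases)
    case (1 A A' B B')
    from split_maps_kron_left[where M = "band_mats (Suc m) p' \<alpha> m (Suc m) r' r'" and N = "band_mats (Suc m) p' \<alpha> m m r' r'"
        and L = "band_mats (Suc m) p' (- \<alpha>) 1 1 r' r'",
        OF p1(1) p(1) 1(1) bc(1) bc(2) bc(3) bc(1) bc(2) bc(3) bc(1) bc(2) bc(3) bc(1) bc(2) bc(3) 1(2-7) M2 N L V]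
    show ?case unfolding irr by blast
  qed
qed

lemma baby_verma_minus:
  fixes m :: nat
  assumes m: "1 \<le> m" and p: "p \<ge> 1" "coprime p (Suc m)" and r: "1 \<le> r"
  shows "mk_module (r * Suc m) (band_mats p (Suc m) \<alpha> r r (Suc (Suc m)) (Suc m)) \<in> modules p (Suc m) \<Longrightarrow>
      irr_module p (Suc m) \<alpha> r m \<in> modules p (Suc m) \<and> irr_module p (Suc m) (- \<alpha>) r 1 \<in> modules p (Suc m) \<and>
      short_exact (irr_module p (Suc m) \<alpha> r m) (mk_module (r * Suc m) (band_mats p (Suc m) \<alpha> r r (Suc (Suc m)) (Suc m)))
        (irr_module p (Suc m) (- \<alpha>) r 1)"
    and "mk_module (r * Suc m) (band_mats p (Suc m) \<alpha> r r m (Suc m)) \<in> modules p (Suc m) \<Longrightarrow>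
      short_exact (irr_module p (Suc m) (- \<alpha>) r 1) (mk_module (r * Suc m) (band_mats p (Suc m) \<alpha> r r m (Suc m)))
        (irr_module p (Suc m) \<alpha> r m)"
proof -
  have p1: "Suc m \<ge> 1" "Suc m \<ge> 2" and cop: "coprime (Suc m) p" using m p by (simp_all add: coprime_commute)
  let ?Q = "Qpar (Suc m) p" and ?q = "qroot (Suc m)"
  have Q: "\<forall>n\<le>m. qnum ?Q (Suc m - n) = - (?Q ^ Suc m) * qnum ?Q n"
    using qnum_reflect[of "Suc m" _ p] by simp
  have xx: "?Q ^ Suc m * ?Q ^ Suc m = 1" by (rule Qpar_sq[OF p1(1)])
  have Qp: "qnum ?Q (Suc m) = 0" using qnum_eq_0_iff[OF p1(2) cop, of "Suc m"] by simp
  have q: "?q ^ Suc m = - 1" by (rule qroot_pow_self[OF p1(1)])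
  note BV = baby_verma_band[where c = 1 and s = "of_int (\<alpha> ^ p) * (- 1) ^ Suc r" and s' = "of_int ((- \<alpha>) ^ p) * (- 1) ^ Suc r",
      OF Q xx Qp q]
  have irr: "irr_module p (Suc m) \<alpha> r m = mk_module (r * m) (band_mats p (Suc m) \<alpha> r r m m)"
    "irr_module p (Suc m) (- \<alpha>) r 1 = mk_module (r * 1) (band_mats p (Suc m) (- \<alpha>) r r 1 1)"
    unfolding irr_module_eq using irr_mat_eq[OF r m] irr_mat_eq[OF r le_refl] by simp_all
  let ?e = "upr r r (\<lambda>j. of_int (\<alpha> ^ Suc m) * (- 1) ^ Suc m * wE (Qpar p (Suc m)) r j)"
  have sign: "of_int (\<alpha> ^ Suc m) * (- 1) ^ Suc (Suc (Suc m)) = (of_int (\<alpha> ^ Suc m) * (- 1) ^ Suc m :: complex)"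
    "of_int ((- \<alpha>) ^ Suc m) * (- 1) ^ Suc 1 = (of_int (\<alpha> ^ Suc m) * (- 1) ^ Suc m :: complex)"
    by (simp_all add: power_minus[of "of_int \<alpha>"])
  have M: "band_mats p (Suc m) \<alpha> r r a d KK = kron (dgr r r (\<lambda>j. of_int \<alpha> * wK (qroot p) r j)) (dgr d d (\<lambda>j. 1 * wK ?q a j))"
    "band_mats p (Suc m) \<alpha> r r a d FP = kron (lor r r (\<lambda>_. 1)) (1\<^sub>m d)"
    "band_mats p (Suc m) \<alpha> r r a d EM = kron (1\<^sub>m r) (upr d d (\<lambda>j. of_int (\<alpha> ^ p) * (- 1) ^ Suc r * wE ?Q a j))"
    "band_mats p (Suc m) \<alpha> r r a d FM = kron (1\<^sub>m r) (lor d d (\<lambda>_. 1))" for a d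
    by (simp_all add: band_mats_def)
  have ME: "band_mats p (Suc m) \<alpha> r r (Suc (Suc m)) d EP = kron ?e (1\<^sub>m d)" "band_mats p (Suc m) \<alpha> r r m d EP = kron ?e (1\<^sub>m d)" for d
    unfolding band_mats_def gen.case sign by (rule refl)+
  \<comment> \<open>\<open>band_mats\<close> stores the sign of K in the first tensor factor; for a
    sequence in the second index it has to be moved across.\<close>
  have flip: "kron (dgr r r (\<lambda>j. - of_int \<alpha> * wK (qroot p) r j)) (dgr 1 1 (wK ?q 1)) =
      kron (dgr r r (\<lambda>j. of_int \<alpha> * wK (qroot p) r j)) (dgr 1 1 (\<lambda>j. - 1 * wK ?q 1 j))"
  proof -
    have "dgr r r (\<lambda>j. - of_int \<alpha> * wK (qroot p) r j) = - 1 \<cdot>\<^sub>m dgr r r (\<lambda>j. of_int \<alpha> * wK (qroot p) r j)"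
      "dgr 1 1 (\<lambda>j. - 1 * wK ?q 1 j) = - 1 \<cdot>\<^sub>m dgr 1 1 (wK ?q 1)"
      unfolding band_smult by simp_all
    then show ?thesis by (simp only: kron_smult_left kron_smult_right)
  qed
  have N: "band_mats p (Suc m) (- \<alpha>) r r 1 1 KK = kron (dgr r r (\<lambda>j. of_int \<alpha> * wK (qroot p) r j)) (dgr 1 1 (\<lambda>j. - 1 * wK ?q 1 j))"
    "band_mats p (Suc m) (- \<alpha>) r r 1 1 EP = kron ?e (1\<^sub>m 1)"
    "band_mats p (Suc m) (- \<alpha>) r r 1 1 FP = kron (lor r r (\<lambda>_. 1)) (1\<^sub>m 1)"
    "band_mats p (Suc m) (- \<alpha>) r r 1 1 EM = kron (1\<^sub>m r) (upr 1 1 (\<lambda>j. of_int ((- \<alpha>) ^ p) * (- 1) ^ Suc r * wE ?Q 1 j))"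
    "band_mats p (Suc m) (- \<alpha>) r r 1 1 FM = kron (1\<^sub>m r) (lor 1 1 (\<lambda>_. 1))"
    unfolding band_mats_def gen.case sign of_int_minus flip by (rule refl)+
  note bc = band_carrier
  note M1 = M(1)[of "Suc (Suc m)" "Suc m"] ME(1)[of "Suc m"] M(2-4)[of "Suc (Suc m)" "Suc m"]
    and M2 = M(1)[of m "Suc m"] ME(2)[of "Suc m"] M(2-4)[of m "Suc m"]
    and L = M(1)[of m m] ME(2)[of m] M(2-4)[of m m]
  show "irr_module p (Suc m) \<alpha> r m \<in> modules p (Suc m) \<and> irr_module p (Suc m) (- \<alpha>) r 1 \<in> modules p (Suc m) \<and>
      short_exact (irr_module p (Suc m) \<alpha> r m) (mk_module (r * Suc m) (band_mats p (Suc m) \<alpha> r r (Suc (Suc m)) (Suc m)))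
        (irr_module p (Suc m) (- \<alpha>) r 1)"
    if V: "mk_module (r * Suc m) (band_mats p (Suc m) \<alpha> r r (Suc (Suc m)) (Suc m)) \<in> modules p (Suc m)"
    using BV(1)
  proof (elim exE conjE, goal_cases)
    case (1 A A' B B')
    from split_maps_kron_right[where M = "band_mats p (Suc m) \<alpha> r r (Suc (Suc m)) (Suc m)" and L = "band_mats p (Suc m) \<alpha> r r m m"
        and N = "band_mats p (Suc m) (- \<alpha>) r r 1 1",
        OF p(1) p1(1) 1(1) bc(1) bc(2) bc(3) bc(1) bc(2) bc(3) bc(1) bc(2) bc(3) bc(1) bc(2) bc(3) 1(2-7) M1 L N V]
    show ?case unfolding irr by blast
  qed
  show "short_exact (irr_module p (Suc m) (- \<alpha>) r 1) (mk_module (r * Suc m) (band_mats p (Suc m) \<alpha> r r m (Suc m)))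
        (irr_module p (Suc m) \<alpha> r m)"
    if V: "mk_module (r * Suc m) (band_mats p (Suc m) \<alpha> r r m (Suc m)) \<in> modules p (Suc m)"
    using BV(2)
  proof (elim exE conjE, goal_cases)
    case (1 A A' B B')
    from split_maps_kron_right[where M = "band_mats p (Suc m) \<alpha> r r m (Suc m)" and N = "band_mats p (Suc m) \<alpha> r r m m"
        and L = "band_mats p (Suc m) (- \<alpha>) r r 1 1",
        OF p(1) p1(1) 1(1) bc(1) bc(2) bc(3) bc(1) bc(2) bc(3) bc(1) bc(2) bc(3) bc(1) bc(2) bc(3) 1(2-7) M2 N L V]
    show ?case unfolding irr by blast
  qed
qed

section \<open>Tensoring with a one-dimensional module\<close>

text \<open>An isomorphism enters the Grothendieck group as an exact sequence with zero-dimensional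
  third term. Involutions suffice because the intertwiner in question is diagonal with entries 1 and
  -1.\<close>

lemma split_maps_iso:
  assumes "A \<in> carrier_mat n n" "A * A = 1\<^sub>m n"
  shows "split_maps n n 0 A A (0\<^sub>m 0 n) (0\<^sub>m n 0)"
  unfolding split_maps_def using assms by (auto intro!: eq_matI)

lemma kron_one_one: "kron A (1\<^sub>m 1) = A"
  by (rule eq_matI) (auto simp: kron_def)

text \<open>The second factor multiplies K by \<beta>, e_- by \<beta>^(p_+) and f_+ by
  \<beta>^(p_-), whereas in the target the last sign sits on e_+. The diagonal matrix with entries
  \<beta>^(p_- n) moves it from f_+ to e_+.\<close>

lemma tensor_one_dim:
  assumes p: "p \<ge> 1" "p' \<ge> 1" "coprime p p'" and a: "\<alpha> \<in> {1, -1}" "\<beta> \<in> {1, -1}" and r: "1 \<le> r" "1 \<le> r'"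
    and V: "irr_module p p' \<alpha> r r' \<in> modules p p'"
  shows "irr_module p p' (\<alpha> * \<beta>) r r' \<in> modules p p'" "mk_module 0 (\<lambda>_. 0\<^sub>m 0 0) \<in> modules p p'"
    "short_exact (irr_module p p' (\<alpha> * \<beta>) r r') (tensor_module p p' (irr_module p p' \<alpha> r r') (irr_module p p' \<beta> 1 1))
      (mk_module 0 (\<lambda>_. 0\<^sub>m 0 0))"
proof -
  let ?M = "band_mats p p' \<alpha> r r r' r'" and ?L = "band_mats p p' (\<alpha> * \<beta>) r r r' r'" and ?N = "irr_mat p p' \<beta> 1 1"
  let ?T = "tgen p p' (r * r') ?M 1 ?N"
  let ?b = "of_int \<beta> :: complex"
  have b2: "?b * ?b = 1" by (rule sign_square(1)[OF a(2)])
  have b0: "?b \<noteq> 0" using a by auto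
  have b2k: "?b ^ k * ?b ^ k = 1" for k using b2 by (metis power_mult_distrib power_one)
  note N = one_dim_in_modules[OF p(1,2) a(2)]
  have NK: "?N KK ^\<^sub>m k = (?b ^ k) \<cdot>\<^sub>m 1\<^sub>m 1" for k
  proof (induction k)
    case 0
    show ?case by (auto simp: irr_mat_def intro!: eq_matI)
  next
    case (Suc k)
    then show ?case unfolding pow_mat.simps N(2)
      by (simp add: mat_smult_left smult_smult_mat mult.commute)
  qed
  have full: "?b ^ (2 * p * p') = 1" using b2 by (simp add: power_mult power2_eq_square)
  have bc: "?b ^ (2 * p * p' - p') = ?b ^ p'"
    using pow_complement[OF full, of p'] exponents_le[OF p(1,2)] b2k[of p'] b0 by (simp add: divide_eq_eq)
  have kz: "kron A (0\<^sub>m 1 1) = 0\<^sub>m (r * r') (r * r')" if "A \<in> carrier_mat (r * r') (r * r')" for A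
    using that by (simp add: kron_zero_right)
  have az: "A + 0\<^sub>m (r * r') (r * r') = A" if "A \<in> carrier_mat (r * r') (r * r')" for A :: "complex mat"
    using that by simp
  note cM = band_mats_carrier[of p p' \<alpha> r r r' r']
  note cs = smult_carrier_mat[OF cM]
  have N0: "?N EP = 0\<^sub>m 1 1" "?N FP = 0\<^sub>m 1 1" "?N EM = 0\<^sub>m 1 1" "?N FM = 0\<^sub>m 1 1"
    using N(3)[of EP] N(3)[of FP] N(3)[of EM] N(3)[of FM] by simp_all
  have T: "?T KK = ?b \<cdot>\<^sub>m ?M KK" "?T EP = ?M EP" "?T FP = (?b ^ p') \<cdot>\<^sub>m ?M FP" "?T EM = (?b ^ p) \<cdot>\<^sub>m ?M EM" "?T FM = ?M FM"
    unfolding tgen_def gen.case N0 NK bc unfolding N(2) kron_smult_right kron_one_one kz[OF pow_carrier_mat[OF cM]] kz[OF one_carrier_mat]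
      az[OF cM] az[OF cs] by (rule refl)+
  let ?D = "dgr r r (\<lambda>j. (?b ^ p') ^ j)"
  have DD: "?D * ?D = 1\<^sub>m r" unfolding band_mult by (rule dgr_oneI) (simp add: b2k flip: power_mult)
  let ?A = "kron ?D (1\<^sub>m r')"
  have cA: "?A \<in> carrier_mat (r * r') (r * r')" by simp
  have AA: "?A * ?A = 1\<^sub>m (r * r')"
    by (simp add: kron_mult[of _ r r _ r' r' _ r _ r'] DD kron_one)
  note cD = band_carrier(1)[of r r "\<lambda>j. (?b ^ p') ^ j"]
  have sm: "(x \<cdot>\<^sub>m ?M g) * ?A = x \<cdot>\<^sub>m (?M g * ?A)" for x g by (rule mult_smult_assoc_mat[OF cM cA])
  have DI: "?D * 1\<^sub>m r = ?D" "1\<^sub>m r * ?D = ?D" using cD by simp_all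
  note km = kron_one_mult(1)[OF cD] kron_one_mult(2)[OF cD]
  have iA: "?A * ?L g = ?T g * ?A" for g
  proof (cases g)
    case KK
    have "?D * dgr r r (\<lambda>j. of_int (\<alpha> * \<beta>) * wK (qroot p) r j) = ?b \<cdot>\<^sub>m (dgr r r (\<lambda>j. of_int \<alpha> * wK (qroot p) r j) * ?D)"
      unfolding band_mult band_smult by (rule band_cong) simp
    then show ?thesis unfolding KK T sm unfolding band_mats_def gen.case
        km(1)[OF band_carrier(1) band_carrier(1)] km(2)[OF band_carrier(1) band_carrier(1)] by (simp only: kron_smult_left)
  next
    case EP
    have "?D * upr r r (\<lambda>j. of_int ((\<alpha> * \<beta>) ^ p') * (- 1) ^ Suc r' * wE (Qpar p p') r j) =
        upr r r (\<lambda>j. of_int (\<alpha> ^ p') * (- 1) ^ Suc r' * wE (Qpar p p') r j) * ?D"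
      unfolding band_mult by (rule band_cong) (simp add: power_mult_distrib)
    then show ?thesis unfolding EP T unfolding band_mats_def gen.case
        km(1)[OF band_carrier(2) one_carrier_mat] km(2)[OF band_carrier(2) one_carrier_mat] by (simp only:)
  next
    case FP
    have "?D * lor r r (\<lambda>_. 1) = (?b ^ p') \<cdot>\<^sub>m (lor r r (\<lambda>_. 1) * ?D)"
      unfolding band_mult band_smult by (rule band_cong) simp
    then show ?thesis unfolding FP T sm unfolding band_mats_def gen.case
        km(1)[OF band_carrier(3) one_carrier_mat] km(2)[OF band_carrier(3) one_carrier_mat] by (simp only: kron_smult_left)
  next
    case EM
    have "upr r' r' (\<lambda>j. of_int ((\<alpha> * \<beta>) ^ p) * (- 1) ^ Suc r * wE (Qpar p' p) r' j) =
        (?b ^ p) \<cdot>\<^sub>m upr r' r' (\<lambda>j. of_int (\<alpha> ^ p) * (- 1) ^ Suc r * wE (Qpar p' p) r' j)"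
      unfolding band_smult by (simp add: power_mult_distrib mult_ac)
    then show ?thesis unfolding EM T sm unfolding band_mats_def gen.case
        km(1)[OF one_carrier_mat band_carrier(2)] km(2)[OF one_carrier_mat band_carrier(2)] DI by (simp only: kron_smult_right)
  next
    case FM
    show ?thesis unfolding FM T unfolding band_mats_def gen.case
        km(1)[OF one_carrier_mat band_carrier(3)] km(2)[OF one_carrier_mat band_carrier(3)] DI ..
  qed
  have cT: "?T g \<in> carrier_mat (r * r') (r * r')" for g
  proof -
    have "?T g \<in> carrier_mat (r * r' * 1) (r * r' * 1)"
      by (rule tgen_carrier) (simp_all add: band_mats_carrier irr_mat_def)
    then show ?thesis by simp
  qed
  have iB: "0\<^sub>m 0 (r * r') * ?T g = 0\<^sub>m 0 0 * 0\<^sub>m 0 (r * r')" for g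
    using cT[of g] by (intro eq_matI) auto
  have V1: "irr_module p p' \<beta> 1 1 \<in> modules p p'" by (rule N(1))
  have VM: "irr_module p p' \<alpha> r r' = mk_module (r * r') ?M" "gens (irr_module p p' \<alpha> r r') = ?M"
    "irr_module p p' (\<alpha> * \<beta>) r r' = mk_module (r * r') ?L"
    unfolding irr_module_eq irr_mat_eq[OF r] by (simp_all add: gens_mk_module[OF band_mats_carrier])
  have XM: "fst (irr_module p p' \<beta> 1 1) = 1" "gens (irr_module p p' \<beta> 1 1) = ?N"
    unfolding irr_module_eq by (auto simp: irr_mat_def intro!: gens_mk_module)
  have T2: "tensor_module p p' (irr_module p p' \<alpha> r r') (irr_module p p' \<beta> 1 1) = mk_module (r * r') ?T"
    unfolding tensor_module_eq[OF p(1,2) V V1] VM(2) XM unfolding VM(1) by simp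
  have TV: "mk_module (r * r') ?T \<in> modules p p'"
    using tensor_in_modules[OF p V V1] unfolding T2 .
  have z: "0\<^sub>m 0 0 \<in> carrier_mat 0 0" by simp
  note res = split_maps_mk_module[OF p(1,2) split_maps_iso[OF cA AA] TV cT band_mats_carrier z iA iB]
  show "irr_module p p' (\<alpha> * \<beta>) r r' \<in> modules p p'" "mk_module 0 (\<lambda>_. 0\<^sub>m 0 0) \<in> modules p p'"
    "short_exact (irr_module p p' (\<alpha> * \<beta>) r r') (tensor_module p p' (irr_module p p' \<alpha> r r') (irr_module p p' \<beta> 1 1))
      (mk_module 0 (\<lambda>_. 0\<^sub>m 0 0))"
    unfolding T2 VM(3) by (rule res)+
qed

section \<open>The Clebsch--Gordan recursion\<close>

text \<open>The Clebsch-Gordan range listed downwards from its top, with \<open>min r s\<close>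
  terms. In this form s = 0 gives the empty sum, which starts the recursion.\<close>

definition cg_sum :: "nat \<Rightarrow> nat \<Rightarrow> (nat \<Rightarrow> 'a::ab_group_add) \<Rightarrow> 'a" where
  "cg_sum r s f = (\<Sum>k<min r s. f (r + s - 1 - 2 * k))"

lemma cg_sum_step2: "1 \<le> r \<Longrightarrow> 1 \<le> s \<Longrightarrow> cg_sum r s f = (\<Sum>u\<in>step2 (nat \<bar>int r - int s\<bar> + 1) (r + s - 1). f u)"
  unfolding cg_sum_def
proof (rule sum.reindex_bij_witness[where j="\<lambda>k. r + s - 1 - 2 * k" and i="\<lambda>u. (r + s - 1 - u) div 2"])
  assume rs: "1 \<le> r" "1 \<le> s"
  fix u assume u: "u \<in> step2 (nat \<bar>int r - int s\<bar> + 1) (r + s - 1)"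
  then have u': "nat \<bar>int r - int s\<bar> + 1 \<le> u" "u \<le> r + s - 1" and e: "even (u - (nat \<bar>int r - int s\<bar> + 1))"
    by (auto simp: step2_def)
  \<comment> \<open>The parity of |r - s| is that of r + s; the passage to integers avoids truncated
    subtraction.\<close>
  have ev: "even (r + s - 1 - u)"
  proof -
    have "even (int (u - (nat \<bar>int r - int s\<bar> + 1)))" using e by simp
    moreover have "int (u - (nat \<bar>int r - int s\<bar> + 1)) = int u - \<bar>int r - int s\<bar> - 1" using u' by simp
    ultimately have "even (int u - \<bar>int r - int s\<bar> - 1)" by simp
    then have "even (int r + int s - 1 - int u)" by (auto simp: abs_if split: if_splits)
    moreover have "int (r + s - 1 - u) = int r + int s - 1 - int u" using u' rs by (simp add: of_nat_diff)
    ultimately have "even (int (r + s - 1 - u))" by simp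
    then show ?thesis by simp
  qed
  then show "r + s - 1 - 2 * ((r + s - 1 - u) div 2) = u" using u' by simp
  have "r + s - 1 - u < 2 * min r s" using u' rs by linarith
  then have "(r + s - 1 - u) div 2 < min r s" by (intro less_mult_imp_div_less) (simp only: mult.commute)
  then show "(r + s - 1 - u) div 2 \<in> {..<min r s}" by simp
next
  assume rs: "1 \<le> r" "1 \<le> s"
  fix k assume k: "k \<in> {..<min r s}"
  then show "(r + s - 1 - (r + s - 1 - 2 * k)) div 2 = k" using rs by simp
  have a: "nat \<bar>int r - int s\<bar> + 1 \<le> r + s - 1 - 2 * k" using k rs by auto
  moreover have "even (r + s - 1 - 2 * k - (nat \<bar>int r - int s\<bar> + 1))"
  proof -
    have "int (r + s - 1 - 2 * k - (nat \<bar>int r - int s\<bar> + 1)) = int r + int s - 1 - 2 * int k - \<bar>int r - int s\<bar> - 1"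
      using a k rs by (auto simp: of_nat_diff)
    moreover have "even (int r + int s - 1 - 2 * int k - \<bar>int r - int s\<bar> - 1)" by (auto simp: abs_if)
    ultimately have "even (int (r + s - 1 - 2 * k - (nat \<bar>int r - int s\<bar> + 1)))" by simp
    then show ?thesis by simp
  qed
  ultimately show "r + s - 1 - 2 * k \<in> step2 (nat \<bar>int r - int s\<bar> + 1) (r + s - 1)"
    unfolding step2_def mem_Collect_eq by (intro conjI diff_le_self)
qed auto

lemma cg_sum_one: "1 \<le> r \<Longrightarrow> cg_sum r 1 f = f r"
  by (simp add: cg_sum_def)

lemma cg_sum_zero: "cg_sum r 0 f = 0"
  by (simp add: cg_sum_def)

text \<open>The shifted sums run over the same values as the two sums on the right but both have
  \<open>min r s\<close> terms; only the last terms need to be compared.\<close>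

lemma cg_sum_recursion:
  assumes rs: "1 \<le> r" "1 \<le> s" and f: "f 0 = 0"
  shows "cg_sum r s (\<lambda>u. f (Suc u) + f (u - 1)) = cg_sum r (Suc s) f + cg_sum r (s - 1) f"
proof -
  let ?m = "min r s"
  have "cg_sum r s (\<lambda>u. f (Suc u) + f (u - 1)) = (\<Sum>k<?m. f (r + s - 2 * k)) + (\<Sum>k<?m. f (r + (s - 1) - 1 - 2 * k))"
    unfolding cg_sum_def sum.distrib using rs
    by (intro arg_cong2[where f = "(+)"] sum.cong refl arg_cong[where f = f]) auto
  also have "\<dots> = cg_sum r (Suc s) f + cg_sum r (s - 1) f"
  proof -
    consider "s < r" | "r = s" | "r < s" by linarith
    then show ?thesis
    proof cases
      case 1
      obtain t where t: "s = Suc t" using rs by (cases s) auto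
      \<comment> \<open>For s < r the last term of the lower shifted sum is f (r - s), exactly the
        additional last term of the sum for s + 1.\<close>
      have "f (r + (s - 1) - 1 - 2 * t) = f (r + s - 2 * s)" by (rule arg_cong[where f = f]) (use 1 t in simp)
      moreover have "min r s = Suc t" "min r (Suc s) = Suc s" "min r (s - 1) = t" using 1 t by auto
      ultimately show ?thesis using t by (simp add: cg_sum_def add_ac)
    next
      case 2
      obtain t where t: "s = Suc t" using rs by (cases s) auto
      \<comment> \<open>For r = s the lower shifted sum ends at index 0, where f vanishes.\<close>
      have "r + (s - 1) - 1 - 2 * t = 0" using 2 t by simp
      then have "f (r + (s - 1) - 1 - 2 * t) = 0" using f by simp
      then show ?thesis using 2 t by (simp add: cg_sum_def min_def)
    next
      case 3
      then show ?thesis by (simp add: cg_sum_def min_def)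
    qed
  qed
  finally show ?thesis .
qed

lemma frag_cmul_2: "frag_cmul 2 x = x + x"
  using frag_cmul_distrib[of 1 1 x] by simp

lemma frag_cmul_4: "frag_cmul 4 x = (x + x) + (x + x)"
  using frag_cmul_distrib[of 2 2 x] by (simp add: frag_cmul_2)

text \<open>With \<open>f\<close> the family of irreducible classes, \<open>extend\<close> is the passage from \<open>X\<close> to \<open>X\<close> with a tilde in
  one of the two indices.\<close>

definition extend :: "nat \<Rightarrow> (int \<Rightarrow> nat \<Rightarrow> 'a::ab_group_add) \<Rightarrow> int \<Rightarrow> nat \<Rightarrow> 'a" where
  "extend q f \<alpha> u = (if u \<le> q then f \<alpha> u else f \<alpha> (2 * q - u) + (f (- \<alpha>) (u - q) + f (- \<alpha>) (u - q)))"

lemma extend_add: "extend q (\<lambda>\<alpha> u. f \<alpha> u + g \<alpha> u) \<alpha> u = extend q f \<alpha> u + extend q g \<alpha> u"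
  by (simp add: extend_def add_ac)

lemma extend_neg: "extend q (\<lambda>\<alpha> u. f (- \<alpha>) u) \<alpha> u = extend q f (- \<alpha>) u"
  by (simp add: extend_def)

lemma neg_sign: "\<alpha> \<in> {1, -1} \<Longrightarrow> - \<alpha> \<in> {1, - 1 :: int}"
  by auto

lemma tens_sum_left: "tens p p' (sum f A) y = (\<Sum>i\<in>A. tens p p' (f i) y)"
  by (induction A rule: infinite_finite_induct) (simp_all add: tens_simps)

section \<open>The recursion in the Grothendieck group\<close>

context groth
begin

lemma sum_closed: "(\<And>i. i \<in> A \<Longrightarrow> f i \<in> C) \<Longrightarrow> sum f A \<in> C"
  by (induction A rule: infinite_finite_induct) (auto intro: C_closed)

text \<open>\<open>extend\<close> involves nothing but addition, and for u between 1 and 2q - 1 all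
  arguments passed to f lie between 1 and q.\<close>

lemma extend_linear:
  assumes T: "\<And>x y. T (x + y) = T x + T y" and q: "1 \<le> u" "u \<le> 2 * q - 1" and a: "\<alpha> \<in> {1, -1}"
    and f: "\<And>\<alpha> u. \<alpha> \<in> {1, -1} \<Longrightarrow> 1 \<le> u \<Longrightarrow> u \<le> q \<Longrightarrow> T (f \<alpha> u) \<approx> g \<alpha> u"
  shows "T (extend q f \<alpha> u) \<approx> extend q g \<alpha> u"
  using q a by (auto simp: extend_def T intro!: equ_add f)

text \<open>The exceptional rule at q becomes the uniform Chebyshev recursion: the value at q - 1
  plus twice the value at 1 with opposite sign is by definition the extended class at q + 1. Beyond
  q both reflected arguments obey the ordinary rule, and their neighbours recombine.\<close>

lemma extend_step:
  assumes T: "\<And>x y. T (x + y) = T x + T y" and q: "2 \<le> q" and u: "1 \<le> u" "u \<le> 2 * q - 2" and a: "\<alpha> \<in> {1, -1}"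
    and f0: "\<And>\<alpha>. f \<alpha> 0 = 0"
    and f: "\<And>\<alpha> u. \<alpha> \<in> {1, -1} \<Longrightarrow> 1 \<le> u \<Longrightarrow> u < q \<Longrightarrow> T (f \<alpha> u) \<approx> f \<alpha> (Suc u) + f \<alpha> (u - 1)"
    and fq: "\<And>\<alpha>. \<alpha> \<in> {1, -1} \<Longrightarrow> T (f \<alpha> q) \<approx> (f \<alpha> (q - 1) + f (- \<alpha>) 1) + (f \<alpha> (q - 1) + f (- \<alpha>) 1)"
  shows "T (extend q f \<alpha> u) \<approx> extend q f \<alpha> (Suc u) + extend q f \<alpha> (u - 1)"
proof -
  note na = neg_sign[OF a]
  \<comment> \<open>Above q, the bound u \<le> 2q - 2 leaves v <= q - 2, so the upper neighbour u +
    1 is still in the range of the extension.\<close>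
  consider "u < q" | "u = q" | v where "u = q + v" "1 \<le> v" "v \<le> q - 2"
  proof (cases "u \<le> q")
    case True
    then show ?thesis using that(1,2) by linarith
  next
    case False
    then show ?thesis using that(3)[of "u - q"] u by auto
  qed
  then show ?thesis
  proof cases
    case 1
    then have "u \<le> q" "Suc u \<le> q" "u - 1 \<le> q" by auto
    then show ?thesis using f[OF a u(1) 1] by (simp add: extend_def del: One_nat_def)
  next
    case 2
    have "extend q f \<alpha> (Suc u) + extend q f \<alpha> (u - 1) = (f \<alpha> (q - 1) + f (- \<alpha>) 1) + (f \<alpha> (q - 1) + f (- \<alpha>) 1)"
      using 2 by (simp add: extend_def add_ac)
    then show ?thesis using 2 fq[OF a] by (simp only:) (simp add: extend_def)
  next
    case (3 v)
    let ?w = "q - v"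
    have w: "1 \<le> ?w" "?w < q" "v < q" "2 * q - u = ?w" "u - q = v" "\<not> u \<le> q" using 3 q by auto
    have "T (extend q f \<alpha> u) \<approx> (f \<alpha> (Suc ?w) + f \<alpha> (?w - 1)) + ((f (- \<alpha>) (Suc v) + f (- \<alpha>) (v - 1)) + (f (- \<alpha>) (Suc v) + f (- \<alpha>) (v - 1)))"
      unfolding extend_def w(4,5) if_not_P[OF w(6)] T using w 3 by (intro equ_add f[OF a] f[OF na])
    also have "\<dots> = extend q f \<alpha> (Suc u) + extend q f \<alpha> (u - 1)"
    proof -
      have e: "2 * q - Suc u = ?w - 1" "Suc u - q = Suc v" using 3 by auto
      show ?thesis
      \<comment> \<open>For v = 1 the lower neighbour u - 1 = q lies in the plain branch of
        \<open>extend\<close>; correspondingly the terms \<open>f (- \<alpha>) (v - 1)\<close>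
        vanish.\<close>
      proof (cases "v = 1")
        case True
        then show ?thesis using 3 q e by (simp add: extend_def f0 numeral_2_eq_2 add_ac)
      next
        case False
        then have "2 * q - (u - 1) = Suc ?w" "u - 1 - q = v - 1" "\<not> u - 1 \<le> q" using 3 by auto
        then show ?thesis using 3 e by (simp add: extend_def add_ac)
      qed
    qed
    finally show ?thesis .
  qed
qed

text \<open>The common form of both inductions. Solving the recursion of \<open>b\<close> for its
  top term gives a b(t+1) = (a b(t)) x - a b(t-1) by associativity, and the Clebsch-Gordan sums obey
  the same recursion. Membership of \<open>x\<close> is asked for q \<ge> 2, the case in which the
  two-dimensional module is available and a step is taken.\<close>

lemma tens_cg_sum:
  assumes q: "1 \<le> r" "r \<le> q" and s: "1 \<le> s" "s \<le> q" and a: "a \<in> C"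
    and b: "\<And>t. t \<le> q \<Longrightarrow> b t \<in> C" "b 0 = 0" and x: "2 \<le> q \<Longrightarrow> x \<in> C"
    and one: "tens p p' a (b 1) \<approx> F r"
    and step: "\<And>t. 1 \<le> t \<Longrightarrow> t < q \<Longrightarrow> tens p p' (b t) x \<approx> b (Suc t) + b (t - 1)"
    and F: "\<And>u. 1 \<le> u \<Longrightarrow> u \<le> 2 * q - 2 \<Longrightarrow> tens p p' (F u) x \<approx> F (Suc u) + F (u - 1)" "F 0 = 0"
    and Fc: "\<And>u. u \<le> 2 * q - 1 \<Longrightarrow> F u \<in> C"
  shows "tens p p' a (b s) \<approx> cg_sum r s F"
  using s
proof (induction s rule: less_induct)
  case (less s)
  consider "s = 1" | t where "s = Suc t" "1 \<le> t" using less(2) that(2)[of "s - 1"] by linarith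
  then show ?case
  proof cases
    case 1
    then show ?thesis using one cg_sum_one[OF q(1), of F] by simp
  next
    case (2 t)
    have tq: "t < q" "2 \<le> q" using 2 less by auto
    have xC: "x \<in> C" by (rule x[OF tq(2)])
    have sC: "cg_sum r t F \<in> C" unfolding cg_sum_def
      using q tq by (intro sum_closed Fc) auto
    \<comment> \<open>For t = 1 both sides are zero, by \<open>b 0 = 0\<close> and the empty sum;
      otherwise the induction hypothesis applies.\<close>
    have low: "tens p p' a (b (t - 1)) \<approx> cg_sum r (t - 1) F"
    proof (cases "t = 1")
      case True
      then show ?thesis by (simp add: b tens_simps cg_sum_zero)
    next
      case False
      then show ?thesis using less 2 by auto
    qed
    have "b s \<approx> tens p p' (b t) x - b (t - 1)"
      using equ_diff[OF equ_sym[OF step[OF 2(2) tq(1)]] equ_refl[of "b (t - 1)"]] 2 by simp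
    then have "tens p p' a (b s) \<approx> tens p p' a (tens p p' (b t) x - b (t - 1))"
      using less(3) a by (intro equ_tens equ_refl b)
    also have "\<dots> = tens p p' (tens p p' a (b t)) x - tens p p' a (b (t - 1))"
      using a b tq xC by (simp add: tens_simps tens_assoc)
    also have "\<dots> \<approx> tens p p' (cg_sum r t F) x - cg_sum r (t - 1) F"
      using less 2 xC sC low by (intro equ_diff equ_tens) auto
    also have "\<dots> \<approx> cg_sum r t (\<lambda>u. F (Suc u) + F (u - 1)) - cg_sum r (t - 1) F"
    proof (intro equ_diff equ_refl)
      have "tens p p' (cg_sum r t F) x = cg_sum r t (\<lambda>u. tens p p' (F u) x)"
        unfolding cg_sum_def by (rule tens_sum_left)
      also have "\<dots> \<approx> cg_sum r t (\<lambda>u. F (Suc u) + F (u - 1))"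
        unfolding cg_sum_def using q tq 2 by (intro equ_sum F) auto
      finally show "tens p p' (cg_sum r t F) x \<approx> cg_sum r t (\<lambda>u. F (Suc u) + F (u - 1))" .
    qed
    also have "\<dots> = cg_sum r s F"
      using cg_sum_recursion[of r t F] q F(2) 2 by simp
    finally show ?thesis .
  qed
qed

text \<open>On the zero space the sequence 0 -> Z -> Z -> Z -> 0 is exact, so [Z] = 2 [Z].\<close>

lemma zero_module:
  assumes M: "\<And>g. M g \<in> carrier_mat 0 0" "mk_module 0 M \<in> modules p p'" shows "frag_of (mk_module 0 M) \<approx> 0"
proof -
  let ?Z = "mk_module 0 M" and ?O = "0\<^sub>m 0 0"
  have "split_maps 0 0 0 ?O ?O ?O ?O" by (auto simp: split_maps_def intro!: eq_matI)
  from split_maps_mk_module(3)[OF p(1,2) this M(2), of M M] M(1)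
  have "short_exact ?Z ?Z ?Z" by (metis carrier_matD eq_matI mult_carrier_mat not_less_zero zero_carrier_mat)
  from equ_exact[OF M(2) M(2) M(2) this] have "frag_of ?Z \<approx> frag_of ?Z + frag_of ?Z" .
  from equ_diff[OF equ_sym[OF this] equ_refl[of "frag_of ?Z"]] show ?thesis by simp
qed

end

lemma band_mats_carrier_0: "d * d' = 0 \<Longrightarrow> band_mats p p' \<alpha> r d r' d' g \<in> carrier_mat 0 0"
  by (metis band_mats_carrier)

lemma irr_module_band: "1 \<le> r \<Longrightarrow> 1 \<le> r' \<Longrightarrow>
    mk_module (r * r') (band_mats p p' \<alpha> r r r' r') = irr_module p p' \<alpha> r r'"
  by (simp only: irr_module_eq irr_mat_eq)

section \<open>Irreducible classes and their products with two-dimensional ones\<close>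

context groth
begin

text \<open>Starting from dimension one, each index is raised by one by taking the submodule of a
  tensor product with X_{2,1} or X_{1,2}; submodules satisfy the relations automatically.\<close>

lemma irr_in:
  assumes a: "\<alpha> \<in> {1, -1}" and r: "1 \<le> r" "r \<le> p" "1 \<le> r'" "r' \<le> p'"
  shows "irr_module p p' \<alpha> r r' \<in> modules p p'"
proof -
  have one: "irr_module p p' \<alpha> r 1 \<in> modules p p'"
    using r(1,2)
  proof (induction r rule: dec_induct)
    case base
    then show ?case using one_dim_in_modules(1)[OF p(1,2) a] by simp
  next
    case (step n)
    then have "p \<ge> 2" "irr_module p p' \<alpha> n 1 \<in> modules p p'" "n < p" by auto
    from plus_step(1)[OF this(1) p(2,3) a step(1) le_refl _ this(2), of "Suc n" "n - 1"] this(3)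
    show ?case using irr_module_band[of "Suc n" 1 p p' \<alpha>] by simp
  qed
  show ?thesis
    using r(3,4)
  proof (induction r' rule: dec_induct)
    case base
    then show ?case using one by simp
  next
    case (step n)
    then have "p' \<ge> 2" "irr_module p p' \<alpha> r n \<in> modules p p'" "n < p'" by auto
    from minus_step(1)[OF p(1) this(1) p(3) a r(1) step(1) _ this(2), of "Suc n" "n - 1"] this(3)
    show ?case using irr_module_band[of r "Suc n" p p' \<alpha>] r by simp
  qed
qed

text \<open>The value 0 at index 0 is the boundary convention under which the recursions hold at r =
  1 and r' = 1 as well.\<close>

definition irr :: "int \<Rightarrow> nat \<Rightarrow> nat \<Rightarrow> fd_module \<Rightarrow>\<^sub>0 int" where
  "irr \<alpha> r r' = (if r = 0 \<or> r' = 0 then 0 else frag_of (irr_module p p' \<alpha> r r'))"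

lemma irr_eq: "1 \<le> r \<Longrightarrow> 1 \<le> r' \<Longrightarrow> irr \<alpha> r r' = frag_of (irr_module p p' \<alpha> r r')"
  by (simp add: irr_def)

lemma irr_0 [simp]: "irr \<alpha> 0 r' = 0" "irr \<alpha> r 0 = 0"
  by (simp_all add: irr_def)

lemma irr_closed: "\<alpha> \<in> {1, -1} \<Longrightarrow> r \<le> p \<Longrightarrow> r' \<le> p' \<Longrightarrow> irr \<alpha> r r' \<in> C"
  by (auto simp: irr_def module_ring_simps intro!: irr_in)

text \<open>For r = 1 the filtration ends in a zero-dimensional quotient, whose class vanishes in
  the Grothendieck group though not in the free group; hence a congruence.\<close>

lemma band_equ_irr:
  assumes "mk_module (d * d') (band_mats p p' \<alpha> d d d' d') \<in> modules p p'"
  shows "frag_of (mk_module (d * d') (band_mats p p' \<alpha> d d d' d')) \<approx> irr \<alpha> d d'"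
proof (cases "d * d' = 0")
  case True
  then show ?thesis
    using assms zero_module[OF band_mats_carrier_0[OF True]] by (auto simp: irr_def)
next
  case False
  then show ?thesis by (simp add: irr_eq irr_module_band)
qed

lemma irr_twist:
  assumes a: "\<alpha> \<in> {1, -1}" "\<beta> \<in> {1, -1}" and r: "1 \<le> r" "r \<le> p" "1 \<le> r'" "r' \<le> p'"
  shows "tens p p' (irr \<alpha> r r') (irr \<beta> 1 1) \<approx> irr (\<alpha> * \<beta>) r r'"
proof -
  let ?T = "tensor_module p p' (irr_module p p' \<alpha> r r') (irr_module p p' \<beta> 1 1)"
  note V = irr_in[OF a(1) r]
  note D = tensor_one_dim[OF p a r(1,3) V]
  have T: "?T \<in> modules p p'" using tensor_in_modules[OF p V one_dim_in_modules(1)[OF p(1,2) a(2)]] .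
  have "frag_of ?T \<approx> irr (\<alpha> * \<beta>) r r' + frag_of (mk_module 0 (\<lambda>_. 0\<^sub>m 0 0))"
    using equ_exact[OF D(1) T D(2,3)] r by (simp add: irr_eq)
  also have "\<dots> \<approx> irr (\<alpha> * \<beta>) r r' + 0"
    using D(2) by (intro equ_add equ_refl zero_module) auto
  finally show ?thesis using r by (simp add: irr_eq tens_simps)
qed

text \<open>At r = p the two baby Verma modules have the same factors with sub and quotient
  exchanged. The Grothendieck group forgets the order, and a factor 2 is left: the source of the
  coefficients 2 and 4 in the tilde classes.\<close>

lemma irr_step_plus:
  assumes P: "2 \<le> p" and a: "\<alpha> \<in> {1, -1}" and r: "1 \<le> r" "1 \<le> r'" "r' \<le> p'"
  shows "r < p \<Longrightarrow> tens p p' (irr \<alpha> r r') (irr 1 2 1) \<approx> irr \<alpha> (Suc r) r' + irr \<alpha> (r - 1) r'"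
    and "tens p p' (irr \<alpha> p r') (irr 1 2 1) \<approx>
      (irr \<alpha> (p - 1) r' + irr (- \<alpha>) 1 r') + (irr \<alpha> (p - 1) r' + irr (- \<alpha>) 1 r')"
proof -
  have N: "irr_module p p' 1 2 1 \<in> modules p p'" by (rule X21_in_modules[OF P p(2,3)])
  show "tens p p' (irr \<alpha> r r') (irr 1 2 1) \<approx> irr \<alpha> (Suc r) r' + irr \<alpha> (r - 1) r'" if rp: "r < p"
  proof -
    note V = irr_in[OF a r(1) less_imp_le[OF rp] r(2,3)]
    note S = plus_step[OF P p(2,3) a r(1,2) _ V, of "Suc r" "r - 1"]
    have d: "(Suc r = Suc r \<and> r - 1 = r - 1 \<and> r < p) \<or> (Suc r = r \<and> r - 1 = r \<and> r = p)" using rp by simp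
    have "tens p p' (irr \<alpha> r r') (irr 1 2 1) \<approx> frag_of (mk_module (Suc r * r') (band_mats p p' \<alpha> (Suc r) (Suc r) r' r')) +
        frag_of (mk_module ((r - 1) * r') (band_mats p p' \<alpha> (r - 1) (r - 1) r' r'))"
      using equ_exact[OF S(1)[OF d] tensor_in_modules[OF p V N] S(2,3)[OF d]] r by (simp add: irr_eq tens_simps)
    also have "\<dots> \<approx> irr \<alpha> (Suc r) r' + irr \<alpha> (r - 1) r'"
      by (intro equ_add band_equ_irr S(1,2)[OF d])
    finally show ?thesis .
  qed
  obtain m where m: "p = Suc m" "1 \<le> m" using P by (cases p) auto
  have p1: "1 \<le> p" "p \<le> p" using p by auto
  note V = irr_in[OF a p1 r(2,3)]
  note S = plus_step[OF P p(2,3) a p1(1) r(2) _ V, of p p]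
  have d: "(p = Suc p \<and> p = p - 1 \<and> p < p) \<or> (p = p \<and> p = p \<and> p = p)" by simp
  note B = baby_verma_plus[where \<alpha> = \<alpha>, OF m(2) p(2) p(3)[unfolded m(1)] r(2), folded m(1)]
  have pm: "p - 1 = m" using m by simp
  note U = S(1)[OF d] and W = S(2)[OF d, unfolded pm]
  note BU = B(1)[OF U]
  have "tens p p' (irr \<alpha> p r') (irr 1 2 1) \<approx> frag_of (mk_module (p * r') (band_mats p p' \<alpha> (Suc p) p r' r')) +
      frag_of (mk_module (p * r') (band_mats p p' \<alpha> m p r' r'))"
    using equ_exact[OF S(1)[OF d] tensor_in_modules[OF p V N] W S(3)[OF d, unfolded pm]] r p1 by (simp add: irr_eq tens_simps)
  also have "\<dots> \<approx> (irr \<alpha> m r' + irr (- \<alpha>) 1 r') + (irr (- \<alpha>) 1 r' + irr \<alpha> m r')"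
    unfolding irr_eq[OF m(2) r(2)] irr_eq[OF le_refl r(2)]
    by (intro equ_add equ_exact B(2)[OF W] BU[THEN conjunct1] BU[THEN conjunct2, THEN conjunct1] BU[THEN conjunct2, THEN conjunct2] U W)
  finally show "tens p p' (irr \<alpha> p r') (irr 1 2 1) \<approx>
      (irr \<alpha> (p - 1) r' + irr (- \<alpha>) 1 r') + (irr \<alpha> (p - 1) r' + irr (- \<alpha>) 1 r')"
    unfolding pm by (simp only: add_ac)
qed

lemma irr_step_minus:
  assumes P: "2 \<le> p'" and a: "\<alpha> \<in> {1, -1}" and r: "1 \<le> r" "r \<le> p" "1 \<le> r'"
  shows "r' < p' \<Longrightarrow> tens p p' (irr \<alpha> r r') (irr 1 1 2) \<approx> irr \<alpha> r (Suc r') + irr \<alpha> r (r' - 1)"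
    and "tens p p' (irr \<alpha> r p') (irr 1 1 2) \<approx>
      (irr \<alpha> r (p' - 1) + irr (- \<alpha>) r 1) + (irr \<alpha> r (p' - 1) + irr (- \<alpha>) r 1)"
proof -
  have N: "irr_module p p' 1 1 2 \<in> modules p p'" by (rule X12_in_modules[OF p(1) P p(3)])
  show "tens p p' (irr \<alpha> r r') (irr 1 1 2) \<approx> irr \<alpha> r (Suc r') + irr \<alpha> r (r' - 1)" if rp: "r' < p'"
  proof -
    note V = irr_in[OF a r(1,2,3) less_imp_le[OF rp]]
    note S = minus_step[OF p(1) P p(3) a r(1,3) _ V, of "Suc r'" "r' - 1"]
    have d: "(Suc r' = Suc r' \<and> r' - 1 = r' - 1 \<and> r' < p') \<or> (Suc r' = r' \<and> r' - 1 = r' \<and> r' = p')" using rp by simp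
    have "tens p p' (irr \<alpha> r r') (irr 1 1 2) \<approx> frag_of (mk_module (r * Suc r') (band_mats p p' \<alpha> r r (Suc r') (Suc r'))) +
        frag_of (mk_module (r * (r' - 1)) (band_mats p p' \<alpha> r r (r' - 1) (r' - 1)))"
      using equ_exact[OF S(1)[OF d] tensor_in_modules[OF p V N] S(2,3)[OF d]] r by (simp add: irr_eq tens_simps)
    also have "\<dots> \<approx> irr \<alpha> r (Suc r') + irr \<alpha> r (r' - 1)"
      by (intro equ_add band_equ_irr S(1,2)[OF d])
    finally show ?thesis .
  qed
  obtain m where m: "p' = Suc m" "1 \<le> m" using P by (cases p') auto
  have p1: "1 \<le> p'" "p' \<le> p'" using p by auto
  note V = irr_in[OF a r(1,2) p1]
  note S = minus_step[OF p(1) P p(3) a r(1) p1(1) _ V, of p' p']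
  have d: "(p' = Suc p' \<and> p' = p' - 1 \<and> p' < p') \<or> (p' = p' \<and> p' = p' \<and> p' = p')" by simp
  note B = baby_verma_minus[where \<alpha> = \<alpha>, OF m(2) p(1) p(3)[unfolded m(1)] r(1), folded m(1)]
  have pm: "p' - 1 = m" using m by simp
  note U = S(1)[OF d] and W = S(2)[OF d, unfolded pm]
  note BU = B(1)[OF U]
  have "tens p p' (irr \<alpha> r p') (irr 1 1 2) \<approx> frag_of (mk_module (r * p') (band_mats p p' \<alpha> r r (Suc p') p')) +
      frag_of (mk_module (r * p') (band_mats p p' \<alpha> r r m p'))"
    using equ_exact[OF S(1)[OF d] tensor_in_modules[OF p V N] W S(3)[OF d, unfolded pm]] r p1 by (simp add: irr_eq tens_simps)
  also have "\<dots> \<approx> (irr \<alpha> r m + irr (- \<alpha>) r 1) + (irr (- \<alpha>) r 1 + irr \<alpha> r m)"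
    unfolding irr_eq[OF r(1) m(2)] irr_eq[OF r(1) le_refl]
    by (intro equ_add equ_exact B(2)[OF W] BU[THEN conjunct1] BU[THEN conjunct2, THEN conjunct1] BU[THEN conjunct2, THEN conjunct2] U W)
  finally show "tens p p' (irr \<alpha> r p') (irr 1 1 2) \<approx>
      (irr \<alpha> r (p' - 1) + irr (- \<alpha>) r 1) + (irr \<alpha> r (p' - 1) + irr (- \<alpha>) r 1)"
    unfolding pm by (simp only: add_ac)
qed

section \<open>The classes with a tilde in both indices\<close>

text \<open>Extension in the first index nested inside extension in the second. Expanding both
  yields the four cases of the tilde classes: signs multiply, and two doublings combine to the
  coefficient 4.\<close>

definition irr_tilde :: "int \<Rightarrow> nat \<Rightarrow> nat \<Rightarrow> fd_module \<Rightarrow>\<^sub>0 int" where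
  "irr_tilde \<alpha> u v = extend p' (\<lambda>\<alpha> v. extend p (\<lambda>\<alpha> u. irr \<alpha> u v) \<alpha> u) \<alpha> v"

lemma irr_tilde_0: "irr_tilde \<alpha> 0 v = 0" "irr_tilde \<alpha> u 0 = 0"
  by (simp_all add: irr_tilde_def extend_def)

lemma irr_tilde_closed:
  assumes "\<alpha> \<in> {1, -1}" "u \<le> 2 * p - 1" "v \<le> 2 * p' - 1" shows "irr_tilde \<alpha> u v \<in> C"
  using assms neg_sign[OF assms(1)]
  unfolding irr_tilde_def extend_def by (auto intro!: C_closed irr_closed)

text \<open>Multiplication passes through the outer extension by additivity, so the recursion is
  needed only for the inner one, with second index at most p'.\<close>

lemma irr_tilde_step_plus:
  assumes P: "2 \<le> p" and a: "\<alpha> \<in> {1, -1}" and u: "1 \<le> u" "u \<le> 2 * p - 2" and v: "1 \<le> v" "v \<le> 2 * p' - 1"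
  shows "tens p p' (irr_tilde \<alpha> u v) (irr 1 2 1) \<approx> irr_tilde \<alpha> (Suc u) v + irr_tilde \<alpha> (u - 1) v"
  unfolding irr_tilde_def extend_add[symmetric]
proof (rule extend_linear[OF tens_simps(5) v a])
  fix \<alpha> :: int and v assume a: "\<alpha> \<in> {1, -1}" and v: "1 \<le> v" "v \<le> p'"
  show "tens p p' (extend p (\<lambda>\<alpha> u. irr \<alpha> u v) \<alpha> u) (irr 1 2 1) \<approx>
      extend p (\<lambda>\<alpha> u. irr \<alpha> u v) \<alpha> (Suc u) + extend p (\<lambda>\<alpha> u. irr \<alpha> u v) \<alpha> (u - 1)"
    using irr_step_plus[OF P] v p(1) by (intro extend_step[OF tens_simps(5) P u a]) auto
qed

text \<open>Roles exchanged: the recursion is applied to the outer extension, whose family consists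
  of inner extensions, and its hypotheses follow by linearity from the irreducible classes.\<close>

lemma irr_tilde_step_minus:
  assumes P: "2 \<le> p'" and a: "\<alpha> \<in> {1, -1}" and u: "1 \<le> u" "u \<le> 2 * p - 1" and v: "1 \<le> v" "v \<le> 2 * p' - 2"
  shows "tens p p' (irr_tilde \<alpha> u v) (irr 1 1 2) \<approx> irr_tilde \<alpha> u (Suc v) + irr_tilde \<alpha> u (v - 1)"
  unfolding irr_tilde_def
proof (rule extend_step[OF tens_simps(5) P v a])
  fix \<alpha> :: int assume a: "\<alpha> \<in> {1, -1}"
  show "tens p p' (extend p (\<lambda>\<alpha> u. irr \<alpha> u v) \<alpha> u) (irr 1 1 2) \<approx>
      extend p (\<lambda>\<alpha> u. irr \<alpha> u (Suc v)) \<alpha> u + extend p (\<lambda>\<alpha> u. irr \<alpha> u (v - 1)) \<alpha> u" if "1 \<le> v" "v < p'" for v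
    unfolding extend_add[symmetric]
    by (rule extend_linear[OF tens_simps(5) u a]) (rule irr_step_minus(1)[OF P _ _ _ that(1) that(2)])
  \<comment> \<open>The exceptional rule at v = p' flips the sign inside the inner extension, which
    amounts to evaluating that extension at the opposite sign.\<close>
  have e: "extend p (\<lambda>\<alpha> u. irr (- \<alpha>) u 1) \<alpha> u = extend p (\<lambda>\<alpha> u. irr \<alpha> u 1) (- \<alpha>) u"
    by (rule extend_neg)
  show "tens p p' (extend p (\<lambda>\<alpha> u. irr \<alpha> u p') \<alpha> u) (irr 1 1 2) \<approx>
      (extend p (\<lambda>\<alpha> u. irr \<alpha> u (p' - 1)) \<alpha> u + extend p (\<lambda>\<alpha> u. irr \<alpha> u 1) (- \<alpha>) u) +
      (extend p (\<lambda>\<alpha> u. irr \<alpha> u (p' - 1)) \<alpha> u + extend p (\<lambda>\<alpha> u. irr \<alpha> u 1) (- \<alpha>) u)"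
    unfolding e[symmetric] extend_add[symmetric]
    by (rule extend_linear[OF tens_simps(5) u a]) (rule irr_step_minus(2)[OF P _ _ _ le_refl])
qed (simp add: extend_def)

text \<open>The result of the first induction is the base of the second, whose family
  \<open>F\<close> consists of whole Clebsch-Gordan sums in the first index; additivity transfers
  the recursion to them.\<close>

lemma irr_product:
  assumes a: "\<alpha> \<in> {1, -1}" "\<beta> \<in> {1, -1}" and r: "1 \<le> r" "r \<le> p" "1 \<le> r'" "r' \<le> p'"
    and s: "1 \<le> s" "s \<le> p" "1 \<le> s'" "s' \<le> p'"
  shows "tens p p' (irr \<alpha> r r') (irr \<beta> s s') \<approx> cg_sum r' s' (\<lambda>v. cg_sum r s (\<lambda>u. irr_tilde (\<alpha> * \<beta>) u v))"
proof -
  have ab: "\<alpha> * \<beta> \<in> {1, -1}" using a by auto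
  have one: "tens p p' (irr \<alpha> r r') (irr \<beta> s 1) \<approx> cg_sum r s (\<lambda>u. irr_tilde (\<alpha> * \<beta>) u r')"
  proof (rule tens_cg_sum[OF r(1,2) s(1,2), where x = "irr 1 2 1"])
    show "tens p p' (irr \<alpha> r r') (irr \<beta> 1 1) \<approx> irr_tilde (\<alpha> * \<beta>) r r'"
      using irr_twist[OF a r] r by (simp add: irr_tilde_def extend_def)
    show "tens p p' (irr \<beta> t 1) (irr 1 2 1) \<approx> irr \<beta> (Suc t) 1 + irr \<beta> (t - 1) 1" if "1 \<le> t" "t < p" for t
      using that p by (intro irr_step_plus(1) a) auto
    show "tens p p' (irr_tilde (\<alpha> * \<beta>) u r') (irr 1 2 1) \<approx> irr_tilde (\<alpha> * \<beta>) (Suc u) r' + irr_tilde (\<alpha> * \<beta>) (u - 1) r'"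
      if "1 \<le> u" "u \<le> 2 * p - 2" for u
      using that r by (intro irr_tilde_step_plus ab) auto
  qed (use a ab r p in \<open>auto simp: irr_tilde_0 intro!: irr_closed irr_tilde_closed\<close>)
  show ?thesis
  proof (rule tens_cg_sum[OF r(3,4) s(3,4), where x = "irr 1 1 2"])
    show "tens p p' (irr \<alpha> r r') (irr \<beta> s 1) \<approx> cg_sum r s (\<lambda>u. irr_tilde (\<alpha> * \<beta>) u r')"
      by (rule one)
    show "tens p p' (irr \<beta> s t) (irr 1 1 2) \<approx> irr \<beta> s (Suc t) + irr \<beta> s (t - 1)" if "1 \<le> t" "t < p'" for t
      using that p s by (intro irr_step_minus(1) a) auto
    show "tens p p' (cg_sum r s (\<lambda>u. irr_tilde (\<alpha> * \<beta>) u v)) (irr 1 1 2) \<approx>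
        cg_sum r s (\<lambda>u. irr_tilde (\<alpha> * \<beta>) u (Suc v)) + cg_sum r s (\<lambda>u. irr_tilde (\<alpha> * \<beta>) u (v - 1))"
      if "1 \<le> v" "v \<le> 2 * p' - 2" for v
      unfolding cg_sum_def tens_sum_left sum.distrib[symmetric]
      using that r s by (intro equ_sum irr_tilde_step_minus ab) auto
    show "cg_sum r s (\<lambda>u. irr_tilde (\<alpha> * \<beta>) u v) \<in> C" if "v \<le> 2 * p' - 1" for v
      unfolding cg_sum_def using that r s by (intro sum_closed irr_tilde_closed ab) auto
  qed (use a ab r s p in \<open>auto simp: irr_tilde_0 cg_sum_def intro!: irr_closed\<close>)
qed

lemma irrX_eq: "1 \<le> r \<Longrightarrow> 1 \<le> r' \<Longrightarrow> irrX p p' \<alpha> r r' = cls (irr \<alpha> r r')"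
  by (simp add: irrX_def Groth_class_def cls_def irr_eq)

text \<open>For u > p the indices 2p - u and u - p lie between 1 and p, and likewise in the second
  index, so each class is that of an actual module and the two nested extensions unfold to the
  listed cases.\<close>

lemma Xtilde_eq:
  assumes a: "\<alpha> \<in> {1, -1}" and u: "1 \<le> u" "u \<le> 2 * p - 1" and v: "1 \<le> v" "v \<le> 2 * p' - 1"
  shows "Xtilde p p' \<alpha> u v = cls (irr_tilde \<alpha> u v)"
proof -
  note na = neg_sign[OF a]
  note c = irr_closed[OF a] irr_closed[OF na]
  have two: "[(2::nat)] \<cdot>\<^bsub>Groth p p'\<^esub> cls x = cls (x + x)" if "x \<in> C" for x
    using Groth_add_pow[OF that, of 2] by (simp add: frag_cmul_2)
  have four: "[(4::nat)] \<cdot>\<^bsub>Groth p p'\<^esub> cls x = cls ((x + x) + (x + x))" if "x \<in> C" for x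
    using Groth_add_pow[OF that, of 4] by (simp add: frag_cmul_4)
  consider "u \<le> p" "v \<le> p'" | "p < u" "v \<le> p'" | "u \<le> p" "p' < v" | "p < u" "p' < v" by linarith
  then show ?thesis
  proof cases
    case 1
    then show ?thesis using u v by (simp add: Xtilde_def irrX_eq irr_tilde_def extend_def)
  next
    case 2
    have w: "1 \<le> 2 * p - u" "2 * p - u \<le> p" "1 \<le> u - p" "u - p \<le> p" using 2 u by auto
    show ?thesis using 2 u v w
      by (simp add: Xtilde_def irrX_eq irr_tilde_def extend_def two Groth_add C_closed c)
  next
    case 3
    have w: "1 \<le> 2 * p' - v" "2 * p' - v \<le> p'" "1 \<le> v - p'" "v - p' \<le> p'" using 3 v by auto
    show ?thesis using 3 u v w
      by (simp add: Xtilde_def irrX_eq irr_tilde_def extend_def two Groth_add C_closed c)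
  next
    case 4
    have w: "1 \<le> 2 * p - u" "2 * p - u \<le> p" "1 \<le> u - p" "u - p \<le> p"
      "1 \<le> 2 * p' - v" "2 * p' - v \<le> p'" "1 \<le> v - p'" "v - p' \<le> p'" using 4 u v by auto
    have "Xtilde p p' \<alpha> u v = irrX p p' \<alpha> (2 * p - u) (2 * p' - v)
       \<oplus>\<^bsub>Groth p p'\<^esub> [(2::nat)] \<cdot>\<^bsub>Groth p p'\<^esub> irrX p p' (- \<alpha>) (2 * p - u) (v - p')
       \<oplus>\<^bsub>Groth p p'\<^esub> [(2::nat)] \<cdot>\<^bsub>Groth p p'\<^esub> irrX p p' (- \<alpha>) (u - p) (2 * p' - v)
       \<oplus>\<^bsub>Groth p p'\<^esub> [(4::nat)] \<cdot>\<^bsub>Groth p p'\<^esub> irrX p p' \<alpha> (u - p) (v - p')"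
      using 4 u v by (simp add: Xtilde_def)
    also have "\<dots> = cls (irr_tilde \<alpha> u v)"
      using 4 w by (simp add: irrX_eq irr_tilde_def extend_def two four Groth_add C_closed c add_ac)
    finally show ?thesis .
  qed
qed

end

theorem theorem1p2:
  fixes p p' r r' s s' :: nat and \<alpha> \<beta> :: int
  assumes "p \<ge> 1" "p' \<ge> 1" "coprime p p'"
    and "\<alpha> \<in> {1, -1}" "\<beta> \<in> {1, -1}"
    and "1 \<le> r" "r \<le> p" "1 \<le> s" "s \<le> p"
    and "1 \<le> r'" "r' \<le> p'" "1 \<le> s'" "s' \<le> p'"
  shows "irrX p p' \<alpha> r r' \<otimes>\<^bsub>Groth p p'\<^esub> irrX p p' \<beta> s s' =
    (\<Oplus>\<^bsub>Groth p p'\<^esub>u \<in> step2 (nat \<bar>int r - int s\<bar> + 1) (r + s - 1).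
      \<Oplus>\<^bsub>Groth p p'\<^esub>u' \<in> step2 (nat \<bar>int r' - int s'\<bar> + 1) (r' + s' - 1).
        Xtilde p p' (\<alpha> * \<beta>) u u')"
proof -
  interpret groth p p' by (rule groth.intro) (use assms in auto)
  have ab: "\<alpha> * \<beta> \<in> {1, -1}" using assms by auto
  let ?I = "step2 (nat \<bar>int r - int s\<bar> + 1) (r + s - 1)" and ?I' = "step2 (nat \<bar>int r' - int s'\<bar> + 1) (r' + s' - 1)"
  have fin: "finite ?I" "finite ?I'" by (auto simp: step2_def)
  have I: "1 \<le> u" "u \<le> 2 * p - 1" if "u \<in> ?I" for u using that assms by (auto simp: step2_def)
  have I': "1 \<le> v" "v \<le> 2 * p' - 1" if "v \<in> ?I'" for v using that assms by (auto simp: step2_def)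
  note c = irr_tilde_closed[OF ab]
  have inner: "(\<Oplus>\<^bsub>Groth p p'\<^esub>v\<in>?I'. Xtilde p p' (\<alpha> * \<beta>) u v) = cls (\<Sum>v\<in>?I'. irr_tilde (\<alpha> * \<beta>) u v) \<and>
      (\<Sum>v\<in>?I'. irr_tilde (\<alpha> * \<beta>) u v) \<in> C" if u: "u \<in> ?I" for u
  proof -
    have "(\<Oplus>\<^bsub>Groth p p'\<^esub>v\<in>?I'. Xtilde p p' (\<alpha> * \<beta>) u v) = (\<Oplus>\<^bsub>Groth p p'\<^esub>v\<in>?I'. cls (irr_tilde (\<alpha> * \<beta>) u v))"
      by (rule abelian_monoid.finsum_cong'[OF abelian_monoid_Groth])
        (use I[OF u] I' c in \<open>auto simp: Xtilde_eq[OF ab] Groth_carrier\<close>)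
    then show ?thesis using Groth_finsum[OF fin(2), of "irr_tilde (\<alpha> * \<beta>) u"] c[OF I(2)[OF u] I'(2)] by simp
  qed
  have "(\<Oplus>\<^bsub>Groth p p'\<^esub>u\<in>?I. \<Oplus>\<^bsub>Groth p p'\<^esub>v\<in>?I'. Xtilde p p' (\<alpha> * \<beta>) u v) =
      (\<Oplus>\<^bsub>Groth p p'\<^esub>u\<in>?I. cls (\<Sum>v\<in>?I'. irr_tilde (\<alpha> * \<beta>) u v))"
    by (rule abelian_monoid.finsum_cong'[OF abelian_monoid_Groth]) (use inner in \<open>auto simp: Groth_carrier\<close>)
  also have "\<dots> = cls (\<Sum>u\<in>?I. \<Sum>v\<in>?I'. irr_tilde (\<alpha> * \<beta>) u v)"
    using Groth_finsum[OF fin(1), of "\<lambda>u. \<Sum>v\<in>?I'. irr_tilde (\<alpha> * \<beta>) u v"] inner by blast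
  \<comment> \<open>The product formula has the second index outermost, hence the interchange of the
    two sums.\<close>
  also have "(\<Sum>u\<in>?I. \<Sum>v\<in>?I'. irr_tilde (\<alpha> * \<beta>) u v) = cg_sum r' s' (\<lambda>v. cg_sum r s (\<lambda>u. irr_tilde (\<alpha> * \<beta>) u v))"
    unfolding cg_sum_step2[OF assms(6,8)] cg_sum_step2[OF assms(10,12)] by (rule sum.swap)
  also have "cls \<dots> = cls (tens p p' (irr \<alpha> r r') (irr \<beta> s s'))"
    using assms by (intro cls_eqI equ_sym[OF irr_product]) auto
  also have "\<dots> = irrX p p' \<alpha> r r' \<otimes>\<^bsub>Groth p p'\<^esub> irrX p p' \<beta> s s'"
    using assms by (simp add: irrX_eq Groth_mult irr_closed)
  finally show ?thesis by simp
qed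

end
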